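(* Let $A$ be an $n\times n$ matrix drawn from the GOE with Laplacian matrix $\mathcal{L}_A$. Let $$a_n := \sqrt{2\log n},\qquad b_n := \sqrt{2\log n}-\frac{\log\log n+\log(4\pi)-2}{2\sqrt{2\log n}},$$ and let $\mathcal{P}_n$ be the random point process on $\mathbb{R}$ $$\mathcal{P}_n=\sum_{j=1}^n\delta_{a_n(\lambda_j(\mathcal{L}_A)-b_n)},$$ where $\delta_x$ is the point mass at $x$. Then $\mathcal{P}_n$ converges in distribution in the vague topology as $n\to\infty$ to the Poisson point process $\mathcal{P}$ on $\mathbb{R}$ with intensity measure $\mu$ given by $d\mu=e^{-x}\,dx$.
   Context: An $n\times n$ real symmetric random matrix $A$ is drawn from the Gaussian Orthogonal Ensemble (GOE) if its entries $A_{ij}$, $1\le i\le j\le n$, are independent Gaussian random variables, $A_{ij}$ having mean zero and variance $\frac{1+\delta_{ij}}{n}$ ($\delta_{ij}$ the Kronecker delta). For a real symmetric $n\times n$ matrix $A$, its Laplacian matrix is $\mathcal{L}_A := D_A-A$, where $D_A$ is the diagonal matrix with $(D_A)_{ii}=\sum_{j=1}^n A_{ij}$. For an $n\times n$ real symmetric matrix $M$, $\lambda_n(M)\le\cdots\le\lambda_1(M)$ denote its ordered eigenvalues. *)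

theory Defs
  imports "HOL-Probability.Probability" "Jordan_Normal_Form.Char_Poly"
begin

definition GOE :: "nat \<Rightarrow> 'a measure \<Rightarrow> ('a \<Rightarrow> real mat) \<Rightarrow> bool" where
  "GOE n M A \<longleftrightarrow>
     prob_space M \<and>
     (\<forall>\<omega>\<in>space M. A \<omega> \<in> carrier_mat n n \<and> transpose_mat (A \<omega>) = A \<omega>) \<and>
     prob_space.indep_vars M (\<lambda>_. borel) (\<lambda>p \<omega>. A \<omega> $$ p) {(i, j). i \<le> j \<and> j < n} \<and>
     (\<forall>i j. i \<le> j \<and> j < n \<longrightarrow>
        distributed M lborel (\<lambda>\<omega>. A \<omega> $$ (i, j))
          (normal_density 0 (sqrt ((1 + (if i = j then 1 else 0)) / real n))))"

definition degree_mat :: "real mat \<Rightarrow> real mat" where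
  "degree_mat A = mat (dim_row A) (dim_row A)
     (\<lambda>(i, j). if i = j then (\<Sum>k<dim_col A. A $$ (i, k)) else 0)"

definition laplacian :: "real mat \<Rightarrow> real mat" where
  "laplacian A = degree_mat A - A"

text \<open>The eigenvalues with multiplicity in decreasing order, so that \<open>ordered_eigenvalue B 1\<close>
  is the largest one. A real symmetric \<open>n \<times> n\<close> matrix has exactly \<open>n\<close> of them; for other
  matrices non-real eigenvalues are not listed.\<close>

definition ordered_eigenvalue :: "real mat \<Rightarrow> nat \<Rightarrow> real" where
  "ordered_eigenvalue B j = rev (sorted_list_of_multiset (proots (char_poly B))) ! (j - 1)"

definition sum_point_masses :: "nat \<Rightarrow> (nat \<Rightarrow> real) \<Rightarrow> real measure" where
  "sum_point_masses n x =
     measure_of UNIV (sets borel) (\<lambda>B. \<Sum>j=1..n. emeasure (return borel (x j)) B)"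

lemma sets_sum_point_masses [simp, measurable_cong]: "sets (sum_point_masses n x) = sets borel"
  using sets.sigma_sets_eq[of "borel :: real measure"] by (simp add: sum_point_masses_def)

lemma space_sum_point_masses [simp]: "space (sum_point_masses n x) = UNIV"
  by (simp add: sum_point_masses_def)

lemma emeasure_sum_point_masses:
  assumes "B \<in> sets borel"
  shows "emeasure (sum_point_masses n x) B = (\<Sum>j=1..n. indicator B (x j))"
proof -
  have "emeasure (sum_point_masses n x) B = (\<Sum>j=1..n. emeasure (return borel (x j)) B)"
  proof (rule emeasure_measure_of[OF sum_point_masses_def])
    show "countably_additive (sets (sum_point_masses n x))
            (\<lambda>B. \<Sum>j=1..n. emeasure (return borel (x j)) B)"
    proof (rule countably_additiveI)
      fix C :: "nat \<Rightarrow> real set"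
      assume C: "range C \<subseteq> sets (sum_point_masses n x)" "disjoint_family C"
      have "(\<Sum>i. \<Sum>j=1..n. emeasure (return borel (x j)) (C i))
          = (\<Sum>j=1..n. \<Sum>i. emeasure (return borel (x j)) (C i))"
        by (intro suminf_sum) auto
      also have "\<dots> = (\<Sum>j=1..n. emeasure (return borel (x j)) (\<Union>i. C i))"
        using C by (intro sum.cong refl suminf_emeasure) auto
      finally show "(\<Sum>i. \<Sum>j=1..n. emeasure (return borel (x j)) (C i))
          = (\<Sum>j=1..n. emeasure (return borel (x j)) (\<Union>i. C i))" .
    qed
  qed (use assms in \<open>auto simp: positive_def\<close>)
  then show ?thesis
    using assms by simp
qed

definition locally_finite_measures :: "real measure set" where
  "locally_finite_measures =
     {\<mu>. sets \<mu> = sets borel \<and> (\<forall>K. compact K \<longrightarrow> emeasure \<mu> K < \<infinity>)}"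

definition continuous_compact_support :: "(real \<Rightarrow> real) \<Rightarrow> bool" where
  "continuous_compact_support f \<longleftrightarrow>
     continuous_on UNIV f \<and> compact (closure {x. f x \<noteq> 0})"

text \<open>The coarsest topology on the locally finite measures that makes \<open>\<mu> \<mapsto> \<integral>f d\<mu>\<close> continuous for
  every continuous \<open>f\<close> with compact support.\<close>

definition vague_topology :: "real measure topology" where
  "vague_topology = topology_generated_by
     {{\<mu> \<in> locally_finite_measures. integral\<^sup>L \<mu> f \<in> U} | f U.
        continuous_compact_support f \<and> open U}"

lemma topspace_vague_topology [simp]: "topspace vague_topology = locally_finite_measures"
proof -
  have "continuous_compact_support (\<lambda>_. 0)"
    by (simp add: continuous_compact_support_def)
  then have "locally_finite_measures \<in>
      {{\<mu> \<in> locally_finite_measures. integral\<^sup>L \<mu> f \<in> U} | f U.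
         continuous_compact_support f \<and> open U}"
    by (auto intro!: exI[of _ "\<lambda>_. 0"] exI[of _ UNIV])
  then show ?thesis
    unfolding vague_topology_def topology_generated_by_topspace by blast
qed

lemma sum_point_masses_locally_finite: "sum_point_masses n x \<in> locally_finite_measures"
proof -
  have "(\<Sum>j=1..n. indicator K (x j) :: ennreal) < \<infinity>" for K
    by (simp add: less_top[symmetric] indicator_eq_0_iff indicator_def)
  then show ?thesis
    by (auto simp: locally_finite_measures_def emeasure_sum_point_masses borel_compact)
qed

definition vague_borel :: "real measure measure" where
  "vague_borel = sigma locally_finite_measures {U. openin vague_topology U}"

definition random_measure :: "'a measure \<Rightarrow> ('a \<Rightarrow> real measure) \<Rightarrow> bool" where
  "random_measure M \<xi> \<longleftrightarrow> prob_space M \<and> \<xi> \<in> measurable M vague_borel"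

text \<open>The random measures may live on different probability spaces, as only their laws matter.
  Measurability is required only for large \<open>n\<close>.\<close>

definition vague_converges_in_distribution ::
  "(nat \<Rightarrow> 'a measure) \<Rightarrow> (nat \<Rightarrow> 'a \<Rightarrow> real measure) \<Rightarrow>
   'b measure \<Rightarrow> ('b \<Rightarrow> real measure) \<Rightarrow> bool" where
  "vague_converges_in_distribution M \<xi> N \<eta> \<longleftrightarrow>
     (\<forall>\<^sub>F n in sequentially. random_measure (M n) (\<xi> n)) \<and> random_measure N \<eta> \<and>
     (\<forall>\<Phi>. continuous_map vague_topology euclideanreal \<Phi> \<and>
           bounded (\<Phi> ` locally_finite_measures) \<longrightarrow>
        (\<lambda>n. integral\<^sup>L (M n) (\<lambda>\<omega>. \<Phi> (\<xi> n \<omega>))) \<longlonglongrightarrow> integral\<^sup>L N (\<lambda>\<omega>. \<Phi> (\<eta> \<omega>)))"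

definition poisson_process :: "real measure \<Rightarrow> 'b measure \<Rightarrow> ('b \<Rightarrow> real measure) \<Rightarrow> bool" where
  "poisson_process \<mu> N \<eta> \<longleftrightarrow>
     random_measure N \<eta> \<and>
     (\<forall>B\<in>sets borel. emeasure \<mu> B < \<infinity> \<longrightarrow>
        (\<forall>k::nat. measure N {\<omega> \<in> space N. emeasure (\<eta> \<omega>) B = of_nat k} =
           exp (- measure \<mu> B) * measure \<mu> B ^ k / fact k)) \<and>
     (\<forall>B\<in>sets borel. emeasure \<mu> B = \<infinity> \<longrightarrow> (AE \<omega> in N. emeasure (\<eta> \<omega>) B = \<infinity>)) \<and>
     (\<forall>(k::nat) B. (\<forall>i<k. B i \<in> sets borel) \<and> disjoint_family_on B {..<k} \<longrightarrow>
        prob_space.indep_vars N (\<lambda>_. borel) (\<lambda>i \<omega>. emeasure (\<eta> \<omega>) (B i)) {..<k})"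

definition a_seq :: "nat \<Rightarrow> real" where
  "a_seq n = sqrt (2 * ln (real n))"

definition b_seq :: "nat \<Rightarrow> real" where
  "b_seq n = sqrt (2 * ln (real n)) -
     (ln (ln (real n)) + ln (4 * pi) - 2) / (2 * sqrt (2 * ln (real n)))"

definition laplacian_point_process :: "nat \<Rightarrow> real mat \<Rightarrow> real measure" where
  "laplacian_point_process n A =
     sum_point_masses n (\<lambda>j. a_seq n * (ordered_eigenvalue (laplacian A) j - b_seq n))"

end

theory Submission
  imports Defs "HOL-Real_Asymp.Real_Asymp"
begin

text \<open>The Laplacian is the diagonal matrix of the row sums \<open>D\<^sub>i\<close>, nearly independent standard Gaussians,
  minus a matrix \<open>A\<close> of bounded norm. Near a level \<open>lam\<close> of order \<open>\<surd>(2 log n)\<close> only the few indices \<open>S\<close>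
  with \<open>D\<^sub>i\<close> close to \<open>lam\<close> matter. The Schur complement of the remaining block changes the form
  \<open>lam - D\<close> on \<open>S\<close> by \<open>\<Sum>\<^sub>j A\<^sub>i\<^sub>j A\<^sub>k\<^sub>j / (lam - D\<^sub>j)\<close>, which is close to \<open>1 / lam\<close> times the identity because
  the columns of \<open>A\<close> are almost orthonormal. Hence, off an event of small probability, the number of
  eigenvalues above \<open>lam\<close> is the number of \<open>i\<close> with \<open>D\<^sub>i > lam - 1 / lam\<close>; this shift is the source of
  the summand \<open>2\<close> in the numerator of \<open>b\<^sub>n\<close>.

  The factorial moments of the counts of row sums in disjoint intervals converge to those of
  independent Poisson variables, since removing the boundedly many mutual entries makes a fixed
  number of row sums independent and moves them by a negligible amount. The Bonferroni
  inequalities turn this into convergence of the joint law of the counts. A bounded vaguely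
  continuous functional is finally sandwiched between functions of the counts on a fine grid.\<close>

section \<open>Symmetric matrices and the counting function of their eigenvalues\<close>

text \<open>After scaling by \<open>a_seq n\<close> only errors of size o(1/\<open>a_seq n\<close>)
  are harmless, whereas the norm of A is of order 1, so eigenvalues cannot be matched with row sums
  by a norm perturbation bound. The comparison is made between counts at a fixed level. Apart from
  events on A of small probability, the counts can disagree only if a row sum falls within
  o(1/\<open>a_seq n\<close>) of the level, which has vanishing probability as well. The row sums
  are functions of A, so conditioning on them is avoided: the Schur complement argument is pathwise
  and uses bounds on A that hold for all indices at once. S must be as wide as the norm of A
  demands, which makes its size as large as exp(23 \<open>a_seq n\<close>). This grows more slowly
  than every power of n, so the entry and Gram errors, which decay like powers of n up to
  logarithms, absorb it. In the last step only upper bounds by functions of the counts are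
  constructed; applying them to the negative of the functional gives the lower bounds.\<close>

lemma real_symmetric_has_eigenvector:
  fixes A :: "real mat"
  assumes A: "A \<in> carrier_mat n n" and sym: "transpose_mat A = A" and n: "n > 0"
  shows "\<exists>e v. v \<in> carrier_vec n \<and> v \<noteq> 0\<^sub>v n \<and> A *\<^sub>v v = e \<cdot>\<^sub>v v"
proof -
  let ?B = "map_mat complex_of_real A"
  have B: "?B \<in> carrier_mat n n" using A by simp
  obtain es where es: "char_poly ?B = (\<Prod>a\<leftarrow>es. [:- a, 1:])" and len: "length es = n"
    using char_poly_factorized[OF B] by blast
  then obtain z where z: "z \<in> set es" using n by (cases es) auto
  have "poly (char_poly ?B) z = 0"
    using z by (auto simp: es poly_prod_list prod_list_zero_iff)
  then have "eigenvalue ?B z" using eigenvalue_root_char_poly[OF B] by simp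
  then obtain w where w: "w \<in> carrier_vec n" "w \<noteq> 0\<^sub>v n" "?B *\<^sub>v w = z \<cdot>\<^sub>v w"
    using B by (auto simp: eigenvalue_def eigenvector_def)
  have Aji: "A $$ (j, i) = A $$ (i, j)" if "i < n" "j < n" for i j
    using that A sym by (metis carrier_matD index_transpose_mat(1))
  have row: "(\<Sum>j<n. of_real (A $$ (i, j)) * w $ j) = z * w $ i" if "i < n" for i
  proof -
    have "(?B *\<^sub>v w) $ i = z * w $ i" using w that by simp
    moreover have "(?B *\<^sub>v w) $ i = (\<Sum>j<n. of_real (A $$ (i, j)) * w $ j)"
      using A w(1) that by (simp add: scalar_prod_def lessThan_atLeast0)
    ultimately show ?thesis by simp
  qed
  \<comment> \<open>For a complex eigenvector w, the number T = w* A w equals z times the squared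
    norm N. It is invariant under conjugation because A is real and symmetric, so z is real.\<close>
  define N where "N = (\<Sum>i<n. cnj (w $ i) * w $ i)"
  define T where "T = (\<Sum>i<n. \<Sum>j<n. of_real (A $$ (i, j)) * (cnj (w $ i) * w $ j))"
  have T: "T = z * N"
    unfolding T_def N_def sum_distrib_left
    by (rule sum.cong[OF refl])
       (use row in \<open>simp add: sum_distrib_left[symmetric] mult_ac, simp add: mult.left_commute[of _ "cnj _"] sum_distrib_left[symmetric]\<close>)
  have "cnj T = (\<Sum>i<n. \<Sum>j<n. of_real (A $$ (i, j)) * (w $ i * cnj (w $ j)))"
    by (simp add: T_def)
  also have "\<dots> = (\<Sum>j<n. \<Sum>i<n. of_real (A $$ (i, j)) * (w $ i * cnj (w $ j)))"
    by (rule sum.swap)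
  also have "\<dots> = T"
    unfolding T_def by (intro sum.cong refl) (auto simp: Aji mult_ac)
  finally have cT: "cnj T = T" .
  have N_eq: "N = of_real (\<Sum>i<n. (cmod (w $ i))\<^sup>2)"
    unfolding N_def of_real_sum by (intro sum.cong refl) (metis complex_norm_square mult.commute)
  obtain i where i: "i < n" "w $ i \<noteq> 0" using w by (metis carrier_vecD eq_vecI index_zero_vec)
  have "(\<Sum>i<n. (cmod (w $ i))\<^sup>2) > 0"
    by (rule sum_pos2[of _ i]) (use i in auto)
  then have "N \<noteq> 0" unfolding N_eq by (metis less_irrefl of_real_eq_0_iff)
  then have "cnj z = z" using cT T N_eq by (metis complex_cnj_complex_of_real complex_cnj_mult mult_cancel_right)
  then have zr: "z = of_real (Re z)" by (metis Reals_cnj_iff complex_is_Real_iff of_real_Re)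
  \<comment> \<open>The root passes from the complexified to the real characteristic polynomial,
    which then provides a real eigenvector; the complex one is discarded.\<close>
  have "poly (map_poly of_real (char_poly A)) (complex_of_real (Re z)) = 0"
    using \<open>poly (char_poly ?B) z = 0\<close> zr by (metis of_real_hom.char_poly_hom[OF A])
  then have "poly (char_poly A) (Re z) = 0" by simp
  then have "eigenvalue A (Re z)" using eigenvalue_root_char_poly[OF A] by simp
  then show ?thesis using A by (auto simp: eigenvalue_def eigenvector_def)
qed

text \<open>The reflection that exchanges q with the first unit vector has q as its first column, so
  it completes q to an orthonormal basis in one step. If q already is the unit vector, then u = 0,
  and c = 0 turns W into the identity.\<close>

lemma householder:
  fixes q :: "nat \<Rightarrow> real"
  assumes q: "(\<Sum>i<n. (q i)\<^sup>2) = 1" and n: "n > 0"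
  shows "\<exists>W. W \<in> carrier_mat n n \<and> transpose_mat W * W = 1\<^sub>m n \<and> (\<forall>i<n. W $$ (i, 0) = q i)"
proof -
  define u where "u i = q i - (if i = 0 then 1 else 0)" for i :: nat
  define c where "c = (if (\<Sum>i<n. (u i)\<^sup>2) = 0 then 0 else 2 / (\<Sum>i<n. (u i)\<^sup>2))"
  define W where "W = mat n n (\<lambda>(i, j). (if i = j then 1 else 0) - c * u i * u j)"
  have s: "(\<Sum>i<n. (u i)\<^sup>2) = 2 - 2 * q 0"
  proof -
    have "(\<Sum>i<n. (u i)\<^sup>2) = (\<Sum>i<n. (q i)\<^sup>2 + (if i = 0 then 1 - 2 * q 0 else 0))"
      by (rule sum.cong) (auto simp: u_def power2_eq_square algebra_simps)
    also have "\<dots> = 1 + (1 - 2 * q 0)" using n by (simp add: sum.distrib q)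
    finally show ?thesis by simp
  qed
  have cs: "c * c * (\<Sum>i<n. (u i)\<^sup>2) = 2 * c" by (simp add: c_def)
  have "(transpose_mat W * W) $$ (i, j) = (if i = j then 1 else 0)" if "i < n" "j < n" for i j
  proof -
    have "(transpose_mat W * W) $$ (i, j) =
       (\<Sum>k<n. ((if k = i then 1 else 0) - c * u k * u i) * ((if k = j then 1 else 0) - c * u k * u j))"
      using that by (auto simp: W_def scalar_prod_def lessThan_atLeast0 intro!: sum.cong)
    also have "\<dots> = (\<Sum>k<n. (if k = i then (if i = j then 1 else 0) - c * u i * u j else 0)
         - (if k = j then c * u i * u j else 0) + c * c * (u k)\<^sup>2 * (u i * u j))"
      by (rule sum.cong) (auto simp: algebra_simps power2_eq_square)
    also have "\<dots> = (if i = j then 1 else 0) - c * u i * u j - c * u i * u j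
        + c * c * (\<Sum>k<n. (u k)\<^sup>2) * (u i * u j)"
      using that by (simp add: sum.distrib sum_subtractf sum_distrib_left sum_distrib_right)
    also have "\<dots> = (if i = j then 1 else 0)" by (simp add: cs)
    finally show ?thesis .
  qed
  then have "transpose_mat W * W = 1\<^sub>m n" by (intro eq_matI) (auto simp: W_def)
  moreover have "W $$ (i, 0) = q i" if i: "i < n" for i
  proof (cases "(\<Sum>i<n. (u i)\<^sup>2) = 0")
    case True
    then have "\<forall>i<n. u i = 0" by (simp add: sum_nonneg_eq_0_iff)
    then show ?thesis using i n by (auto simp: W_def u_def)
  next
    case False
    have "c * u 0 = -1" using False s by (simp add: c_def u_def field_simps)
    then show ?thesis using i n by (simp add: W_def mult.assoc mult.left_commute[of _ "u i"]) (simp add: u_def)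
  qed
  ultimately show ?thesis by (intro exI[of _ W]) (auto simp: W_def)
qed

definition diag_matrix :: "nat \<Rightarrow> (nat \<Rightarrow> real) \<Rightarrow> real mat" where
  "diag_matrix n d = mat n n (\<lambda>(i, j). if i = j then d i else 0)"

text \<open>Deflation: completing a unit eigenvector to an orthogonal matrix W makes the first
  column of \<open>transpose_mat W * A * W\<close>, and by symmetry its first row, a multiple of the
  unit vector. The induction hypothesis diagonalises the remaining block.\<close>

lemma spectral_theorem_mat:
  fixes A :: "real mat"
  assumes "A \<in> carrier_mat n n" and "transpose_mat A = A"
  shows "\<exists>U d. U \<in> carrier_mat n n \<and> transpose_mat U * U = 1\<^sub>m n \<and>
     transpose_mat U * A * U = diag_matrix n d"
  using assms
proof (induction n arbitrary: A)
  case 0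
  then show ?case by (intro exI[of _ "1\<^sub>m 0"]) (auto simp: diag_matrix_def intro!: eq_matI)
next
  case (Suc m)
  let ?n = "Suc m"
  note A = Suc.prems(1)
  obtain e v where v: "v \<in> carrier_vec ?n" "v \<noteq> 0\<^sub>v ?n" "A *\<^sub>v v = e \<cdot>\<^sub>v v"
    using real_symmetric_has_eigenvector[OF Suc.prems] by auto
  define r where "r = sqrt (\<Sum>i<?n. (v $ i)\<^sup>2)"
  obtain i where i: "i < ?n" "v $ i \<noteq> 0" using v by (metis carrier_vecD eq_vecI index_zero_vec)
  have pos: "(\<Sum>i<?n. (v $ i)\<^sup>2) > 0"
    by (rule sum_pos2[of _ i]) (use i in auto)
  then have r: "r > 0" "r\<^sup>2 = (\<Sum>i<?n. (v $ i)\<^sup>2)" by (auto simp: r_def sum_nonneg)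
  have "(\<Sum>i<?n. (v $ i / r)\<^sup>2) = 1"
    using r pos by (simp add: power_divide sum_divide_distrib[symmetric] del: sum.lessThan_Suc)
  from householder[OF this] obtain W where W: "W \<in> carrier_mat ?n ?n"
    "transpose_mat W * W = 1\<^sub>m ?n" "\<And>i. i < ?n \<Longrightarrow> W $$ (i, 0) = v $ i / r" by auto
  let ?Wt = "transpose_mat W"
  have Wt: "?Wt \<in> carrier_mat ?n ?n" using W by simp
  define B where "B = ?Wt * A * W"
  have B: "B \<in> carrier_mat ?n ?n" using W A by (simp add: B_def)
  have symB: "transpose_mat B = B"
    using W A Suc.prems(2) Wt unfolding B_def
    by (simp add: transpose_mult[of _ ?n ?n _ ?n] assoc_mult_mat[of _ ?n ?n _ ?n _ ?n])
  have colW: "col W 0 = (1 / r) \<cdot>\<^sub>v v"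
    using W v by (intro eq_vecI) auto
  have "B = ?Wt * (A * W)" unfolding B_def by (rule assoc_mult_mat[OF Wt A W(1)])
  then have "col B 0 = ?Wt *\<^sub>v col (A * W) 0"
    using W A Wt col_mult2[OF Wt, of "A * W" ?n 0] by simp
  also have "col (A * W) 0 = A *\<^sub>v col W 0"
    by (rule col_mult2[OF A W(1)]) simp
  finally have "col B 0 = ?Wt *\<^sub>v (A *\<^sub>v col W 0)" .
  also have "A *\<^sub>v col W 0 = e \<cdot>\<^sub>v col W 0"
    using v A by (simp add: colW mult_mat_vec[of _ ?n ?n] smult_smult_assoc mult.commute)
  also have "?Wt *\<^sub>v (e \<cdot>\<^sub>v col W 0) = e \<cdot>\<^sub>v (?Wt *\<^sub>v col W 0)"
    by (rule mult_mat_vec[OF Wt]) (metis W(1) carrier_matD(1) col_carrier_vec zero_less_Suc carrier_matD(2))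
  also have "?Wt *\<^sub>v col W 0 = col (?Wt * W) 0"
    by (rule col_mult2[OF Wt W(1), symmetric]) simp
  also have "\<dots> = unit_vec ?n 0" unfolding W(2) by simp
  finally have colB: "col B 0 = e \<cdot>\<^sub>v unit_vec ?n 0" .
  have B0: "B $$ (i, 0) = (if i = 0 then e else 0)" if "i < ?n" for i
  proof -
    have "B $$ (i, 0) = col B 0 $ i" using that B by simp
    then show ?thesis using that by (simp add: colB unit_vec_def)
  qed
  have B0': "B $$ (0, i) = (if i = 0 then e else 0)" if "i < ?n" for i
    using B0[OF that] symB B that by (metis carrier_matD index_transpose_mat(1) zero_less_Suc)
  define B2 where "B2 = mat m m (\<lambda>(i, j). B $$ (Suc i, Suc j))"
  have B2: "B2 \<in> carrier_mat m m" by (simp add: B2_def)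
  have symB2: "transpose_mat B2 = B2"
  proof (intro eq_matI)
    fix i j assume "i < dim_row B2" "j < dim_col B2"
    then show "transpose_mat B2 $$ (i, j) = B2 $$ (i, j)"
      using symB B by (simp add: B2_def) (metis Suc_less_eq carrier_matD index_transpose_mat(1))
  qed (auto simp: B2_def)
  obtain U2 d2 where U2: "U2 \<in> carrier_mat m m" "transpose_mat U2 * U2 = 1\<^sub>m m"
    "transpose_mat U2 * B2 * U2 = diag_matrix m d2" using Suc.IH[OF B2 symB2] by auto
  note [simp del] = One_nat_def
  let ?o = "mat 1 1 (\<lambda>_. 1 :: real)"
  define V where "V = four_block_mat ?o (0\<^sub>m 1 m) (0\<^sub>m m 1) U2"
  have V: "V \<in> carrier_mat ?n ?n"
    using four_block_carrier_mat[of ?o 1 1 U2 m m "0\<^sub>m 1 m" "0\<^sub>m m 1"] U2(1)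
    unfolding V_def by (metis mat_carrier plus_1_eq_Suc)
  have Vt: "transpose_mat V = four_block_mat ?o (0\<^sub>m 1 m) (0\<^sub>m m 1) (transpose_mat U2)"
    using U2 unfolding V_def by (subst transpose_four_block_mat[of _ 1 1 _ m _ m]) (auto intro!: arg_cong2[where f="\<lambda>x y. four_block_mat x _ _ y"] eq_matI)
  have BB: "B = four_block_mat (mat 1 1 (\<lambda>_. e)) (0\<^sub>m 1 m) (0\<^sub>m m 1) B2"
    using B B0 B0' by (intro eq_matI) (auto simp: B2_def)
  have oo: "?o * ?o = ?o" "?o * mat 1 1 (\<lambda>_. e) = mat 1 1 (\<lambda>_. e)" "mat 1 1 (\<lambda>_. e) * ?o = mat 1 1 (\<lambda>_. e)"
    by (auto intro!: eq_matI simp: scalar_prod_def)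
  have VtV: "transpose_mat V * V = 1\<^sub>m ?n"
  proof -
    have "transpose_mat V * V = four_block_mat ?o (0\<^sub>m 1 m) (0\<^sub>m m 1) (1\<^sub>m m)"
      unfolding Vt unfolding V_def using U2
      by (subst mult_four_block_mat[of _ 1 1 _ m _ m _ _ 1 _ m]) (auto simp: oo left_mult_zero_mat[of _ m] right_mult_zero_mat[of _ _ m])
    also have "\<dots> = 1\<^sub>m ?n" by (intro eq_matI) auto
    finally show ?thesis .
  qed
  have VtBV: "transpose_mat V * B * V = diag_matrix ?n (\<lambda>i. case i of 0 \<Rightarrow> e | Suc k \<Rightarrow> d2 k)"
  proof -
    have "transpose_mat V * B = four_block_mat (mat 1 1 (\<lambda>_. e)) (0\<^sub>m 1 m) (0\<^sub>m m 1) (transpose_mat U2 * B2)"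
      unfolding Vt BB using U2 B2
      by (subst mult_four_block_mat[of _ 1 1 _ m _ m _ _ 1 _ m]) (auto simp: oo left_mult_zero_mat[of _ m] right_mult_zero_mat[of _ _ m])
    moreover have "0\<^sub>m m m + diag_matrix m d2 = diag_matrix m d2"
      by (intro left_add_zero_mat) (simp add: diag_matrix_def)
    ultimately have "transpose_mat V * B * V = four_block_mat (mat 1 1 (\<lambda>_. e)) (0\<^sub>m 1 m) (0\<^sub>m m 1) (transpose_mat U2 * B2 * U2)"
      unfolding V_def using U2 B2
      by (simp only:, subst mult_four_block_mat[of _ 1 1 _ m _ m _ _ 1 _ m]) (auto simp: oo left_mult_zero_mat[of _ m] right_mult_zero_mat[of _ _ m])
    then show ?thesis unfolding U2
      by (intro eq_matI) (auto simp: diag_matrix_def split: nat.splits)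
  qed
  define U where "U = W * V"
  have U: "U \<in> carrier_mat ?n ?n" using W V by (simp add: U_def)
  have Vtc: "transpose_mat V \<in> carrier_mat ?n ?n" using V by simp
  have tU: "transpose_mat U = transpose_mat V * ?Wt" using W V by (simp add: U_def transpose_mult[of _ ?n ?n _ ?n])
  have WV: "W * V \<in> carrier_mat ?n ?n" using W V by simp
  have "transpose_mat U * U = transpose_mat V * (?Wt * (W * V))"
    unfolding tU unfolding U_def by (rule assoc_mult_mat[OF Vtc Wt WV])
  also have "?Wt * (W * V) = V"
    using assoc_mult_mat[OF Wt W(1) V] W(2) V by simp
  finally have "transpose_mat U * U = 1\<^sub>m ?n" using VtV by simp
  moreover have "transpose_mat U * A * U = transpose_mat V * B * V"
  proof -
    have "transpose_mat U * A = transpose_mat V * (?Wt * A)"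
      unfolding tU by (rule assoc_mult_mat[OF Vtc Wt A])
    then have "transpose_mat U * A * U = transpose_mat V * ((?Wt * A) * (W * V))"
      unfolding U_def using assoc_mult_mat[OF Vtc _ WV, of "?Wt * A"] Wt A by simp
    also have "(?Wt * A) * (W * V) = B * V"
      unfolding B_def using assoc_mult_mat[of "?Wt * A" ?n ?n W ?n V ?n] Wt A W V by simp
    also have "transpose_mat V * (B * V) = transpose_mat V * B * V"
      by (rule assoc_mult_mat[OF Vtc B V, symmetric])
    finally show ?thesis .
  qed
  ultimately show ?case using U VtBV by metis
qed

lemma proots_prod_list_linear:
  "proots (\<Prod>a\<leftarrow>es. [:- a, 1:]) = mset (es :: real list)"
proof (induction es)
  case (Cons a es)
  have "(\<Prod>a\<leftarrow>es. [:- a, 1:]) \<noteq> (0 :: real poly)" by (auto simp: prod_list_zero_iff)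
  then have "proots ([:- a, 1:] * (\<Prod>a\<leftarrow>es. [:- a, 1:])) = proots [:- a, 1:] + mset es"
    using Cons by (subst proots_mult) auto
  then show ?case by simp
qed simp

definition quad_form :: "nat \<Rightarrow> real mat \<Rightarrow> (nat \<Rightarrow> real) \<Rightarrow> real" where
  "quad_form n A v = (\<Sum>k<n. \<Sum>l<n. A $$ (k, l) * v k * v l)"

text \<open>The form in which diagonalisation enters all counting arguments: only the coordinates of
  a vector in the eigenbasis appear, so that matrix products can be forgotten from here on. The
  multiset of roots is read off from the similarity to a diagonal matrix.\<close>

lemma spectral_theorem:
  fixes A :: "real mat"
  assumes A: "A \<in> carrier_mat n n" and sym: "transpose_mat A = A"
  obtains q d where
    "\<And>i j. i < n \<Longrightarrow> j < n \<Longrightarrow> (\<Sum>k<n. q i k * q j k) = (if i = j then 1 else 0 :: real)"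
    "\<And>v. quad_form n A v = (\<Sum>i<n. d i * (\<Sum>k<n. q i k * v k)\<^sup>2)"
    "\<And>v. (\<Sum>k<n. (v k)\<^sup>2) = (\<Sum>i<n. (\<Sum>k<n. q i k * v k)\<^sup>2)"
    "proots (char_poly A) = image_mset d (mset_set {..<n})"
proof -
  obtain U d where U: "U \<in> carrier_mat n n" "transpose_mat U * U = 1\<^sub>m n"
     "transpose_mat U * A * U = diag_matrix n d" using spectral_theorem_mat[OF assms] by blast
  have Ut: "transpose_mat U \<in> carrier_mat n n" using U by simp
  have UU: "U * transpose_mat U = 1\<^sub>m n"
    using mat_mult_left_right_inverse[OF Ut U(1) U(2)] .
  have D: "diag_matrix n d \<in> carrier_mat n n" by (simp add: diag_matrix_def)
  have UA: "transpose_mat U * A \<in> carrier_mat n n" using A Ut by simp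
  have "U * (transpose_mat U * A * U) = U * (transpose_mat U * A) * U"
    by (rule assoc_mult_mat[OF U(1) UA U(1), symmetric])
  also have "U * (transpose_mat U * A) = A"
    using assoc_mult_mat[OF U(1) Ut A] UU A by simp
  finally have "U * diag_matrix n d * transpose_mat U = A * U * transpose_mat U" using U by simp
  also have "\<dots> = A * (U * transpose_mat U)" by (rule assoc_mult_mat[OF A U(1) Ut])
  finally have dec: "A = U * diag_matrix n d * transpose_mat U" using UU A by simp
  define q where "q i k = U $$ (k, i)" for i k
  have orth: "(\<Sum>k<n. q i k * q j k) = (if i = j then 1 else 0)" if "i < n" "j < n" for i j
  proof -
    have "(transpose_mat U * U) $$ (i, j) = (\<Sum>k<n. q i k * q j k)"
      using U(1) that by (simp add: scalar_prod_def lessThan_atLeast0 q_def)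
    then show ?thesis using U(2) that by simp
  qed
  have orth': "(\<Sum>i<n. q i k * q i l) = (if k = l then 1 else 0)" if "k < n" "l < n" for k l
  proof -
    have "(U * transpose_mat U) $$ (k, l) = (\<Sum>i<n. q i k * q i l)"
      using U(1) that by (simp add: scalar_prod_def lessThan_atLeast0 q_def)
    then show ?thesis using UU that by simp
  qed
  have Akl: "A $$ (k, l) = (\<Sum>i<n. d i * q i k * q i l)" if "k < n" "l < n" for k l
  proof -
    have UD: "(U * diag_matrix n d) $$ (k, i) = d i * q i k" if i: "i < n" for i
    proof -
      have "(U * diag_matrix n d) $$ (k, i) = (\<Sum>j<n. q j k * (if j = i then d j else 0))"
        using U(1) \<open>k < n\<close> i by (simp add: scalar_prod_def lessThan_atLeast0 q_def diag_matrix_def)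
      also have "\<dots> = (\<Sum>j<n. if j = i then q j k * d j else 0)" by (rule sum.cong) auto
      also have "\<dots> = d i * q i k" using i by simp
      finally show ?thesis .
    qed
    have "(U * diag_matrix n d * transpose_mat U) $$ (k, l)
        = (\<Sum>i<n. (U * diag_matrix n d) $$ (k, i) * q i l)"
      using U(1) D that by (simp add: scalar_prod_def lessThan_atLeast0 q_def del: assoc_mult_mat)
    also have "\<dots> = (\<Sum>i<n. d i * q i k * q i l)" by (rule sum.cong) (auto simp: UD)
    finally show ?thesis using dec by simp
  qed
  have sq: "(\<Sum>k<n. q i k * v k)\<^sup>2 = (\<Sum>k<n. \<Sum>l<n. q i k * q i l * (v k * v l))" for i v
    unfolding power2_eq_square sum_product by (simp add: mult_ac)
  have form: "quad_form n A v = (\<Sum>i<n. d i * (\<Sum>k<n. q i k * v k)\<^sup>2)" for v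
  proof -
    have "quad_form n A v = (\<Sum>k<n. \<Sum>l<n. \<Sum>i<n. d i * (q i k * q i l * (v k * v l)))"
      unfolding quad_form_def
      by (intro sum.cong refl) (simp add: Akl sum_distrib_right sum_distrib_left mult_ac)
    also have "\<dots> = (\<Sum>k<n. \<Sum>i<n. \<Sum>l<n. d i * (q i k * q i l * (v k * v l)))"
      by (intro sum.cong refl sum.swap)
    also have "\<dots> = (\<Sum>i<n. \<Sum>k<n. \<Sum>l<n. d i * (q i k * q i l * (v k * v l)))"
      by (rule sum.swap)
    finally show ?thesis by (simp add: sq sum_distrib_left)
  qed
  have norm: "(\<Sum>k<n. (v k)\<^sup>2) = (\<Sum>i<n. (\<Sum>k<n. q i k * v k)\<^sup>2)" for v
  proof -
    have "(\<Sum>i<n. (\<Sum>k<n. q i k * v k)\<^sup>2) = (\<Sum>k<n. \<Sum>i<n. \<Sum>l<n. q i k * q i l * (v k * v l))"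
      unfolding sq by (rule sum.swap)
    also have "\<dots> = (\<Sum>k<n. \<Sum>l<n. \<Sum>i<n. q i k * q i l * (v k * v l))"
      by (intro sum.cong refl sum.swap)
    also have "\<dots> = (\<Sum>k<n. \<Sum>l<n. if k = l then v k * v l else 0)"
      by (intro sum.cong refl) (simp add: sum_distrib_right[symmetric] orth')
    also have "\<dots> = (\<Sum>k<n. (v k)\<^sup>2)" by (intro sum.cong refl) (simp add: power2_eq_square)
    finally show ?thesis by simp
  qed
  have "similar_mat A (diag_matrix n d)"
    unfolding similar_mat_def similar_mat_wit_def Let_def
    by (intro exI[of _ U] exI[of _ "transpose_mat U"]) (use A U Ut UU D dec in auto)
  then have "char_poly A = char_poly (diag_matrix n d)" by (rule char_poly_similar)
  also have "\<dots> = (\<Prod>a\<leftarrow>diag_mat (diag_matrix n d). [:- a, 1:])"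
    by (rule char_poly_upper_triangular[OF D]) (auto simp: diag_matrix_def)
  also have "diag_mat (diag_matrix n d) = map d [0..<n]"
    by (auto simp: diag_mat_def diag_matrix_def)
  finally have "proots (char_poly A) = image_mset d (mset_set {..<n})"
    by (simp only: proots_prod_list_linear) (simp add: mset_upt lessThan_atLeast0)
  with orth form norm that show ?thesis by blast
qed

text \<open>Gaussian elimination: an equation with a nonzero coefficient at j0 is solved for that
  unknown and substituted into the others, which removes one equation and one unknown. This is the
  dimension count behind every comparison of eigenvalue counts.\<close>

lemma homogeneous_system_nontrivial:
  fixes c :: "'i \<Rightarrow> 'j \<Rightarrow> real"
  assumes "finite I" "finite J" "card I < card J"
  shows "\<exists>x. (\<exists>j\<in>J. x j \<noteq> 0) \<and> (\<forall>i\<in>I. (\<Sum>j\<in>J. c i j * x j) = 0)"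
  using assms
proof (induction I arbitrary: J c rule: finite_induct)
  case empty
  then obtain j where "j \<in> J" by fastforce
  then show ?case by (intro exI[of _ "\<lambda>_. 1"]) auto
next
  case (insert i I)
  show ?case
  proof (cases "\<forall>j\<in>J. c i j = 0")
    case True
    have "card I < card J" using insert by simp
    from insert.IH[OF insert.prems(1) this, of c] True show ?thesis by auto
  next
    case False
    then obtain j0 where j0: "j0 \<in> J" "c i j0 \<noteq> 0" by auto
    let ?J = "J - {j0}"
    have "finite ?J" "card I < card ?J" using insert j0 by auto
    from insert.IH[OF this, of "\<lambda>i' j. c i' j - c i' j0 * c i j / c i j0"]
    obtain x where x: "\<exists>j\<in>?J. x j \<noteq> 0"
       "\<And>i'. i' \<in> I \<Longrightarrow> (\<Sum>j\<in>?J. (c i' j - c i' j0 * c i j / c i j0) * x j) = 0" by auto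
    define y where "y j = (if j = j0 then - (\<Sum>j\<in>?J. c i j * x j) / c i j0 else x j)" for j
    have y: "(\<Sum>j\<in>J. c i' j * y j) = c i' j0 * y j0 + (\<Sum>j\<in>?J. c i' j * x j)" for i'
      using insert.prems(1) j0 by (subst sum.remove[of J j0]) (auto simp: y_def intro!: sum.cong)
    have "(\<Sum>j\<in>J. c i j * y j) = 0" unfolding y using j0 by (simp add: y_def)
    moreover have "(\<Sum>j\<in>J. c i' j * y j) = 0" if "i' \<in> I" for i'
    proof -
      have "(\<Sum>j\<in>?J. (c i' j - c i' j0 * c i j / c i j0) * x j)
         = (\<Sum>j\<in>?J. c i' j * x j) - c i' j0 / c i j0 * (\<Sum>j\<in>?J. c i j * x j)"
        by (simp add: sum_subtractf sum_distrib_left algebra_simps)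
      then show ?thesis unfolding y using x(2)[OF that] j0 by (simp add: y_def)
    qed
    moreover have "\<exists>j\<in>J. y j \<noteq> 0" using x(1) by (auto simp: y_def)
    ultimately show ?thesis by auto
  qed
qed

lemma orthonormal_combination:
  fixes q :: "nat \<Rightarrow> nat \<Rightarrow> real"
  assumes orth: "\<And>i j. i < n \<Longrightarrow> j < n \<Longrightarrow> (\<Sum>k<n. q i k * q j k) = (if i = j then 1 else 0)"
    and K: "K \<subseteq> {..<n}" and j: "j < n"
  shows "(\<Sum>k<n. q j k * (\<Sum>i\<in>K. x i * q i k)) = (if j \<in> K then x j else 0)"
proof -
  have fin: "finite K" using K finite_subset by blast
  have "(\<Sum>k<n. q j k * (\<Sum>i\<in>K. x i * q i k)) = (\<Sum>k<n. \<Sum>i\<in>K. x i * (q j k * q i k))"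
    by (simp add: sum_distrib_left mult_ac)
  also have "\<dots> = (\<Sum>i\<in>K. \<Sum>k<n. x i * (q j k * q i k))" by (rule sum.swap)
  also have "\<dots> = (\<Sum>i\<in>K. if j = i then x i else 0)"
    using K j by (intro sum.cong refl) (auto simp: sum_distrib_left[symmetric] orth)
  finally show ?thesis using fin by simp
qed

section \<open>Eigenvalue counts by comparing dimensions\<close>

definition count_above :: "real mat \<Rightarrow> real \<Rightarrow> nat" where
  "count_above A t = size (filter_mset (\<lambda>x. t < x) (proots (char_poly A)))"

lemma count_above_spectral:
  fixes n :: nat
  assumes "proots (char_poly A) = image_mset d (mset_set {..<n})"
  shows "count_above A t = card {i. i < n \<and> t < d i}"
proof -
  have "filter_mset (\<lambda>x. t < x) (image_mset d (mset_set {..<n}))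
     = image_mset d (mset_set {i. i < n \<and> t < d i})"
    unfolding filter_mset_image_mset by (subst filter_mset_mset_set) (auto intro!: arg_cong[where f="\<lambda>S. image_mset d (mset_set S)"])
  then show ?thesis by (simp add: count_above_def assms)
qed

lemma weighted_square_sum_greater:
  fixes d x :: "'a \<Rightarrow> real"
  assumes "finite K" "\<exists>i\<in>K. x i \<noteq> 0" "\<And>i. i \<in> K \<Longrightarrow> t < d i"
  shows "t * (\<Sum>i\<in>K. (x i)\<^sup>2) < (\<Sum>i\<in>K. d i * (x i)\<^sup>2)"
proof -
  obtain i where i: "i \<in> K" "x i \<noteq> 0" using assms by blast
  have "0 < (\<Sum>i\<in>K. (d i - t) * (x i)\<^sup>2)"
  proof (rule sum_pos2[of _ i])
    show "0 < (d i - t) * (x i)\<^sup>2" using assms(3)[OF i(1)] i by simp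
    show "0 \<le> (d j - t) * (x j)\<^sup>2" if "j \<in> K" for j
      using assms(3)[OF that] by simp
  qed (use assms i in auto)
  then show ?thesis by (simp add: algebra_simps sum_subtractf sum_distrib_left)
qed

text \<open>If more than \<open>card S\<close> eigenvalues exceeded t, the span of their
  eigenvectors would contain a nonzero vector vanishing on S, and its form would exceed t times its
  squared norm.\<close>

lemma count_above_le:
  assumes A: "A \<in> carrier_mat n n" "transpose_mat A = A" and fin: "finite S"
    and le: "\<And>v. (\<And>i. i \<in> S \<Longrightarrow> v i = 0) \<Longrightarrow> quad_form n A v \<le> t * (\<Sum>k<n. (v k)\<^sup>2)"
  shows "count_above A t \<le> card S"
proof (rule ccontr)
  assume not: "\<not> ?thesis"
  obtain q d where orth: "\<And>i j. i < n \<Longrightarrow> j < n \<Longrightarrow> (\<Sum>k<n. q i k * q j k) = (if i = j then 1 else 0)"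
    and form: "\<And>v. quad_form n A v = (\<Sum>i<n. d i * (\<Sum>k<n. q i k * v k)\<^sup>2)"
    and norm: "\<And>v. (\<Sum>k<n. (v k)\<^sup>2) = (\<Sum>i<n. (\<Sum>k<n. q i k * v k)\<^sup>2)"
    and pr: "proots (char_poly A) = image_mset d (mset_set {..<n})"
    by (rule spectral_theorem[OF A]; rule that; assumption)
  define K where "K = {i. i < n \<and> t < d i}"
  have K: "finite K" "K \<subseteq> {..<n}" by (auto simp: K_def)
  have "card S < card K" using not count_above_spectral[OF pr] by (simp add: K_def)
  from homogeneous_system_nontrivial[OF fin K(1) this, of "\<lambda>s i. q i s"]
  obtain x where x: "\<exists>i\<in>K. x i \<noteq> 0" "\<And>s. s \<in> S \<Longrightarrow> (\<Sum>i\<in>K. q i s * x i) = 0" by blast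
  define v where "v k = (\<Sum>i\<in>K. x i * q i k)" for k
  have qv: "(\<Sum>k<n. q j k * v k) = (if j \<in> K then x j else 0)" if "j < n" for j
    unfolding v_def using orthonormal_combination[OF orth K(2) that] .
  have "v s = 0" if "s \<in> S" for s using x(2)[OF that] by (simp add: v_def mult.commute)
  then have "quad_form n A v \<le> t * (\<Sum>k<n. (v k)\<^sup>2)" by (rule le)
  moreover have "quad_form n A v = (\<Sum>i\<in>K. d i * (x i)\<^sup>2)"
    unfolding form using K by (intro sum.mono_neutral_cong_right) (auto simp: qv)
  moreover have "(\<Sum>k<n. (v k)\<^sup>2) = (\<Sum>i\<in>K. (x i)\<^sup>2)"
    unfolding norm[of v] using K by (intro sum.mono_neutral_cong_right) (auto simp: qv)
  moreover have "t * (\<Sum>i\<in>K. (x i)\<^sup>2) < (\<Sum>i\<in>K. d i * (x i)\<^sup>2)"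
    by (rule weighted_square_sum_greater[OF K(1) x(1)]) (auto simp: K_def)
  ultimately show False by simp
qed

text \<open>If fewer than \<open>card S\<close> eigenvalues exceeded t, some nontrivial combination
  of the vectors \<open>T s\<close> would be orthogonal to all their eigenvectors, and its form
  would be at most t times its squared norm. Since the strict inequality is required for all nonzero
  coefficients, it contains the linear independence of the \<open>T s\<close>.\<close>

lemma count_above_ge:
  assumes A: "A \<in> carrier_mat n n" "transpose_mat A = A" and fin: "finite S"
    and gt: "\<And>x. (\<exists>s\<in>S. x s \<noteq> 0) \<Longrightarrow>
      t * (\<Sum>k<n. (\<Sum>s\<in>S. T s k * x s)\<^sup>2) < quad_form n A (\<lambda>k. \<Sum>s\<in>S. T s k * x s)"
  shows "card S \<le> count_above A t"
proof (rule ccontr)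
  assume not: "\<not> ?thesis"
  obtain q d where "\<And>i j. i < n \<Longrightarrow> j < n \<Longrightarrow> (\<Sum>k<n. q i k * q j k) = (if i = j then 1 else 0 :: real)"
    and form: "\<And>v. quad_form n A v = (\<Sum>i<n. d i * (\<Sum>k<n. q i k * v k)\<^sup>2)"
    and norm: "\<And>v. (\<Sum>k<n. (v k)\<^sup>2) = (\<Sum>i<n. (\<Sum>k<n. q i k * v k)\<^sup>2)"
    and pr: "proots (char_poly A) = image_mset d (mset_set {..<n})"
    by (rule spectral_theorem[OF A]; rule that; assumption)
  define K where "K = {i. i < n \<and> t < d i}"
  have K: "finite K" "K \<subseteq> {..<n}" by (auto simp: K_def)
  have "card K < card S" using not count_above_spectral[OF pr] by (simp add: K_def)
  from homogeneous_system_nontrivial[OF K(1) fin this, of "\<lambda>i s. \<Sum>k<n. q i k * T s k"]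
  obtain x where x: "\<exists>s\<in>S. x s \<noteq> 0" "\<And>i. i \<in> K \<Longrightarrow> (\<Sum>s\<in>S. (\<Sum>k<n. q i k * T s k) * x s) = 0"
    by blast
  let ?v = "\<lambda>k. \<Sum>s\<in>S. T s k * x s"
  have "(\<Sum>k<n. q i k * ?v k) = (\<Sum>s\<in>S. (\<Sum>k<n. q i k * T s k) * x s)" for i
    unfolding sum_distrib_left sum_distrib_right mult.assoc by (rule sum.swap)
  then have z: "(\<Sum>k<n. q i k * ?v k) = 0" if "i \<in> K" for i using x(2)[OF that] by simp
  have "quad_form n A ?v \<le> t * (\<Sum>k<n. (?v k)\<^sup>2)"
    unfolding form norm[of ?v] sum_distrib_left[where r=t]
  proof (rule sum_mono)
    fix i assume "i \<in> {..<n}"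
    then show "d i * (\<Sum>k<n. q i k * ?v k)\<^sup>2 \<le> t * (\<Sum>k<n. q i k * ?v k)\<^sup>2"
      using z[of i] by (cases "i \<in> K") (auto simp: K_def intro!: mult_right_mono)
  qed
  with gt[OF x(1)] show False by simp
qed

section \<open>Continuity and measurability of the eigenvalues\<close>

text \<open>Weyl's inequality in terms of counts. If B had more eigenvalues above t + e than A has
  above t, a nonzero combination of the corresponding eigenvectors of B would be orthogonal to those
  of A, which contradicts the comparison of the forms.\<close>

lemma count_above_perturb:
  assumes A: "A \<in> carrier_mat n n" "transpose_mat A = A"
    and B: "B \<in> carrier_mat n n" "transpose_mat B = B"
    and le: "\<And>v. quad_form n B v \<le> quad_form n A v + e * (\<Sum>k<n. (v k)\<^sup>2)"
  shows "count_above B (t + e) \<le> count_above A t"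
proof (rule ccontr)
  assume not: "\<not> ?thesis"
  obtain q d where orth: "\<And>i j. i < n \<Longrightarrow> j < n \<Longrightarrow> (\<Sum>k<n. q i k * q j k) = (if i = j then 1 else 0)"
    and form: "\<And>v. quad_form n A v = (\<Sum>i<n. d i * (\<Sum>k<n. q i k * v k)\<^sup>2)"
    and norm: "\<And>v. (\<Sum>k<n. (v k)\<^sup>2) = (\<Sum>i<n. (\<Sum>k<n. q i k * v k)\<^sup>2)"
    and pr: "proots (char_poly A) = image_mset d (mset_set {..<n})"
    by (rule spectral_theorem[OF A]; rule that; assumption)
  obtain q' d' where orth': "\<And>i j. i < n \<Longrightarrow> j < n \<Longrightarrow> (\<Sum>k<n. q' i k * q' j k) = (if i = j then 1 else 0)"
    and form': "\<And>v. quad_form n B v = (\<Sum>i<n. d' i * (\<Sum>k<n. q' i k * v k)\<^sup>2)"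
    and norm': "\<And>v. (\<Sum>k<n. (v k)\<^sup>2) = (\<Sum>i<n. (\<Sum>k<n. q' i k * v k)\<^sup>2)"
    and pr': "proots (char_poly B) = image_mset d' (mset_set {..<n})"
    by (rule spectral_theorem[OF B]; rule that; assumption)
  define K where "K = {i. i < n \<and> t < d i}"
  define K' where "K' = {i. i < n \<and> t + e < d' i}"
  have K: "finite K" "finite K'" "K' \<subseteq> {..<n}" by (auto simp: K_def K'_def)
  have "card K < card K'"
    using not count_above_spectral[OF pr] count_above_spectral[OF pr'] by (simp add: K_def K'_def)
  from homogeneous_system_nontrivial[OF K(1,2) this, of "\<lambda>i s. \<Sum>k<n. q i k * q' s k"]
  obtain x where x: "\<exists>s\<in>K'. x s \<noteq> 0" "\<And>i. i \<in> K \<Longrightarrow> (\<Sum>s\<in>K'. (\<Sum>k<n. q i k * q' s k) * x s) = 0"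
    by blast
  define v where "v k = (\<Sum>s\<in>K'. x s * q' s k)" for k
  have "(\<Sum>k<n. q i k * v k) = (\<Sum>s\<in>K'. (\<Sum>k<n. q i k * q' s k) * x s)" for i
    unfolding v_def sum_distrib_left sum_distrib_right mult.assoc mult.commute[of "x _"] by (rule sum.swap)
  then have z: "(\<Sum>k<n. q i k * v k) = 0" if "i \<in> K" for i using x(2)[OF that] by simp
  have "quad_form n A v \<le> t * (\<Sum>k<n. (v k)\<^sup>2)"
    unfolding form norm[of v] sum_distrib_left[where r=t]
  proof (rule sum_mono)
    fix i assume "i \<in> {..<n}"
    then show "d i * (\<Sum>k<n. q i k * v k)\<^sup>2 \<le> t * (\<Sum>k<n. q i k * v k)\<^sup>2"
      using z[of i] by (cases "i \<in> K") (auto simp: K_def intro!: mult_right_mono)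
  qed
  moreover have qv: "(\<Sum>k<n. q' j k * v k) = (if j \<in> K' then x j else 0)" if "j < n" for j
    unfolding v_def using orthonormal_combination[OF orth' K(3) that] .
  moreover have "quad_form n B v = (\<Sum>i\<in>K'. d' i * (x i)\<^sup>2)"
    unfolding form' using K by (intro sum.mono_neutral_cong_right) (auto simp: qv)
  moreover have "(\<Sum>k<n. (v k)\<^sup>2) = (\<Sum>i\<in>K'. (x i)\<^sup>2)"
    unfolding norm'[of v] using K by (intro sum.mono_neutral_cong_right) (auto simp: qv)
  moreover have "(t + e) * (\<Sum>i\<in>K'. (x i)\<^sup>2) < (\<Sum>i\<in>K'. d' i * (x i)\<^sup>2)"
    by (rule weighted_square_sum_greater[OF K(2) x(1)]) (auto simp: K'_def)
  ultimately show False using le[of v] by (simp add: algebra_simps)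
qed

lemma sorted_nth_greater_iff:
  fixes l :: "real list"
  assumes l: "sorted l" and j: "1 \<le> j" "j \<le> length l"
  shows "t < rev l ! (j - 1) \<longleftrightarrow> j \<le> length (filter (\<lambda>x. t < x) l)"
proof -
  let ?n = "length l"
  have nth: "rev l ! (j - 1) = l ! (?n - j)" using j by (simp add: rev_nth)
  have len: "length (filter (\<lambda>x. t < x) l) = card {i. i < ?n \<and> t < l ! i}"
    by (rule length_filter_conv_card)
  show ?thesis
  proof
    assume t: "t < rev l ! (j - 1)"
    have "t < l ! i" if "?n - j \<le> i" "i < ?n" for i
      using sorted_nth_mono[OF l that] t nth by simp
    then have "{?n - j..<?n} \<subseteq> {i. i < ?n \<and> t < l ! i}" by auto
    then have "card {?n - j..<?n} \<le> card {i. i < ?n \<and> t < l ! i}" by (intro card_mono) auto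
    then show "j \<le> length (filter (\<lambda>x. t < x) l)" using j len by simp
  next
    assume c: "j \<le> length (filter (\<lambda>x. t < x) l)"
    show "t < rev l ! (j - 1)"
    proof (rule ccontr)
      assume "\<not> ?thesis"
      then have t: "l ! (?n - j) \<le> t" using nth by simp
      have "l ! i \<le> t" if "i \<le> ?n - j" for i
        using sorted_nth_mono[OF l that] t j by fastforce
      then have "{i. i < ?n \<and> t < l ! i} \<subseteq> {?n - j<..<?n}" by (force simp: not_le[symmetric])
      then have "card {i. i < ?n \<and> t < l ! i} \<le> card {?n - j<..<?n}" by (intro card_mono) auto
      then show False using c len j by simp
    qed
  qed
qed

lemma size_proots_char_poly_symmetric:
  assumes A: "A \<in> carrier_mat n n" "transpose_mat A = (A :: real mat)"
  shows "size (proots (char_poly A)) = n"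
  by (rule spectral_theorem[OF A]) simp

text \<open>The bridge between the sorted list and the counting function. The later facts on single
  eigenvalues, monotonicity under perturbation and continuity included, go through it.\<close>

lemma ordered_eigenvalue_greater_iff:
  assumes A: "A \<in> carrier_mat n n" "transpose_mat A = A" and j: "1 \<le> j" "j \<le> n"
  shows "t < ordered_eigenvalue A j \<longleftrightarrow> j \<le> count_above A t"
proof -
  let ?l = "sorted_list_of_multiset (proots (char_poly A))"
  have "length ?l = n"
    using size_proots_char_poly_symmetric[OF A] by (metis mset_sorted_list_of_multiset size_mset)
  moreover have "length (filter (\<lambda>x. t < x) ?l) = count_above A t"
    unfolding count_above_def by (metis mset_filter mset_sorted_list_of_multiset size_mset)
  ultimately show ?thesis
    using sorted_nth_greater_iff[of ?l j t] j by (simp add: ordered_eigenvalue_def)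
qed

lemma card_ordered_eigenvalues_greater:
  assumes A: "A \<in> carrier_mat n n" "transpose_mat A = A"
  shows "card {j \<in> {1..n}. t < ordered_eigenvalue A j} = count_above A t"
proof -
  have "count_above A t \<le> n"
    using size_proots_char_poly_symmetric[OF A] unfolding count_above_def
    by (metis size_filter_mset_lesseq)
  then have "{j \<in> {1..n}. t < ordered_eigenvalue A j} = {1..count_above A t}"
    using ordered_eigenvalue_greater_iff[OF A] by auto
  then show ?thesis by simp
qed

lemma ordered_eigenvalue_le_perturb:
  assumes A: "A \<in> carrier_mat n n" "transpose_mat A = A"
    and B: "B \<in> carrier_mat n n" "transpose_mat B = B"
    and le: "\<And>v. quad_form n B v \<le> quad_form n A v + e * (\<Sum>k<n. (v k)\<^sup>2)"
    and j: "1 \<le> j" "j \<le> n"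
  shows "ordered_eigenvalue B j \<le> ordered_eigenvalue A j + e"
proof (rule ccontr)
  assume "\<not> ?thesis"
  then have "j \<le> count_above B (ordered_eigenvalue A j + e)"
    by (simp add: ordered_eigenvalue_greater_iff[OF B j, symmetric])
  then have "j \<le> count_above A (ordered_eigenvalue A j)"
    using count_above_perturb[OF A B le] by (rule order_trans)
  then show False using ordered_eigenvalue_greater_iff[OF A j] by blast
qed

text \<open>Rests on 2 |v k v l| <= (v k)^2 + (v l)^2. The factor n is crude, but the bound serves
  only the continuity of the eigenvalues for fixed n.\<close>

lemma quad_form_entrywise_le:
  assumes "\<And>k l. k < n \<Longrightarrow> l < n \<Longrightarrow> \<bar>B $$ (k, l) - A $$ (k, l)\<bar> \<le> e"
  shows "quad_form n B v \<le> quad_form n A v + (e * real n) * (\<Sum>k<n. (v k)\<^sup>2)"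
proof -
  have "quad_form n B v - quad_form n A v = (\<Sum>k<n. \<Sum>l<n. (B $$ (k, l) - A $$ (k, l)) * (v k * v l))"
    by (simp add: quad_form_def sum_subtractf algebra_simps)
  also have "\<dots> \<le> (\<Sum>k<n. \<Sum>l<n. e * (((v k)\<^sup>2 + (v l)\<^sup>2) / 2))"
  proof (intro sum_mono)
    fix k l assume kl: "k \<in> {..<n}" "l \<in> {..<n}"
    have "(B $$ (k, l) - A $$ (k, l)) * (v k * v l) \<le> \<bar>B $$ (k, l) - A $$ (k, l)\<bar> * \<bar>v k * v l\<bar>"
      by (metis abs_ge_self abs_mult)
    also have "\<dots> \<le> e * (((v k)\<^sup>2 + (v l)\<^sup>2) / 2)"
    proof (rule mult_mono)
      have "2 * (\<bar>v k\<bar> * \<bar>v l\<bar>) \<le> (v k)\<^sup>2 + (v l)\<^sup>2"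
        using sum_squares_bound[of "\<bar>v k\<bar>" "\<bar>v l\<bar>"] by simp
      then show "\<bar>v k * v l\<bar> \<le> ((v k)\<^sup>2 + (v l)\<^sup>2) / 2" by (simp add: abs_mult)
      show "\<bar>B $$ (k, l) - A $$ (k, l)\<bar> \<le> e" using assms kl by simp
      then show "0 \<le> e" by linarith
    qed simp
    finally show "(B $$ (k, l) - A $$ (k, l)) * (v k * v l) \<le> e * (((v k)\<^sup>2 + (v l)\<^sup>2) / 2)" .
  qed
  also have "\<dots> = e * (\<Sum>k<n. \<Sum>l<n. ((v k)\<^sup>2 + (v l)\<^sup>2) / 2)" by (simp add: sum_distrib_left)
  also have "(\<Sum>k<n. \<Sum>l<n. ((v k)\<^sup>2 + (v l)\<^sup>2) / 2) = real n * (\<Sum>k<n. (v k)\<^sup>2)"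
    by (simp add: sum.distrib add_divide_distrib sum_divide_distrib[symmetric] sum_distrib_left[symmetric])
  finally show ?thesis by (simp add: algebra_simps)
qed

text \<open>Reads a symmetric matrix off the upper triangle of a function on all index pairs. The
  parameter thus ranges over a fixed countable product of real lines, whose Borel structure is
  available for every n.\<close>

definition symmetric_mat :: "nat \<Rightarrow> (nat \<times> nat \<Rightarrow> real) \<Rightarrow> real mat" where
  "symmetric_mat n x = mat n n (\<lambda>(i, j). x (min i j, max i j))"

lemma laplacian_carrier [simp]: "A \<in> carrier_mat n n \<Longrightarrow> laplacian A \<in> carrier_mat n n"
  by (auto simp: laplacian_def degree_mat_def)

lemma laplacian_index:
  assumes "A \<in> carrier_mat n n" "i < n" "j < n"
  shows "laplacian A $$ (i, j) = (if i = j then (\<Sum>k<n. A $$ (i, k)) else 0) - A $$ (i, j)"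
  using assms by (simp add: laplacian_def degree_mat_def)

lemma laplacian_symmetric:
  assumes "A \<in> carrier_mat n n" "transpose_mat A = A"
  shows "transpose_mat (laplacian A) = laplacian A"
proof (intro eq_matI)
  fix i j assume "i < dim_row (laplacian A)" "j < dim_col (laplacian A)"
  then have ij: "i < n" "j < n" using laplacian_carrier[OF assms(1)] by auto
  have "A $$ (j, i) = A $$ (i, j)"
    using assms ij by (metis carrier_matD index_transpose_mat(1))
  then show "transpose_mat (laplacian A) $$ (i, j) = laplacian A $$ (i, j)"
    using ij laplacian_carrier[OF assms(1)] laplacian_index[OF assms(1)] by auto
qed (use laplacian_carrier[OF assms(1)] in auto)

lemma symmetric_mat_carrier [simp]: "symmetric_mat n x \<in> carrier_mat n n"
  by (simp add: symmetric_mat_def)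

lemma transpose_symmetric_mat [simp]: "transpose_mat (symmetric_mat n x) = symmetric_mat n x"
  by (intro eq_matI) (auto simp: symmetric_mat_def min.commute max.commute)

text \<open>Weyl's inequality in both directions. A row sum moves by at most n times the change of
  an entry, so an entry of the Laplacian moves by at most n + 1 times that change; the other factor
  n comes from the entrywise bound on forms.\<close>

lemma ordered_eigenvalue_laplacian_lipschitz:
  assumes j: "1 \<le> j" "j \<le> n"
  shows "\<bar>ordered_eigenvalue (laplacian (symmetric_mat n y)) j - ordered_eigenvalue (laplacian (symmetric_mat n x)) j\<bar>
     \<le> real n * (real n + 1) * (\<Sum>p\<in>{..<n}\<times>{..<n}. \<bar>y p - x p\<bar>)"
proof -
  define D where "D = (\<Sum>p\<in>{..<n}\<times>{..<n}. \<bar>y p - x p\<bar>)"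
  have sym: "D = (\<Sum>p\<in>{..<n}\<times>{..<n}. \<bar>x p - y p\<bar>)" unfolding D_def by (simp add: abs_minus_commute)
  have le: "ordered_eigenvalue (laplacian (symmetric_mat n y)) j
       \<le> ordered_eigenvalue (laplacian (symmetric_mat n x)) j + real n * (real n + 1) * D"
    if D: "D = (\<Sum>p\<in>{..<n}\<times>{..<n}. \<bar>y p - x p\<bar>)" for x y
  proof -
    have ent: "\<bar>symmetric_mat n y $$ (k, l) - symmetric_mat n x $$ (k, l)\<bar> \<le> D" if "k < n" "l < n" for k l
      unfolding D using that
      by (auto simp: symmetric_mat_def intro!: member_le_sum[of _ _ "\<lambda>p. \<bar>y p - x p\<bar>"] split: if_splits)
    have D0: "0 \<le> D" unfolding D by (intro sum_nonneg) auto
    have dg: "\<bar>(\<Sum>i<n. symmetric_mat n y $$ (k, i)) - (\<Sum>i<n. symmetric_mat n x $$ (k, i))\<bar> \<le> real n * D"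
      if "k < n" for k
    proof -
      have "\<bar>\<Sum>i<n. symmetric_mat n y $$ (k, i) - symmetric_mat n x $$ (k, i)\<bar>
        \<le> (\<Sum>i<n. \<bar>symmetric_mat n y $$ (k, i) - symmetric_mat n x $$ (k, i)\<bar>)" by (rule sum_abs)
      also have "\<dots> \<le> (\<Sum>i<n. D)" by (intro sum_mono ent that) auto
      finally show ?thesis by (simp add: sum_subtractf)
    qed
    have "\<bar>laplacian (symmetric_mat n y) $$ (k, l) - laplacian (symmetric_mat n x) $$ (k, l)\<bar> \<le> (real n + 1) * D"
      if "k < n" "l < n" for k l
    proof -
      have "0 \<le> real n * D" using D0 by simp
      then show ?thesis using ent[OF that] dg[OF that(1)] that
        by (auto simp: laplacian_index[of _ n] algebra_simps)
    qed
    then have "quad_form n (laplacian (symmetric_mat n y)) v \<le> quad_form n (laplacian (symmetric_mat n x)) v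
       + ((real n + 1) * D * real n) * (\<Sum>k<n. (v k)\<^sup>2)" for v
      by (rule quad_form_entrywise_le)
    from ordered_eigenvalue_le_perturb[OF _ _ _ _ this j] show ?thesis
      by (simp add: laplacian_symmetric[of _ n] mult_ac)
  qed
  show ?thesis
    using le[of y x] le[of x y] sym unfolding D_def[symmetric] by (simp add: abs_le_iff)
qed

lemma continuous_on_ordered_eigenvalue_laplacian:
  assumes j: "1 \<le> j" "j \<le> n"
  shows "continuous_on UNIV (\<lambda>x. ordered_eigenvalue (laplacian (symmetric_mat n x)) j)"
  unfolding continuous_on_eq_continuous_at[OF open_UNIV]
proof
  fix x :: "nat \<times> nat \<Rightarrow> real"
  have "isCont (\<lambda>y :: nat \<times> nat \<Rightarrow> real. y p) x" for p
    using continuous_on_product_coordinates[of p] continuous_on_eq_continuous_at[OF open_UNIV] by blast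
  then have "isCont (\<lambda>y. real n * (real n + 1) * (\<Sum>p\<in>{..<n}\<times>{..<n}. \<bar>y p - x p\<bar>)) x"
    by (intro continuous_intros) auto
  then have "((\<lambda>y. real n * (real n + 1) * (\<Sum>p\<in>{..<n}\<times>{..<n}. \<bar>y p - x p\<bar>)) \<longlongrightarrow> 0) (at x)"
    by (simp add: isCont_def)
  then have "((\<lambda>y. ordered_eigenvalue (laplacian (symmetric_mat n y)) j
     - ordered_eigenvalue (laplacian (symmetric_mat n x)) j) \<longlongrightarrow> 0) (at x)"
    by (rule Lim_null_comparison[rotated])
       (use ordered_eigenvalue_laplacian_lipschitz[OF j] in \<open>simp add: always_eventually\<close>)
  then show "isCont (\<lambda>x. ordered_eigenvalue (laplacian (symmetric_mat n x)) j) x"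
    unfolding isCont_def by (subst (asm) LIM_zero_iff)
qed

section \<open>The point process as a measurable function of the matrix entries\<close>

lemma sum_point_masses_eq_distr:
  "sum_point_masses n x = distr (count_space {1..n}) borel x"
proof (rule measure_eqI)
  fix B assume "B \<in> sets (sum_point_masses n x)"
  then have B: "B \<in> sets borel" by simp
  have "emeasure (distr (count_space {1..n}) borel x) B = of_nat (card ({1..n} \<inter> x -` B))"
    using B by (simp add: emeasure_distr emeasure_count_space_finite Int_commute)
  also have "\<dots> = (\<Sum>j=1..n. indicator B (x j))"
    by (simp add: indicator_def sum.If_cases vimage_def)
  finally show "emeasure (sum_point_masses n x) B = emeasure (distr (count_space {1..n}) borel x) B"
    using B by (simp add: emeasure_sum_point_masses)
qed simp

lemma integral_sum_point_masses:
  fixes f :: "real \<Rightarrow> real"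
  assumes "f \<in> borel_measurable borel"
  shows "integral\<^sup>L (sum_point_masses n x) f = (\<Sum>j=1..n. f (x j))"
  unfolding sum_point_masses_eq_distr using assms
  by (subst integral_distr) (auto simp: lebesgue_integral_count_space_finite)

text \<open>It suffices to test subbasic sets of the vague topology. There the integral of a
  continuous f is a finite sum of values of f at continuous functions of the entries.\<close>

lemma continuous_map_laplacian_point_process:
  "continuous_map euclidean vague_topology (\<lambda>x. laplacian_point_process n (symmetric_mat n x))"
  unfolding vague_topology_def
proof (rule continuous_on_generated_topo)
  fix W assume "W \<in> {{\<mu> \<in> locally_finite_measures. integral\<^sup>L \<mu> f \<in> U} | f U.
        continuous_compact_support f \<and> open U}"
  then obtain f :: "real \<Rightarrow> real" and U where W: "W = {\<mu> \<in> locally_finite_measures. integral\<^sup>L \<mu> f \<in> U}"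
    and f: "continuous_on UNIV f" and U: "open U" unfolding continuous_compact_support_def by blast
  let ?g = "\<lambda>x. \<Sum>j=1..n. f (a_seq n * (ordered_eigenvalue (laplacian (symmetric_mat n x)) j - b_seq n))"
  have "continuous_on UNIV ?g"
    by (intro continuous_on_sum continuous_on_compose2[OF f] continuous_intros
        continuous_on_ordered_eigenvalue_laplacian) auto
  then have "open (?g -` U)" using U by (rule open_vimage[rotated])
  moreover have "(\<lambda>x. laplacian_point_process n (symmetric_mat n x)) -` W = ?g -` U"
    by (simp add: W laplacian_point_process_def sum_point_masses_locally_finite
        integral_sum_point_masses[OF borel_measurable_continuous_onI[OF f]] vimage_def)
  ultimately show "openin euclidean ((\<lambda>x. laplacian_point_process n (symmetric_mat n x)) -` W \<inter> topspace euclidean)"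
    by simp
next
  have "\<Union> {{\<mu> \<in> locally_finite_measures. integral\<^sup>L \<mu> f \<in> U} | f U.
        continuous_compact_support f \<and> open U} = locally_finite_measures"
    using topspace_vague_topology unfolding vague_topology_def topology_generated_by_topspace .
  then show "(\<lambda>x. laplacian_point_process n (symmetric_mat n x)) ` topspace euclidean \<subseteq>
    \<Union> {{\<mu> \<in> locally_finite_measures. integral\<^sup>L \<mu> f \<in> U} | f U.
        continuous_compact_support f \<and> open U}"
    by (auto simp: laplacian_point_process_def sum_point_masses_locally_finite)
qed

lemma measurable_laplacian_point_process:
  "(\<lambda>x. laplacian_point_process n (symmetric_mat n x)) \<in> measurable borel vague_borel"
  unfolding vague_borel_def
proof (rule measurable_measure_of)
  show "{U. openin vague_topology U} \<subseteq> Pow locally_finite_measures"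
    using openin_subset[of vague_topology] by auto
  show "(\<lambda>x. laplacian_point_process n (symmetric_mat n x)) \<in> space borel \<rightarrow> locally_finite_measures"
    by (auto simp: laplacian_point_process_def sum_point_masses_locally_finite)
  fix U assume "U \<in> {U. openin vague_topology U}"
  then have "openin euclidean {x \<in> topspace euclidean. laplacian_point_process n (symmetric_mat n x) \<in> U}"
    using continuous_map_laplacian_point_process[of n] unfolding continuous_map_def by blast
  then show "(\<lambda>x. laplacian_point_process n (symmetric_mat n x)) -` U \<inter> space borel \<in> sets borel"
    by (simp add: vimage_def)
qed

text \<open>The entries of the upper triangle, padded by 0, form a random element of a countable
  product, where the product sigma-algebra coincides with the Borel sets. Continuity in the entries
  then becomes measurability in the sample point.\<close>

lemma GOE_entries:
  assumes G: "GOE n M A"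
  obtains X where "X \<in> measurable M borel" "\<And>\<omega>. \<omega> \<in> space M \<Longrightarrow> symmetric_mat n (X \<omega>) = A \<omega>"
proof -
  define I where "I = {(i, j). i \<le> j \<and> j < n}"
  define X where "X \<omega> p = (if p \<in> I then A \<omega> $$ p else 0)" for \<omega> p
  from G have M: "prob_space M" and ind: "prob_space.indep_vars M (\<lambda>_. borel) (\<lambda>p \<omega>. A \<omega> $$ p) I"
    and sym: "\<And>\<omega>. \<omega> \<in> space M \<Longrightarrow> A \<omega> \<in> carrier_mat n n \<and> transpose_mat (A \<omega>) = A \<omega>"
    by (auto simp: GOE_def I_def)
  have "(\<lambda>\<omega>. X \<omega> p) \<in> borel_measurable M" for p
    using ind unfolding prob_space.indep_vars_def[OF M] X_def by (cases "p \<in> I") auto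
  then have "X \<in> measurable M (PiM UNIV (\<lambda>_. borel))"
    by (intro measurable_PiM_single') auto
  then have X: "X \<in> measurable M borel"
    using measurable_cong_sets[OF refl sets_PiM_equal_borel[where ?'a="nat \<times> nat" and ?'b=real]] by blast
  have "symmetric_mat n (X \<omega>) = A \<omega>" if w: "\<omega> \<in> space M" for \<omega>
  proof (intro eq_matI)
    fix i j assume "i < dim_row (A \<omega>)" "j < dim_col (A \<omega>)"
    moreover have "A \<omega> $$ (j, i) = A \<omega> $$ (i, j)" if "i < n" "j < n" for i j
      using sym[OF w] that by (metis carrier_matD index_transpose_mat(1))
    ultimately show "symmetric_mat n (X \<omega>) $$ (i, j) = A \<omega> $$ (i, j)"
      using sym[OF w] by (auto simp: symmetric_mat_def X_def I_def min_def max_def)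
  qed (use sym[OF w] in \<open>auto simp: symmetric_mat_def\<close>)
  with X show ?thesis by (rule that)
qed

lemma GOE_random_measure:
  assumes G: "GOE n M A"
  shows "random_measure M (\<lambda>\<omega>. laplacian_point_process n (A \<omega>))"
proof -
  obtain X where X: "X \<in> measurable M borel" "\<And>\<omega>. \<omega> \<in> space M \<Longrightarrow> symmetric_mat n (X \<omega>) = A \<omega>"
    by (rule GOE_entries[OF G]; rule that; assumption)
  from measurable_compose[OF X(1) measurable_laplacian_point_process[of n]]
  have "(\<lambda>\<omega>. laplacian_point_process n (A \<omega>)) \<in> measurable M vague_borel"
    by (rule measurable_cong[THEN iffD1, rotated]) (simp add: X(2))
  then show ?thesis using G by (simp add: random_measure_def GOE_def)
qed

section \<open>Eigenvalues of a spiked diagonal matrix with a perturbation\<close>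

lemma double_sum_entrywise_le:
  fixes x :: "'a \<Rightarrow> real"
  assumes S: "finite S" and c: "\<And>i k. i \<in> S \<Longrightarrow> k \<in> S \<Longrightarrow> \<bar>c i k\<bar> \<le> e"
  shows "\<bar>\<Sum>i\<in>S. \<Sum>k\<in>S. c i k * (x i * x k)\<bar> \<le> e * real (card S) * (\<Sum>i\<in>S. (x i)\<^sup>2)"
proof -
  have "\<bar>\<Sum>i\<in>S. \<Sum>k\<in>S. c i k * (x i * x k)\<bar> \<le> (\<Sum>i\<in>S. \<Sum>k\<in>S. \<bar>c i k * (x i * x k)\<bar>)"
    by (rule order_trans[OF sum_abs]) (intro sum_mono sum_abs)
  also have "\<dots> \<le> (\<Sum>i\<in>S. \<Sum>k\<in>S. e * (((x i)\<^sup>2 + (x k)\<^sup>2) / 2))"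
  proof (intro sum_mono)
    fix i k assume ik: "i \<in> S" "k \<in> S"
    have "2 * (\<bar>x i\<bar> * \<bar>x k\<bar>) \<le> (x i)\<^sup>2 + (x k)\<^sup>2"
      using sum_squares_bound[of "\<bar>x i\<bar>" "\<bar>x k\<bar>"] by simp
    then show "\<bar>c i k * (x i * x k)\<bar> \<le> e * (((x i)\<^sup>2 + (x k)\<^sup>2) / 2)"
      unfolding abs_mult using c[OF ik] by (intro mult_mono) auto
  qed
  also have "\<dots> = e * (\<Sum>i\<in>S. \<Sum>k\<in>S. ((x i)\<^sup>2 + (x k)\<^sup>2) / 2)" by (simp add: sum_distrib_left)
  also have "(\<Sum>i\<in>S. \<Sum>k\<in>S. ((x i)\<^sup>2 + (x k)\<^sup>2) / 2) = real (card S) * (\<Sum>i\<in>S. (x i)\<^sup>2)"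
    by (simp add: sum.distrib add_divide_distrib sum_divide_distrib[symmetric] sum_distrib_left[symmetric])
  finally show ?thesis by (simp add: algebra_simps)
qed

text \<open>The pathwise setting. S contains every index whose diagonal entry is above lam - C - 1,
  where C bounds the norm of g; off S the gap C + 1 leaves a reserve of 1 over the norm. \<alpha>
  bounds the entries, \<epsilon> the deviation of the Gram matrix from the identity, and M separates
  the bulk of the diagonal from its few large values.\<close>

locale spiked_diagonal =
  fixes n :: nat and S :: "nat set" and g :: "nat \<Rightarrow> nat \<Rightarrow> real" and D :: "nat \<Rightarrow> real"
    and lam C \<alpha> \<epsilon> M :: real
  assumes S: "S \<subseteq> {..<n}"
    and g_sym: "\<And>i j. i < n \<Longrightarrow> j < n \<Longrightarrow> g i j = g j i"
    and lam: "1 \<le> lam" and C: "0 \<le> C"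
    and g_bounded: "\<And>u v. (\<Sum>k<n. \<Sum>l<n. g k l * (u k * v l)) \<le> C * (sqrt (\<Sum>k<n. (u k)\<^sup>2) * sqrt (\<Sum>k<n. (v k)\<^sup>2))"
    and D_le: "\<And>j. j < n \<Longrightarrow> j \<notin> S \<Longrightarrow> D j \<le> lam - C - 1"
    and entries: "\<And>i j. i < n \<Longrightarrow> j < n \<Longrightarrow> \<bar>g i j\<bar> \<le> \<alpha>"
    and gram: "\<And>i k. i < n \<Longrightarrow> k < n \<Longrightarrow> \<bar>(\<Sum>j<n. g i j * g k j) - (if i = k then 1 else 0)\<bar> \<le> \<epsilon>"
    and M: "0 \<le> M" "M \<le> lam / 2"
begin

definition G :: "(nat \<Rightarrow> real) \<Rightarrow> (nat \<Rightarrow> real) \<Rightarrow> real" where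
  "G u v = (\<Sum>k<n. \<Sum>l<n. g k l * (u k * v l))"

text \<open>The form of lam minus the matrix with diagonal part \<open>D\<close> and remaining part
  \<open>- g\<close>, that is, of lam minus the Laplacian. Directions in which \<open>Q\<close> is
  negative account for eigenvalues above lam.\<close>

definition Q :: "(nat \<Rightarrow> real) \<Rightarrow> real" where
  "Q u = (\<Sum>k<n. (lam - D k) * (u k)\<^sup>2) + G u u"

definition nsq :: "(nat \<Rightarrow> real) \<Rightarrow> real" where
  "nsq u = (\<Sum>k<n. (u k)\<^sup>2)"

text \<open>The relative error made when the columns of g with index in S, restricted to the rows
  outside S, are treated as orthonormal. The first term comes from the Gram matrix, the second from
  the removed rows.\<close>

definition \<kappa> :: real where "\<kappa> = \<epsilon> * real (card S) + \<alpha>\<^sup>2 * (real (card S))\<^sup>2"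

text \<open>The relative mass that \<open>w\<close> can put on the indices outside the bulk: their
  number times the largest possible share of one coordinate.\<close>

definition \<rho> :: real where "\<rho> = real (card {j. j < n \<and> M < \<bar>D j\<bar>}) * (\<alpha>\<^sup>2 * real (card S))"

text \<open>The total error in the level of the diagonal. The summands stem from the coupling inside
  S, from replacing 1 / (lam - D j) by 1 / lam, from the form \<open>G\<close> on \<open>y\<close>
  (factor C), and from completing the square against vectors supported off S (factor C^2).\<close>

definition \<eta> :: real where
  "\<eta> = \<alpha> * real (card S) + (4 * M / lam\<^sup>2 + \<rho> + \<kappa>) + (C + C\<^sup>2) * (8 / lam\<^sup>2 + \<rho>)"

definition w :: "(nat \<Rightarrow> real) \<Rightarrow> nat \<Rightarrow> real" where "w x j = (\<Sum>i\<in>S. g j i * x i)"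

text \<open>Solves (lam - D j) y j + w j = 0 off S. This is the Schur complement solution with the
  block off S replaced by its diagonal part, so no block has to be inverted; the price is the term
  \<open>G (y x) (y x)\<close>, which is small because \<open>y\<close> is.\<close>

definition y :: "(nat \<Rightarrow> real) \<Rightarrow> nat \<Rightarrow> real" where
  "y x j = (if j < n \<and> j \<notin> S then - w x j / (lam - D j) else 0)"

lemma finS: "finite S" using S finite_subset by blast

lemma nsq_nonneg: "0 \<le> nsq u" by (simp add: nsq_def sum_nonneg)

lemma G_le: "\<bar>G u v\<bar> \<le> C * (sqrt (nsq u) * sqrt (nsq v))"
proof -
  have "- G u v = G (\<lambda>k. - u k) v" by (simp add: G_def sum_negf)
  then show ?thesis
    using g_bounded[of u v] g_bounded[of "\<lambda>k. - u k" v] by (simp add: G_def nsq_def abs_le_iff)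
qed

lemma G_self_le: "\<bar>G u u\<bar> \<le> C * nsq u"
  using G_le[of u u] nsq_nonneg[of u] by simp

lemma G_commute: "G u v = G v u"
proof -
  have "G u v = (\<Sum>l<n. \<Sum>k<n. g k l * (u k * v l))" unfolding G_def by (rule sum.swap)
  also have "\<dots> = G v u" unfolding G_def by (intro sum.cong refl) (auto simp: g_sym mult_ac)
  finally show ?thesis .
qed

lemma G_add_left: "G (\<lambda>k. u k + u' k) v = G u v + G u' v"
  by (simp add: G_def algebra_simps sum.distrib)

lemma G_add_right: "G u (\<lambda>k. v k + v' k) = G u v + G u v'"
  by (simp add: G_def algebra_simps sum.distrib)

lemma gap: "j < n \<Longrightarrow> j \<notin> S \<Longrightarrow> 1 \<le> lam - D j"
  using D_le[of j] C by simp

lemma entries_nonneg: assumes "n > 0" shows "0 \<le> \<alpha>" "0 \<le> \<epsilon>"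
proof -
  show "0 \<le> \<alpha>" using entries[of 0 0] assms by linarith
  show "0 \<le> \<epsilon>" using gram[of 0 0] assms by (meson abs_ge_zero order_trans)
qed

lemma \<rho>_nonneg: "0 \<le> \<rho>" by (simp add: \<rho>_def)

context
  fixes x :: "nat \<Rightarrow> real"
  assumes x: "\<And>k. k \<notin> S \<Longrightarrow> x k = 0"
begin

lemma nsq_x: "nsq x = (\<Sum>i\<in>S. (x i)\<^sup>2)"
  unfolding nsq_def using S x by (intro sum.mono_neutral_right) auto

lemma sum_g_x: "(\<Sum>l<n. g k l * x l) = w x k"
  unfolding w_def using S x by (intro sum.mono_neutral_right) auto

lemma G_left_x: "G u x = (\<Sum>k<n. u k * w x k)"
  unfolding G_def sum_g_x[symmetric] sum_distrib_left by (simp add: mult_ac)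

lemma w_sq_le: assumes "j < n" shows "(w x j)\<^sup>2 \<le> \<alpha>\<^sup>2 * real (card S) * nsq x"
proof -
  have "(w x j)\<^sup>2 \<le> (\<Sum>i\<in>S. (g j i)\<^sup>2) * (\<Sum>i\<in>S. (x i)\<^sup>2)"
    unfolding w_def by (rule Cauchy_Schwarz_ineq_sum)
  also have "\<dots> \<le> (\<Sum>i\<in>S. \<alpha>\<^sup>2) * (\<Sum>i\<in>S. (x i)\<^sup>2)"
  proof (intro mult_right_mono sum_mono sum_nonneg)
    fix i assume "i \<in> S"
    then show "(g j i)\<^sup>2 \<le> \<alpha>\<^sup>2" using entries[of j i] S assms
      by (metis abs_ge_zero abs_le_square_iff abs_of_nonneg lessThan_iff order_trans subsetD)
  qed auto
  finally show ?thesis by (simp add: nsq_x mult.commute)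
qed

text \<open>The left sum is a quadratic form in x whose matrix is the Gram matrix of the columns in
  S without the rows in S. The missing rows change each of its entries by at most
  \<open>\<alpha>\<^sup>2 * card S\<close>.\<close>

lemma sum_w_sq: "\<bar>(\<Sum>j\<in>{..<n}-S. (w x j)\<^sup>2) - nsq x\<bar> \<le> \<kappa> * nsq x"
proof (cases "n > 0")
  case n: True
  have exp: "(\<Sum>j\<in>T. (w x j)\<^sup>2) = (\<Sum>i\<in>S. \<Sum>k\<in>S. (\<Sum>j\<in>T. g j i * g j k) * (x i * x k))" for T
  proof -
    have "(\<Sum>j\<in>T. (w x j)\<^sup>2) = (\<Sum>j\<in>T. \<Sum>i\<in>S. \<Sum>k\<in>S. g j i * g j k * (x i * x k))"
      unfolding w_def power2_eq_square sum_product by (simp add: mult_ac)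
    also have "\<dots> = (\<Sum>i\<in>S. \<Sum>j\<in>T. \<Sum>k\<in>S. g j i * g j k * (x i * x k))" by (rule sum.swap)
    also have "\<dots> = (\<Sum>i\<in>S. \<Sum>k\<in>S. \<Sum>j\<in>T. g j i * g j k * (x i * x k))"
      by (intro sum.cong refl sum.swap)
    finally show ?thesis by (simp add: sum_distrib_right)
  qed
  let ?c = "\<lambda>i k. (\<Sum>j\<in>{..<n}-S. g j i * g j k) - (if i = k then 1 else 0)"
  have "\<bar>?c i k\<bar> \<le> \<epsilon> + \<alpha>\<^sup>2 * real (card S)" if ik: "i \<in> S" "k \<in> S" for i k
  proof -
    have ikn: "i < n" "k < n" using ik S by auto
    have "(\<Sum>j<n. g i j * g k j) = (\<Sum>j<n. g j i * g j k)"
      using ikn by (intro sum.cong refl) (auto simp: g_sym)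
    also have "\<dots> = (\<Sum>j\<in>{..<n}-S. g j i * g j k) + (\<Sum>j\<in>S. g j i * g j k)"
      using S by (rule sum.subset_diff) simp
    finally have eq: "?c i k = ((\<Sum>j<n. g i j * g k j) - (if i = k then 1 else 0)) - (\<Sum>j\<in>S. g j i * g j k)"
      by simp
    have "\<bar>\<Sum>j\<in>S. g j i * g j k\<bar> \<le> (\<Sum>j\<in>S. \<bar>g j i * g j k\<bar>)" by (rule sum_abs)
    also have "\<dots> \<le> (\<Sum>j\<in>S. \<alpha> * \<alpha>)"
      unfolding abs_mult using S ikn entries_nonneg[OF n]
      by (intro sum_mono mult_mono entries) auto
    finally have "\<bar>\<Sum>j\<in>S. g j i * g j k\<bar> \<le> \<alpha>\<^sup>2 * real (card S)" by (simp add: power2_eq_square mult_ac)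
    then show ?thesis using gram[OF ikn] unfolding eq by linarith
  qed
  from double_sum_entrywise_le[OF finS this, where x=x]
  have "\<bar>\<Sum>i\<in>S. \<Sum>k\<in>S. ?c i k * (x i * x k)\<bar>
      \<le> (\<epsilon> + \<alpha>\<^sup>2 * real (card S)) * real (card S) * nsq x" by (simp only: nsq_x)
  also have "\<dots> = \<kappa> * nsq x" by (simp add: \<kappa>_def algebra_simps power2_eq_square)
  finally have "\<bar>\<Sum>i\<in>S. \<Sum>k\<in>S. ?c i k * (x i * x k)\<bar> \<le> \<kappa> * nsq x" .
  moreover have "(\<Sum>i\<in>S. \<Sum>k\<in>S. ?c i k * (x i * x k)) = (\<Sum>j\<in>{..<n}-S. (w x j)\<^sup>2)
      - (\<Sum>i\<in>S. \<Sum>k\<in>S. (if i = k then 1 else 0) * (x i * x k))"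
    unfolding exp by (simp add: left_diff_distrib sum_subtractf)
  moreover have "(\<Sum>i\<in>S. \<Sum>k\<in>S. (if i = k then 1 else 0) * (x i * x k)) = (\<Sum>i\<in>S. (x i)\<^sup>2)"
  proof (intro sum.cong refl)
    fix i assume "i \<in> S"
    have "(\<Sum>k\<in>S. (if i = k then 1 else 0) * (x i * x k)) = (\<Sum>k\<in>S. if i = k then x i * x k else 0)"
      by (rule sum.cong) auto
    then show "(\<Sum>k\<in>S. (if i = k then 1 else 0) * (x i * x k)) = (x i)\<^sup>2"
      using finS \<open>i \<in> S\<close> by (simp add: power2_eq_square)
  qed
  ultimately show ?thesis by (simp add: nsq_x)
next
  case False
  then have "nsq x = 0" "{..<n} - S = {}" unfolding nsq_def by auto
  then show ?thesis by (simp only: sum.empty)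
qed

lemma sum_w_sq_le:
  assumes "\<kappa> \<le> 1" shows "(\<Sum>j\<in>{..<n}-S. (w x j)\<^sup>2) \<le> 2 * nsq x"
  using sum_w_sq mult_right_mono[OF assms nsq_nonneg[of x]] by linarith

text \<open>Splitting at \<open>\<bar>D j\<bar> \<le> M\<close>: on the bulk the weight is at most \<open>c\<close>, and the few exceptional
  indices carry little of the mass of \<open>w\<close>, because \<open>x\<close> has a small support.\<close>

lemma weighted_sum_w_sq:
  assumes \<kappa>: "\<kappa> \<le> 1" and c: "0 \<le> c"
    and small: "\<And>j. j < n \<Longrightarrow> j \<notin> S \<Longrightarrow> \<bar>D j\<bar> \<le> M \<Longrightarrow> \<bar>f j\<bar> \<le> c"
    and large: "\<And>j. j < n \<Longrightarrow> j \<notin> S \<Longrightarrow> \<bar>f j\<bar> \<le> 1"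
  shows "\<bar>\<Sum>j\<in>{..<n}-S. (w x j)\<^sup>2 * f j\<bar> \<le> (2 * c + \<rho>) * nsq x"
proof -
  define H where "H = {j. j < n \<and> M < \<bar>D j\<bar>}"
  let ?b = "\<alpha>\<^sup>2 * real (card S) * nsq x"
  have "\<bar>\<Sum>j\<in>{..<n}-S. (w x j)\<^sup>2 * f j\<bar> \<le> (\<Sum>j\<in>{..<n}-S. (w x j)\<^sup>2 * \<bar>f j\<bar>)"
    by (rule order_trans[OF sum_abs]) (simp add: abs_mult)
  also have "\<dots> \<le> (\<Sum>j\<in>{..<n}-S. c * (w x j)\<^sup>2 + (if j \<in> H then ?b else 0))"
  proof (rule sum_mono)
    fix j assume j: "j \<in> {..<n} - S"
    show "(w x j)\<^sup>2 * \<bar>f j\<bar> \<le> c * (w x j)\<^sup>2 + (if j \<in> H then ?b else 0)"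
    proof (cases "j \<in> H")
      case True
      have "(w x j)\<^sup>2 * \<bar>f j\<bar> \<le> (w x j)\<^sup>2" using large[of j] j by (simp add: mult_left_le)
      also have "\<dots> \<le> ?b" using w_sq_le j by simp
      finally have "(w x j)\<^sup>2 * \<bar>f j\<bar> \<le> ?b" .
      moreover have "0 \<le> c * (w x j)\<^sup>2" using c by simp
      ultimately show ?thesis using True by simp
    next
      case False
      then have "\<bar>f j\<bar> \<le> c" using small[of j] j by (auto simp: H_def)
      then have "\<bar>f j\<bar> * (w x j)\<^sup>2 \<le> c * (w x j)\<^sup>2" by (intro mult_right_mono) auto
      then show ?thesis using False by (simp add: mult.commute)
    qed
  qed
  also have "\<dots> = c * (\<Sum>j\<in>{..<n}-S. (w x j)\<^sup>2) + real (card (({..<n}-S) \<inter> H)) * ?b"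
    by (simp add: sum.distrib sum_distrib_left sum.If_cases)
  also have "\<dots> \<le> c * (2 * nsq x) + real (card H) * ?b"
  proof (intro add_mono mult_left_mono mult_right_mono sum_w_sq_le \<kappa> c)
    have "card (({..<n}-S) \<inter> H) \<le> card H" by (intro card_mono) (auto simp: H_def)
    then show "real (card (({..<n}-S) \<inter> H)) \<le> real (card H)" by simp
    show "0 \<le> ?b" using nsq_nonneg by simp
  qed
  also have "\<dots> = (2 * c + \<rho>) * nsq x" by (simp add: \<rho>_def H_def algebra_simps)
  finally show ?thesis .
qed

lemma inverse_gap_le: "j < n \<Longrightarrow> j \<notin> S \<Longrightarrow> \<bar>D j\<bar> \<le> M \<Longrightarrow> 1 / (lam - D j) \<le> 2 / lam"
  using M lam by (simp add: divide_simps abs_le_iff)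

text \<open>The source of the shift 1 / lam. On the bulk, 1 / (lam - D j) - 1 / lam = D j / (lam
  (lam - D j)) is at most 2 M / lam^2 in absolute value; elsewhere both reciprocals lie between 0
  and 1, and \<open>\<rho>\<close> accounts for the mass.\<close>

lemma sum_inverse_gap:
  assumes \<kappa>: "\<kappa> \<le> 1"
  shows "\<bar>(\<Sum>j\<in>{..<n}-S. (w x j)\<^sup>2 / (lam - D j)) - nsq x / lam\<bar> \<le> (4 * M / lam\<^sup>2 + \<rho> + \<kappa>) * nsq x"
proof -
  have "\<bar>\<Sum>j\<in>{..<n}-S. (w x j)\<^sup>2 * (1 / (lam - D j) - 1 / lam)\<bar> \<le> (2 * (2 * M / lam\<^sup>2) + \<rho>) * nsq x"
  proof (rule weighted_sum_w_sq[OF \<kappa>])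
    fix j assume j: "j < n" "j \<notin> S"
    have "1 / (lam - D j) \<le> 1" "1 / lam \<le> 1" "0 < 1 / (lam - D j)" "0 < 1 / lam"
      using gap[OF j] lam by auto
    then show "\<bar>1 / (lam - D j) - 1 / lam\<bar> \<le> 1" by linarith
    assume DM: "\<bar>D j\<bar> \<le> M"
    have "1 / (lam - D j) - 1 / lam = D j * (1 / (lam - D j)) / lam"
      using gap[OF j] lam by (simp add: field_simps)
    then have "\<bar>1 / (lam - D j) - 1 / lam\<bar> = \<bar>D j\<bar> * (1 / (lam - D j)) / lam"
      using gap[OF j] lam by (simp add: abs_mult)
    also have "\<dots> \<le> M * (2 / lam) / lam"
      using lam M gap[OF j] by (intro divide_right_mono mult_mono DM inverse_gap_le[OF j DM]) auto
    finally show "\<bar>1 / (lam - D j) - 1 / lam\<bar> \<le> 2 * M / lam\<^sup>2"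
      by (simp add: power2_eq_square mult.commute)
  qed (use M in simp)
  moreover have "(\<Sum>j\<in>{..<n}-S. (w x j)\<^sup>2 * (1 / (lam - D j) - 1 / lam))
     = (\<Sum>j\<in>{..<n}-S. (w x j)\<^sup>2 / (lam - D j)) - (\<Sum>j\<in>{..<n}-S. (w x j)\<^sup>2) / lam"
    by (simp add: right_diff_distrib sum_subtractf sum_divide_distrib)
  moreover have "\<bar>(\<Sum>j\<in>{..<n}-S. (w x j)\<^sup>2) / lam - nsq x / lam\<bar> \<le> \<kappa> * nsq x"
  proof -
    have "\<bar>(\<Sum>j\<in>{..<n}-S. (w x j)\<^sup>2) / lam - nsq x / lam\<bar> = \<bar>(\<Sum>j\<in>{..<n}-S. (w x j)\<^sup>2) - nsq x\<bar> / lam"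
      using lam by (simp add: diff_divide_distrib[symmetric])
    also have "\<dots> \<le> \<bar>(\<Sum>j\<in>{..<n}-S. (w x j)\<^sup>2) - nsq x\<bar> / 1"
      using lam by (intro divide_left_mono) auto
    also have "\<dots> \<le> \<kappa> * nsq x" using sum_w_sq by simp
    finally show ?thesis .
  qed
  ultimately show ?thesis by (simp add: algebra_simps abs_le_iff)
qed

lemma nsq_y_eq: "nsq (y x) = (\<Sum>j\<in>{..<n}-S. (w x j)\<^sup>2 * (1 / (lam - D j))\<^sup>2)"
  unfolding nsq_def
  by (rule sum.mono_neutral_cong_right) (auto simp: y_def power_divide)

lemma nsq_y:
  assumes \<kappa>: "\<kappa> \<le> 1"
  shows "nsq (y x) \<le> (8 / lam\<^sup>2 + \<rho>) * nsq x"
proof -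
  have "\<bar>\<Sum>j\<in>{..<n}-S. (w x j)\<^sup>2 * (1 / (lam - D j))\<^sup>2\<bar> \<le> (2 * (4 / lam\<^sup>2) + \<rho>) * nsq x"
  proof (rule weighted_sum_w_sq[OF \<kappa>])
    fix j assume j: "j < n" "j \<notin> S"
    have "1 / (lam - D j) \<le> 1" "0 < 1 / (lam - D j)" using gap[OF j] by auto
    then show "\<bar>(1 / (lam - D j))\<^sup>2\<bar> \<le> 1" by (simp add: power_le_one)
    assume "\<bar>D j\<bar> \<le> M"
    from inverse_gap_le[OF j this] have "(1 / (lam - D j))\<^sup>2 \<le> (2 / lam)\<^sup>2"
      using gap[OF j] by (intro power_mono) auto
    then show "\<bar>(1 / (lam - D j))\<^sup>2\<bar> \<le> 4 / lam\<^sup>2" by (simp add: power_divide)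
  qed simp
  then show ?thesis unfolding nsq_y_eq by simp
qed

lemma G_x_x: "\<bar>G x x\<bar> \<le> \<alpha> * real (card S) * nsq x"
proof -
  have "G x x = (\<Sum>k<n. x k * w x k)" by (rule G_left_x)
  also have "\<dots> = (\<Sum>k\<in>S. x k * w x k)" using S x by (intro sum.mono_neutral_right) auto
  also have "\<dots> = (\<Sum>i\<in>S. \<Sum>k\<in>S. g i k * (x i * x k))"
    by (simp add: w_def sum_distrib_left mult_ac)
  finally show ?thesis
    using double_sum_entrywise_le[OF finS, of g \<alpha> x] entries S by (simp add: nsq_x subset_iff)
qed

text \<open>With W the weighted sum of squares of \<open>w\<close>, the diagonal part off S
  contributes W and the two cross terms contribute -2 W. The remaining -W is about - nsq x / lam,
  which turns lam - D i into lam - 1 / lam - D i.\<close>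

lemma Q_x_plus_y:
  assumes \<kappa>: "\<kappa> \<le> 1"
  shows "\<bar>Q (\<lambda>k. x k + y x k) - (\<Sum>i\<in>S. (lam - 1 / lam - D i) * (x i)\<^sup>2)\<bar> \<le> (\<eta> - C\<^sup>2 * (8 / lam\<^sup>2 + \<rho>)) * nsq x"
proof -
  let ?W = "\<Sum>j\<in>{..<n}-S. (w x j)\<^sup>2 / (lam - D j)"
  have "(\<Sum>k<n. (lam - D k) * (x k + y x k)\<^sup>2)
     = (\<Sum>k\<in>{..<n}-S. (lam - D k) * (x k + y x k)\<^sup>2) + (\<Sum>k\<in>S. (lam - D k) * (x k + y x k)\<^sup>2)"
    using S by (rule sum.subset_diff) simp
  also have "(\<Sum>k\<in>{..<n}-S. (lam - D k) * (x k + y x k)\<^sup>2) = ?W"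
  proof (intro sum.cong refl)
    fix j assume j: "j \<in> {..<n} - S"
    then show "(lam - D j) * (x j + y x j)\<^sup>2 = (w x j)\<^sup>2 / (lam - D j)"
      using gap[of j] x[of j] by (simp add: y_def power2_eq_square)
  qed
  also have "(\<Sum>k\<in>S. (lam - D k) * (x k + y x k)\<^sup>2) = (\<Sum>k\<in>S. (lam - D k) * (x k)\<^sup>2)"
    by (intro sum.cong refl) (simp add: y_def)
  finally have d: "(\<Sum>k<n. (lam - D k) * (x k + y x k)\<^sup>2) = ?W + (\<Sum>k\<in>S. (lam - D k) * (x k)\<^sup>2)" .
  have yx: "G (y x) x = - ?W"
  proof -
    have "G (y x) x = (\<Sum>k\<in>{..<n}-S. y x k * w x k)"
      unfolding G_left_x by (rule sum.mono_neutral_right) (auto simp: y_def)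
    also have "\<dots> = - ?W"
      unfolding sum_negf[symmetric] by (intro sum.cong refl) (simp add: y_def power2_eq_square)
    finally show ?thesis .
  qed
  have "Q (\<lambda>k. x k + y x k) = (\<Sum>k\<in>S. (lam - D k) * (x k)\<^sup>2) + G x x - ?W + G (y x) (y x)"
    unfolding Q_def d by (simp add: G_add_left G_add_right G_commute[of x "y x"] yx)
  moreover have "(\<Sum>k\<in>S. (lam - D k) * (x k)\<^sup>2) = (\<Sum>i\<in>S. (lam - 1 / lam - D i) * (x i)\<^sup>2) + nsq x / lam"
    by (simp add: nsq_x sum_divide_distrib sum.distrib[symmetric] algebra_simps)
  moreover have "\<bar>G (y x) (y x)\<bar> \<le> C * ((8 / lam\<^sup>2 + \<rho>) * nsq x)"
    using G_self_le[of "y x"] mult_left_mono[OF nsq_y[OF \<kappa>] C] by linarith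
  ultimately have "\<bar>Q (\<lambda>k. x k + y x k) - (\<Sum>i\<in>S. (lam - 1 / lam - D i) * (x i)\<^sup>2)\<bar>
     \<le> \<alpha> * real (card S) * nsq x + (4 * M / lam\<^sup>2 + \<rho> + \<kappa>) * nsq x + C * ((8 / lam\<^sup>2 + \<rho>) * nsq x)"
    using G_x_x sum_inverse_gap[OF \<kappa>] by linarith
  also have "\<dots> = (\<eta> - C\<^sup>2 * (8 / lam\<^sup>2 + \<rho>)) * nsq x" by (simp add: \<eta>_def algebra_simps add_divide_distrib)
  finally show ?thesis .
qed

text \<open>\<open>y x\<close> nearly minimises \<open>Q\<close> given the coordinates \<open>x\<close> in \<open>S\<close>: its first variation is
  \<open>G z (y x)\<close>, which the positivity of \<open>Q\<close> off \<open>S\<close> absorbs.\<close>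

lemma Q_ge:
  assumes \<kappa>: "\<kappa> \<le> 1" and z: "\<And>k. k \<in> S \<Longrightarrow> z k = 0"
  shows "(\<Sum>i\<in>S. (lam - 1 / lam - D i) * (x i)\<^sup>2) - \<eta> * nsq x \<le> Q (\<lambda>k. (x k + y x k) + z k)"
proof -
  let ?u = "\<lambda>k. x k + y x k"
  have Gzu: "G z ?u = (\<Sum>k<n. z k * w x k) + G z (y x)" by (simp add: G_add_right G_left_x)
  \<comment> \<open>By the equation defining \<open>y\<close>, the cross term of the diagonal part
    cancels the coupling of z with x, so that only \<open>G z (y x)\<close> is left of the terms
    linear in z.\<close>
  have c: "(\<Sum>k<n. (lam - D k) * ?u k * z k) = - (\<Sum>k<n. z k * w x k)"
    unfolding sum_negf[symmetric]
  proof (intro sum.cong refl)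
    fix k assume "k \<in> {..<n}"
    then show "(lam - D k) * ?u k * z k = - (z k * w x k)"
      using gap[of k] x[of k] z[of k] by (cases "k \<in> S") (simp_all add: y_def)
  qed
  have "(\<Sum>k<n. (lam - D k) * (?u k + z k)\<^sup>2)
      = (\<Sum>k<n. (lam - D k) * (?u k)\<^sup>2) + 2 * (\<Sum>k<n. (lam - D k) * ?u k * z k) + (\<Sum>k<n. (lam - D k) * (z k)\<^sup>2)"
    unfolding sum_distrib_left sum.distrib[symmetric]
    by (intro sum.cong refl) (simp add: power2_eq_square algebra_simps)
  moreover have "G (\<lambda>k. ?u k + z k) (\<lambda>k. ?u k + z k) = G ?u ?u + 2 * G z ?u + G z z"
  proof -
    have "G (\<lambda>k. ?u k + z k) (\<lambda>k. ?u k + z k) = G ?u (\<lambda>k. ?u k + z k) + G z (\<lambda>k. ?u k + z k)"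
      by (rule G_add_left)
    also have "G ?u (\<lambda>k. ?u k + z k) = G ?u ?u + G ?u z" by (rule G_add_right)
    also have "G z (\<lambda>k. ?u k + z k) = G z ?u + G z z" by (rule G_add_right)
    finally show ?thesis using G_commute[of z ?u] by linarith
  qed
  ultimately have Qe: "Q (\<lambda>k. ?u k + z k) = Q ?u + 2 * G z (y x) + Q z"
    unfolding Q_def using Gzu c by linarith
  have "(C + 1) * nsq z \<le> (\<Sum>k<n. (lam - D k) * (z k)\<^sup>2)"
    unfolding nsq_def sum_distrib_left
  proof (rule sum_mono)
    fix k assume "k \<in> {..<n}"
    then show "(C + 1) * (z k)\<^sup>2 \<le> (lam - D k) * (z k)\<^sup>2"
      using D_le[of k] z[of k] by (cases "k \<in> S") (auto intro!: mult_right_mono)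
  qed
  then have Qz: "nsq z \<le> Q z" using G_self_le[of z] by (simp add: Q_def algebra_simps abs_le_iff)
  have "2 * \<bar>G z (y x)\<bar> \<le> 2 * (sqrt (nsq z) * (C * sqrt (nsq (y x))))"
    using G_le[of z "y x"] by (simp add: mult_ac)
  also have "\<dots> \<le> (sqrt (nsq z))\<^sup>2 + (C * sqrt (nsq (y x)))\<^sup>2"
    using sum_squares_bound[of "sqrt (nsq z)" "C * sqrt (nsq (y x))"] by simp
  also have "\<dots> = nsq z + C\<^sup>2 * nsq (y x)" by (simp add: power_mult_distrib nsq_nonneg)
  finally have "Q ?u - C\<^sup>2 * nsq (y x) \<le> Q (\<lambda>k. ?u k + z k)" using Qe Qz by linarith
  moreover have "C\<^sup>2 * nsq (y x) \<le> C\<^sup>2 * ((8 / lam\<^sup>2 + \<rho>) * nsq x)"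
    by (intro mult_left_mono nsq_y \<kappa>) auto
  ultimately show ?thesis using Q_x_plus_y[OF \<kappa>] by (simp add: algebra_simps abs_le_iff)
qed

end

text \<open>Upper bound: on vectors vanishing on \<open>?S\<close> the form \<open>Q\<close> is
  nonnegative. Lower bound: \<open>Q\<close> is negative on the graph of x to x + y x over
  coordinates in \<open>?S\<close>. In both cases the error \<open>\<eta>\<close> is outweighed
  because no diagonal entry lies within \<open>\<eta>\<close> of lam - 1 / lam.\<close>

lemma count_above_spiked:
  assumes B: "B \<in> carrier_mat n n" "transpose_mat B = B"
    and Q: "\<And>v. quad_form n B v = lam * (\<Sum>k<n. (v k)\<^sup>2) - Q v"
    and \<kappa>: "\<kappa> \<le> 1"
    and window: "\<And>i. i < n \<Longrightarrow> \<bar>D i - (lam - 1 / lam)\<bar> > \<eta>"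
  shows "count_above B lam = card {i. i < n \<and> lam - 1 / lam < D i}"
proof (rule antisym)
  let ?S = "{i. i < n \<and> lam - 1 / lam < D i}"
  have inv: "1 / lam \<le> 1" using lam by simp
  have sub: "?S \<subseteq> S"
  proof
    fix i assume "i \<in> ?S"
    then have i: "i < n" "lam - 1 / lam < D i" by auto
    show "i \<in> S"
    proof (rule ccontr)
      assume "i \<notin> S"
      from D_le[OF i(1) this] i(2) inv C show False by linarith
    qed
  qed
  show "count_above B lam \<le> card ?S"
  proof (rule count_above_le[OF B])
    fix v :: "nat \<Rightarrow> real" assume v0: "\<And>i. i \<in> ?S \<Longrightarrow> v i = 0"
    \<comment> \<open>x is the part of v on S, and z measures how far the rest of v is from the near
      minimiser \<open>y x\<close>.\<close>
    define x where "x k = (if k \<in> S then v k else 0)" for k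
    define z where "z k = (if k \<in> S then 0 else v k - y x k)" for k
    have xs: "\<And>k. k \<notin> S \<Longrightarrow> x k = 0" by (simp add: x_def)
    have "(x k + y x k) + z k = v k" for k by (cases "k \<in> S") (simp_all add: x_def z_def y_def)
    then have "(\<lambda>k. (x k + y x k) + z k) = v" by blast
    then have "(\<Sum>i\<in>S. (lam - 1 / lam - D i) * (x i)\<^sup>2) - \<eta> * nsq x \<le> Q v"
      using Q_ge[of x z, OF xs \<kappa>] by (simp add: z_def)
    moreover have "\<eta> * (\<Sum>i\<in>S. (x i)\<^sup>2) \<le> (\<Sum>i\<in>S. (lam - 1 / lam - D i) * (x i)\<^sup>2)"
      unfolding sum_distrib_left
    proof (rule sum_mono)
      fix i assume i: "i \<in> S"
      then have "i < n" using S by auto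
      show "\<eta> * (x i)\<^sup>2 \<le> (lam - 1 / lam - D i) * (x i)\<^sup>2"
      proof (cases "i \<in> ?S")
        case True
        then show ?thesis using v0[OF True] by (simp add: x_def)
      next
        case False
        then have "\<eta> \<le> lam - 1 / lam - D i" using window[OF \<open>i < n\<close>] \<open>i < n\<close> by simp
        then show ?thesis by (intro mult_right_mono) auto
      qed
    qed
    ultimately show "quad_form n B v \<le> lam * (\<Sum>k<n. (v k)\<^sup>2)"
      using nsq_x[of x, OF xs] unfolding Q by simp
  qed simp
  show "card ?S \<le> count_above B lam"
  \<comment> \<open>\<open>T s\<close> is the unit vector at s completed off S by \<open>y\<close>;
    by linearity a combination of these vectors is x + y x.\<close>
  proof (rule count_above_ge[OF B, where T = "\<lambda>s k. if k \<in> S then (if k = s then 1 else 0) else if k < n then - g k s / (lam - D k) else 0"])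
    fix x' :: "nat \<Rightarrow> real" assume ex: "\<exists>s\<in>?S. x' s \<noteq> 0"
    let ?T = "\<lambda>s k. if k \<in> S then (if k = s then 1 else 0) else if k < n then - g k s / (lam - D k) else 0"
    define x where "x k = (if k \<in> ?S then x' k else 0)" for k
    have xs: "\<And>k. k \<notin> S \<Longrightarrow> x k = 0" using sub by (simp add: x_def subset_iff) blast
    have n: "n > 0" using ex by auto
    have wx: "w x k = (\<Sum>s\<in>?S. g k s * x' s)" for k
      unfolding w_def by (rule sum.mono_neutral_cong_right[OF finS sub]) (auto simp: x_def)
    have T: "(\<lambda>k. \<Sum>s\<in>?S. ?T s k * x' s) = (\<lambda>k. x k + y x k)"
    proof
      fix k
      show "(\<Sum>s\<in>?S. ?T s k * x' s) = x k + y x k"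
      proof (cases "k \<in> S")
        case True
        have "(\<Sum>s\<in>?S. (if k = s then 1 else 0) * x' s) = (\<Sum>s\<in>?S. if k = s then x' s else 0)"
          by (rule sum.cong) auto
        then show ?thesis using True by (simp add: x_def y_def)
      next
        case False
        then show ?thesis using xs[OF False]
          by (cases "k < n") (simp_all add: y_def wx sum_divide_distrib sum_negf)
      qed
    qed
    have nx: "nsq x = (\<Sum>i\<in>?S. (x' i)\<^sup>2)"
      unfolding nsq_def by (intro sum.mono_neutral_cong_right) (auto simp: x_def)
    obtain s where s: "s \<in> ?S" "x' s \<noteq> 0" using ex by blast
    have "(\<Sum>i\<in>S. (lam - 1 / lam - D i) * (x i)\<^sup>2) = (\<Sum>i\<in>?S. (lam - 1 / lam - D i) * (x' i)\<^sup>2)"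
      by (rule sum.mono_neutral_cong_right[OF finS sub]) (auto simp: x_def)
    also have "\<dots> < (\<Sum>i\<in>?S. - \<eta> * (x' i)\<^sup>2)"
    proof (rule sum_strict_mono_ex1)
      have lt: "lam - 1 / lam - D i < - \<eta>" if "i \<in> ?S" for i
      proof -
        have "i < n" "lam - 1 / lam < D i" using that by auto
        then show ?thesis using window[of i] by linarith
      qed
      show "\<forall>i\<in>?S. (lam - 1 / lam - D i) * (x' i)\<^sup>2 \<le> - \<eta> * (x' i)\<^sup>2"
        by (intro ballI mult_right_mono less_imp_le lt zero_le_power2)
      show "\<exists>i\<in>?S. (lam - 1 / lam - D i) * (x' i)\<^sup>2 < - \<eta> * (x' i)\<^sup>2"
        by (rule bexI[OF _ s(1)], rule mult_strict_right_mono[OF lt[OF s(1)]]) (simp add: s(2))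
    qed simp
    also have "\<dots> = - \<eta> * nsq x" by (simp add: nx sum_distrib_left)
    finally have lt: "(\<Sum>i\<in>S. (lam - 1 / lam - D i) * (x i)\<^sup>2) < - \<eta> * nsq x" .
    have "0 \<le> C\<^sup>2 * (8 / lam\<^sup>2 + \<rho>) * nsq x"
      using \<rho>_nonneg nsq_nonneg by (intro mult_nonneg_nonneg add_nonneg_nonneg) auto
    then have "Q (\<lambda>k. x k + y x k) < 0"
      using lt Q_x_plus_y[of x, OF xs \<kappa>] by (simp add: algebra_simps abs_le_iff)
    then show "lam * (\<Sum>k<n. (\<Sum>s\<in>?S. ?T s k * x' s)\<^sup>2) < quad_form n B (\<lambda>k. \<Sum>s\<in>?S. ?T s k * x' s)"
      unfolding Q T fun_cong[OF T] by simp
  qed simp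
qed

end

section \<open>Gaussian tail estimates\<close>

lemma (in prob_space) measurable_distributed_lborel:
  "distributed M lborel X f \<Longrightarrow> X \<in> borel_measurable M"
  by (auto simp: distributed_def)

text \<open>Completing the square: the tilted density is a constant times the normal density with
  mean c \<sigma>^2.\<close>

lemma (in prob_space) normal_exp_moment:
  assumes D: "distributed M lborel X (normal_density 0 \<sigma>)" and \<sigma>: "0 < \<sigma>"
  shows "(\<integral>\<^sup>+\<omega>. ennreal (exp (c * X \<omega>)) \<partial>M) = ennreal (exp (c\<^sup>2 * \<sigma>\<^sup>2 / 2))"
proof -
  have eq: "normal_density 0 \<sigma> x * exp (c * x) = exp (c\<^sup>2 * \<sigma>\<^sup>2 / 2) * normal_density (c * \<sigma>\<^sup>2) \<sigma> x" for x
  proof -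
    have "- (x - 0)\<^sup>2 / (2 * \<sigma>\<^sup>2) + c * x = c\<^sup>2 * \<sigma>\<^sup>2 / 2 + - (x - c * \<sigma>\<^sup>2)\<^sup>2 / (2 * \<sigma>\<^sup>2)"
      using \<sigma> by (simp add: field_simps power2_eq_square)
    then have "exp (- (x - 0)\<^sup>2 / (2 * \<sigma>\<^sup>2)) * exp (c * x)
        = exp (c\<^sup>2 * \<sigma>\<^sup>2 / 2) * exp (- (x - c * \<sigma>\<^sup>2)\<^sup>2 / (2 * \<sigma>\<^sup>2))"
      by (simp only: exp_add[symmetric])
    then show ?thesis unfolding normal_density_def by (simp add: mult_ac)
  qed
  have "(\<integral>\<^sup>+\<omega>. ennreal (exp (c * X \<omega>)) \<partial>M) = (\<integral>\<^sup>+x. ennreal (normal_density 0 \<sigma> x) * ennreal (exp (c * x)) \<partial>lborel)"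
    by (rule distributed_nn_integral[OF D, symmetric]) measurable
  also have "\<dots> = (\<integral>\<^sup>+x. ennreal (exp (c\<^sup>2 * \<sigma>\<^sup>2 / 2)) * ennreal (normal_density (c * \<sigma>\<^sup>2) \<sigma> x) \<partial>lborel)"
    by (simp add: ennreal_mult'[symmetric] normal_density_nonneg eq)
  also have "\<dots> = ennreal (exp (c\<^sup>2 * \<sigma>\<^sup>2 / 2)) * (\<integral>\<^sup>+x. ennreal (normal_density (c * \<sigma>\<^sup>2) \<sigma> x) \<partial>lborel)"
    by (rule nn_integral_cmult) measurable
  also have "(\<integral>\<^sup>+x. ennreal (normal_density (c * \<sigma>\<^sup>2) \<sigma> x) \<partial>lborel) = 1"
    using \<sigma> by (subst nn_integral_eq_integral) (auto simp: normal_density_nonneg)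
  finally show ?thesis by simp
qed

text \<open>The factor exp (s x^2) rescales the standard deviation to \<sigma> / r, and the change
  of the normalising constant leaves the factor 1 / r.\<close>

lemma (in prob_space) normal_exp_square_moment:
  assumes D: "distributed M lborel X (normal_density 0 \<sigma>)" and \<sigma>: "0 < \<sigma>" and s: "2 * s * \<sigma>\<^sup>2 < 1"
  shows "(\<integral>\<^sup>+\<omega>. ennreal (exp (s * (X \<omega>)\<^sup>2)) \<partial>M) = ennreal (1 / sqrt (1 - 2 * s * \<sigma>\<^sup>2))"
proof -
  define r where "r = sqrt (1 - 2 * s * \<sigma>\<^sup>2)"
  have r: "0 < r" "r\<^sup>2 = 1 - 2 * s * \<sigma>\<^sup>2" using s by (auto simp: r_def)
  have eq: "normal_density 0 \<sigma> x * exp (s * x\<^sup>2) = (1 / r) * normal_density 0 (\<sigma> / r) x" for x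
  proof -
    have "- (x - 0)\<^sup>2 / (2 * \<sigma>\<^sup>2) + s * x\<^sup>2 = - (x - 0)\<^sup>2 * r\<^sup>2 / (2 * \<sigma>\<^sup>2)"
      unfolding r using \<sigma> by (simp add: field_simps)
    also have "\<dots> = - (x - 0)\<^sup>2 / (2 * (\<sigma> / r)\<^sup>2)" using \<sigma> r by (simp add: power_divide)
    finally have e: "exp (- (x - 0)\<^sup>2 / (2 * \<sigma>\<^sup>2)) * exp (s * x\<^sup>2) = exp (- (x - 0)\<^sup>2 / (2 * (\<sigma> / r)\<^sup>2))"
      by (simp only: exp_add[symmetric])
    have "sqrt (2 * pi * (\<sigma> / r)\<^sup>2) = sqrt (2 * pi * \<sigma>\<^sup>2) / r"
      using r(1) by (simp add: power_divide real_sqrt_divide)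
    then show ?thesis using e r unfolding normal_density_def by (simp add: mult_ac)
  qed
  have "(\<integral>\<^sup>+\<omega>. ennreal (exp (s * (X \<omega>)\<^sup>2)) \<partial>M) = (\<integral>\<^sup>+x. ennreal (normal_density 0 \<sigma> x) * ennreal (exp (s * x\<^sup>2)) \<partial>lborel)"
    by (rule distributed_nn_integral[OF D, symmetric]) measurable
  also have "\<dots> = (\<integral>\<^sup>+x. ennreal (1 / r) * ennreal (normal_density 0 (\<sigma> / r) x) \<partial>lborel)"
    using r by (simp add: ennreal_mult'[symmetric] normal_density_nonneg eq del: times_divide_eq_left)
  also have "\<dots> = ennreal (1 / r) * (\<integral>\<^sup>+x. ennreal (normal_density 0 (\<sigma> / r) x) \<partial>lborel)"
    by (rule nn_integral_cmult) measurable
  also have "(\<integral>\<^sup>+x. ennreal (normal_density 0 (\<sigma> / r) x) \<partial>lborel) = 1"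
    using \<sigma> r by (subst nn_integral_eq_integral) (auto simp: normal_density_nonneg)
  finally show ?thesis by (simp add: r_def)
qed

lemma (in prob_space) chernoff_independent:
  assumes fin: "finite J" and ind: "indep_vars (\<lambda>_. borel) Y J" and s: "0 < s"
    and mgf: "\<And>j. j \<in> J \<Longrightarrow> (\<integral>\<^sup>+\<omega>. ennreal (exp (s * Y j \<omega>)) \<partial>M) = ennreal (K j)" and K: "\<And>j. j \<in> J \<Longrightarrow> 0 \<le> K j"
  shows "prob {\<omega> \<in> space M. t \<le> (\<Sum>j\<in>J. Y j \<omega>)} \<le> exp (- s * t) * (\<Prod>j\<in>J. K j)"
proof -
  have [measurable]: "Y j \<in> borel_measurable M" if "j \<in> J" for j
    using ind that by (auto simp: indep_vars_def)
  have "emeasure M {\<omega> \<in> space M. t \<le> (\<Sum>j\<in>J. Y j \<omega>)}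
      \<le> ennreal (exp (- s * t)) * (\<integral>\<^sup>+\<omega>. ennreal (exp (s * (\<Sum>j\<in>J. Y j \<omega>))) * indicator (space M) \<omega> \<partial>M)"
    by (rule Chernoff_ineq_nn_integral_ge[OF s]) auto
  also have "(\<integral>\<^sup>+\<omega>. ennreal (exp (s * (\<Sum>j\<in>J. Y j \<omega>))) * indicator (space M) \<omega> \<partial>M)
      = (\<integral>\<^sup>+\<omega>. (\<Prod>j\<in>J. ennreal (exp (s * Y j \<omega>))) \<partial>M)"
    by (intro nn_integral_cong) (simp add: sum_distrib_left exp_sum[OF fin] prod_ennreal)
  also have "\<dots> = (\<Prod>j\<in>J. \<integral>\<^sup>+\<omega>. ennreal (exp (s * Y j \<omega>)) \<partial>M)"
    by (rule indep_vars_nn_integral[OF fin]) (auto intro!: indep_vars_compose2[OF ind])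
  also have "\<dots> = ennreal (\<Prod>j\<in>J. K j)" by (simp add: mgf prod_ennreal K)
  finally have "emeasure M {\<omega> \<in> space M. t \<le> (\<Sum>j\<in>J. Y j \<omega>)} \<le> ennreal (exp (- s * t) * (\<Prod>j\<in>J. K j))"
    by (simp add: ennreal_mult' prod_nonneg K)
  then show ?thesis by (simp add: emeasure_eq_measure prod_nonneg K)
qed

lemma (in prob_space) normal_linear_form_tail:
  assumes fin: "finite J" and ind: "indep_vars (\<lambda>_. borel) X J"
    and D: "\<And>j. j \<in> J \<Longrightarrow> distributed M lborel (X j) (normal_density 0 (\<sigma> j))" and \<sigma>: "\<And>j. j \<in> J \<Longrightarrow> 0 < \<sigma> j"
    and v: "(\<Sum>j\<in>J. (c j)\<^sup>2 * (\<sigma> j)\<^sup>2) \<le> v" "0 < v" and t: "0 < t"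
  shows "prob {\<omega> \<in> space M. t \<le> (\<Sum>j\<in>J. c j * X j \<omega>)} \<le> exp (- t\<^sup>2 / (2 * v))"
proof -
  \<comment> \<open>The minimiser of s^2 v / 2 - s t, the exponent in the Chernoff bound.\<close>
  define s where "s = t / v"
  have s: "0 < s" using v t by (simp add: s_def)
  have "prob {\<omega> \<in> space M. t \<le> (\<Sum>j\<in>J. c j * X j \<omega>)} \<le> exp (- s * t) * (\<Prod>j\<in>J. exp ((s * c j)\<^sup>2 * (\<sigma> j)\<^sup>2 / 2))"
  proof (rule chernoff_independent[OF fin _ s])
    show "indep_vars (\<lambda>_. borel) (\<lambda>j \<omega>. c j * X j \<omega>) J" by (intro indep_vars_compose2[OF ind]) auto
    show "(\<integral>\<^sup>+\<omega>. ennreal (exp (s * (c j * X j \<omega>))) \<partial>M) = ennreal (exp ((s * c j)\<^sup>2 * (\<sigma> j)\<^sup>2 / 2))"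
      if "j \<in> J" for j
      using normal_exp_moment[OF D[OF that] \<sigma>[OF that], of "s * c j"] by (simp add: mult.assoc)
  qed auto
  also have "(\<Prod>j\<in>J. exp ((s * c j)\<^sup>2 * (\<sigma> j)\<^sup>2 / 2)) = exp (s\<^sup>2 / 2 * (\<Sum>j\<in>J. (c j)\<^sup>2 * (\<sigma> j)\<^sup>2))"
    unfolding exp_sum[OF fin, symmetric] sum_distrib_left
    by (rule arg_cong[where f=exp], rule sum.cong) (auto simp: power_mult_distrib)
  also have "exp (- s * t) * exp (s\<^sup>2 / 2 * (\<Sum>j\<in>J. (c j)\<^sup>2 * (\<sigma> j)\<^sup>2)) \<le> exp (- s * t) * exp (s\<^sup>2 / 2 * v)"
    using v by (intro mult_left_mono) (auto intro!: mult_left_mono)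
  also have "\<dots> = exp (- t\<^sup>2 / (2 * v))"
    using v unfolding exp_add[symmetric]
    by (intro arg_cong[where f=exp]) (simp add: s_def field_simps power2_eq_square)
  finally show ?thesis .
qed

text \<open>Chernoff bound with parameter n \<theta> / 2 and \<theta> = \<epsilon> / 4. Each factor
  is at most exp (\<theta>^2) because ln (1 + u) - u is at least -2 u^2 for |u| <= 1/2, and the
  exponents add up to - n \<epsilon>^2 / 8 + n \<epsilon>^2 / 16. The sign \<open>sg\<close> selects
  the upper or the lower tail.\<close>

lemma (in prob_space) chi_square_tail:
  fixes Z :: "'i \<Rightarrow> 'a \<Rightarrow> real"
  assumes fin: "finite J" and ind: "indep_vars (\<lambda>_. borel) Z J"
    and D: "\<And>j. j \<in> J \<Longrightarrow> distributed M lborel (Z j) (normal_density 0 (1 / sqrt (real n)))"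
    and card: "card J \<le> n" and n: "0 < n" and \<epsilon>: "0 < \<epsilon>" "\<epsilon> \<le> 1" and sg: "sg = 1 \<or> sg = - 1"
  shows "prob {\<omega> \<in> space M. \<epsilon> \<le> (\<Sum>j\<in>J. sg * ((Z j \<omega>)\<^sup>2 - 1 / real n))} \<le> exp (- real n * \<epsilon>\<^sup>2 / 16)"
proof -
  define \<theta> where "\<theta> = \<epsilon> / 4"
  have \<theta>: "0 < \<theta>" "\<theta> \<le> 1/4" using \<epsilon> by (auto simp: \<theta>_def)
  define s where "s = real n * \<theta> / 2"
  have s: "0 < s" using \<theta> n by (simp add: s_def)
  have sn: "2 * (s * sg) * (1 / sqrt (real n))\<^sup>2 = \<theta> * sg" using n by (simp add: s_def power_divide)
  have lt: "\<theta> * sg < 1" "\<bar>\<theta> * sg\<bar> \<le> 1/2" "(\<theta> * sg)\<^sup>2 = \<theta>\<^sup>2" using \<theta> sg by auto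
  let ?K = "exp (- s * sg / real n) * (1 / sqrt (1 - \<theta> * sg))"
  have "prob {\<omega> \<in> space M. \<epsilon> \<le> (\<Sum>j\<in>J. sg * ((Z j \<omega>)\<^sup>2 - 1 / real n))} \<le> exp (- s * \<epsilon>) * (\<Prod>j\<in>J. ?K)"
  proof (rule chernoff_independent[OF fin _ s])
    show "indep_vars (\<lambda>_. borel) (\<lambda>j \<omega>. sg * ((Z j \<omega>)\<^sup>2 - 1 / real n)) J"
      by (intro indep_vars_compose2[OF ind]) auto
    fix j assume j: "j \<in> J"
    have [measurable]: "Z j \<in> borel_measurable M" using measurable_distributed_lborel[OF D[OF j]] .
    have "(\<integral>\<^sup>+\<omega>. ennreal (exp (s * (sg * ((Z j \<omega>)\<^sup>2 - 1 / real n)))) \<partial>M)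
      = (\<integral>\<^sup>+\<omega>. ennreal (exp (- s * sg / real n)) * ennreal (exp (s * sg * (Z j \<omega>)\<^sup>2)) \<partial>M)"
      by (intro nn_integral_cong) (simp add: ennreal_mult'[symmetric] exp_add[symmetric] algebra_simps)
    also have "\<dots> = ennreal (exp (- s * sg / real n)) * (\<integral>\<^sup>+\<omega>. ennreal (exp (s * sg * (Z j \<omega>)\<^sup>2)) \<partial>M)"
      by (rule nn_integral_cmult) measurable
    also have "(\<integral>\<^sup>+\<omega>. ennreal (exp (s * sg * (Z j \<omega>)\<^sup>2)) \<partial>M) = ennreal (1 / sqrt (1 - \<theta> * sg))"
      using normal_exp_square_moment[OF D[OF j], of "s * sg"] n lt sn by simp
    finally show "(\<integral>\<^sup>+\<omega>. ennreal (exp (s * (sg * ((Z j \<omega>)\<^sup>2 - 1 / real n)))) \<partial>M) = ennreal ?K"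
      by (simp add: ennreal_mult'[symmetric])
    show "0 \<le> ?K" using lt by simp
  qed
  also have "(\<Prod>j\<in>J. ?K) = ?K ^ card J" by simp
  also have "?K \<le> exp (\<theta>\<^sup>2)"
  proof -
    have "1 / sqrt (1 - \<theta> * sg) = exp (- ln (1 - \<theta> * sg) / 2)"
      using lt by (simp add: exp_minus exp_ln_iff ln_sqrt[symmetric] inverse_eq_divide)
    then have "?K = exp (- \<theta> * sg / 2 - ln (1 - \<theta> * sg) / 2)"
      using n by (simp add: exp_add[symmetric] s_def)
    moreover have "- (\<theta> * sg) - ln (1 - \<theta> * sg) \<le> 2 * \<theta>\<^sup>2"
      using abs_ln_one_plus_x_minus_x_bound[of "- (\<theta> * sg)"] lt by (simp add: abs_le_iff)
    ultimately show ?thesis by simp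
  qed
  then have "?K ^ card J \<le> exp (\<theta>\<^sup>2) ^ card J" using lt by (intro power_mono) auto
  also have "exp (\<theta>\<^sup>2) ^ card J = exp (real (card J) * \<theta>\<^sup>2)" by (simp add: exp_of_nat_mult)
  also have "\<dots> \<le> exp (real n * \<theta>\<^sup>2)" using card by (auto intro!: mult_right_mono)
  also have "exp (- s * \<epsilon>) * exp (real n * \<theta>\<^sup>2) = exp (- real n * \<epsilon>\<^sup>2 / 16)"
    unfolding exp_add[symmetric] by (rule arg_cong[where f=exp]) (simp add: s_def \<theta>_def field_simps power2_eq_square)
  finally show ?thesis by simp
qed

lemma (in prob_space) indep_vars_block_sums:
  fixes X :: "'i \<Rightarrow> 'a \<Rightarrow> real"
  assumes ind: "indep_vars (\<lambda>_. borel) X I" and K: "\<And>j. j \<in> L \<Longrightarrow> K j \<subseteq> I" and disj: "disjoint_family_on K L"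
  shows "indep_vars (\<lambda>_. borel) (\<lambda>j \<omega>. \<Sum>p\<in>K j. c j p * X p \<omega>) L"
proof -
  have "indep_vars (\<lambda>_. borel) (\<lambda>j \<omega>. (\<lambda>f. \<Sum>p\<in>K j. c j p * f p) (restrict (\<lambda>p. X p \<omega>) (K j))) L"
    by (rule indep_vars_compose2[OF indep_vars_restrict[OF ind K disj]]) auto
  then show ?thesis by (rule indep_vars_cong[THEN iffD1, rotated -1]) auto
qed

lemma (in prob_space) normal_linear_form_distributed:
  assumes fin: "finite J" "J \<noteq> {}" and ind: "indep_vars (\<lambda>_. borel) X J"
    and D: "\<And>j. j \<in> J \<Longrightarrow> distributed M lborel (X j) (normal_density 0 (\<sigma> j))" and \<sigma>: "\<And>j. j \<in> J \<Longrightarrow> 0 < \<sigma> j"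
    and c: "\<And>j. j \<in> J \<Longrightarrow> c j \<noteq> 0"
  shows "distributed M lborel (\<lambda>\<omega>. \<Sum>j\<in>J. c j * X j \<omega>) (normal_density 0 (sqrt (\<Sum>j\<in>J. (c j)\<^sup>2 * (\<sigma> j)\<^sup>2)))"
proof -
  have "distributed M lborel (\<lambda>\<omega>. \<Sum>j\<in>J. c j * X j \<omega>) (normal_density (\<Sum>j\<in>J. 0) (sqrt (\<Sum>j\<in>J. (\<bar>c j\<bar> * \<sigma> j)\<^sup>2)))"
  proof (rule sum_indep_normal[OF fin])
    show "indep_vars (\<lambda>_. borel) (\<lambda>j \<omega>. c j * X j \<omega>) J" by (intro indep_vars_compose2[OF ind]) auto
    show "distributed M lborel (\<lambda>\<omega>. c j * X j \<omega>) (normal_density 0 (\<bar>c j\<bar> * \<sigma> j))" if "j \<in> J" for j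
      using normal_density_affine[OF D[OF that] \<sigma>[OF that] c[OF that], of 0] by simp
  qed (use \<sigma> c in auto)
  then show ?thesis by (simp add: power_mult_distrib)
qed

section \<open>Row sums of a GOE matrix\<close>

definition upair :: "nat \<Rightarrow> nat \<Rightarrow> nat \<times> nat" where
  "upair i j = (min i j, max i j)"

lemma upair_eq_iff: "upair i j = upair k l \<longleftrightarrow> (i = k \<and> j = l) \<or> (i = l \<and> j = k)"
  by (auto simp: upair_def min_def max_def split: if_splits)

lemma sum_symmetric_square:
  fixes f :: "nat \<Rightarrow> nat \<Rightarrow> real"
  assumes "\<And>i j. i < n \<Longrightarrow> j < n \<Longrightarrow> f i j = f j i"
  shows "(\<Sum>i<n. \<Sum>j<n. f i j) = (\<Sum>p\<in>{(i, j). i \<le> j \<and> j < n}. (if fst p = snd p then 1 else 2) * f (fst p) (snd p))"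
proof -
  have "(\<Sum>p\<in>{(i, j). i \<le> j \<and> j < n}. (if fst p = snd p then 1 else 2) * f (fst p) (snd p))
     = (\<Sum>j<n. \<Sum>i\<le>j. (if i = j then 1 else 2) * f i j)"
  proof -
    have "{(i, j). i \<le> j \<and> j < n} = prod.swap ` (SIGMA j:{..<n}. {..j})" by (auto simp: image_iff)
    then show ?thesis by (simp add: sum.reindex sum.Sigma case_prod_beta)
  qed
  also have "\<dots> = (\<Sum>i<n. \<Sum>j<n. f i j)"
    using assms
  proof (induction n)
    case (Suc n)
    have "(\<Sum>i\<le>n. (if i = n then 1 else 2) * f i n) = f n n + (\<Sum>i<n. f i n + f n i)"
    proof -
      have "(\<Sum>i\<le>n. (if i = n then 1 else 2) * f i n) = (\<Sum>i<n. (if i = n then 1 else 2) * f i n) + f n n"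
        by (simp add: lessThan_Suc_atMost[symmetric])
      also have "(\<Sum>i<n. (if i = n then 1 else 2) * f i n) = (\<Sum>i<n. f i n + f n i)"
        by (intro sum.cong refl) (auto simp: Suc.prems[of n])
      finally show ?thesis by simp
    qed
    then have "(\<Sum>j<Suc n. \<Sum>i\<le>j. (if i = j then 1 else 2) * f i j)
      = (\<Sum>i<n. \<Sum>j<n. f i j) + (f n n + (\<Sum>i<n. f i n + f n i))"
      using Suc.IH Suc.prems by simp
    also have "\<dots> = (\<Sum>i<Suc n. \<Sum>j<Suc n. f i j)" by (simp only: sum.lessThan_Suc sum.distrib)
    finally show ?case .
  qed simp
  finally show ?thesis ..
qed

locale goe_matrix = prob_space M for M :: "'a measure" +
  fixes n :: nat and A :: "'a \<Rightarrow> real mat"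
  assumes GOE: "GOE n M A" and n_pos: "0 < n"
begin

definition I :: "(nat \<times> nat) set" where "I = {(i, j). i \<le> j \<and> j < n}"
definition X :: "nat \<times> nat \<Rightarrow> 'a \<Rightarrow> real" where "X p \<omega> = A \<omega> $$ p"
definition sd :: "nat \<times> nat \<Rightarrow> real" where "sd p = sqrt ((1 + (if fst p = snd p then 1 else 0)) / real n)"
definition g :: "'a \<Rightarrow> nat \<Rightarrow> nat \<Rightarrow> real" where "g \<omega> i j = X (upair i j) \<omega>"
definition D :: "'a \<Rightarrow> nat \<Rightarrow> real" where "D \<omega> i = (\<Sum>j<n. g \<omega> i j)"

lemma sd_off_diagonal: "i \<noteq> j \<Longrightarrow> sd (upair i j) = 1 / sqrt (real n)"
  by (auto simp: sd_def upair_def min_def max_def real_sqrt_divide)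

lemma finite_I: "finite I"
proof -
  have "I \<subseteq> {..<n} \<times> {..<n}" by (auto simp: I_def)
  then show ?thesis by (rule finite_subset) auto
qed

lemma indep_X: "indep_vars (\<lambda>_. borel) X I"
  using GOE unfolding GOE_def I_def X_def[abs_def] by auto

lemma X_normal: "p \<in> I \<Longrightarrow> distributed M lborel (X p) (normal_density 0 (sd p))"
  using GOE unfolding GOE_def I_def X_def[abs_def] sd_def by (cases p) auto

lemma sd_pos: "0 < sd p" using n_pos by (auto simp: sd_def intro!: divide_pos_pos)

lemma sd_sq: "(sd p)\<^sup>2 = (1 + (if fst p = snd p then 1 else 0)) / real n"
  unfolding sd_def by (subst real_sqrt_pow2) auto

lemma measurable_X [measurable]: "p \<in> I \<Longrightarrow> X p \<in> borel_measurable M"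
  using indep_X by (auto simp: indep_vars_def)

lemma upair_in_I: "i < n \<Longrightarrow> j < n \<Longrightarrow> upair i j \<in> I"
  by (auto simp: upair_def I_def)

lemma measurable_g [measurable]: "i < n \<Longrightarrow> j < n \<Longrightarrow> (\<lambda>\<omega>. g \<omega> i j) \<in> borel_measurable M"
  unfolding g_def by (intro measurable_X upair_in_I)

lemma measurable_D [measurable]: "i < n \<Longrightarrow> (\<lambda>\<omega>. D \<omega> i) \<in> borel_measurable M"
  unfolding D_def by (intro borel_measurable_sum measurable_g) auto

lemma g_commute: "g \<omega> i j = g \<omega> j i"
  by (simp add: g_def upair_def min.commute max.commute)

lemma A_carrier: "\<omega> \<in> space M \<Longrightarrow> A \<omega> \<in> carrier_mat n n"
  and A_sym: "\<omega> \<in> space M \<Longrightarrow> transpose_mat (A \<omega>) = A \<omega>"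
  using GOE by (auto simp: GOE_def)

lemma A_eq_g: assumes "\<omega> \<in> space M" "i < n" "j < n" shows "A \<omega> $$ (i, j) = g \<omega> i j"
proof -
  have "A \<omega> $$ (j, i) = A \<omega> $$ (i, j)"
    using A_carrier[OF assms(1)] A_sym[OF assms(1)] assms(2,3) by (metis carrier_matD index_transpose_mat(1))
  then show ?thesis by (auto simp: g_def X_def upair_def min_def max_def)
qed

lemma linear_form_tail:
  assumes J: "J \<subseteq> I" and v: "(\<Sum>p\<in>J. (c p)\<^sup>2 * (sd p)\<^sup>2) \<le> v" "0 < v" and t: "0 < t"
  shows "prob {\<omega> \<in> space M. t \<le> (\<Sum>p\<in>J. c p * X p \<omega>)} \<le> exp (- t\<^sup>2 / (2 * v))"
  using J by (intro normal_linear_form_tail[where \<sigma>=sd] v t indep_vars_subset[OF indep_X] X_normal sd_pos finite_subset[OF J finite_I]) auto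

lemma entry_tail:
  assumes ij: "i < n" "j < n" and t: "0 < t" and s: "s = 1 \<or> s = - 1"
  shows "prob {\<omega> \<in> space M. t \<le> s * g \<omega> i j} \<le> exp (- real n * t\<^sup>2 / 4)"
proof -
  have "prob {\<omega> \<in> space M. t \<le> (\<Sum>p\<in>{upair i j}. s * X p \<omega>)} \<le> exp (- t\<^sup>2 / (2 * (2 / real n)))"
  proof (rule linear_form_tail)
    have "s\<^sup>2 = 1" using s by auto
    then show "(\<Sum>p\<in>{upair i j}. s\<^sup>2 * (sd p)\<^sup>2) \<le> 2 / real n" by (simp add: sd_sq divide_right_mono)
  qed (use n_pos ij t in \<open>auto intro: upair_in_I\<close>)
  then show ?thesis by (simp add: g_def mult.commute)
qed

text \<open>As a linear form in the independent entries it has variance exactly 2 / n times the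
  fourth power of the norm of u: the coefficient 2 of an off-diagonal entry is balanced by the
  doubled variance on the diagonal.\<close>

lemma quad_form_tail:
  assumes u: "(\<Sum>i<n. (u i)\<^sup>2) \<le> 1" and t: "0 < t" and s: "s = 1 \<or> s = - 1"
  shows "prob {\<omega> \<in> space M. t \<le> s * (\<Sum>i<n. \<Sum>j<n. g \<omega> i j * (u i * u j))} \<le> exp (- real n * t\<^sup>2 / 4)"
proof -
  define c where "c p = s * ((if fst p = snd p then 1 else 2) * (u (fst p) * u (snd p)))" for p :: "nat \<times> nat"
  have form: "s * (\<Sum>i<n. \<Sum>j<n. g \<omega> i j * (u i * u j)) = (\<Sum>p\<in>I. c p * X p \<omega>)" for \<omega>
  proof -
    have "(\<Sum>i<n. \<Sum>j<n. g \<omega> i j * (u i * u j))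
      = (\<Sum>p\<in>I. (if fst p = snd p then 1 else 2) * (g \<omega> (fst p) (snd p) * (u (fst p) * u (snd p))))"
      unfolding I_def by (rule sum_symmetric_square) (simp add: g_commute mult_ac)
    also have "s * \<dots> = (\<Sum>p\<in>I. c p * X p \<omega>)"
      unfolding sum_distrib_left
      by (intro sum.cong refl) (auto simp: c_def g_def upair_def I_def mult_ac)
    finally show ?thesis .
  qed
  have "(\<Sum>p\<in>I. (c p)\<^sup>2 * (sd p)\<^sup>2) = (\<Sum>p\<in>I. (if fst p = snd p then 1 else 2) * (2 / real n * ((u (fst p))\<^sup>2 * (u (snd p))\<^sup>2)))"
    using s by (intro sum.cong refl) (auto simp: c_def sd_sq power_mult_distrib)
  also have "\<dots> = (\<Sum>i<n. \<Sum>j<n. 2 / real n * ((u i)\<^sup>2 * (u j)\<^sup>2))"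
    unfolding I_def by (rule sum_symmetric_square[symmetric]) simp
  also have "\<dots> = 2 / real n * ((\<Sum>i<n. (u i)\<^sup>2) * (\<Sum>j<n. (u j)\<^sup>2))"
    unfolding sum_product by (simp add: sum_distrib_left)
  also have "\<dots> \<le> 2 / real n * (1 * 1)"
    using u by (intro mult_left_mono mult_mono sum_nonneg) auto
  finally have "(\<Sum>p\<in>I. (c p)\<^sup>2 * (sd p)\<^sup>2) \<le> 2 / real n" by simp
  from linear_form_tail[OF order_refl this _ t] n_pos
  show ?thesis unfolding form by (simp add: mult.commute)
qed

lemma sum_row_X:
  assumes "K \<subseteq> {..<n}" shows "(\<Sum>k\<in>K. g \<omega> j k) = (\<Sum>p\<in>upair j ` K. X p \<omega>)"
  unfolding g_def by (subst sum.reindex) (auto simp: inj_on_def upair_eq_iff)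

lemma row_sum_tail:
  assumes j: "j < n" and t: "0 < t" and s: "s = 1 \<or> s = - 1"
  shows "prob {\<omega> \<in> space M. t \<le> s * D \<omega> j} \<le> exp (- t\<^sup>2 / (2 * (1 + 1 / real n)))"
proof -
  have s2: "s\<^sup>2 = 1" using s by auto
  have "prob {\<omega> \<in> space M. t \<le> (\<Sum>p\<in>upair j ` {..<n}. s * X p \<omega>)} \<le> exp (- t\<^sup>2 / (2 * (1 + 1 / real n)))"
  proof (rule linear_form_tail)
    show "upair j ` {..<n} \<subseteq> I" using j by (auto intro: upair_in_I)
    have "(\<Sum>p\<in>upair j ` {..<n}. s\<^sup>2 * (sd p)\<^sup>2) = (\<Sum>k<n. (1 + (if k = j then 1 else 0)) / real n)"
      by (subst sum.reindex) (auto simp: inj_on_def upair_eq_iff s2 sd_sq upair_def min_def max_def intro!: sum.cong)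
    also have "\<dots> = 1 + 1 / real n"
      using j n_pos by (simp add: sum.distrib add_divide_distrib sum_divide_distrib[symmetric])
    finally show "(\<Sum>p\<in>upair j ` {..<n}. s\<^sup>2 * (sd p)\<^sup>2) \<le> 1 + 1 / real n" by simp
  qed (use t in \<open>auto intro: add_pos_nonneg\<close>)
  then show ?thesis by (simp add: D_def sum_row_X sum_distrib_left)
qed

lemma disjoint_row_blocks:
  assumes R: "R \<subseteq> {..<n}"
  shows "disjoint_family_on (\<lambda>l. upair l ` ({..<n} - R)) R"
  unfolding disjoint_family_on_def by (auto simp: upair_eq_iff)

text \<open>Two rows share only their mutual entry. Once the columns in R are removed, rows with
  index in R use disjoint sets of positions in the upper triangle.\<close>

lemma indep_truncated_rows:
  assumes R: "R \<subseteq> {..<n}"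
  shows "indep_vars (\<lambda>_. borel) (\<lambda>l \<omega>. \<Sum>k\<in>{..<n}-R. g \<omega> l k) R"
proof -
  have "indep_vars (\<lambda>_. borel) (\<lambda>l \<omega>. \<Sum>p\<in>upair l ` ({..<n} - R). 1 * X p \<omega>) R"
    using R by (intro indep_vars_block_sums[OF indep_X _ disjoint_row_blocks]) (auto intro!: upair_in_I)
  then show ?thesis by (simp add: sum_row_X)
qed

text \<open>Removing the columns in R also removes the diagonal entry, so all remaining variances
  are 1 / n.\<close>

lemma truncated_row_normal:
  assumes R: "R \<subseteq> {..<n}" and l: "l \<in> R" and lt: "card R < n"
  shows "distributed M lborel (\<lambda>\<omega>. \<Sum>k\<in>{..<n}-R. g \<omega> l k) (normal_density 0 (sqrt (1 - real (card R) / real n)))"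
proof -
  let ?J = "upair l ` ({..<n} - R)"
  have J: "?J \<subseteq> I" using R l by (auto intro!: upair_in_I)
  have fR: "finite R" using R finite_subset by blast
  have "card ({..<n} - R) = n - card R" using R by (simp add: card_Diff_subset fR)
  then have ne: "{..<n} - R \<noteq> {}" using lt by (metis card.empty zero_less_diff less_irrefl)
  have "distributed M lborel (\<lambda>\<omega>. \<Sum>p\<in>?J. 1 * X p \<omega>) (normal_density 0 (sqrt (\<Sum>p\<in>?J. 1\<^sup>2 * (sd p)\<^sup>2)))"
    using J ne by (intro normal_linear_form_distributed indep_vars_subset[OF indep_X J] X_normal sd_pos) auto
  also have "(\<Sum>p\<in>?J. 1\<^sup>2 * (sd p)\<^sup>2) = (\<Sum>k\<in>{..<n}-R. 1 / real n)"
  proof (subst sum.reindex)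
    have "sd (upair l k) = 1 / sqrt (real n)" if "k \<in> {..<n} - R" for k
      using l that by (intro sd_off_diagonal) auto
    then show "sum ((\<lambda>p. 1\<^sup>2 * (sd p)\<^sup>2) \<circ> upair l) ({..<n} - R) = (\<Sum>k\<in>{..<n}-R. 1 / real n)"
      by (intro sum.cong refl) (simp add: power_divide)
  qed (auto simp: inj_on_def upair_eq_iff)
  also have "\<dots> = 1 - real (card R) / real n"
    using \<open>card ({..<n} - R) = n - card R\<close> lt n_pos by (simp add: of_nat_diff diff_divide_distrib)
  finally show ?thesis by (simp add: sum_row_X)
qed

lemma gram_diagonal_tail:
  assumes i: "i < n" and \<delta>: "0 < \<delta>" "\<delta> \<le> 1" and s: "s = 1 \<or> s = - 1"
  shows "prob {\<omega> \<in> space M. \<delta> \<le> (\<Sum>j\<in>{..<n}-{i}. s * ((g \<omega> i j)\<^sup>2 - 1 / real n))} \<le> exp (- real n * \<delta>\<^sup>2 / 16)"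
proof (rule chi_square_tail[OF _ _ _ _ n_pos \<delta> s])
  have "indep_vars (\<lambda>_. borel) (\<lambda>j \<omega>. \<Sum>p\<in>{upair i j}. 1 * X p \<omega>) ({..<n} - {i})"
    using i by (intro indep_vars_block_sums[OF indep_X])
      (auto intro: upair_in_I simp: disjoint_family_on_def upair_eq_iff)
  then show "indep_vars (\<lambda>_. borel) (\<lambda>j \<omega>. g \<omega> i j) ({..<n} - {i})" by (simp add: g_def)
  fix j assume j: "j \<in> {..<n} - {i}"
  have "sd (upair i j) = 1 / sqrt (real n)" using j by (intro sd_off_diagonal) auto
  with X_normal[of "upair i j"] i j
  show "distributed M lborel (\<lambda>\<omega>. g \<omega> i j) (normal_density 0 (1 / sqrt (real n)))"
    by (simp add: g_def upair_in_I)
next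
  have "card ({..<n} - {i}) \<le> card {..<n}" by (rule card_mono) auto
  then show "card ({..<n} - {i}) \<le> n" by simp
qed simp

text \<open>Polarisation: the product of two entries is half the difference of the squares of their
  normalised sum and difference, each of which is normal with variance 1 / n again. The columns i
  and k are left out because they contain the shared entry and the diagonal entries of larger
  variance.\<close>

lemma gram_off_diagonal_tail:
  assumes ik: "i < n" "k < n" "i \<noteq> k" and \<delta>: "0 < \<delta>" "\<delta> \<le> 1"
    and s: "s = 1 \<or> s = - 1" and r: "r = 1 \<or> r = - 1"
  shows "prob {\<omega> \<in> space M. \<delta> \<le> (\<Sum>j\<in>{..<n}-{i,k}. s * (((g \<omega> i j + r * g \<omega> k j) / sqrt 2)\<^sup>2 - 1 / real n))}
     \<le> exp (- real n * \<delta>\<^sup>2 / 16)"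
proof (rule chi_square_tail[OF _ _ _ _ n_pos \<delta> s])
  define c where "c j p = (if p = upair i j then 1 / sqrt 2 else r / sqrt 2)" for j p
  let ?J = "\<lambda>j. {upair i j, upair k j}"
  have ne: "upair i j \<noteq> upair k j" for j using ik by (auto simp: upair_eq_iff)
  have Z: "(\<Sum>p\<in>?J j. c j p * X p \<omega>) = (g \<omega> i j + r * g \<omega> k j) / sqrt 2" for j \<omega>
    using ne[of j] ne[of j, symmetric] by (simp add: c_def g_def add_divide_distrib)
  have "indep_vars (\<lambda>_. borel) (\<lambda>j \<omega>. \<Sum>p\<in>?J j. c j p * X p \<omega>) ({..<n} - {i,k})"
    using ik by (intro indep_vars_block_sums[OF indep_X])
      (auto intro: upair_in_I simp: disjoint_family_on_def upair_eq_iff)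
  then show "indep_vars (\<lambda>_. borel) (\<lambda>j \<omega>. (g \<omega> i j + r * g \<omega> k j) / sqrt 2) ({..<n} - {i,k})" by (simp only: Z)
  fix j assume j: "j \<in> {..<n} - {i,k}"
  then have J: "?J j \<subseteq> I" using ik by (auto intro: upair_in_I)
  have "distributed M lborel (\<lambda>\<omega>. \<Sum>p\<in>?J j. c j p * X p \<omega>) (normal_density 0 (sqrt (\<Sum>p\<in>?J j. (c j p)\<^sup>2 * (sd p)\<^sup>2)))"
    using J r by (intro normal_linear_form_distributed indep_vars_subset[OF indep_X J] X_normal sd_pos) (auto simp: c_def)
  moreover have "(\<Sum>p\<in>?J j. (c j p)\<^sup>2 * (sd p)\<^sup>2) = 1 / real n"
  proof -
    have "(sd (upair i j))\<^sup>2 = 1 / real n" "(sd (upair k j))\<^sup>2 = 1 / real n"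
      using j by (auto simp: sd_sq upair_def min_def max_def)
    then show ?thesis using ne[of j] ne[of j, symmetric] r by (auto simp: c_def power_divide)
  qed
  ultimately show "distributed M lborel (\<lambda>\<omega>. (g \<omega> i j + r * g \<omega> k j) / sqrt 2) (normal_density 0 (1 / sqrt (real n)))"
    by (simp add: Z real_sqrt_divide)
next
  have "card ({..<n} - {i,k}) \<le> card {..<n}" by (rule card_mono) auto
  then show "card ({..<n} - {i,k}) \<le> n" by simp
qed simp

text \<open>Puts back the columns left out of the chi-square sums. They contribute at most two
  products of entries, and 1 / n corrects the centring of the omitted diagonal square.\<close>

lemma gram_bound:
  assumes ik: "i < n" "k < n"
    and ent: "\<And>i j. i < n \<Longrightarrow> j < n \<Longrightarrow> \<bar>g \<omega> i j\<bar> \<le> \<alpha>"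
    and diag: "\<And>s. s = 1 \<or> s = - 1 \<Longrightarrow> (\<Sum>j\<in>{..<n}-{i}. s * ((g \<omega> i j)\<^sup>2 - 1 / real n)) \<le> \<delta>"
    and off: "\<And>s r. i \<noteq> k \<Longrightarrow> s = 1 \<or> s = - 1 \<Longrightarrow> r = 1 \<or> r = - 1 \<Longrightarrow>
       (\<Sum>j\<in>{..<n}-{i,k}. s * (((g \<omega> i j + r * g \<omega> k j) / sqrt 2)\<^sup>2 - 1 / real n)) \<le> \<delta>"
  shows "\<bar>(\<Sum>j<n. g \<omega> i j * g \<omega> k j) - (if i = k then 1 else 0)\<bar> \<le> \<delta> + 2 * \<alpha>\<^sup>2 + 1 / real n"
proof -
  have prod: "\<bar>g \<omega> i j * g \<omega> i' j'\<bar> \<le> \<alpha>\<^sup>2" if "i < n" "j < n" "i' < n" "j' < n" for i j i' j'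
    unfolding abs_mult power2_eq_square using ent that by (intro mult_mono) (auto intro: order_trans[OF abs_ge_zero])
  show ?thesis
  proof (cases "i = k")
    case True
    let ?T = "\<Sum>j\<in>{..<n}-{i}. ((g \<omega> i j)\<^sup>2 - 1 / real n)"
    have "(\<Sum>j<n. g \<omega> i j * g \<omega> i j) - 1 = (\<Sum>j<n. (g \<omega> i j)\<^sup>2 - 1 / real n)"
      using n_pos by (simp add: sum_subtractf power2_eq_square)
    also have "\<dots> = (g \<omega> i i)\<^sup>2 - 1 / real n + ?T" using ik by (simp add: sum.remove[of "{..<n}" i])
    finally have eq: "(\<Sum>j<n. g \<omega> i j * g \<omega> i j) - 1 = (g \<omega> i i)\<^sup>2 - 1 / real n + ?T" .
    have "?T \<le> \<delta>" "- ?T \<le> \<delta>" using diag[of 1] diag[of "- 1"] by (simp_all only: sum_distrib_left[symmetric]) simp_all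
    moreover have "(g \<omega> i i)\<^sup>2 \<le> \<alpha>\<^sup>2" using prod[of i i i i] ik by (simp add: power2_eq_square)
    moreover have "0 \<le> \<alpha>\<^sup>2" "0 \<le> (g \<omega> i i)\<^sup>2" "0 \<le> 1 / real n" by auto
    ultimately have "\<bar>(\<Sum>j<n. g \<omega> i j * g \<omega> i j) - 1\<bar> \<le> \<delta> + 2 * \<alpha>\<^sup>2 + 1 / real n"
      using eq by linarith
    then show ?thesis using True by simp
  next
    case False
    let ?T = "\<lambda>r. \<Sum>j\<in>{..<n}-{i,k}. (((g \<omega> i j + r * g \<omega> k j) / sqrt 2)\<^sup>2 - 1 / real n)"
    have "g \<omega> i j * g \<omega> k j = ((((g \<omega> i j + 1 * g \<omega> k j) / sqrt 2)\<^sup>2 - 1 / real n)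
         - (((g \<omega> i j + (- 1) * g \<omega> k j) / sqrt 2)\<^sup>2 - 1 / real n)) / 2" for j
      by (simp add: power_divide power2_eq_square field_simps)
    then have "(\<Sum>j\<in>{..<n}-{i,k}. g \<omega> i j * g \<omega> k j) = (?T 1 - ?T (- 1)) / 2"
      by (simp only: sum_subtractf[symmetric] sum_divide_distrib)
    moreover have "(\<Sum>j<n. g \<omega> i j * g \<omega> k j) = (\<Sum>j\<in>{..<n}-{i,k}. g \<omega> i j * g \<omega> k j) + (\<Sum>j\<in>{i,k}. g \<omega> i j * g \<omega> k j)"
      using ik by (intro sum.subset_diff) auto
    moreover have "(\<Sum>j\<in>{i,k}. g \<omega> i j * g \<omega> k j) = g \<omega> i i * g \<omega> k i + g \<omega> i k * g \<omega> k k" using False by simp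
    moreover have "\<bar>g \<omega> i i * g \<omega> k i\<bar> \<le> \<alpha>\<^sup>2" "\<bar>g \<omega> i k * g \<omega> k k\<bar> \<le> \<alpha>\<^sup>2" using prod ik by auto
    moreover have "?T r \<le> \<delta>" "- ?T r \<le> \<delta>" if "r = 1 \<or> r = - 1" for r
      using off[OF False, of 1 r] off[OF False, of "- 1" r] that by (simp_all only: sum_distrib_left[symmetric]) simp_all
    from this[of 1] this[of "- 1"] have "?T 1 \<le> \<delta>" "- ?T 1 \<le> \<delta>" "?T (- 1) \<le> \<delta>" "- ?T (- 1) \<le> \<delta>" by blast+
    moreover have "0 \<le> 1 / real n" by simp
    moreover have "s = (a - b) / 2 \<Longrightarrow> t = s + u \<Longrightarrow> u = c + d \<Longrightarrow> \<bar>c\<bar> \<le> q \<Longrightarrow> \<bar>d\<bar> \<le> q \<Longrightarrow>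
       a \<le> \<delta> \<Longrightarrow> - a \<le> \<delta> \<Longrightarrow> b \<le> \<delta> \<Longrightarrow> - b \<le> \<delta> \<Longrightarrow> 0 \<le> e \<Longrightarrow> \<bar>t\<bar> \<le> \<delta> + 2 * q + e"
      for s a b t u c d q e :: real by (simp add: abs_le_iff field_simps)
    ultimately have "\<bar>(\<Sum>j<n. g \<omega> i j * g \<omega> k j)\<bar> \<le> \<delta> + 2 * \<alpha>\<^sup>2 + 1 / real n" by blast
    then show ?thesis using False by simp
  qed
qed

text \<open>The expected number of indices is a sum of probabilities whatever the dependence between
  the rows, and Markov's inequality does the rest.\<close>

lemma count_markov:
  assumes E: "\<And>j. j < n \<Longrightarrow> {\<omega> \<in> space M. P j \<omega>} \<in> events"
    and p: "\<And>j. j < n \<Longrightarrow> prob {\<omega> \<in> space M. P j \<omega>} \<le> p" and N: "0 < N"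
  shows "{\<omega> \<in> space M. N \<le> real (card {j. j < n \<and> P j \<omega>})} \<in> events"
    and "prob {\<omega> \<in> space M. N \<le> real (card {j. j < n \<and> P j \<omega>})} \<le> real n * p / N"
proof -
  let ?f = "\<lambda>\<omega>. \<Sum>j<n. indicat_real {\<omega> \<in> space M. P j \<omega>} \<omega>"
  have f: "real (card {j. j < n \<and> P j \<omega>}) = ?f \<omega>" if "\<omega> \<in> space M" for \<omega>
    using that by (simp add: indicator_def sum.If_cases Collect_conj_eq Int_commute lessThan_def)
  have set: "{\<omega> \<in> space M. N \<le> real (card {j. j < n \<and> P j \<omega>})} = {\<omega> \<in> space M. N \<le> ?f \<omega>}"
    using f by auto
  have int: "integrable M (\<lambda>\<omega>. indicat_real {\<omega> \<in> space M. P j \<omega>} \<omega>)" if "j < n" for j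
    using E[OF that] by (simp add: emeasure_eq_measure)
  have [measurable]: "?f \<in> borel_measurable M"
    using int by (intro borel_measurable_sum) auto
  show "{\<omega> \<in> space M. N \<le> real (card {j. j < n \<and> P j \<omega>})} \<in> events" unfolding set by measurable
  have "measure M {\<omega> \<in> space M. N \<le> ?f \<omega>} \<le> (\<integral>\<omega>. ?f \<omega> \<partial>M) / N"
    using int by (intro integral_Markov_inequality_measure[where A="space M - {}"] Bochner_Integration.integrable_sum N) (auto intro!: sum_nonneg)
  also have "(\<integral>\<omega>. ?f \<omega> \<partial>M) = (\<Sum>j<n. prob {\<omega> \<in> space M. P j \<omega>})"
    using int E by (subst Bochner_Integration.integral_sum) auto
  also have "\<dots> \<le> (\<Sum>j<n. p)" using p by (intro sum_mono) auto
  finally show "prob {\<omega> \<in> space M. N \<le> real (card {j. j < n \<and> P j \<omega>})} \<le> real n * p / N"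
    unfolding set using N by (simp add: divide_right_mono)
qed

end

section \<open>Operator norm and exceptional events\<close>

definition bilin :: "nat \<Rightarrow> (nat \<Rightarrow> nat \<Rightarrow> real) \<Rightarrow> (nat \<Rightarrow> real) \<Rightarrow> (nat \<Rightarrow> real) \<Rightarrow> real" where
  "bilin n g u v = (\<Sum>k<n. \<Sum>l<n. g k l * (u k * v l))"

lemma bilin_add_left: "bilin n g (\<lambda>k. u k + u' k) v = bilin n g u v + bilin n g u' v"
  and bilin_add_right: "bilin n g u (\<lambda>k. v k + v' k) = bilin n g u v + bilin n g u v'"
  and bilin_diff_left: "bilin n g (\<lambda>k. u k - u' k) v = bilin n g u v - bilin n g u' v"
  and bilin_diff_right: "bilin n g u (\<lambda>k. v k - v' k) = bilin n g u v - bilin n g u v'"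
  by (simp_all add: bilin_def algebra_simps sum.distrib sum_subtractf)

lemma bilin_scale: "bilin n g (\<lambda>k. a * u k) (\<lambda>k. b * v k) = a * b * bilin n g u v"
  by (simp add: bilin_def sum_distrib_left mult_ac)

lemma bilin_commute:
  assumes "\<And>i j. i < n \<Longrightarrow> j < n \<Longrightarrow> g i j = g j i"
  shows "bilin n g u v = bilin n g v u"
proof -
  have "bilin n g u v = (\<Sum>l<n. \<Sum>k<n. g k l * (u k * v l))" unfolding bilin_def by (rule sum.swap)
  also have "\<dots> = bilin n g v u" unfolding bilin_def by (intro sum.cong refl) (auto simp: assms mult_ac)
  finally show ?thesis .
qed

lemma bilin_zero:
  assumes "(\<Sum>k<n. (u k)\<^sup>2) = (0::real)" shows "bilin n g u v = 0" "bilin n g v u = 0"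
proof -
  have "\<forall>k<n. u k = 0" using assms by (simp add: sum_nonneg_eq_0_iff)
  then show "bilin n g u v = 0" "bilin n g v u = 0" by (auto simp: bilin_def intro!: sum.neutral)
qed

text \<open>Polarisation after rescaling: with norms a and b of x and y, the vectors b x and a y
  both have norm a b, and the parallelogram identity then gives the constant K without loss.\<close>

lemma bilin_le_of_quadratic:
  assumes sym: "\<And>i j. i < n \<Longrightarrow> j < n \<Longrightarrow> g i j = g j i"
    and q: "\<And>v. \<bar>bilin n g v v\<bar> \<le> K * (\<Sum>k<n. (v k)\<^sup>2)"
  shows "\<bar>bilin n g x y\<bar> \<le> K * (sqrt (\<Sum>k<n. (x k)\<^sup>2) * sqrt (\<Sum>k<n. (y k)\<^sup>2))"
proof -
  define a where "a = sqrt (\<Sum>k<n. (x k)\<^sup>2)"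
  define b where "b = sqrt (\<Sum>k<n. (y k)\<^sup>2)"
  have ab: "0 \<le> a" "0 \<le> b" "a\<^sup>2 = (\<Sum>k<n. (x k)\<^sup>2)" "b\<^sup>2 = (\<Sum>k<n. (y k)\<^sup>2)"
    by (auto simp: a_def b_def sum_nonneg)
  consider "a = 0" | "b = 0" | "0 < a" "0 < b" using ab by linarith
  then have "\<bar>bilin n g x y\<bar> \<le> K * (a * b)"
  proof cases
    case 1
    then show ?thesis using bilin_zero(1)[where n=n and u=x] ab by simp
  next
    case 2
    then show ?thesis using bilin_zero(2)[where n=n and u=y] ab by simp
  next
    case 3
    let ?x = "\<lambda>k. b * x k" and ?y = "\<lambda>k. a * y k"
    let ?p = "\<lambda>k. ?x k + ?y k" and ?m = "\<lambda>k. ?x k - ?y k"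
    have "4 * bilin n g ?x ?y = bilin n g ?p ?p - bilin n g ?m ?m"
      using bilin_commute[OF sym, where u="?y" and v="?x"]
      by (simp add: bilin_add_left[of n g ?x ?y] bilin_add_right[of n g _ ?x ?y]
          bilin_diff_left[of n g ?x ?y] bilin_diff_right[of n g _ ?x ?y])
    then have "4 * \<bar>bilin n g ?x ?y\<bar> \<le> K * (\<Sum>k<n. (?p k)\<^sup>2) + K * (\<Sum>k<n. (?m k)\<^sup>2)"
      using q[of ?p] q[of ?m] by linarith
    also have "\<dots> = K * (\<Sum>k<n. (?p k)\<^sup>2 + (?m k)\<^sup>2)" by (simp add: sum.distrib distrib_left)
    also have "(\<Sum>k<n. (?p k)\<^sup>2 + (?m k)\<^sup>2) = (\<Sum>k<n. 2 * b\<^sup>2 * (x k)\<^sup>2 + 2 * a\<^sup>2 * (y k)\<^sup>2)"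
      by (intro sum.cong refl) (simp add: power2_eq_square algebra_simps)
    also have "\<dots> = 4 * (a * b * (a * b))"
      unfolding sum.distrib sum_distrib_left[symmetric] ab(3,4)[symmetric] by (simp add: power2_eq_square algebra_simps)
    finally have "\<bar>bilin n g ?x ?y\<bar> \<le> K * (a * b) * (a * b)" by simp
    also have "bilin n g ?x ?y = (a * b) * bilin n g x y" by (simp add: bilin_scale mult.commute)
    also have "\<bar>(a * b) * bilin n g x y\<bar> = \<bar>bilin n g x y\<bar> * (a * b)" using 3 by (simp add: abs_mult)
    finally show ?thesis using 3 by simp
  qed
  then show ?thesis by (simp add: a_def b_def)
qed

text \<open>The points of the lattice of spacing 1 / (4 sqrt n) in the unit ball, stored by their
  integer coordinates. With this spacing a coordinatewise error of one lattice step amounts to a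
  distance of at most 1/4.\<close>

definition lattice_net :: "nat \<Rightarrow> (nat \<Rightarrow> int) set" where
  "lattice_net n = {m \<in> PiE {..<n} (\<lambda>_. {- 16 * int n..16 * int n}). (\<Sum>i<n. (m i)\<^sup>2) \<le> 16 * int n}"

definition net_vector :: "nat \<Rightarrow> (nat \<Rightarrow> int) \<Rightarrow> nat \<Rightarrow> real" where
  "net_vector n m i = of_int (m i) / (4 * sqrt (real n))"

lemma finite_lattice_net: "finite (lattice_net n)"
  unfolding lattice_net_def by (rule finite_subset[of _ "PiE {..<n} (\<lambda>_. {- 16 * int n..16 * int n})"])
    (auto intro: finite_PiE)

lemma net_vector_norm:
  assumes "m \<in> lattice_net n" shows "(\<Sum>i<n. (net_vector n m i)\<^sup>2) \<le> 1"
proof (cases "n = 0")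
  case False
  have "(\<Sum>i<n. (net_vector n m i)\<^sup>2) = of_int (\<Sum>i<n. (m i)\<^sup>2) / (16 * real n)"
    by (simp add: net_vector_def power_divide power_mult_distrib sum_divide_distrib)
  also have "\<dots> \<le> of_int (16 * int n) / (16 * real n)"
    using assms by (intro divide_right_mono) (auto simp: lattice_net_def simp del: of_int_sum of_int_mult)
  finally show ?thesis using False by simp
qed simp

text \<open>For k >= 1, exp (- k^2) <= exp (- k) <= 2^(-k), so either sign contributes at most 1,
  uniformly in N.\<close>

lemma sum_exp_neg_square_le: "(\<Sum>k\<in>{- int N..int N}. exp (- ((real_of_int k)\<^sup>2))) \<le> 3"
proof -
  have "(\<Sum>k\<in>{- int N..int N}. exp (- ((real_of_int k)\<^sup>2))) = 1 + 2 * (\<Sum>k<N. exp (- ((real (Suc k))\<^sup>2)))"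
  proof (induction N)
    case (Suc N)
    have "{- int (Suc N)..int (Suc N)} = insert (- int (Suc N)) (insert (int (Suc N)) {- int N..int N})" by auto
    moreover have "(- 1 - real N)\<^sup>2 = (1 + real N)\<^sup>2" by (simp add: power2_eq_square algebra_simps)
    ultimately show ?case using Suc by simp
  qed simp
  also have "(\<Sum>k<N. exp (- ((real (Suc k))\<^sup>2))) \<le> (\<Sum>k<N. (1/2) * (1/2) ^ k :: real)"
  proof (rule sum_mono)
    fix k
    have "exp (- ((real (Suc k))\<^sup>2)) \<le> exp (- real (Suc k))"
      by (simp add: power2_eq_square algebra_simps)
    also have "\<dots> = exp (-1) ^ Suc k" by (simp only: exp_of_nat_mult[symmetric]) simp
    also have "\<dots> \<le> (1/2) ^ Suc k"
    proof (rule power_mono)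
      have "(2::real) \<le> exp 1" using exp_ge_add_one_self[of 1] by simp
      then show "exp (-1) \<le> (1/2 :: real)" by (simp add: exp_minus field_simps)
    qed simp
    finally show "exp (- ((real (Suc k))\<^sup>2)) \<le> (1/2) * (1/2) ^ k" by simp
  qed
  also have "\<dots> \<le> 1"
    unfolding sum_distrib_left[symmetric] by (simp add: sum_gp_strict)
  finally show ?thesis by simp
qed

text \<open>Each net point gets the weight \<open>exp (16 n - \<bar>m\<bar>\<^sup>2) \<ge> 1\<close>; the total weight factorises.\<close>

lemma card_lattice_net_le: "real (card (lattice_net n)) \<le> (3 * exp 16) ^ n"
proof -
  let ?P = "PiE {..<n} (\<lambda>_. {- int (16 * n)..int (16 * n)})"
  have "real (card (lattice_net n)) = (\<Sum>m\<in>lattice_net n. 1)" by simp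
  also have "\<dots> \<le> (\<Sum>m\<in>lattice_net n. exp (16 * real n) * (\<Prod>i<n. exp (- ((real_of_int (m i))\<^sup>2))))"
  proof (rule sum_mono)
    fix m assume m: "m \<in> lattice_net n"
    have "(\<Sum>i<n. (real_of_int (m i))\<^sup>2) = of_int (\<Sum>i<n. (m i)\<^sup>2)" by simp
    also have "\<dots> \<le> of_int (16 * int n)" using m unfolding lattice_net_def of_int_le_iff by auto
    finally have "(\<Sum>i<n. (real_of_int (m i))\<^sup>2) \<le> 16 * real n" by simp
    then have "exp 0 \<le> exp (16 * real n + (\<Sum>i<n. - ((real_of_int (m i))\<^sup>2)))"
      unfolding exp_le_cancel_iff by (simp add: sum_negf)
    then show "1 \<le> exp (16 * real n) * (\<Prod>i<n. exp (- ((real_of_int (m i))\<^sup>2)))"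
      by (simp add: exp_add exp_sum)
  qed
  also have "\<dots> \<le> (\<Sum>m\<in>?P. exp (16 * real n) * (\<Prod>i<n. exp (- ((real_of_int (m i))\<^sup>2))))"
  proof (rule sum_mono2)
    show "finite ?P" by (intro finite_PiE) auto
    show "lattice_net n \<subseteq> ?P" by (auto simp: lattice_net_def)
    show "0 \<le> exp (16 * real n) * (\<Prod>i<n. exp (- ((real_of_int (m i))\<^sup>2)))" for m
      by (intro mult_nonneg_nonneg prod_nonneg) auto
  qed
  also have "\<dots> = exp (16 * real n) * (\<Prod>i<n. \<Sum>k\<in>{- int (16 * n)..int (16 * n)}. exp (- ((real_of_int k)\<^sup>2)))"
    by (subst prod_sum_PiE) (auto simp: sum_distrib_left)
  also have "\<dots> \<le> exp (16 * real n) * (\<Prod>i<n. 3)"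
    by (intro mult_left_mono prod_mono conjI sum_exp_neg_square_le sum_nonneg) auto
  also have "\<dots> = (3 * exp 16) ^ n"
    using exp_of_nat_mult[of n "16::real"] by (simp add: power_mult_distrib mult.commute)
  finally show ?thesis .
qed

lemma lattice_net_approx:
  assumes v: "(\<Sum>i<n. (v i)\<^sup>2) \<le> 1" and n: "0 < n"
  shows "\<exists>m\<in>lattice_net n. (\<Sum>i<n. (v i - net_vector n m i)\<^sup>2) \<le> 1/16"
proof -
  define s where "s = 4 * sqrt (real n)"
  have s: "0 < s" "s\<^sup>2 = 16 * real n" using n by (auto simp: s_def power_mult_distrib)
  \<comment> \<open>Rounding towards 0 never increases an absolute value, so the rounded vector
    stays in the ball and hence in the net.\<close>
  define tr where "tr r = (if 0 \<le> r then \<lfloor>r\<rfloor> else \<lceil>r\<rceil>)" for r :: real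
  have tr: "\<bar>real_of_int (tr r)\<bar> \<le> \<bar>r\<bar> \<and> \<bar>r - of_int (tr r)\<bar> \<le> 1" for r
  proof (cases "0 \<le> r")
    case True
    then have "0 \<le> real_of_int \<lfloor>r\<rfloor>" by simp
    then show ?thesis using True of_int_floor_le[of r] real_of_int_floor_add_one_gt[of r] by (simp add: tr_def) linarith
  next
    case False
    then have "real_of_int \<lceil>r\<rceil> \<le> 0" by (simp add: ceiling_le_iff)
    then show ?thesis using False le_of_int_ceiling[of r] of_int_ceiling_diff_one_le[of r] by (simp add: tr_def) linarith
  qed
  note tr1 = tr[THEN conjunct1] and tr2 = tr[THEN conjunct2]
  define m where "m = (\<lambda>i\<in>{..<n}. tr (s * v i))"
  have le: "(real_of_int (m i))\<^sup>2 \<le> s\<^sup>2 * (v i)\<^sup>2" if "i < n" for i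
    using tr1[of "s * v i"] that by (simp add: m_def abs_le_square_iff power_mult_distrib)
  have "real_of_int (\<Sum>i<n. (m i)\<^sup>2) \<le> (\<Sum>i<n. s\<^sup>2 * (v i)\<^sup>2)"
    unfolding of_int_sum of_int_power by (intro sum_mono le) auto
  also have "\<dots> \<le> 16 * real n" using v s by (simp add: sum_distrib_left[symmetric] mult_left_le)
  finally have msq: "(\<Sum>i<n. (m i)\<^sup>2) \<le> 16 * int n" by linarith
  have "\<bar>m i\<bar> \<le> 16 * int n" if i: "i < n" for i
  proof -
    have "\<bar>m i\<bar> * 1 \<le> \<bar>m i\<bar> * \<bar>m i\<bar>"
      by (cases "m i = 0") (simp, intro mult_left_mono, auto)
    then have "\<bar>m i\<bar> \<le> (m i)\<^sup>2" by (simp add: power2_eq_square)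
    also have "\<dots> \<le> (\<Sum>i<n. (m i)\<^sup>2)" using i by (intro member_le_sum) auto
    finally show ?thesis using msq by simp
  qed
  then have "m \<in> PiE {..<n} (\<lambda>_. {- 16 * int n..16 * int n})"
    by (intro PiE_I) (simp add: abs_le_iff minus_le_iff, simp add: m_def)
  then have "m \<in> lattice_net n" using msq by (simp add: lattice_net_def)
  moreover have "(\<Sum>i<n. (v i - net_vector n m i)\<^sup>2) \<le> 1/16"
  proof -
    have "(\<Sum>i<n. (v i - net_vector n m i)\<^sup>2) \<le> (\<Sum>i<n. 1 / s\<^sup>2)"
    proof (rule sum_mono)
      fix i assume "i \<in> {..<n}"
      then have "v i - net_vector n m i = (s * v i - of_int (tr (s * v i))) / s"
        using s by (simp add: net_vector_def m_def s_def[symmetric] diff_divide_distrib)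
      moreover have "(s * v i - of_int (tr (s * v i)))\<^sup>2 \<le> 1"
        using tr2[of "s * v i"] by (simp add: abs_square_le_1)
      ultimately show "(v i - net_vector n m i)\<^sup>2 \<le> 1 / s\<^sup>2" by (simp add: power_divide divide_right_mono)
    qed
    also have "\<dots> = 1/16" using n s by simp
    finally show ?thesis .
  qed
  ultimately show ?thesis by blast
qed

text \<open>Let \<theta> be the supremum over the unit ball. For a net point u within 1/4 of v, the
  values at v and u differ by \<open>bilin\<close> at v - u and v + u, hence by at most \<theta>
  times 1/4 times 2. So \<theta> <= t + \<theta> / 2, and finiteness of \<theta> allows absorbing
  the last term.\<close>

lemma quadratic_bound_from_net:
  assumes sym: "\<And>i j. i < n \<Longrightarrow> j < n \<Longrightarrow> g i j = g j i" and n: "0 < n"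
    and net: "\<And>m. m \<in> lattice_net n \<Longrightarrow> \<bar>bilin n g (net_vector n m) (net_vector n m)\<bar> \<le> t"
  shows "\<bar>bilin n g v v\<bar> \<le> 2 * t * (\<Sum>k<n. (v k)\<^sup>2)"
proof -
  let ?U = "{v. (\<Sum>k<n. (v k)\<^sup>2) \<le> (1::real)}"
  define \<theta> where "\<theta> = (SUP v\<in>?U. \<bar>bilin n g v v\<bar>)"
  have bdd: "bdd_above ((\<lambda>v. \<bar>bilin n g v v\<bar>) ` ?U)"
  proof (rule bdd_aboveI2)
    fix v assume v: "v \<in> ?U"
    have v1: "\<bar>v k\<bar> \<le> 1" if "k < n" for k
    proof -
      have "(v k)\<^sup>2 \<le> (\<Sum>k<n. (v k)\<^sup>2)" using that by (intro member_le_sum) auto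
      then have "(v k)\<^sup>2 \<le> 1" using v by simp
      then show ?thesis by (simp add: abs_square_le_1)
    qed
    have "\<bar>bilin n g v v\<bar> \<le> (\<Sum>k<n. \<Sum>l<n. \<bar>g k l * (v k * v l)\<bar>)"
      unfolding bilin_def by (rule order_trans[OF sum_abs]) (intro sum_mono sum_abs)
    also have "\<dots> \<le> (\<Sum>k<n. \<Sum>l<n. \<bar>g k l\<bar> * (1 * 1))"
      unfolding abs_mult by (intro sum_mono mult_left_mono mult_mono v1) auto
    finally show "\<bar>bilin n g v v\<bar> \<le> (\<Sum>k<n. \<Sum>l<n. \<bar>g k l\<bar> * (1 * 1))" .
  qed
  have le\<theta>: "\<bar>bilin n g v v\<bar> \<le> \<theta>" if "v \<in> ?U" for v
    unfolding \<theta>_def using that bdd by (rule cSUP_upper)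
  have q: "\<bar>bilin n g v v\<bar> \<le> \<theta> * (\<Sum>k<n. (v k)\<^sup>2)" for v
  proof (cases "(\<Sum>k<n. (v k)\<^sup>2) = 0")
    case True
    then show ?thesis using bilin_zero(1)[OF True] by simp
  next
    case False
    define r where "r = sqrt (\<Sum>k<n. (v k)\<^sup>2)"
    have "0 < (\<Sum>k<n. (v k)\<^sup>2)" using False by (metis less_eq_real_def sum_nonneg zero_le_power2)
    then have r: "0 < r" "r\<^sup>2 = (\<Sum>k<n. (v k)\<^sup>2)" by (auto simp: r_def)
    let ?v = "\<lambda>k. 1 / r * v k"
    have "(\<Sum>k<n. (?v k)\<^sup>2) = 1"
      using r(1) by (simp add: power_divide sum_divide_distrib[symmetric] r(2)[symmetric])
    then have "\<bar>bilin n g ?v ?v\<bar> \<le> \<theta>" by (intro le\<theta>) simp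
    then have "\<bar>bilin n g v v\<bar> / r\<^sup>2 \<le> \<theta>"
      unfolding bilin_scale using r(1) by (simp add: abs_mult power2_eq_square)
    then show ?thesis unfolding r(2)[symmetric] using r(1) by (simp add: pos_divide_le_eq)
  qed
  have "\<theta> \<le> t + \<theta> / 2"
    unfolding \<theta>_def
  proof (rule cSUP_least)
    show "?U \<noteq> {}" by (auto intro!: exI[of _ "\<lambda>_. 0"])
    fix v assume v: "v \<in> ?U"
    then obtain m where m: "m \<in> lattice_net n" "(\<Sum>i<n. (v i - net_vector n m i)\<^sup>2) \<le> 1/16"
      using lattice_net_approx[OF _ n] by blast
    let ?u = "net_vector n m"
    have \<theta>0: "0 \<le> \<theta>" using le\<theta>[OF v] by linarith
    have "(\<Sum>k<n. (v k + ?u k)\<^sup>2) \<le> (\<Sum>k<n. 2 * (v k)\<^sup>2 + 2 * (?u k)\<^sup>2)"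
    proof (rule sum_mono)
      fix k show "(v k + ?u k)\<^sup>2 \<le> 2 * (v k)\<^sup>2 + 2 * (?u k)\<^sup>2"
        using zero_le_power2[of "v k - ?u k"] by (simp add: power2_eq_square algebra_simps)
    qed
    also have "\<dots> \<le> 4" using v net_vector_norm[OF m(1)] by (simp add: sum.distrib sum_distrib_left[symmetric])
    finally have p: "sqrt (\<Sum>k<n. (v k + ?u k)\<^sup>2) \<le> 2" by (simp add: real_le_lsqrt)
    have d: "sqrt (\<Sum>k<n. (v k - ?u k)\<^sup>2) \<le> 1/4" using m(2) by (intro real_le_lsqrt) (auto simp: power2_eq_square)
    have "bilin n g v v - bilin n g ?u ?u = bilin n g (\<lambda>k. v k - ?u k) (\<lambda>k. v k + ?u k)"
      using bilin_commute[OF sym, where u=v and v="?u"] by (simp add: bilin_diff_left bilin_add_right)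
    also have "\<bar>\<dots>\<bar> \<le> \<theta> * (sqrt (\<Sum>k<n. (v k - ?u k)\<^sup>2) * sqrt (\<Sum>k<n. (v k + ?u k)\<^sup>2))"
      by (rule bilin_le_of_quadratic[OF sym q])
    also have "\<dots> \<le> \<theta> * ((1/4) * 2)"
      by (intro mult_left_mono mult_mono p d \<theta>0) (auto intro!: sum_nonneg)
    finally have "\<bar>bilin n g v v\<bar> \<le> t + \<theta> / 2" using net[OF m(1)] by linarith
    then show "\<bar>bilin n g v v\<bar> \<le> t + (SUP v\<in>?U. \<bar>bilin n g v v\<bar>) / 2" by (simp add: \<theta>_def)
  qed
  then have "\<theta> \<le> 2 * t" by linarith
  then have "\<theta> * (\<Sum>k<n. (v k)\<^sup>2) \<le> 2 * t * (\<Sum>k<n. (v k)\<^sup>2)" by (intro mult_right_mono sum_nonneg) auto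
  then show ?thesis using q[of v] by linarith
qed

lemma (in prob_space) prob_UN_le:
  assumes "finite K" "\<And>k. k \<in> K \<Longrightarrow> E k \<in> events" "\<And>k. k \<in> K \<Longrightarrow> prob (E k) \<le> p"
  shows "prob (\<Union>k\<in>K. E k) \<le> real (card K) * p"
proof -
  have "prob (\<Union>k\<in>K. E k) \<le> (\<Sum>k\<in>K. prob (E k))"
    using assms by (intro finite_measure_subadditive_finite) auto
  also have "\<dots> \<le> (\<Sum>k\<in>K. p)" using assms by (intro sum_mono) auto
  finally show ?thesis by simp
qed

section \<open>High-probability events for the random matrix\<close>

context goe_matrix begin

text \<open>Union bound over the net and both signs at t = 10: at most exp (18 n) points against a
  tail of exp (- 25 n). The passage from the net to the ball doubles 10 to 20.\<close>

lemma operator_norm_event: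
  "\<exists>B\<in>events. prob B \<le> 2 * exp (- 7 * real n) \<and>
     (\<forall>\<omega>\<in>space M - B. \<forall>v. \<bar>bilin n (g \<omega>) v v\<bar> \<le> 20 * (\<Sum>k<n. (v k)\<^sup>2))"
proof -
  let ?K = "lattice_net n \<times> {1, - 1 :: real}"
  define E where "E k = {\<omega> \<in> space M. 10 \<le> snd k * (\<Sum>i<n. \<Sum>j<n. g \<omega> i j * (net_vector n (fst k) i * net_vector n (fst k) j))}" for k
  have E: "E k \<in> events" for k
  proof -
    have [measurable]: "(\<lambda>\<omega>. \<Sum>i<n. \<Sum>j<n. g \<omega> i j * (net_vector n (fst k) i * net_vector n (fst k) j)) \<in> borel_measurable M"
      by (intro borel_measurable_sum borel_measurable_times measurable_g) auto
    show ?thesis unfolding E_def by measurable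
  qed
  have "prob (\<Union>k\<in>?K. E k) \<le> real (card ?K) * exp (- real n * 10\<^sup>2 / 4)"
  proof (rule prob_UN_le)
    fix k assume "k \<in> ?K"
    then have "fst k \<in> lattice_net n" "snd k = 1 \<or> snd k = - 1" by auto
    then show "prob (E k) \<le> exp (- real n * 10\<^sup>2 / 4)"
      unfolding E_def by (intro quad_form_tail net_vector_norm) auto
  qed (use finite_lattice_net E in auto)
  also have "\<dots> \<le> ((3 * exp 16) ^ n * 2) * exp (- real n * 10\<^sup>2 / 4)"
    using card_lattice_net_le[of n] by (intro mult_right_mono) (auto simp: card_cartesian_product)
  also have "\<dots> \<le> ((exp 18) ^ n * 2) * exp (- real n * 10\<^sup>2 / 4)"
  proof (intro mult_right_mono power_mono)
    have "(3::real) \<le> exp 2" using exp_ge_add_one_self[of 2] by simp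
    then have "3 * exp 16 \<le> exp 2 * exp (16::real)" by (intro mult_right_mono) auto
    then show "3 * exp 16 \<le> exp (18::real)" by (simp add: exp_add[symmetric])
  qed auto
  also have "\<dots> = 2 * exp (- 7 * real n)"
  proof -
    have "exp 18 ^ n = exp (real n * 18)" by (rule exp_of_nat_mult[symmetric])
    moreover have "exp (real n * 18) * exp (- real n * 10\<^sup>2 / 4) = exp (- 7 * real n)"
      unfolding exp_add[symmetric] by (rule arg_cong[where f=exp]) simp
    ultimately show ?thesis by simp
  qed
  finally have "prob (\<Union>k\<in>?K. E k) \<le> 2 * exp (- 7 * real n)" .
  moreover have "\<bar>bilin n (g \<omega>) v v\<bar> \<le> 20 * (\<Sum>k<n. (v k)\<^sup>2)" if w: "\<omega> \<in> space M - (\<Union>k\<in>?K. E k)" for \<omega> v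
  proof -
    have "\<bar>bilin n (g \<omega>) (net_vector n m) (net_vector n m)\<bar> \<le> 10" if m: "m \<in> lattice_net n" for m
    proof -
      have "\<omega> \<notin> E (m, 1)" "\<omega> \<notin> E (m, - 1)" using w m by auto
      then show ?thesis using w by (simp add: E_def bilin_def abs_le_iff)
    qed
    from quadratic_bound_from_net[OF g_commute n_pos this] show ?thesis by simp
  qed
  ultimately show ?thesis using E finite_lattice_net by (intro bexI[of _ "\<Union>k\<in>?K. E k"]) auto
qed

lemma entries_event:
  assumes "0 < \<alpha>"
  shows "\<exists>B\<in>events. prob B \<le> 2 * (real n)\<^sup>2 * exp (- real n * \<alpha>\<^sup>2 / 4) \<and>
     (\<forall>\<omega>\<in>space M - B. \<forall>i<n. \<forall>j<n. \<bar>g \<omega> i j\<bar> \<le> \<alpha>)"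
proof -
  let ?K = "({..<n} \<times> {..<n}) \<times> {1, - 1 :: real}"
  define E where "E k = {\<omega> \<in> space M. \<alpha> \<le> snd k * g \<omega> (fst (fst k)) (snd (fst k))}" for k
  have E: "E k \<in> events" if k: "k \<in> ?K" for k
  proof -
    have [measurable]: "(\<lambda>\<omega>. g \<omega> (fst (fst k)) (snd (fst k))) \<in> borel_measurable M"
      using k by (intro measurable_g) auto
    show ?thesis unfolding E_def by measurable
  qed
  have "prob (\<Union>k\<in>?K. E k) \<le> real (card ?K) * exp (- real n * \<alpha>\<^sup>2 / 4)"
  proof (rule prob_UN_le)
    fix k assume k: "k \<in> ?K"
    then have "fst (fst k) < n" "snd (fst k) < n" "snd k = 1 \<or> snd k = - 1" by auto
    then show "prob (E k) \<le> exp (- real n * \<alpha>\<^sup>2 / 4)"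
      unfolding E_def using assms by (intro entry_tail)
  qed (use E in auto)
  also have "\<dots> = 2 * (real n)\<^sup>2 * exp (- real n * \<alpha>\<^sup>2 / 4)"
    by (simp add: card_cartesian_product power2_eq_square)
  finally have "prob (\<Union>k\<in>?K. E k) \<le> 2 * (real n)\<^sup>2 * exp (- real n * \<alpha>\<^sup>2 / 4)" .
  moreover have "\<bar>g \<omega> i j\<bar> \<le> \<alpha>" if w: "\<omega> \<in> space M - (\<Union>k\<in>?K. E k)" and "i < n" "j < n" for \<omega> i j
  proof -
    have "\<omega> \<notin> E ((i, j), 1)" "\<omega> \<notin> E ((i, j), - 1)" using that by auto
    then show ?thesis using w by (simp add: E_def abs_le_iff)
  qed
  ultimately show ?thesis using E by (intro bexI[of _ "\<Union>k\<in>?K. E k"]) auto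
qed

text \<open>The factor 6 consists of two signs for a diagonal Gram entry and four combinations of
  signs for an off-diagonal one. The entry bound is quantified inside, so the event itself is
  determined by \<delta> alone and combines with any event on the entries.\<close>

lemma gram_event:
  assumes \<delta>: "0 < \<delta>" "\<delta> \<le> 1"
  shows "\<exists>B\<in>events. prob B \<le> 6 * (real n)\<^sup>2 * exp (- real n * \<delta>\<^sup>2 / 16) \<and>
     (\<forall>\<omega>\<in>space M - B. \<forall>\<alpha>. (\<forall>i<n. \<forall>j<n. \<bar>g \<omega> i j\<bar> \<le> \<alpha>) \<longrightarrow>
       (\<forall>i<n. \<forall>k<n. \<bar>(\<Sum>j<n. g \<omega> i j * g \<omega> k j) - (if i = k then 1 else 0)\<bar> \<le> \<delta> + 2 * \<alpha>\<^sup>2 + 1 / real n))"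
proof -
  let ?e = "exp (- real n * \<delta>\<^sup>2 / 16)"
  let ?K = "{..<n} \<times> {1, - 1 :: real}"
  define E where "E k = {\<omega> \<in> space M. \<delta> \<le> (\<Sum>j\<in>{..<n}-{fst k}. snd k * ((g \<omega> (fst k) j)\<^sup>2 - 1 / real n))}" for k
  have E: "E k \<in> events" if k: "k \<in> ?K" for k
  proof -
    have "(\<lambda>\<omega>. \<Sum>j\<in>{..<n}-{fst k}. snd k * ((g \<omega> (fst k) j)\<^sup>2 - 1 / real n)) \<in> borel_measurable M"
      using k by (intro borel_measurable_sum borel_measurable_times borel_measurable_const
          borel_measurable_diff borel_measurable_power measurable_g) auto
    then show ?thesis unfolding E_def by measurable
  qed
  have PE: "prob (\<Union>k\<in>?K. E k) \<le> real (card ?K) * ?e"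
  proof (rule prob_UN_le)
    fix k assume k: "k \<in> ?K"
    then have "fst k < n" "snd k = 1 \<or> snd k = - 1" by auto
    then show "prob (E k) \<le> ?e"
      unfolding E_def using \<delta> by (intro gram_diagonal_tail)
  qed (use E in auto)
  let ?L = "{(i, k). i < n \<and> k < n \<and> i \<noteq> k} \<times> ({1, - 1 :: real} \<times> {1, - 1 :: real})"
  define F where "F k = {\<omega> \<in> space M. \<delta> \<le> (\<Sum>j\<in>{..<n}-{fst (fst k),snd (fst k)}. fst (snd k) *
     (((g \<omega> (fst (fst k)) j + snd (snd k) * g \<omega> (snd (fst k)) j) / sqrt 2)\<^sup>2 - 1 / real n))}" for k
  have F: "F k \<in> events" if k: "k \<in> ?L" for k
  proof -
    have "(\<lambda>\<omega>. \<Sum>j\<in>{..<n}-{fst (fst k),snd (fst k)}. fst (snd k) *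
     (((g \<omega> (fst (fst k)) j + snd (snd k) * g \<omega> (snd (fst k)) j) / sqrt 2)\<^sup>2 - 1 / real n)) \<in> borel_measurable M"
      using k by (intro borel_measurable_sum borel_measurable_times borel_measurable_const borel_measurable_divide
          borel_measurable_add borel_measurable_diff borel_measurable_power measurable_g) auto
    then show ?thesis unfolding F_def by measurable
  qed
  have sub: "{(i, k). i < n \<and> k < n \<and> i \<noteq> k} \<subseteq> {..<n} \<times> {..<n}" by auto
  then have finL: "finite {(i, k). i < n \<and> k < n \<and> i \<noteq> k}" by (rule finite_subset) auto
  have PF: "prob (\<Union>k\<in>?L. F k) \<le> real (card ?L) * ?e"
  proof (rule prob_UN_le)
    fix k assume k: "k \<in> ?L"
    then have "fst (fst k) < n" "snd (fst k) < n" "fst (fst k) \<noteq> snd (fst k)"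
      "fst (snd k) = 1 \<or> fst (snd k) = - 1" "snd (snd k) = 1 \<or> snd (snd k) = - 1" by auto
    then show "prob (F k) \<le> ?e"
      unfolding F_def using \<delta> by (intro gram_off_diagonal_tail)
  qed (use F finL in auto)
  have "card {(i, k). i < n \<and> k < n \<and> i \<noteq> k} \<le> card ({..<n} \<times> {..<n})" using sub by (intro card_mono) auto
  then have "card ?L \<le> 4 * n\<^sup>2" by (simp add: card_cartesian_product power2_eq_square)
  then have "real (card ?L) \<le> real (4 * n\<^sup>2)" by (rule of_nat_mono)
  then have cL: "real (card ?L) \<le> 4 * (real n)\<^sup>2" by simp
  have "real n * 1 \<le> real n * real n" using n_pos by (intro mult_left_mono) auto
  then have cK: "real (card ?K) \<le> 2 * (real n)\<^sup>2" by (simp add: card_cartesian_product power2_eq_square)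
  let ?B = "(\<Union>k\<in>?K. E k) \<union> (\<Union>k\<in>?L. F k)"
  have "prob ?B \<le> prob (\<Union>k\<in>?K. E k) + prob (\<Union>k\<in>?L. F k)"
    using E F finL by (intro measure_Un_le sets.finite_UN) auto
  also have "\<dots> \<le> 2 * (real n)\<^sup>2 * ?e + 4 * (real n)\<^sup>2 * ?e"
    by (intro add_mono order_trans[OF PE] order_trans[OF PF] mult_right_mono cL cK) auto
  finally have "prob ?B \<le> 6 * (real n)\<^sup>2 * ?e" by simp
  moreover have "\<bar>(\<Sum>j<n. g \<omega> i j * g \<omega> k j) - (if i = k then 1 else 0)\<bar> \<le> \<delta> + 2 * \<alpha>\<^sup>2 + 1 / real n"
    if w: "\<omega> \<in> space M - ?B" and \<alpha>: "\<forall>i<n. \<forall>j<n. \<bar>g \<omega> i j\<bar> \<le> \<alpha>" and ik: "i < n" "k < n" for \<omega> \<alpha> i k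
  proof (rule gram_bound[OF ik])
    fix s :: real assume s: "s = 1 \<or> s = - 1"
    then have "\<omega> \<notin> E (i, s)" using w ik by auto
    then show "(\<Sum>j\<in>{..<n}-{i}. s * ((g \<omega> i j)\<^sup>2 - 1 / real n)) \<le> \<delta>" using w by (simp add: E_def)
    fix r :: real assume r: "r = 1 \<or> r = - 1" and "i \<noteq> k"
    then have "\<omega> \<notin> F ((i, k), (s, r))" using w ik s by auto
    then show "(\<Sum>j\<in>{..<n}-{i,k}. s * (((g \<omega> i j + r * g \<omega> k j) / sqrt 2)\<^sup>2 - 1 / real n)) \<le> \<delta>"
      using w by (simp add: F_def)
  qed (use \<alpha> in auto)
  ultimately show ?thesis using E F finL by (intro bexI[of _ ?B]) (auto intro!: sets.finite_UN)
qed

text \<open>The first count will bound the size of S, the second the number of indices outside the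
  bulk that enters \<open>\<rho>\<close>.\<close>

lemma row_sum_counts_event:
  assumes u: "0 < u" and M': "0 < M'" and N: "0 < N1" "0 < N2"
  shows "\<exists>B\<in>events. prob B \<le> real n * exp (- u\<^sup>2 / (2 * (1 + 1 / real n))) / N1
       + real n * (2 * exp (- M'\<^sup>2 / (2 * (1 + 1 / real n)))) / N2 \<and>
     (\<forall>\<omega>\<in>space M - B. real (card {j. j < n \<and> u \<le> D \<omega> j}) \<le> N1 \<and>
        real (card {j. j < n \<and> M' < \<bar>D \<omega> j\<bar>}) \<le> N2)"
proof -
  have p1: "prob {\<omega> \<in> space M. u \<le> D \<omega> j} \<le> exp (- u\<^sup>2 / (2 * (1 + 1 / real n)))" if "j < n" for j
    using row_sum_tail[OF that u, of 1] by simp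
  have p2: "prob {\<omega> \<in> space M. M' < \<bar>D \<omega> j\<bar>} \<le> 2 * exp (- M'\<^sup>2 / (2 * (1 + 1 / real n)))" if j: "j < n" for j
  proof -
    have "prob {\<omega> \<in> space M. M' < \<bar>D \<omega> j\<bar>} \<le> prob ({\<omega> \<in> space M. M' \<le> 1 * D \<omega> j} \<union> {\<omega> \<in> space M. M' \<le> (- 1) * D \<omega> j})"
      using j by (intro finite_measure_mono) auto
    also have "\<dots> \<le> prob {\<omega> \<in> space M. M' \<le> 1 * D \<omega> j} + prob {\<omega> \<in> space M. M' \<le> (- 1) * D \<omega> j}"
      using j by (intro measure_Un_le) auto
    also have "\<dots> \<le> exp (- M'\<^sup>2 / (2 * (1 + 1 / real n))) + exp (- M'\<^sup>2 / (2 * (1 + 1 / real n)))"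
      by (intro add_mono row_sum_tail j M') auto
    finally show ?thesis by simp
  qed
  define B1 where "B1 = {\<omega> \<in> space M. N1 \<le> real (card {j. j < n \<and> u \<le> D \<omega> j})}"
  define B2 where "B2 = {\<omega> \<in> space M. N2 \<le> real (card {j. j < n \<and> M' < \<bar>D \<omega> j\<bar>})}"
  have B: "B1 \<in> events" "B2 \<in> events"
    unfolding B1_def B2_def by (rule count_markov[OF _ p1 N(1)] count_markov[OF _ p2 N(2)]; simp)+
  have "prob (B1 \<union> B2) \<le> prob B1 + prob B2" using B by (intro measure_Un_le)
  also have "\<dots> \<le> real n * exp (- u\<^sup>2 / (2 * (1 + 1 / real n))) / N1
       + real n * (2 * exp (- M'\<^sup>2 / (2 * (1 + 1 / real n)))) / N2"
    unfolding B1_def B2_def by (intro add_mono count_markov(2) p1 p2 N) auto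
  finally show ?thesis using B by (intro bexI[of _ "B1 \<union> B2"]) (auto simp: B1_def B2_def)
qed

end

section \<open>Extreme value asymptotics of the Gaussian tail\<close>

text \<open>The weight 1 + 1 / t^2 makes the integrand the exact derivative of minus the density
  divided by t, which yields both sides of the Mills ratio estimate.\<close>

lemma nn_integral_normal_tail_weighted:
  assumes y: "0 < y"
  shows "(\<integral>\<^sup>+t. ennreal (std_normal_density t * (1 + 1 / t\<^sup>2)) * indicator {y..} t \<partial>lborel) = ennreal (std_normal_density y / y)"
proof -
  have "(\<integral>\<^sup>+t. ennreal (std_normal_density t * (1 + 1 / t\<^sup>2)) * indicator {y..} t \<partial>lborel)
     = ennreal (0 - (- (std_normal_density y / y)))"
  proof (rule nn_integral_FTC_atLeast)
    fix t assume t: "y \<le> t"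
    then have t0: "t \<noteq> 0" using y by simp
    have "(std_normal_density has_real_derivative - t * std_normal_density t) (at t)"
      unfolding std_normal_density_def by (auto intro!: derivative_eq_intros simp: field_simps)
    from DERIV_minus[OF DERIV_divide[OF this DERIV_ident t0]]
    have "((\<lambda>t. - (std_normal_density t / t)) has_real_derivative
        - (((- t * std_normal_density t) * t - std_normal_density t * 1) / (t * t))) (at t)" .
    also have "- (((- t * std_normal_density t) * t - std_normal_density t * 1) / (t * t)) = std_normal_density t * (1 + 1 / t\<^sup>2)"
      using t0 by (simp add: field_simps power2_eq_square)
    finally show "DERIV (\<lambda>t. - (std_normal_density t / t)) t :> std_normal_density t * (1 + 1 / t\<^sup>2)" .
    show "0 \<le> std_normal_density t * (1 + 1 / t\<^sup>2)" by (simp add: normal_density_nonneg)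
  next
    have "((\<lambda>t::real. - (exp (- t\<^sup>2 / 2) / sqrt (2 * pi) / t)) \<longlongrightarrow> 0) at_top" by real_asymp
    then show "((\<lambda>t. - (std_normal_density t / t)) \<longlongrightarrow> 0) at_top"
      unfolding std_normal_density_def by simp
  qed measurable
  then show ?thesis by simp
qed

text \<open>Mills ratio: on the half-line from y the weight 1 + 1 / t^2 lies between 1 and 1 + 1 /
  y^2, so the weighted integral encloses the tail.\<close>

lemma (in prob_space) normal_tail_bounds:
  assumes D: "distributed M lborel X (normal_density 0 \<sigma>)" and \<sigma>: "0 < \<sigma>" and c: "0 < c"
  defines "y \<equiv> c / \<sigma>"
  shows "prob {\<omega> \<in> space M. c < X \<omega>} \<le> std_normal_density y / y"
    and "std_normal_density y / y \<le> (1 + 1 / y\<^sup>2) * prob {\<omega> \<in> space M. c < X \<omega>}"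
proof -
  have y: "0 < y" using \<sigma> c by (simp add: y_def)
  have Z: "distributed M lborel (\<lambda>\<omega>. (X \<omega> - 0) / \<sigma>) std_normal_density"
    using normal_standard_normal_convert[OF \<sigma>] D by blast
  have "emeasure M {\<omega> \<in> space M. c < X \<omega>} = emeasure M ((\<lambda>\<omega>. (X \<omega> - 0) / \<sigma>) -` {y<..} \<inter> space M)"
    using \<sigma> by (intro arg_cong[where f="emeasure M"]) (auto simp: y_def divide_less_cancel)
  also have "\<dots> = (\<integral>\<^sup>+t. ennreal (std_normal_density t) * indicator {y<..} t \<partial>lborel)"
    by (rule distributed_emeasure[OF Z]) simp
  also have "\<dots> = (\<integral>\<^sup>+t. ennreal (std_normal_density t) * indicator {y..} t \<partial>lborel)"
    by (intro nn_integral_cong_AE eventually_mono[OF AE_lborel_singleton[of y]]) (auto simp: indicator_def)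
  finally have e: "ennreal (prob {\<omega> \<in> space M. c < X \<omega>})
      = (\<integral>\<^sup>+t. ennreal (std_normal_density t) * indicator {y..} t \<partial>lborel)"
    by (simp add: emeasure_eq_measure)
  have "(\<integral>\<^sup>+t. ennreal (std_normal_density t) * indicator {y..} t \<partial>lborel)
     \<le> (\<integral>\<^sup>+t. ennreal (std_normal_density t * (1 + 1 / t\<^sup>2)) * indicator {y..} t \<partial>lborel)"
  proof (intro nn_integral_mono mult_right_mono ennreal_leI)
    fix t :: real
    have "std_normal_density t * 1 \<le> std_normal_density t * (1 + 1 / t\<^sup>2)"
      by (intro mult_left_mono) (auto simp: normal_density_nonneg)
    then show "std_normal_density t \<le> std_normal_density t * (1 + 1 / t\<^sup>2)" by simp
  qed simp
  then have "ennreal (prob {\<omega> \<in> space M. c < X \<omega>}) \<le> ennreal (std_normal_density y / y)"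
    unfolding e nn_integral_normal_tail_weighted[OF y] .
  then show "prob {\<omega> \<in> space M. c < X \<omega>} \<le> std_normal_density y / y"
    using y by (simp add: normal_density_nonneg)
  define k where "k = 1 + 1 / y\<^sup>2"
  have k: "0 \<le> k" by (simp add: k_def)
  have "ennreal (std_normal_density y / y)
     = (\<integral>\<^sup>+t. ennreal (std_normal_density t * (1 + 1 / t\<^sup>2)) * indicator {y..} t \<partial>lborel)"
    by (rule nn_integral_normal_tail_weighted[OF y, symmetric])
  also have "\<dots> \<le> (\<integral>\<^sup>+t. ennreal k * (ennreal (std_normal_density t) * indicator {y..} t) \<partial>lborel)"
  proof (intro nn_integral_mono)
    fix t :: real
    have "std_normal_density t * (1 + 1 / t\<^sup>2) \<le> k * std_normal_density t" if "y \<le> t"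
    proof -
      have "1 / t\<^sup>2 \<le> 1 / y\<^sup>2" using that y by (intro divide_left_mono power_mono) auto
      then show ?thesis by (simp add: k_def mult.commute mult_left_mono normal_density_nonneg)
    qed
    then show "ennreal (std_normal_density t * (1 + 1 / t\<^sup>2)) * indicator {y..} t
      \<le> ennreal k * (ennreal (std_normal_density t) * indicator {y..} t)"
      using k by (auto simp: indicator_def ennreal_mult'[symmetric] normal_density_nonneg intro!: ennreal_leI)
  qed
  also have "\<dots> = ennreal k * ennreal (prob {\<omega> \<in> space M. c < X \<omega>})"
    unfolding e by (rule nn_integral_cmult) measurable
  finally have "std_normal_density y / y \<le> k * prob {\<omega> \<in> space M. c < X \<omega>}"
    using k by (simp add: ennreal_mult'[symmetric])
  then show "std_normal_density y / y \<le> (1 + 1 / y\<^sup>2) * prob {\<omega> \<in> space M. c < X \<omega>}" by (simp add: k_def)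
qed

text \<open>The classical extreme value normalisation: a standard normal variable exceeds this level
  with probability asymptotic to exp (- x) / n. Its centring is smaller than \<open>b_seq\<close> by
  exactly 1 / \<open>a_seq n\<close>.\<close>

definition tail_level :: "nat \<Rightarrow> real \<Rightarrow> real" where
  "tail_level n x = a_seq n + (x - (ln (ln (real n)) + ln (4 * pi)) / 2) / a_seq n"

lemma a_seq_at_top: "filterlim a_seq at_top sequentially"
  unfolding a_seq_def by real_asymp

lemma a_seq_sq: "1 \<le> n \<Longrightarrow> (a_seq n)\<^sup>2 = 2 * ln (real n)"
  unfolding a_seq_def by (rule real_sqrt_pow2) simp

text \<open>Half the square of the level is ln n + x - L up to o(1), where exp L =
  \<open>a_seq n\<close> times sqrt (2 pi) cancels the normalising constant and the denominator of
  the Mills ratio. The argument x may vary with n so that perturbations of level and variance can be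
  moved into it.\<close>

lemma tail_level_density_limit:
  assumes x: "x \<longlonglongrightarrow> l"
  shows "(\<lambda>n. real n * (std_normal_density (tail_level n (x n)) / tail_level n (x n))) \<longlonglongrightarrow> exp (- l)"
    and "filterlim (\<lambda>n. tail_level n (x n)) at_top sequentially"
proof -
  let ?L = "\<lambda>n. (ln (ln (real n)) + ln (4 * pi)) / 2"
  have ea: "\<forall>\<^sub>F n in sequentially. 0 < a_seq n"
    using a_seq_at_top by (rule filterlim_at_top_dense[THEN iffD1, rule_format])
  have l1: "(\<lambda>n. 1 / a_seq n) \<longlonglongrightarrow> 0" unfolding a_seq_def by real_asymp
  have l2: "(\<lambda>n. ?L n / a_seq n) \<longlonglongrightarrow> 0" unfolding a_seq_def by real_asymp
  have u0: "(\<lambda>n. (x n - ?L n) / a_seq n) \<longlonglongrightarrow> 0"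
    using tendsto_diff[OF tendsto_mult[OF x l1] l2] by (simp add: diff_divide_distrib)
  have r: "(\<lambda>n. tail_level n (x n) / a_seq n) \<longlonglongrightarrow> 1"
  proof -
    have "(\<lambda>n. 1 + (x n - ?L n) / a_seq n * (1 / a_seq n)) \<longlonglongrightarrow> 1 + 0 * 0"
      by (intro tendsto_intros u0 l1)
    moreover have "\<forall>\<^sub>F n in sequentially. 1 + (x n - ?L n) / a_seq n * (1 / a_seq n) = tail_level n (x n) / a_seq n"
      using ea by eventually_elim (simp add: tail_level_def add_divide_distrib)
    ultimately show ?thesis using tendsto_cong by fastforce
  qed
  have "filterlim (\<lambda>n. tail_level n (x n) / a_seq n * a_seq n) at_top sequentially"
    by (rule filterlim_tendsto_pos_mult_at_top[OF r _ a_seq_at_top]) simp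
  moreover have "\<forall>\<^sub>F n in sequentially. tail_level n (x n) / a_seq n * a_seq n = tail_level n (x n)"
    using ea by eventually_elim simp
  ultimately show top: "filterlim (\<lambda>n. tail_level n (x n)) at_top sequentially"
    using filterlim_cong[OF refl refl] by fast
  let ?R = "\<lambda>n. exp (- x n) * exp (- ((x n - ?L n) / a_seq n)\<^sup>2 / 2) / (tail_level n (x n) / a_seq n)"
  have "?R \<longlonglongrightarrow> exp (- l) * exp (- 0\<^sup>2 / 2) / 1"
    by (intro tendsto_intros x u0 r) auto
  then have lim: "?R \<longlonglongrightarrow> exp (- l)" by simp
  have "\<forall>\<^sub>F n in sequentially. ?R n = real n * (std_normal_density (tail_level n (x n)) / tail_level n (x n))"
    using ea eventually_gt_at_top[of 2] filterlim_at_top_dense[THEN iffD1, rule_format, OF top, of 0]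
  proof eventually_elim
    case (elim n)
    define a y where "a = a_seq n" and "y = tail_level n (x n)"
    define u where "u = x n - ?L n"
    have a: "0 < a" "a\<^sup>2 = 2 * ln (real n)" using elim a_seq_sq[of n] by (auto simp: a_def)
    have ln: "0 < ln (real n)" using elim by simp
    have y: "y = a + u / a" "0 < y" using elim by (auto simp: y_def tail_level_def a_def u_def)
    have "y\<^sup>2 / 2 = a\<^sup>2 / 2 + u + (u / a)\<^sup>2 / 2" unfolding y(1) using a(1) by (simp add: power2_eq_square field_simps)
    then have "exp (- y\<^sup>2 / 2) = exp (- ln (real n) + (- x n + ?L n + - (u / a)\<^sup>2 / 2))"
      unfolding a by (intro arg_cong[where f=exp]) (simp add: u_def)
    also have "\<dots> = (1 / real n) * (exp (- x n) * exp (?L n) * exp (- (u / a)\<^sup>2 / 2))"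
      unfolding exp_add using elim by (simp add: exp_minus inverse_eq_divide)
    also have "exp (?L n) = sqrt (ln (real n) * (4 * pi))"
    proof -
      have "?L n = ln (sqrt (ln (real n) * (4 * pi)))" using ln by (simp add: ln_sqrt ln_mult)
      then show ?thesis using ln by simp
    qed
    also have "sqrt (ln (real n) * (4 * pi)) = a * sqrt (2 * pi)"
      using ln by (simp add: a_def a_seq_def real_sqrt_mult[symmetric] mult_ac)
    finally have "real n * exp (- y\<^sup>2 / 2) = exp (- x n) * exp (- (u / a)\<^sup>2 / 2) * a * sqrt (2 * pi)"
      using elim by simp
    then have "real n * std_normal_density y = exp (- x n) * exp (- (u / a)\<^sup>2 / 2) * a"
      by (simp add: std_normal_density_def field_simps)
    then show ?case
      using a y(2) unfolding a_def[symmetric] y_def[symmetric] u_def[symmetric] by (simp add: field_simps)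
  qed
  then show "(\<lambda>n. real n * (std_normal_density (tail_level n (x n)) / tail_level n (x n))) \<longlonglongrightarrow> exp (- l)"
    using lim by (rule Lim_transform_eventually[rotated])
qed

text \<open>A relative error \<open>O(1/n)\<close> in the standard deviation and an error \<open>o(1/a n)\<close> in the level are
  both invisible in the limit.\<close>

lemma normal_tail_limit:
  assumes D: "\<forall>\<^sub>F n in sequentially. prob_space (M n) \<and> distributed (M n) lborel (X n) (normal_density 0 (\<sigma> n)) \<and> 0 < \<sigma> n"
    and \<sigma>: "(\<lambda>n. (1 / \<sigma> n - 1) * (a_seq n)\<^sup>2) \<longlonglongrightarrow> 0"
    and c: "(\<lambda>n. a_seq n * (c n - tail_level n x)) \<longlonglongrightarrow> 0"
  shows "(\<lambda>n. real n * measure (M n) {\<omega> \<in> space (M n). c n < X n \<omega>}) \<longlonglongrightarrow> exp (- x)"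
proof -
  let ?L = "\<lambda>n. (ln (ln (real n)) + ln (4 * pi)) / 2"
  let ?p = "\<lambda>n. measure (M n) {\<omega> \<in> space (M n). c n < X n \<omega>}"
  have ea: "\<forall>\<^sub>F n in sequentially. 0 < a_seq n"
    using a_seq_at_top by (rule filterlim_at_top_dense[THEN iffD1, rule_format])
  have l1: "(\<lambda>n. 1 / a_seq n) \<longlonglongrightarrow> 0" unfolding a_seq_def by real_asymp
  have l2: "(\<lambda>n. ?L n / (a_seq n)\<^sup>2) \<longlonglongrightarrow> 0" unfolding a_seq_def by real_asymp
  have ca: "(\<lambda>n. c n / a_seq n) \<longlonglongrightarrow> 1"
  proof -
    have "(\<lambda>n. a_seq n * (c n - tail_level n x) * (1 / a_seq n * (1 / a_seq n)) + (1 + x * (1 / a_seq n * (1 / a_seq n)) - ?L n / (a_seq n)\<^sup>2))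
       \<longlonglongrightarrow> 0 * (0 * 0) + (1 + x * (0 * 0) - 0)" by (intro tendsto_intros c l1 l2)
    moreover have "\<forall>\<^sub>F n in sequentially. a_seq n * (c n - tail_level n x) * (1 / a_seq n * (1 / a_seq n)) + (1 + x * (1 / a_seq n * (1 / a_seq n)) - ?L n / (a_seq n)\<^sup>2) = c n / a_seq n"
      using ea by eventually_elim (simp add: tail_level_def field_simps power2_eq_square)
    ultimately show ?thesis using tendsto_cong by fastforce
  qed
  \<comment> \<open>Chosen such that the standardised level \<open>c n / \<sigma> n\<close> is
    exactly \<open>tail_level n (x' n)\<close>; both perturbations are thereby turned into a
    perturbation of x.\<close>
  define x' where "x' n = x + a_seq n * (c n - tail_level n x) + (1 / \<sigma> n - 1) * (a_seq n)\<^sup>2 * (c n / a_seq n)" for n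
  have x': "x' \<longlonglongrightarrow> x"
  proof -
    have "x' \<longlonglongrightarrow> x + 0 + 0 * 1" unfolding x'_def by (intro tendsto_intros c \<sigma> ca)
    then show ?thesis by simp
  qed
  have lev: "\<forall>\<^sub>F n in sequentially. tail_level n (x' n) = c n / \<sigma> n"
    using ea by eventually_elim (simp add: tail_level_def x'_def field_simps power2_eq_square)
  note lim = tail_level_density_limit[OF x']
  let ?y = "\<lambda>n. tail_level n (x' n)"
  have ypos: "\<forall>\<^sub>F n in sequentially. 0 < ?y n"
    using lim(2) by (rule filterlim_at_top_dense[THEN iffD1, rule_format])
  have bounds: "\<forall>\<^sub>F n in sequentially. real n * ?p n \<le> real n * (std_normal_density (?y n) / ?y n)
      \<and> real n * (std_normal_density (?y n) / ?y n) / (1 + 1 / (?y n)\<^sup>2) \<le> real n * ?p n"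
    using D lev ypos
  proof eventually_elim
    case (elim n)
    then interpret prob_space "M n" by simp
    have c0: "0 < c n" using elim by (simp add: zero_less_divide_iff)
    have "0 < 1 + 1 / (?y n)\<^sup>2" by (intro add_pos_nonneg) auto
    note b = normal_tail_bounds[of "X n" "\<sigma> n" "c n", folded elim(2)]
    have "?p n \<le> std_normal_density (?y n) / ?y n" using b(1) elim c0 by auto
    moreover have "std_normal_density (?y n) / ?y n / (1 + 1 / (?y n)\<^sup>2) \<le> ?p n"
      unfolding pos_divide_le_eq[OF \<open>0 < 1 + 1 / (?y n)\<^sup>2\<close>] using b(2) elim c0 by (simp add: mult.commute)
    ultimately show ?case
      unfolding times_divide_eq_right[of "real n" "std_normal_density (?y n) / ?y n", symmetric]
      by (intro conjI mult_left_mono) auto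
  qed
  have inv0: "(\<lambda>n. 1 / (?y n)\<^sup>2) \<longlonglongrightarrow> 0"
    by (intro tendsto_divide_0[OF tendsto_const] filterlim_at_top_imp_at_infinity filterlim_pow_at_top lim(2)) simp
  have "(\<lambda>n. real n * (std_normal_density (?y n) / ?y n) / (1 + 1 / (?y n)\<^sup>2)) \<longlonglongrightarrow> exp (- x) / (1 + 0)"
    by (intro tendsto_intros lim(1) inv0) simp
  then have low: "(\<lambda>n. real n * (std_normal_density (?y n) / ?y n) / (1 + 1 / (?y n)\<^sup>2)) \<longlonglongrightarrow> exp (- x)" by simp
  show ?thesis
    by (rule tendsto_sandwich[OF _ _ low lim(1)]) (use bounds in \<open>auto elim: eventually_mono\<close>)
qed

section \<open>Eigenvalue counts and row sum counts\<close>

definition lam_seq :: "nat \<Rightarrow> real \<Rightarrow> real" where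
  "lam_seq n x = b_seq n + x / a_seq n"

definition gram_err :: "nat \<Rightarrow> real" where
  "gram_err n = real n powr (-1/4) + 2 * (ln (real n) / sqrt (real n))\<^sup>2 + 1 / real n"

text \<open>exp (23 a) with a = \<open>a_seq n\<close> bounds the size of S: since n = exp (a^2 /
  2), the expected number of row sums above a - 22 is of order at most exp (22 a), and one more
  factor exp a is left for Markov's inequality.\<close>

definition \<kappa>_bound :: "nat \<Rightarrow> real" where
  "\<kappa>_bound n = gram_err n * exp (23 * a_seq n) + (ln (real n) / sqrt (real n))\<^sup>2 * (exp (23 * a_seq n))\<^sup>2"

text \<open>The bulk is cut at M = a powr (3/4) with a = \<open>a_seq n\<close>. Any exponent
  strictly between 1/2 and 1 balances the two demands: exp (- M^2 / 4) has to beat exp (23 a), and M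
  / a has to tend to 0. Half of the Gaussian exponent M^2 / 2 is spent on Markov's
  inequality.\<close>

definition \<rho>_bound :: "nat \<Rightarrow> real" where
  "\<rho>_bound n = real n * exp (- (a_seq n powr (3/2)) / 4) * ((ln (real n) / sqrt (real n))\<^sup>2 * exp (23 * a_seq n))"

text \<open>The error of the spiked diagonal with its parameters filled in: norm bound 20, entry
  bound log n / sqrt n, and the bounds above for the exceptional indices.\<close>

definition \<eta>_bound :: "nat \<Rightarrow> real \<Rightarrow> real" where
  "\<eta>_bound n x = ln (real n) / sqrt (real n) * exp (23 * a_seq n)
     + (4 * a_seq n powr (3/4) / (lam_seq n x)\<^sup>2 + \<rho>_bound n + \<kappa>_bound n)
     + (20 + 20\<^sup>2) * (8 / (lam_seq n x)\<^sup>2 + \<rho>_bound n)"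

lemma lam_seq_ratio: "(\<lambda>n. a_seq n / lam_seq n x) \<longlonglongrightarrow> 1"
  unfolding lam_seq_def b_seq_def a_seq_def by real_asymp

lemma \<kappa>_bound_tendsto: "(\<lambda>n. a_seq n * \<kappa>_bound n) \<longlonglongrightarrow> 0"
  unfolding \<kappa>_bound_def gram_err_def a_seq_def by real_asymp

lemma \<rho>_bound_tendsto: "(\<lambda>n. a_seq n * \<rho>_bound n) \<longlonglongrightarrow> 0"
  unfolding \<rho>_bound_def a_seq_def by real_asymp

lemma entry_error_tendsto: "(\<lambda>n. a_seq n * (ln (real n) / sqrt (real n) * exp (23 * a_seq n))) \<longlonglongrightarrow> 0"
  unfolding a_seq_def by real_asymp

text \<open>Lets limits that mix n and \<open>a_seq n\<close> be taken in the single real variable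
  a.\<close>

lemma real_eq_exp_a_seq: "1 \<le> n \<Longrightarrow> real n = exp ((a_seq n)\<^sup>2 / 2)"
  by (simp add: a_seq_sq)

lemma spike_count_tendsto: "(\<lambda>n. real n * exp (- (a_seq n - 22)\<^sup>2 / (2 * (1 + 1 / real n))) / exp (23 * a_seq n)) \<longlonglongrightarrow> 0"
proof -
  have "((\<lambda>a::real. exp (a\<^sup>2 / 2 - (a - 22)\<^sup>2 / (2 * (1 + 1 / exp (a\<^sup>2 / 2))) - 23 * a)) \<longlongrightarrow> 0) at_top"
    by real_asymp
  from filterlim_compose[OF this a_seq_at_top]
  have "(\<lambda>n. exp ((a_seq n)\<^sup>2 / 2 - (a_seq n - 22)\<^sup>2 / (2 * (1 + 1 / exp ((a_seq n)\<^sup>2 / 2))) - 23 * a_seq n)) \<longlonglongrightarrow> 0" .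
  moreover have "\<forall>\<^sub>F n in sequentially. exp ((a_seq n)\<^sup>2 / 2 - (a_seq n - 22)\<^sup>2 / (2 * (1 + 1 / exp ((a_seq n)\<^sup>2 / 2))) - 23 * a_seq n)
     = real n * exp (- (a_seq n - 22)\<^sup>2 / (2 * (1 + 1 / real n))) / exp (23 * a_seq n)"
    using eventually_ge_at_top[of 1]
  proof eventually_elim
    case (elim n)
    show ?case
      unfolding real_eq_exp_a_seq[OF elim, symmetric] exp_diff by (simp add: exp_minus inverse_eq_divide real_eq_exp_a_seq[OF elim, symmetric])
  qed
  ultimately show ?thesis by (rule Lim_transform_eventually)
qed

lemma large_count_tendsto: "(\<lambda>n. real n * (2 * exp (- (a_seq n powr (3/4))\<^sup>2 / (2 * (1 + 1 / real n)))) / (real n * exp (- (a_seq n powr (3/2)) / 4))) \<longlonglongrightarrow> 0"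
proof -
  have "((\<lambda>a::real. 2 * exp (a powr (3/2) / 4 - a powr (3/2) / (2 * (1 + 1 / exp (a\<^sup>2 / 2))))) \<longlongrightarrow> 0) at_top"
    by real_asymp
  from filterlim_compose[OF this a_seq_at_top]
  have "(\<lambda>n. 2 * exp (a_seq n powr (3/2) / 4 - a_seq n powr (3/2) / (2 * (1 + 1 / exp ((a_seq n)\<^sup>2 / 2))))) \<longlonglongrightarrow> 0" .
  moreover have "\<forall>\<^sub>F n in sequentially. 2 * exp (a_seq n powr (3/2) / 4 - a_seq n powr (3/2) / (2 * (1 + 1 / exp ((a_seq n)\<^sup>2 / 2))))
     = real n * (2 * exp (- (a_seq n powr (3/4))\<^sup>2 / (2 * (1 + 1 / real n)))) / (real n * exp (- (a_seq n powr (3/2)) / 4))"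
    using eventually_ge_at_top[of 1]
  proof eventually_elim
    case (elim n)
    define q where "q = a_seq n powr (3/2) / (2 * (1 + 1 / real n))"
    have "(a_seq n powr (3/4))\<^sup>2 = a_seq n powr (3/2)" by (simp add: power2_eq_square powr_add[symmetric])
    then have q: "- (a_seq n powr (3/4))\<^sup>2 / (2 * (1 + 1 / real n)) = - q"
      by (simp add: q_def)
    show ?case
      unfolding real_eq_exp_a_seq[OF elim, symmetric] q unfolding q_def[symmetric]
      unfolding exp_diff using elim by (simp add: exp_minus field_simps)
  qed
  ultimately show ?thesis by (rule Lim_transform_eventually)
qed

lemma exceptional_prob_tendsto: "(\<lambda>n. 2 * exp (- 7 * real n)) \<longlonglongrightarrow> 0"
   "(\<lambda>n. 2 * (real n)\<^sup>2 * exp (- real n * (ln (real n) / sqrt (real n))\<^sup>2 / 4)) \<longlonglongrightarrow> 0"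
   "(\<lambda>n. 6 * (real n)\<^sup>2 * exp (- real n * (real n powr (-1/4))\<^sup>2 / 16)) \<longlonglongrightarrow> 0"
  by real_asymp+

text \<open>A diagonal entry \<open>d\<close> gives rise to an eigenvalue close to \<open>d + 1/d\<close>, so the eigenvalue level
  \<open>lam_seq n x\<close> corresponds to the following level for the diagonal.\<close>

definition c_seq :: "nat \<Rightarrow> real \<Rightarrow> real" where
  "c_seq n x = lam_seq n x - 1 / lam_seq n x"

lemma eventually_a_seq_pos: "\<forall>\<^sub>F n in sequentially. 0 < a_seq n"
  using a_seq_at_top by (rule filterlim_at_top_dense[THEN iffD1, rule_format])

text \<open>\<open>lam_seq\<close> exceeds \<open>tail_level\<close> by exactly 1 /
  \<open>a_seq n\<close>, and the shift 1 / lam cancels this up to o(1 / \<open>a_seq n\<close>).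
  This is the computation behind the centring \<open>b_seq\<close>.\<close>

lemma c_seq_tail_level: "(\<lambda>n. a_seq n * (c_seq n x - tail_level n x)) \<longlonglongrightarrow> 0"
proof -
  have "(\<lambda>n. 1 - a_seq n / lam_seq n x) \<longlonglongrightarrow> 1 - 1" by (intro tendsto_intros lam_seq_ratio)
  then have l: "(\<lambda>n. 1 - a_seq n / lam_seq n x) \<longlonglongrightarrow> 0" by simp
  have "\<forall>\<^sub>F n in sequentially. 1 - a_seq n / lam_seq n x = a_seq n * (c_seq n x - tail_level n x)"
    using eventually_a_seq_pos
  proof eventually_elim
    case (elim n)
    have "lam_seq n x = tail_level n x + 1 / a_seq n"
      using elim by (simp add: lam_seq_def b_seq_def a_seq_def[symmetric] tail_level_def field_simps)
    then have "c_seq n x - tail_level n x = 1 / a_seq n - 1 / lam_seq n x" by (simp add: c_seq_def)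
    then show ?case using elim by (simp add: right_diff_distrib)
  qed
  with l show ?thesis by (rule Lim_transform_eventually)
qed

text \<open>Row sums near the level are spaced on the scale 1 / \<open>a_seq n\<close>, so this is
  the accuracy at which the window around the level becomes empty with high probability.\<close>

lemma \<eta>_bound_tendsto: "(\<lambda>n. a_seq n * \<eta>_bound n x) \<longlonglongrightarrow> 0"
proof -
  have m1: "(\<lambda>n. 4 * (a_seq n powr (3/4) / a_seq n)) \<longlonglongrightarrow> 0" unfolding a_seq_def by real_asymp
  have m2: "(\<lambda>n. 1 / a_seq n) \<longlonglongrightarrow> 0" unfolding a_seq_def by real_asymp
  let ?r = "\<lambda>n. a_seq n / lam_seq n x"
  have "(\<lambda>n. a_seq n * (ln (real n) / sqrt (real n) * exp (23 * a_seq n))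
     + (4 * (a_seq n powr (3/4) / a_seq n) * (?r n)\<^sup>2 + a_seq n * \<rho>_bound n + a_seq n * \<kappa>_bound n)
     + (20 + 20\<^sup>2) * (8 * (1 / a_seq n) * (?r n)\<^sup>2 + a_seq n * \<rho>_bound n))
     \<longlonglongrightarrow> 0 + (0 * 1\<^sup>2 + 0 + 0) + (20 + 20\<^sup>2) * (8 * 0 * 1\<^sup>2 + 0)"
    by (intro tendsto_intros entry_error_tendsto m1 m2 lam_seq_ratio \<rho>_bound_tendsto \<kappa>_bound_tendsto)
  then have l: "(\<lambda>n. a_seq n * (ln (real n) / sqrt (real n) * exp (23 * a_seq n))
     + (4 * (a_seq n powr (3/4) / a_seq n) * (?r n)\<^sup>2 + a_seq n * \<rho>_bound n + a_seq n * \<kappa>_bound n)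
     + (20 + 20\<^sup>2) * (8 * (1 / a_seq n) * (?r n)\<^sup>2 + a_seq n * \<rho>_bound n)) \<longlonglongrightarrow> 0" by simp
  have e: "a * (A + (4 * M / (l\<^sup>2) + R + K) + c * (8 / l\<^sup>2 + R))
     = a * A + (4 * (M / a) * (a / l)\<^sup>2 + a * R + a * K) + c * (8 * (1 / a) * (a / l)\<^sup>2 + a * R)"
    if "0 < a" for a A M l R K c :: real
    using that by (simp add: power_divide power2_eq_square distrib_left mult_ac)
  have "\<forall>\<^sub>F n in sequentially. a_seq n * (ln (real n) / sqrt (real n) * exp (23 * a_seq n))
     + (4 * (a_seq n powr (3/4) / a_seq n) * (?r n)\<^sup>2 + a_seq n * \<rho>_bound n + a_seq n * \<kappa>_bound n)
     + (20 + 20\<^sup>2) * (8 * (1 / a_seq n) * (?r n)\<^sup>2 + a_seq n * \<rho>_bound n) = a_seq n * \<eta>_bound n x"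
    using eventually_a_seq_pos unfolding \<eta>_bound_def by eventually_elim (rule e[symmetric])
  with l show ?thesis by (rule Lim_transform_eventually)
qed

lemma goe_matrixI:
  assumes "GOE n M A" "1 \<le> n" shows "goe_matrix M n A"
  using assms by (auto simp: goe_matrix_def goe_matrix_axioms_def GOE_def)

text \<open>On the complement of the exceptional events the counting lemma for a spiked diagonal applies
  with \<open>S\<close> the set of indices whose diagonal entry is within a constant of the level.\<close>

lemma (in goe_matrix) count_above_laplacian_event:
  assumes a: "1 \<le> a_seq n" and lam: "a_seq n - 1 \<le> lam_seq n x" "1 \<le> lam_seq n x" "22 < a_seq n"
    and M0: "a_seq n powr (3/4) \<le> lam_seq n x / 2" and \<kappa>1: "\<kappa>_bound n \<le> 1" and n2: "2 \<le> n"
  shows "\<exists>B\<in>events. prob B \<le> 2 * exp (- 7 * real n) + 2 * (real n)\<^sup>2 * exp (- real n * (ln (real n) / sqrt (real n))\<^sup>2 / 4)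
      + 6 * (real n)\<^sup>2 * exp (- real n * (real n powr (-1/4))\<^sup>2 / 16)
      + (real n * exp (- (a_seq n - 22)\<^sup>2 / (2 * (1 + 1 / real n))) / exp (23 * a_seq n)
        + real n * (2 * exp (- (a_seq n powr (3/4))\<^sup>2 / (2 * (1 + 1 / real n)))) / (real n * exp (- (a_seq n powr (3/2)) / 4))) \<and>
     (\<forall>\<omega>\<in>space M - B. (\<forall>i<n. \<bar>D \<omega> i - c_seq n x\<bar> > \<eta>_bound n x) \<longrightarrow>
        count_above (laplacian (A \<omega>)) (lam_seq n x) = card {i. i < n \<and> c_seq n x < D \<omega> i})"
proof -
  define \<alpha> where "\<alpha> = ln (real n) / sqrt (real n)"
  define \<delta> where "\<delta> = real n powr (-1/4)"
  define N1 where "N1 = exp (23 * a_seq n)"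
  define N2 where "N2 = real n * exp (- (a_seq n powr (3/2)) / 4)"
  define m where "m = a_seq n powr (3/4)"
  define l where "l = lam_seq n x"
  have \<alpha>0: "0 < \<alpha>" using n2 by (simp add: \<alpha>_def)
  have \<delta>0: "0 < \<delta>" "\<delta> \<le> 1"
    using n2 powr_mono[of "-1/4" 0 "real n"] by (auto simp: \<delta>_def)
  have N0: "0 < N1" "0 < N2" "0 < m" using n2 a by (auto simp: N1_def N2_def m_def)
  obtain B1 where B1: "B1 \<in> events" "prob B1 \<le> 2 * exp (- 7 * real n)"
    "\<And>\<omega> v. \<omega> \<in> space M - B1 \<Longrightarrow> \<bar>bilin n (g \<omega>) v v\<bar> \<le> 20 * (\<Sum>k<n. (v k)\<^sup>2)"
    using operator_norm_event by blast
  obtain B2 where B2: "B2 \<in> events" "prob B2 \<le> 2 * (real n)\<^sup>2 * exp (- real n * \<alpha>\<^sup>2 / 4)"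
    "\<And>\<omega> i j. \<omega> \<in> space M - B2 \<Longrightarrow> i < n \<Longrightarrow> j < n \<Longrightarrow> \<bar>g \<omega> i j\<bar> \<le> \<alpha>"
    using entries_event[OF \<alpha>0] by blast
  obtain B3 where B3: "B3 \<in> events" "prob B3 \<le> 6 * (real n)\<^sup>2 * exp (- real n * \<delta>\<^sup>2 / 16)"
    "\<And>\<omega> i k. \<omega> \<in> space M - B3 \<Longrightarrow> \<forall>i<n. \<forall>j<n. \<bar>g \<omega> i j\<bar> \<le> \<alpha> \<Longrightarrow> i < n \<Longrightarrow> k < n \<Longrightarrow>
      \<bar>(\<Sum>j<n. g \<omega> i j * g \<omega> k j) - (if i = k then 1 else 0)\<bar> \<le> \<delta> + 2 * \<alpha>\<^sup>2 + 1 / real n"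
    using gram_event[OF \<delta>0] by blast
  have "0 < a_seq n - 22" using lam by simp
  from row_sum_counts_event[OF this N0(3) N0(1,2)]
  obtain B4 where B4: "B4 \<in> events"
    "prob B4 \<le> real n * exp (- (a_seq n - 22)\<^sup>2 / (2 * (1 + 1 / real n))) / N1
       + real n * (2 * exp (- m\<^sup>2 / (2 * (1 + 1 / real n)))) / N2"
    "\<And>\<omega>. \<omega> \<in> space M - B4 \<Longrightarrow> real (card {j. j < n \<and> a_seq n - 22 \<le> D \<omega> j}) \<le> N1"
    "\<And>\<omega>. \<omega> \<in> space M - B4 \<Longrightarrow> real (card {j. j < n \<and> m < \<bar>D \<omega> j\<bar>}) \<le> N2"
    by blast
  define B where "B = B1 \<union> B2 \<union> B3 \<union> B4"
  have B: "B \<in> events" using B1(1) B2(1) B3(1) B4(1) by (simp add: B_def)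
  have "prob B \<le> prob B1 + prob B2 + prob B3 + prob B4"
    unfolding B_def using B1(1) B2(1) B3(1) B4(1)
    by (intro order_trans[OF measure_Un_le] add_right_mono) auto
  then have PB: "prob B \<le> 2 * exp (- 7 * real n) + 2 * (real n)\<^sup>2 * exp (- real n * \<alpha>\<^sup>2 / 4)
      + 6 * (real n)\<^sup>2 * exp (- real n * \<delta>\<^sup>2 / 16)
      + (real n * exp (- (a_seq n - 22)\<^sup>2 / (2 * (1 + 1 / real n))) / N1
        + real n * (2 * exp (- m\<^sup>2 / (2 * (1 + 1 / real n)))) / N2)"
    using B1(2) B2(2) B3(2) B4(2) by linarith
  have main: "count_above (laplacian (A \<omega>)) l = card {i. i < n \<and> l - 1 / l < D \<omega> i}"
    if w: "\<omega> \<in> space M - B" and window: "\<forall>i<n. \<bar>D \<omega> i - (l - 1 / l)\<bar> > \<eta>_bound n x" for \<omega>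
  proof -
    \<comment> \<open>21 is the norm bound 20 plus the reserve 1. Because lam is at least
      \<open>a_seq n - 1\<close>, all of S lies above \<open>a_seq n - 22\<close>, the level at
      which the row sums were counted.\<close>
    define S where "S = {j. j < n \<and> l - 21 < D \<omega> j}"
    have wB: "\<omega> \<in> space M - B1" "\<omega> \<in> space M - B2" "\<omega> \<in> space M - B3" "\<omega> \<in> space M - B4" "\<omega> \<in> space M"
      using w by (auto simp: B_def)
    have q: "\<bar>bilin n (g \<omega>) u v\<bar> \<le> 20 * (sqrt (\<Sum>k<n. (u k)\<^sup>2) * sqrt (\<Sum>k<n. (v k)\<^sup>2))" for u v
      by (rule bilin_le_of_quadratic[OF g_commute B1(3)[OF wB(1)]])
    interpret sp: spiked_diagonal n S "g \<omega>" "D \<omega>" l 20 \<alpha> "\<delta> + 2 * \<alpha>\<^sup>2 + 1 / real n" m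
    proof
      show "S \<subseteq> {..<n}" by (auto simp: S_def)
      show "(\<Sum>k<n. \<Sum>l<n. g \<omega> k l * (u k * v l)) \<le> 20 * (sqrt (\<Sum>k<n. (u k)\<^sup>2) * sqrt (\<Sum>k<n. (v k)\<^sup>2))" for u v
        using q[of u v] unfolding bilin_def by linarith
      show "D \<omega> j \<le> l - 20 - 1" if "j < n" "j \<notin> S" for j using that by (auto simp: S_def)
      show "\<bar>(\<Sum>j<n. g \<omega> i j * g \<omega> k j) - (if i = k then 1 else 0)\<bar> \<le> \<delta> + 2 * \<alpha>\<^sup>2 + 1 / real n"
        if "i < n" "k < n" for i k
        using B3(3)[OF wB(3) _ that] B2(3)[OF wB(2)] by blast
    qed (use lam M0 B2(3)[OF wB(2)] in \<open>auto simp: l_def m_def g_commute\<close>)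
    have "S \<subseteq> {j. j < n \<and> a_seq n - 22 \<le> D \<omega> j}" using lam by (auto simp: S_def l_def)
    then have "card S \<le> card {j. j < n \<and> a_seq n - 22 \<le> D \<omega> j}" by (intro card_mono) auto
    then have cS: "real (card S) \<le> N1" using B4(3)[OF wB(4)] by linarith
    have \<epsilon>0: "0 \<le> \<delta> + 2 * \<alpha>\<^sup>2 + 1 / real n" using \<delta>0 by (intro add_nonneg_nonneg) auto
    have "sp.\<kappa> \<le> (\<delta> + 2 * \<alpha>\<^sup>2 + 1 / real n) * N1 + \<alpha>\<^sup>2 * N1\<^sup>2"
      unfolding sp.\<kappa>_def by (intro add_mono mult_left_mono power_mono cS \<epsilon>0) auto
    then have \<kappa>: "sp.\<kappa> \<le> \<kappa>_bound n"
      by (simp add: \<kappa>_bound_def gram_err_def \<alpha>_def \<delta>_def N1_def)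
    have "sp.\<rho> \<le> N2 * (\<alpha>\<^sup>2 * N1)"
      unfolding sp.\<rho>_def using N0 by (intro mult_mono mult_left_mono cS B4(4)[OF wB(4)]) auto
    then have \<rho>: "sp.\<rho> \<le> \<rho>_bound n" by (simp add: \<rho>_bound_def \<alpha>_def N1_def N2_def)
    have "sp.\<eta> \<le> \<alpha> * N1 + (4 * m / l\<^sup>2 + \<rho>_bound n + \<kappa>_bound n) + (20 + 20\<^sup>2) * (8 / l\<^sup>2 + \<rho>_bound n)"
      unfolding sp.\<eta>_def using \<alpha>0 by (intro add_mono mult_left_mono cS \<rho> \<kappa> order_refl) auto
    then have \<eta>: "sp.\<eta> \<le> \<eta>_bound n x" by (simp add: \<eta>_bound_def \<alpha>_def N1_def m_def l_def)
    note Aw = A_carrier[OF wB(5)] A_sym[OF wB(5)]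
    show ?thesis
    proof (rule sp.count_above_spiked)
      show "laplacian (A \<omega>) \<in> carrier_mat n n" "transpose_mat (laplacian (A \<omega>)) = laplacian (A \<omega>)"
        using Aw by (auto intro: laplacian_symmetric)
      show "sp.\<kappa> \<le> 1" using \<kappa> \<kappa>1 by linarith
      show "sp.\<eta> < \<bar>D \<omega> i - (l - 1 / l)\<bar>" if "i < n" for i using window that \<eta> by fastforce
      fix v
      have "quad_form n (laplacian (A \<omega>)) v = (\<Sum>k<n. \<Sum>j<n. (if k = j then D \<omega> k * (v k)\<^sup>2 else 0) - g \<omega> k j * (v k * v j))"
        unfolding quad_form_def
        by (intro sum.cong refl) (auto simp: laplacian_index[OF Aw(1)] A_eq_g[OF wB(5)] D_def power2_eq_square algebra_simps)
      also have "\<dots> = (\<Sum>k<n. D \<omega> k * (v k)\<^sup>2) - sp.G v v"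
        by (simp add: sum_subtractf sp.G_def)
      also have "\<dots> = l * (\<Sum>k<n. (v k)\<^sup>2) - sp.Q v"
        by (simp add: sp.Q_def sum_distrib_left left_diff_distrib sum_subtractf)
      finally show "quad_form n (laplacian (A \<omega>)) v = l * (\<Sum>k<n. (v k)\<^sup>2) - sp.Q v" .
    qed
  qed
  show ?thesis
    using B PB main unfolding \<alpha>_def \<delta>_def N1_def N2_def m_def l_def c_seq_def by (intro bexI[of _ B]) auto
qed

section \<open>From factorial moments to the Poisson law\<close>

text \<open>The elementary symmetric polynomials. For indicators this is the binomial coefficient of
  the number of occurrences over r, so its expectation is a factorial moment divided by r!.\<close>

definition esym :: "'i set \<Rightarrow> ('i \<Rightarrow> real) \<Rightarrow> nat \<Rightarrow> real" where
  "esym L f r = (\<Sum>R | R \<subseteq> L \<and> card R = r. \<Prod>l\<in>R. f l)"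

lemma esym_0: "finite L \<Longrightarrow> esym L f 0 = 1"
proof -
  assume "finite L"
  then have "{R. R \<subseteq> L \<and> card R = 0} = {{}}" using finite_subset by fastforce
  then show ?thesis by (simp add: esym_def)
qed

lemma esym_insert:
  assumes L: "finite L" "x \<notin> L"
  shows "esym (insert x L) f (Suc r) = esym L f (Suc r) + f x * esym L f r"
proof -
  let ?A = "{R. R \<subseteq> L \<and> card R = Suc r}" and ?B = "{R. R \<subseteq> L \<and> card R = r}"
  have fin: "finite R" if "R \<subseteq> L" for R using that L finite_subset by blast
  have x: "x \<notin> R" if "R \<subseteq> L" for R using that L by blast
  have eq: "{R. R \<subseteq> insert x L \<and> card R = Suc r} = ?A \<union> insert x ` ?B"
  proof (rule equalityI; rule subsetI)
    fix R assume R: "R \<in> {R. R \<subseteq> insert x L \<and> card R = Suc r}"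
    show "R \<in> ?A \<union> insert x ` ?B"
    proof (cases "x \<in> R")
      case True
      then have "R = insert x (R - {x})" "R - {x} \<subseteq> L" "card (R - {x}) = r"
        using R by (auto simp: card_Diff_singleton)
      then show ?thesis by blast
    next
      case False
      then show ?thesis using R by auto
    qed
  next
    fix R assume "R \<in> ?A \<union> insert x ` ?B"
    then show "R \<in> {R. R \<subseteq> insert x L \<and> card R = Suc r}"
      using fin x by (auto simp: card_insert_if)
  qed
  have inj: "inj_on (insert x) ?B"
    using x by (intro inj_onI) (metis (no_types, lifting) Diff_insert_absorb mem_Collect_eq)
  have "finite ?A" "finite ?B" using L by auto
  then have "esym (insert x L) f (Suc r) = (\<Sum>R\<in>?A. \<Prod>l\<in>R. f l) + (\<Sum>R\<in>insert x ` ?B. \<Prod>l\<in>R. f l)"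
    unfolding esym_def eq using x by (intro sum.union_disjoint) auto
  also have "(\<Sum>R\<in>insert x ` ?B. \<Prod>l\<in>R. f l) = (\<Sum>R\<in>?B. f x * (\<Prod>l\<in>R. f l))"
    by (subst sum.reindex[OF inj], intro sum.cong refl) (use fin x in \<open>auto simp: prod.insert\<close>)
  finally show ?thesis by (simp add: esym_def sum_distrib_left)
qed

definition esym_partial :: "'i set \<Rightarrow> ('i \<Rightarrow> real) \<Rightarrow> nat \<Rightarrow> real" where
  "esym_partial L f k = (\<Sum>r\<le>k. (- 1) ^ r * esym L f r)"

lemma esym_partial_insert:
  assumes L: "finite L" "x \<notin> L"
  shows "esym_partial (insert x L) f (Suc k) = esym_partial L f (Suc k) - f x * esym_partial L f k"
proof (induction k)
  case 0
  then show ?case using L by (simp add: esym_partial_def esym_insert esym_0)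
next
  case (Suc k)
  have "esym_partial (insert x L) f (Suc (Suc k)) = esym_partial (insert x L) f (Suc k)
      + (- 1) ^ (Suc (Suc k)) * esym (insert x L) f (Suc (Suc k))" by (simp add: esym_partial_def)
  then show ?case using Suc L by (simp add: esym_insert esym_partial_def algebra_simps)
qed

text \<open>Holds for values in [0, 1] and not just for indicators. A new factor turns both the
  product and its truncated expansion into a difference; the subtracted truncation is one step
  shorter, so its opposite parity gives the inequality in the right direction.\<close>

lemma bonferroni:
  assumes "finite L" "\<And>l. l \<in> L \<Longrightarrow> 0 \<le> f l \<and> f l \<le> 1"
  shows "(even k \<longrightarrow> (\<Prod>l\<in>L. 1 - f l) \<le> esym_partial L f k) \<and>
     (odd k \<longrightarrow> esym_partial L f k \<le> (\<Prod>l\<in>L. 1 - f l))"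
  using assms
proof (induction L arbitrary: k rule: finite_induct)
  case empty
  have "{R :: 'a set. R = {} \<and> card R = r} = (if r = 0 then {{}} else {})" for r by auto
  then have "esym {} f r = (if r = 0 then 1 else 0)" for r by (simp add: esym_def)
  then have "esym_partial {} f k = (\<Sum>r\<le>k. if r = 0 then 1 else 0)"
    unfolding esym_partial_def by (intro sum.cong refl) auto
  then have "esym_partial {} f k = 1" by simp
  then show ?case by simp
next
  case (insert x L)
  let ?P = "\<Prod>l\<in>L. 1 - f l"
  have fx: "0 \<le> f x" "f x \<le> 1" using insert.prems by auto
  have IH: "(even k \<longrightarrow> ?P \<le> esym_partial L f k) \<and> (odd k \<longrightarrow> esym_partial L f k \<le> ?P)" for k
    using insert by blast
  have P: "(\<Prod>l\<in>insert x L. 1 - f l) = ?P - f x * ?P" using insert by (simp add: algebra_simps)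
  have P0: "0 \<le> ?P" using insert.prems by (intro prod_nonneg) auto
  have P1: "?P \<le> 1" using insert.prems by (intro prod_le_1) auto
  show ?case
  proof (cases k)
    case 0
    have "0 \<le> f x * ?P" using fx P0 by simp
    then show ?thesis using 0 P P1 insert by (simp add: esym_partial_def esym_0)
  next
    case (Suc j)
    have e: "esym_partial (insert x L) f k = esym_partial L f k - f x * esym_partial L f j"
      unfolding Suc using insert by (intro esym_partial_insert)
    show ?thesis
    proof (cases "even k")
      case True
      then have "f x * esym_partial L f j \<le> f x * ?P" using IH[of j] fx Suc by (intro mult_left_mono) auto
      then show ?thesis using IH[of k] True P e by auto
    next
      case False
      then have "f x * ?P \<le> f x * esym_partial L f j" using IH[of j] fx Suc by (intro mult_left_mono) auto
      then show ?thesis using IH[of k] False P e by auto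
    qed
  qed
qed

lemma exp_neg_partial_sums:
  fixes q :: real
  shows "(\<lambda>k. \<Sum>r\<le>k. (- 1) ^ r * (q ^ r / fact r)) \<longlonglongrightarrow> exp (- q)"
proof -
  have "(\<lambda>r. (- q) ^ r /\<^sub>R fact r) sums exp (- q)" by (rule exp_converges)
  then have "(\<lambda>r. (- 1) ^ r * (q ^ r / fact r)) sums exp (- q)"
    by (simp add: power_minus[of q] divide_inverse scaleR_conv_of_real mult_ac)
  then show ?thesis by (simp add: sums_def_le)
qed

text \<open>\<open>E n r\<close> is the \<open>r\<close>-th factorial moment over \<open>r!\<close>; the last two hypotheses are the Bonferroni
  inequalities for the avoidance functional \<open>\<Phi> n\<close>.\<close>

lemma avoidance_limit_of_esym:
  fixes \<Phi> :: "nat \<Rightarrow> real" and E :: "nat \<Rightarrow> nat \<Rightarrow> real"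
  assumes E: "\<And>r. (\<lambda>n. E n r) \<longlonglongrightarrow> q ^ r / fact r"
    and le: "\<forall>\<^sub>F n in sequentially. \<forall>k. even k \<longrightarrow> \<Phi> n \<le> (\<Sum>r\<le>k. (- 1) ^ r * E n r)"
    and ge: "\<forall>\<^sub>F n in sequentially. \<forall>k. odd k \<longrightarrow> (\<Sum>r\<le>k. (- 1) ^ r * E n r) \<le> \<Phi> n"
  shows "\<Phi> \<longlonglongrightarrow> exp (- q)"
proof (rule tendstoI)
  fix e :: real assume e: "0 < e"
  let ?S = "\<lambda>k. \<Sum>r\<le>k. (- 1) ^ r * (q ^ r / fact r)"
  have "\<forall>\<^sub>F k in sequentially. dist (?S k) (exp (- q)) < e / 2"
    using exp_neg_partial_sums e by (intro tendstoD) auto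
  then obtain K where K: "\<And>k. k \<ge> K \<Longrightarrow> dist (?S k) (exp (- q)) < e / 2"
    by (auto simp: eventually_sequentially)
  have S: "(\<lambda>n. \<Sum>r\<le>k. (- 1) ^ r * E n r) \<longlonglongrightarrow> ?S k" for k by (intro tendsto_intros E)
  have ev: "\<forall>\<^sub>F n in sequentially. dist (\<Sum>r\<le>k. (- 1) ^ r * E n r) (?S k) < e / 2" for k
    using S[of k] e by (intro tendstoD) auto
  show "\<forall>\<^sub>F n in sequentially. dist (\<Phi> n) (exp (- q)) < e"
    using ev[of "2 * K"] ev[of "2 * K + 1"] le ge
  proof eventually_elim
    case (elim n)
    have "\<Phi> n \<le> (\<Sum>r\<le>2 * K. (- 1) ^ r * E n r)" by (rule elim(3)[rule_format]) simp
    moreover have "(\<Sum>r\<le>2 * K + 1. (- 1) ^ r * E n r) \<le> \<Phi> n" by (rule elim(4)[rule_format]) simp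
    ultimately show ?case using elim(1,2) K[of "2 * K"] K[of "2 * K + 1"] unfolding dist_real_def by linarith
  qed
qed

section \<open>From generating functions to Poisson point probabilities\<close>

definition poisson_weight :: "real \<Rightarrow> nat \<Rightarrow> real" where
  "poisson_weight p k = exp (- p) * p ^ k / fact k"

lemma poisson_weight_nonneg: "0 \<le> p \<Longrightarrow> 0 \<le> poisson_weight p k"
  by (simp add: poisson_weight_def)

lemma poisson_weight_gf: "(\<lambda>k. poisson_weight p k * t ^ k) sums exp (- (1 - t) * p)"
proof -
  have "(\<lambda>k. (p * t) ^ k /\<^sub>R fact k) sums exp (p * t)" by (rule exp_converges)
  then have "(\<lambda>k. exp (- p) * ((p * t) ^ k /\<^sub>R fact k)) sums (exp (- p) * exp (p * t))" by (rule sums_mult)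
  moreover have "exp (- p) * ((p * t) ^ k /\<^sub>R fact k) = poisson_weight p k * t ^ k" for k
    by (simp add: poisson_weight_def power_mult_distrib divide_inverse scaleR_conv_of_real mult_ac)
  moreover have "exp (- p) * exp (p * t) = exp (- (1 - t) * p)"
    by (simp add: exp_add[symmetric] algebra_simps)
  ultimately show ?thesis by simp
qed

lemma poisson_weight_sums: "poisson_weight p sums 1"
  using poisson_weight_gf[of p 1] by simp

lemma poisson_weight_le_1: assumes "0 \<le> p" shows "poisson_weight p k \<le> 1"
proof -
  have "sum (poisson_weight p) {k} \<le> suminf (poisson_weight p)"
    using poisson_weight_sums[of p] poisson_weight_nonneg[OF assms]
    by (intro sum_le_suminf) (auto simp: sums_iff)
  then show ?thesis using poisson_weight_sums[of p] by (simp add: sums_iff)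
qed

text \<open>The points \<open>2\<^sup>-\<^sup>w\<close> are isolated in \<open>[0, 1]\<close>, so indicators of single values of \<open>w\<close> are
  approximable by polynomials in \<open>2\<^sup>-\<^sup>w\<close>.\<close>

lemma indicator_polynomial_approx:
  fixes e :: real
  assumes "0 < e"
  shows "\<exists>c m. \<forall>w::nat. \<bar>(if w = v then 1 else 0) - (\<Sum>i\<le>m. c i * ((1/2) ^ w) ^ i)\<bar> < e"
proof -
  define h where "h = (1/2 :: real) ^ v"
  have h: "0 < h" by (simp add: h_def)
  \<comment> \<open>A tent of half-width h / 2 around h = 2^(-v). The neighbouring powers h / 2 and
    2 h are at distance at least h / 2, so it vanishes at every other power.\<close>
  define f where "f u = max 0 (1 - \<bar>u - h\<bar> / (h / 2))" for u :: real
  have "continuous_on {0..1} f" unfolding f_def using h by (intro continuous_intros) auto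
  then obtain g where g: "real_polynomial_function g" "\<And>u. u \<in> {0..1} \<Longrightarrow> \<bar>f u - g u\<bar> < e"
    using Stone_Weierstrass_real_polynomial_function[of "{0..1::real}" f e] assms by auto
  obtain c m where cm: "g = (\<lambda>x. \<Sum>i\<le>m. c i * x ^ i)"
    using g(1) unfolding real_polynomial_function_iff_sum by blast
  have "f ((1/2) ^ w) = (if w = v then 1 else 0)" for w
  proof (cases w v rule: linorder_cases)
    case less
    define y where "y = (1/2 :: real) ^ w"
    have "(1/2::real) ^ v \<le> (1/2) ^ Suc w" using less by (intro power_decreasing) auto
    then have "h \<le> y / 2" by (simp add: y_def h_def)
    then have "1 \<le> \<bar>y - h\<bar> / (h / 2)" using h by (simp add: field_simps)
    then show ?thesis using less unfolding y_def[symmetric] by (simp add: f_def)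
  next
    case greater
    define y where "y = (1/2 :: real) ^ w"
    have "(1/2::real) ^ w \<le> (1/2) ^ Suc v" using greater by (intro power_decreasing) auto
    then have "y \<le> h / 2" by (simp add: y_def h_def)
    then have "1 \<le> \<bar>y - h\<bar> / (h / 2)" using h by (simp add: field_simps)
    then show ?thesis using greater unfolding y_def[symmetric] by (simp add: f_def)
  qed (simp add: f_def h_def)
  moreover have "\<bar>f ((1/2) ^ w) - (\<Sum>i\<le>m. c i * ((1/2) ^ w) ^ i)\<bar> < e" for w
  proof -
    have "(1/2::real) ^ w \<in> {0..1}" by (simp add: power_le_one)
    from g(2)[OF this] show ?thesis by (simp only: cm)
  qed
  ultimately have "\<bar>(if w = v then 1 else 0) - (\<Sum>i\<le>m. c i * ((1/2) ^ w) ^ i)\<bar> < e" for w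
    by (simp only: )
  then show ?thesis by blast
qed

lemma power_power_commute: "(x ^ i) ^ w = (x ^ w) ^ i" for x :: "'a :: monoid_mult"
  by (simp only: power_mult[symmetric] mult.commute)

text \<open>Averages the polynomial approximation of the indicator over the Poisson weights; the
  generating function at 2^(-i) evaluates each power.\<close>

lemma poisson_weight_polynomial_error:
  assumes p: "0 \<le> p" and c: "\<And>w. \<bar>(if w = v then 1 else 0) - (\<Sum>i\<le>m. c i * ((1/2) ^ w) ^ i)\<bar> < e"
  shows "\<bar>poisson_weight p v - (\<Sum>i\<le>m. c i * exp (- (1 - (1/2) ^ i) * p))\<bar> \<le> e"
proof -
  have "(\<lambda>w. \<Sum>i\<le>m. c i * (poisson_weight p w * ((1/2) ^ i) ^ w)) sums (\<Sum>i\<le>m. c i * exp (- (1 - (1/2) ^ i) * p))"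
    by (intro sums_sum sums_mult poisson_weight_gf)
  moreover have "(\<Sum>i\<le>m. c i * (poisson_weight p w * ((1/2) ^ i) ^ w)) = poisson_weight p w * (\<Sum>i\<le>m. c i * ((1/2) ^ w) ^ i)" for w
    unfolding sum_distrib_left power_power_commute[of _ _ w] by (simp only: mult.left_commute)
  ultimately have s1: "(\<lambda>w. poisson_weight p w * (\<Sum>i\<le>m. c i * ((1/2) ^ w) ^ i)) sums (\<Sum>i\<le>m. c i * exp (- (1 - (1/2) ^ i) * p))"
    by simp
  have "(\<lambda>w. if w = v then poisson_weight p w else 0) sums poisson_weight p v"
    using sums_single[of v "poisson_weight p"] by simp
  from sums_diff[OF this s1]
  have s2: "(\<lambda>w. poisson_weight p w * ((if w = v then 1 else 0) - (\<Sum>i\<le>m. c i * ((1/2) ^ w) ^ i)))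
     sums (poisson_weight p v - (\<Sum>i\<le>m. c i * exp (- (1 - (1/2) ^ i) * p)))"
    by (rule sums_cong[THEN iffD1, rotated]) (simp add: algebra_simps)
  have b: "\<bar>poisson_weight p w * ((if w = v then 1 else 0) - (\<Sum>i\<le>m. c i * ((1/2) ^ w) ^ i))\<bar> \<le> poisson_weight p w * e" for w
    unfolding abs_mult using c[of w] poisson_weight_nonneg[OF p] by (simp add: mult_left_mono less_imp_le)
  have s3: "(\<lambda>w. poisson_weight p w * e) sums (1 * e)" by (rule sums_mult2[OF poisson_weight_sums])
  have "\<bar>suminf (\<lambda>w. poisson_weight p w * ((if w = v then 1 else 0) - (\<Sum>i\<le>m. c i * ((1/2) ^ w) ^ i)))\<bar>
     \<le> suminf (\<lambda>w. poisson_weight p w * e)"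
    using norm_suminf_le[of "\<lambda>w. poisson_weight p w * ((if w = v then 1 else 0) - (\<Sum>i\<le>m. c i * ((1/2) ^ w) ^ i))" "\<lambda>w. poisson_weight p w * e"] b s3
    by (simp add: sums_iff)
  then show ?thesis using s2 s3 by (simp add: sums_iff)
qed

text \<open>The powers \<open>s i ^ N n i\<close> are replaced by indicators one coordinate at a
  time, with the limit kept for all values of the remaining parameters. The freedom in
  \<open>s j\<close> allows the values 2^(-i), and a polynomial in 2^(-N) approximates the indicator
  uniformly, both at stage n and in the Poisson limit.\<close>

lemma pgf_to_point_probabilities:
  fixes N :: "nat \<Rightarrow> nat \<Rightarrow> 'a \<Rightarrow> nat"
  assumes M: "\<forall>\<^sub>F n in sequentially. prob_space (M n)"
    and N: "\<forall>\<^sub>F n in sequentially. \<forall>i<k. N n i \<in> measurable (M n) (count_space UNIV)"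
    and p: "\<And>i. i < k \<Longrightarrow> 0 \<le> p i"
    and pgf: "\<And>s. (\<And>i. 0 \<le> s i \<and> s i \<le> 1) \<Longrightarrow>
      (\<lambda>n. \<integral>\<omega>. (\<Prod>i<k. s i ^ N n i \<omega>) \<partial>M n) \<longlonglongrightarrow> (\<Prod>i<k. exp (- (1 - s i) * p i))"
  shows "(\<lambda>n. measure (M n) {\<omega> \<in> space (M n). \<forall>i<k. N n i \<omega> = v i}) \<longlonglongrightarrow> (\<Prod>i<k. poisson_weight (p i) (v i))"
proof -
  define F where "F s j n \<omega> = (\<Prod>i<j. if N n i \<omega> = v i then 1 else 0) * (\<Prod>i\<in>{j..<k}. s i ^ N n i \<omega>)"
    for s :: "nat \<Rightarrow> real" and j n and \<omega> :: 'a
  define L where "L s j = (\<Prod>i<j. poisson_weight (p i) (v i)) * (\<Prod>i\<in>{j..<k}. exp (- (1 - s i) * p i))"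
    for s :: "nat \<Rightarrow> real" and j
  have claim: "\<forall>s. (\<forall>i. 0 \<le> s i \<and> s i \<le> 1) \<longrightarrow> (\<lambda>n. \<integral>\<omega>. F s j n \<omega> \<partial>M n) \<longlonglongrightarrow> L s j" if "j \<le> k" for j
    using that
  proof (induction j)
    case 0
    then show ?case using pgf by (simp add: F_def L_def lessThan_atLeast0)
  next
    case (Suc j)
    then have jk: "j < k" by simp
    show ?case
    proof (intro allI impI)
      fix s :: "nat \<Rightarrow> real" assume s: "\<forall>i. 0 \<le> s i \<and> s i \<le> 1"
      define H where "H n \<omega> = (\<Prod>i<j. if N n i \<omega> = v i then 1 else 0 :: real) * (\<Prod>i\<in>{Suc j..<k}. s i ^ N n i \<omega>)" for n \<omega>
      define l where "l = (\<Prod>i<j. poisson_weight (p i) (v i)) * (\<Prod>i\<in>{Suc j..<k}. exp (- (1 - s i) * p i))"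
      have l01: "0 \<le> l \<and> l \<le> 1"
      proof -
        have "0 \<le> (\<Prod>i<j. poisson_weight (p i) (v i)) \<and> (\<Prod>i<j. poisson_weight (p i) (v i)) \<le> 1"
          using jk p by (intro conjI prod_nonneg prod_le_1) (auto intro: poisson_weight_nonneg poisson_weight_le_1)
        moreover have "0 \<le> (\<Prod>i\<in>{Suc j..<k}. exp (- (1 - s i) * p i)) \<and> (\<Prod>i\<in>{Suc j..<k}. exp (- (1 - s i) * p i)) \<le> 1"
          using s p by (intro conjI prod_nonneg prod_le_1) (auto intro!: mult_nonpos_nonneg)
        ultimately show ?thesis by (simp add: l_def mult_le_one)
      qed
      have H01: "0 \<le> H n \<omega> \<and> H n \<omega> \<le> 1" for n \<omega>
      proof -
        have "0 \<le> (\<Prod>i<j. if N n i \<omega> = v i then 1 else 0 :: real) \<and> (\<Prod>i<j. if N n i \<omega> = v i then 1 else 0 :: real) \<le> 1"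
          by (intro conjI prod_nonneg prod_le_1) auto
        moreover have "0 \<le> (\<Prod>i\<in>{Suc j..<k}. s i ^ N n i \<omega>) \<and> (\<Prod>i\<in>{Suc j..<k}. s i ^ N n i \<omega>) \<le> 1"
          using s by (intro conjI prod_nonneg prod_le_1) (auto intro: power_le_one)
        ultimately show ?thesis by (simp add: H_def mult_le_one)
      qed
      have HF: "F (s(j := t)) j n = (\<lambda>\<omega>. H n \<omega> * t ^ N n j \<omega>)" for t n
      proof
        fix \<omega>
        have "(\<Prod>i\<in>{j..<k}. (s(j := t)) i ^ N n i \<omega>) = t ^ N n j \<omega> * (\<Prod>i\<in>{Suc j..<k}. s i ^ N n i \<omega>)"
          using jk by (subst prod.atLeast_Suc_lessThan) (auto intro!: prod.cong)
        then show "F (s(j := t)) j n \<omega> = H n \<omega> * t ^ N n j \<omega>" by (simp add: F_def H_def)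
      qed
      have HL: "L (s(j := t)) j = l * exp (- (1 - t) * p j)" for t
      proof -
        have "(\<Prod>i\<in>{j..<k}. exp (- (1 - (s(j := t)) i) * p i)) = exp (- (1 - t) * p j) * (\<Prod>i\<in>{Suc j..<k}. exp (- (1 - s i) * p i))"
          using jk by (subst prod.atLeast_Suc_lessThan) (auto intro!: prod.cong)
        then show ?thesis by (simp add: L_def l_def)
      qed
      have conv: "(\<lambda>n. \<integral>\<omega>. H n \<omega> * t ^ N n j \<omega> \<partial>M n) \<longlonglongrightarrow> l * exp (- (1 - t) * p j)" if "0 \<le> t" "t \<le> 1" for t
        using Suc.IH[rule_format, of "s(j := t)"] jk s that by (simp add: HF HL)
      have FS: "F s (Suc j) n \<omega> = H n \<omega> * (if N n j \<omega> = v j then 1 else 0)" for n \<omega>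
        by (simp add: F_def H_def)
      have LS: "L s (Suc j) = l * poisson_weight (p j) (v j)" by (simp add: L_def l_def)
      have meas: "\<forall>\<^sub>F n in sequentially. H n \<in> borel_measurable (M n) \<and> N n j \<in> measurable (M n) (count_space UNIV) \<and> prob_space (M n)"
        using M N
      proof eventually_elim
        case (elim n)
        have m: "(\<lambda>\<omega>. h (N n i \<omega>)) \<in> borel_measurable (M n)" if "i < k" for i and h :: "nat \<Rightarrow> real"
          using measurable_compose[of "N n i" "M n" "count_space UNIV" h borel] elim that by simp
        have "(\<lambda>\<omega>. \<Prod>i<j. if N n i \<omega> = v i then 1 else 0 :: real) \<in> borel_measurable (M n)"
          using jk by (intro borel_measurable_prod m[where h="\<lambda>w. if w = v _ then 1 else 0"]) auto
        moreover have "(\<lambda>\<omega>. \<Prod>i\<in>{Suc j..<k}. s i ^ N n i \<omega>) \<in> borel_measurable (M n)"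
          by (intro borel_measurable_prod m) auto
        ultimately have "H n \<in> borel_measurable (M n)"
          unfolding H_def by (rule borel_measurable_times)
        then show ?case using elim jk by auto
      qed
      show "(\<lambda>n. \<integral>\<omega>. F s (Suc j) n \<omega> \<partial>M n) \<longlonglongrightarrow> L s (Suc j)"
      proof (rule tendstoI)
        fix e :: real assume e: "0 < e"
        obtain c m where cm: "\<And>w::nat. \<bar>(if w = v j then 1 else 0) - (\<Sum>i\<le>m. c i * ((1/2) ^ w) ^ i)\<bar> < e / 4"
          using indicator_polynomial_approx[of "e / 4" "v j"] e by auto
        let ?P = "\<lambda>w::nat. \<Sum>i\<le>m. c i * ((1/2) ^ w) ^ i :: real"
        have "(\<lambda>n. \<Sum>i\<le>m. c i * (\<integral>\<omega>. H n \<omega> * ((1/2) ^ i) ^ N n j \<omega> \<partial>M n)) \<longlonglongrightarrow> (\<Sum>i\<le>m. c i * (l * exp (- (1 - (1/2) ^ i) * p j)))"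
          by (intro tendsto_intros conv) (auto simp: power_le_one)
        from tendstoD[OF this, of "e / 4"] e
        have "\<forall>\<^sub>F n in sequentially. dist (\<Sum>i\<le>m. c i * (\<integral>\<omega>. H n \<omega> * ((1/2) ^ i) ^ N n j \<omega> \<partial>M n)) (\<Sum>i\<le>m. c i * (l * exp (- (1 - (1/2) ^ i) * p j))) < e / 4" by simp
        then show "\<forall>\<^sub>F n in sequentially. dist (\<integral>\<omega>. F s (Suc j) n \<omega> \<partial>M n) (L s (Suc j)) < e"
          using meas
        proof eventually_elim
          case (elim n)
          then interpret prob_space "M n" by simp
          have [measurable]: "H n \<in> borel_measurable (M n)" "N n j \<in> measurable (M n) (count_space UNIV)" using elim by auto
          have int1: "integrable (M n) (\<lambda>\<omega>. H n \<omega> * ((1/2) ^ i) ^ N n j \<omega>)" for i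
          proof (rule integrable_const_bound[where B=1])
            have "norm (H n \<omega> * ((1/2) ^ i) ^ N n j \<omega>) \<le> 1 * 1" for \<omega>
              unfolding norm_mult using H01[of n \<omega>] by (intro mult_mono) (auto simp: power_le_one)
            then show "AE \<omega> in M n. norm (H n \<omega> * ((1/2) ^ i) ^ N n j \<omega>) \<le> 1" by simp
            have "(\<lambda>\<omega>. ((1/2) ^ i) ^ N n j \<omega> :: real) \<in> borel_measurable (M n)"
              using measurable_compose[of "N n j" "M n" "count_space UNIV" "\<lambda>w. ((1/2) ^ i) ^ w :: real" borel] by simp
            then show "(\<lambda>\<omega>. H n \<omega> * ((1/2) ^ i) ^ N n j \<omega>) \<in> borel_measurable (M n)" by measurable
          qed
          have int2: "integrable (M n) (\<lambda>\<omega>. H n \<omega> * (if N n j \<omega> = v j then 1 else 0))"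
          proof (rule integrable_const_bound[where B=1])
            have "norm (H n \<omega> * (if N n j \<omega> = v j then 1 else 0)) \<le> 1" for \<omega>
              using H01[of n \<omega>] by simp
            then show "AE \<omega> in M n. norm (H n \<omega> * (if N n j \<omega> = v j then 1 else 0)) \<le> 1" by simp
          qed measurable
          have eqP: "(\<Sum>i\<le>m. c i * (\<integral>\<omega>. H n \<omega> * ((1/2) ^ i) ^ N n j \<omega> \<partial>M n)) = (\<integral>\<omega>. H n \<omega> * ?P (N n j \<omega>) \<partial>M n)"
          proof -
            have "(\<integral>\<omega>. H n \<omega> * ?P (N n j \<omega>) \<partial>M n) = (\<integral>\<omega>. (\<Sum>i\<le>m. c i * (H n \<omega> * ((1/2) ^ i) ^ N n j \<omega>)) \<partial>M n)"
              unfolding sum_distrib_left power_power_commute[where i="N n j _"] by (simp only: mult.left_commute)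
            also have "\<dots> = (\<Sum>i\<le>m. c i * (\<integral>\<omega>. H n \<omega> * ((1/2) ^ i) ^ N n j \<omega> \<partial>M n))"
              by (subst Bochner_Integration.integral_sum) (auto intro!: integrable_mult_right int1)
            finally show ?thesis ..
          qed
          have intP: "integrable (M n) (\<lambda>\<omega>. H n \<omega> * ?P (N n j \<omega>))"
          proof -
            have "integrable (M n) (\<lambda>\<omega>. \<Sum>i\<le>m. c i * (H n \<omega> * ((1/2) ^ i) ^ N n j \<omega>))"
              by (intro Bochner_Integration.integrable_sum integrable_mult_right int1)
            then show ?thesis
              unfolding sum_distrib_left power_power_commute[where i="N n j _"] by (simp only: mult.left_commute)
          qed
          have "\<bar>(\<integral>\<omega>. F s (Suc j) n \<omega> \<partial>M n) - (\<integral>\<omega>. H n \<omega> * ?P (N n j \<omega>) \<partial>M n)\<bar>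
            = \<bar>\<integral>\<omega>. H n \<omega> * ((if N n j \<omega> = v j then 1 else 0) - ?P (N n j \<omega>)) \<partial>M n\<bar>"
            unfolding FS using int2 intP by (simp add: right_diff_distrib)
          also have "\<dots> \<le> (\<integral>\<omega>. \<bar>H n \<omega> * ((if N n j \<omega> = v j then 1 else 0) - ?P (N n j \<omega>))\<bar> \<partial>M n)"
            by (rule integral_abs_bound)
          also have "\<dots> \<le> (\<integral>\<omega>. e / 4 \<partial>M n)"
          proof (rule integral_mono)
            show "integrable (M n) (\<lambda>\<omega>. \<bar>H n \<omega> * ((if N n j \<omega> = v j then 1 else 0) - ?P (N n j \<omega>))\<bar>)"
              using Bochner_Integration.integrable_diff[OF int2 intP] by (simp add: right_diff_distrib)
            fix \<omega>
            have "\<bar>H n \<omega>\<bar> * \<bar>(if N n j \<omega> = v j then 1 else 0) - ?P (N n j \<omega>)\<bar> \<le> 1 * (e / 4)"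
              using H01[of n \<omega>] cm[of "N n j \<omega>"] by (intro mult_mono) auto
            then show "\<bar>H n \<omega> * ((if N n j \<omega> = v j then 1 else 0) - ?P (N n j \<omega>))\<bar> \<le> e / 4" by (simp add: abs_mult)
          qed simp
          finally have d1: "\<bar>(\<integral>\<omega>. F s (Suc j) n \<omega> \<partial>M n) - (\<integral>\<omega>. H n \<omega> * ?P (N n j \<omega>) \<partial>M n)\<bar> \<le> e / 4"
            by (simp add: prob_space)
          have "\<bar>L s (Suc j) - (\<Sum>i\<le>m. c i * (l * exp (- (1 - (1/2) ^ i) * p j)))\<bar>
             = l * \<bar>poisson_weight (p j) (v j) - (\<Sum>i\<le>m. c i * exp (- (1 - (1/2) ^ i) * p j))\<bar>"
          proof -
            have "L s (Suc j) - (\<Sum>i\<le>m. c i * (l * exp (- (1 - (1/2) ^ i) * p j)))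
              = l * (poisson_weight (p j) (v j) - (\<Sum>i\<le>m. c i * exp (- (1 - (1/2) ^ i) * p j)))"
              unfolding LS right_diff_distrib sum_distrib_left by (simp add: mult_ac)
            then show ?thesis using l01 by (simp add: abs_mult)
          qed
          also have "\<dots> \<le> 1 * (e / 4)"
            using l01 p jk by (intro mult_mono poisson_weight_polynomial_error cm) auto
          finally show ?case using d1 elim(1) unfolding eqP dist_real_def by linarith
        qed
      qed
    qed
  qed
  have lim: "(\<lambda>n. \<integral>\<omega>. F (\<lambda>_. 1) k n \<omega> \<partial>M n) \<longlonglongrightarrow> (\<Prod>i<k. poisson_weight (p i) (v i))"
    using claim[of k, rule_format, of "\<lambda>_. 1"] by (simp add: L_def)
  have F: "F (\<lambda>_. 1) k n \<omega> = (if \<forall>i<k. N n i \<omega> = v i then 1 else 0)" for n \<omega>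
  proof (cases "\<forall>i<k. N n i \<omega> = v i")
    case False
    then have "(\<Prod>i<k. if N n i \<omega> = v i then 1 else 0 :: real) = 0" by (auto intro!: prod_zero)
    then show ?thesis unfolding F_def using False by simp
  qed (simp add: F_def)
  have "\<forall>\<^sub>F n in sequentially. (\<integral>\<omega>. F (\<lambda>_. 1) k n \<omega> \<partial>M n) = measure (M n) {\<omega> \<in> space (M n). \<forall>i<k. N n i \<omega> = v i}"
    using M N
  proof eventually_elim
    case (elim n)
    then interpret prob_space "M n" by simp
    have "{\<omega> \<in> space (M n). N n i \<omega> = v i} \<in> sets (M n)" if "i \<in> {..<k}" for i
    proof -
      have "N n i \<in> measurable (M n) (count_space UNIV)" using elim that by simp
      then have "N n i -` {v i} \<inter> space (M n) \<in> sets (M n)" by (rule measurable_sets) simp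
      moreover have "N n i -` {v i} \<inter> space (M n) = {\<omega> \<in> space (M n). N n i \<omega> = v i}" by auto
      ultimately show ?thesis by simp
    qed
    then have "{\<omega> \<in> space (M n). \<forall>i\<in>{..<k}. N n i \<omega> = v i} \<in> sets (M n)"
      by (rule sets.sets_Collect_finite_All) auto
    moreover have "{\<omega> \<in> space (M n). \<forall>i\<in>{..<k}. N n i \<omega> = v i} = {\<omega> \<in> space (M n). \<forall>i<k. N n i \<omega> = v i}" by auto
    ultimately have E: "{\<omega> \<in> space (M n). \<forall>i<k. N n i \<omega> = v i} \<in> sets (M n)" by (simp only:)
    define S where "S = {\<omega> \<in> space (M n). \<forall>i<k. N n i \<omega> = v i}"
    have "(\<integral>\<omega>. F (\<lambda>_. 1) k n \<omega> \<partial>M n) = (\<integral>\<omega>. indicator S \<omega> \<partial>M n)"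
    proof (rule Bochner_Integration.integral_cong[OF refl])
      fix \<omega> assume "\<omega> \<in> space (M n)"
      then have "\<omega> \<in> S \<longleftrightarrow> (\<forall>i<k. N n i \<omega> = v i)" unfolding S_def by blast
      then show "F (\<lambda>_. 1) k n \<omega> = indicator S \<omega>" unfolding F indicator_def by (simp only: of_bool_def)
    qed
    also have "\<dots> = measure (M n) (S \<inter> space (M n))" by (rule Bochner_Integration.integral_indicator)
    also have "S \<inter> space (M n) = S" unfolding S_def by blast
    finally show ?case unfolding S_def .
  qed
  with lim show ?thesis by (rule Lim_transform_eventually)
qed

section \<open>Joint moments of the row sums\<close>

text \<open>Expressed by the parameters alone, so that tails computed on the different spaces
  \<open>M n\<close> can be subtracted and passed to the limit.\<close>

definition normal_tail :: "real \<Rightarrow> real \<Rightarrow> real" where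
  "normal_tail \<sigma> c = measure (density lborel (normal_density 0 \<sigma>)) {c<..}"

lemma (in prob_space) normal_tail_eq:
  assumes "distributed M lborel X (normal_density 0 \<sigma>)"
  shows "prob {\<omega> \<in> space M. c < X \<omega>} = normal_tail \<sigma> c"
proof -
  have X: "X \<in> measurable M lborel" and d: "distr M lborel X = density lborel (normal_density 0 \<sigma>)"
    using assms by (auto simp: distributed_def)
  have "measure (distr M lborel X) {c<..} = measure M (X -` {c<..} \<inter> space M)"
    by (rule measure_distr[OF X]) simp
  also have "X -` {c<..} \<inter> space M = {\<omega> \<in> space M. c < X \<omega>}" by auto
  finally show ?thesis by (simp add: normal_tail_def d)
qed

lemma (in prob_space) normal_interval_prob:
  assumes X: "distributed M lborel X (normal_density 0 \<sigma>)" and cd: "c \<le> d"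
  shows "prob {\<omega> \<in> space M. c < X \<omega> \<and> X \<omega> \<le> d} = normal_tail \<sigma> c - normal_tail \<sigma> d"
proof -
  have [measurable]: "X \<in> borel_measurable M" by (rule measurable_distributed_lborel[OF X])
  have "{\<omega> \<in> space M. c < X \<omega> \<and> X \<omega> \<le> d} = {\<omega> \<in> space M. c < X \<omega>} - {\<omega> \<in> space M. d < X \<omega>}" by auto
  also have "prob \<dots> = prob {\<omega> \<in> space M. c < X \<omega>} - prob {\<omega> \<in> space M. d < X \<omega>}"
    using cd by (intro finite_measure_Diff) auto
  finally show ?thesis by (simp add: normal_tail_eq[OF X])
qed

lemma normal_tail_tendsto:
  assumes "\<forall>\<^sub>F n in sequentially. 0 < \<sigma> n"
    and "(\<lambda>n. (1 / \<sigma> n - 1) * (a_seq n)\<^sup>2) \<longlonglongrightarrow> 0"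
    and "(\<lambda>n. a_seq n * (c n - tail_level n x)) \<longlonglongrightarrow> 0"
  shows "(\<lambda>n. real n * normal_tail (\<sigma> n) (c n)) \<longlonglongrightarrow> exp (- x)"
proof -
  let ?M = "\<lambda>n. density lborel (normal_density 0 (\<sigma> n))"
  have id: "distr (?M n) lborel (\<lambda>x. x) = ?M n" for n
    by (rule distr_id2) simp
  have "\<forall>\<^sub>F n in sequentially. prob_space (?M n) \<and> distributed (?M n) lborel (\<lambda>x. x) (normal_density 0 (\<sigma> n)) \<and> 0 < \<sigma> n"
    by (rule eventually_mono[OF assms(1)]) (simp add: distributed_def prob_space_normal_density id)
  from normal_tail_limit[OF this assms(2,3)]
  show ?thesis by (simp add: normal_tail_def greaterThan_def)
qed

text \<open>A test function with weight \<open>w i\<close> on the i-th of consecutive intervals. The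
  margin h enlarges the intervals, or shrinks them if negative, to absorb a shift of the row sums.
  For h = 0 and \<open>w i = 1 - s i\<close>, the product of 1 - \<open>step_fun\<close> over all
  rows is the product of \<open>s i\<close> to the power of the i-th count.\<close>

definition step_fun :: "nat \<Rightarrow> (nat \<Rightarrow> real) \<Rightarrow> (nat \<Rightarrow> real) \<Rightarrow> real \<Rightarrow> real \<Rightarrow> real" where
  "step_fun k w c h d = (\<Sum>i<k. w i * indicator {c i - h<..c (Suc i) + h} d)"

lemma step_fun_measurable [measurable]: "step_fun k w c h \<in> borel_measurable borel"
  unfolding step_fun_def by measurable

lemma step_fun_nonneg: "(\<And>i. 0 \<le> w i) \<Longrightarrow> 0 \<le> step_fun k w c h d"
  unfolding step_fun_def by (intro sum_nonneg mult_nonneg_nonneg) auto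

lemma step_fun_mono:
  assumes w: "\<And>i. 0 \<le> w i" and d: "\<bar>d - y\<bar> \<le> h"
  shows "step_fun k w c h' d \<le> step_fun k w c (h' + h) y"
  unfolding step_fun_def
proof (intro sum_mono mult_left_mono w)
  fix i show "indicator {c i - h'<..c (Suc i) + h'} d \<le> (indicator {c i - (h' + h)<..c (Suc i) + (h' + h)} y :: real)"
    using d by (auto simp: indicator_def)
qed

lemma one_minus_step_fun:
  assumes c: "\<And>i j. i \<le> j \<Longrightarrow> j \<le> k \<Longrightarrow> c i \<le> c j"
  shows "(\<Prod>i<k. if c i < d \<and> d \<le> c (Suc i) then 1 - w i else 1) = 1 - step_fun k w c 0 d"
proof (cases "\<exists>i<k. c i < d \<and> d \<le> c (Suc i)")
  case True
  then obtain i where i: "i < k" "c i < d" "d \<le> c (Suc i)" by blast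
  have uniq: "j = i" if "j < k" "c j < d" "d \<le> c (Suc j)" for j
  proof (rule ccontr)
    assume "j \<noteq> i"
    then consider "Suc j \<le> i" | "Suc i \<le> j" by linarith
    then show False
    proof cases
      case 1
      have "c (Suc j) \<le> c i" by (rule c[OF 1]) (use i(1) in simp)
      then show False using i(2) that(3) by linarith
    next
      case 2
      have "c (Suc i) \<le> c j" by (rule c[OF 2]) (use that(1) in simp)
      then show False using i(3) that(2) by linarith
    qed
  qed
  have "(\<Prod>j<k. if c j < d \<and> d \<le> c (Suc j) then 1 - w j else 1) = (\<Prod>j<k. if j = i then 1 - w j else 1)"
  proof (intro prod.cong refl)
    fix j assume "j \<in> {..<k}"
    then have "c j < d \<and> d \<le> c (Suc j) \<longleftrightarrow> j = i" using uniq i by blast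
    then show "(if c j < d \<and> d \<le> c (Suc j) then 1 - w j else 1) = (if j = i then 1 - w j else 1)"
      by (simp only:)
  qed
  moreover have "step_fun k w c 0 d = (\<Sum>j<k. if j = i then w j else 0)"
    unfolding step_fun_def
  proof (intro sum.cong refl)
    fix j assume "j \<in> {..<k}"
    then have "c j < d \<and> d \<le> c (Suc j) \<longleftrightarrow> j = i" using uniq i by blast
    then show "w j * indicator {c j - 0<..c (Suc j) + 0} d = (if j = i then w j else 0)"
      by (simp add: indicator_def)
  qed
  ultimately show ?thesis using i by simp
next
  case False
  then have "(\<Prod>j<k. if c j < d \<and> d \<le> c (Suc j) then 1 - w j else 1) = 1"
    by (intro prod.neutral) auto
  moreover have "step_fun k w c 0 d = 0"
    unfolding step_fun_def using False by (intro sum.neutral) (auto simp: indicator_def)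
  ultimately show ?thesis by simp
qed

lemma step_fun_le_1:
  assumes c: "\<And>i j. i \<le> j \<Longrightarrow> j \<le> k \<Longrightarrow> c i \<le> c j" and w: "\<And>i. 0 \<le> w i \<and> w i \<le> 1"
  shows "step_fun k w c 0 d \<le> 1"
proof -
  have "0 \<le> (\<Prod>i<k. if c i < d \<and> d \<le> c (Suc i) then 1 - w i else 1)"
    using w by (intro prod_nonneg) auto
  then show ?thesis using one_minus_step_fun[where k=k and c=c and d=d and w=w, OF c] by simp
qed

definition step_mean :: "nat \<Rightarrow> (nat \<Rightarrow> real) \<Rightarrow> (nat \<Rightarrow> real) \<Rightarrow> real \<Rightarrow> real \<Rightarrow> real" where
  "step_mean k w c h \<sigma> = (\<Sum>i<k. w i * (normal_tail \<sigma> (c i - h) - normal_tail \<sigma> (c (Suc i) + h)))"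

lemma (in prob_space) expectation_step_fun:
  assumes X: "distributed M lborel X (normal_density 0 \<sigma>)" and c: "\<And>i. i < k \<Longrightarrow> c i - h \<le> c (Suc i) + h"
  shows "integrable M (\<lambda>\<omega>. step_fun k w c h (X \<omega>))" "expectation (\<lambda>\<omega>. step_fun k w c h (X \<omega>)) = step_mean k w c h \<sigma>"
proof -
  have [measurable]: "X \<in> borel_measurable M" by (rule measurable_distributed_lborel[OF X])
  have int: "integrable M (\<lambda>\<omega>. w i * indicator {c i - h<..c (Suc i) + h} (X \<omega>))" for i
  proof (intro integrable_mult_right integrable_const_bound[where B=1])
    show "AE \<omega> in M. norm (indicator {c i - h<..c (Suc i) + h} (X \<omega>) :: real) \<le> 1" by (simp add: indicator_def)
  qed measurable
  show "integrable M (\<lambda>\<omega>. step_fun k w c h (X \<omega>))"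
    unfolding step_fun_def by (intro Bochner_Integration.integrable_sum int)
  have "expectation (\<lambda>\<omega>. step_fun k w c h (X \<omega>)) = (\<Sum>i<k. expectation (\<lambda>\<omega>. w i * indicator {c i - h<..c (Suc i) + h} (X \<omega>)))"
    unfolding step_fun_def by (intro Bochner_Integration.integral_sum int)
  also have "\<dots> = step_mean k w c h \<sigma>"
    unfolding step_mean_def
  proof (intro sum.cong refl)
    fix i assume "i \<in> {..<k}"
    have "expectation (\<lambda>\<omega>. w i * indicator {c i - h<..c (Suc i) + h} (X \<omega>))
       = w i * expectation (indicator {\<omega> \<in> space M. c i - h < X \<omega> \<and> X \<omega> \<le> c (Suc i) + h})"
      unfolding integral_mult_right_zero
      by (intro arg_cong[where f="\<lambda>x. w i * x"] Bochner_Integration.integral_cong refl) (auto simp: indicator_def)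
    also have "expectation (indicator {\<omega> \<in> space M. c i - h < X \<omega> \<and> X \<omega> \<le> c (Suc i) + h})
       = prob {\<omega> \<in> space M. c i - h < X \<omega> \<and> X \<omega> \<le> c (Suc i) + h}"
      by (subst Bochner_Integration.integral_indicator) (rule arg_cong[where f=prob], blast)
    also have "\<dots> = normal_tail \<sigma> (c i - h) - normal_tail \<sigma> (c (Suc i) + h)"
      using c \<open>i \<in> {..<k}\<close> by (intro normal_interval_prob[OF X]) auto
    finally show "expectation (\<lambda>\<omega>. w i * indicator {c i - h<..c (Suc i) + h} (X \<omega>))
       = w i * (normal_tail \<sigma> (c i - h) - normal_tail \<sigma> (c (Suc i) + h))" .
  qed
  finally show "expectation (\<lambda>\<omega>. step_fun k w c h (X \<omega>)) = step_mean k w c h \<sigma>" .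
qed

section \<open>Approximate independence of finitely many row sums\<close>

context goe_matrix begin

lemma D_normal:
  assumes j: "j < n" shows "distributed M lborel (\<lambda>\<omega>. D \<omega> j) (normal_density 0 (sqrt (1 + 1 / real n)))"
proof -
  let ?J = "upair j ` {..<n}"
  have J: "?J \<subseteq> I" using j by (auto intro!: upair_in_I)
  have "distributed M lborel (\<lambda>\<omega>. \<Sum>p\<in>?J. 1 * X p \<omega>) (normal_density 0 (sqrt (\<Sum>p\<in>?J. 1\<^sup>2 * (sd p)\<^sup>2)))"
    using J n_pos by (intro normal_linear_form_distributed indep_vars_subset[OF indep_X J] X_normal sd_pos) auto
  also have "(\<Sum>p\<in>?J. 1\<^sup>2 * (sd p)\<^sup>2) = (\<Sum>k<n. (1 + (if k = j then 1 else 0)) / real n)"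
    by (subst sum.reindex) (auto simp: inj_on_def upair_eq_iff sd_sq upair_def min_def max_def intro!: sum.cong)
  also have "\<dots> = 1 + 1 / real n"
    using j n_pos by (simp add: sum.distrib add_divide_distrib sum_divide_distrib[symmetric])
  finally show ?thesis by (simp add: D_def sum_row_X)
qed

text \<open>Deleting the mutual entries makes the row sums with index in \<open>R\<close> independent and moves each of
  them by at most \<open>card R * \<alpha>\<close>.\<close>

lemma joint_moment_bounds:
  assumes R: "R \<subseteq> {..<n}" "card R < n" and \<alpha>: "0 < \<alpha>"
    and w: "\<And>i. 0 \<le> w i \<and> w i \<le> 1"
    and c: "\<And>i j. i \<le> j \<Longrightarrow> j \<le> k \<Longrightarrow> c i \<le> c j"
    and gap: "\<And>i. i < k \<Longrightarrow> c i + 2 * (real (card R) * \<alpha>) \<le> c (Suc i)"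
  defines "h \<equiv> real (card R) * \<alpha>" and "\<sigma> \<equiv> sqrt (1 - real (card R) / real n)"
    and "e \<equiv> 2 * (real n)\<^sup>2 * exp (- real n * \<alpha>\<^sup>2 / 4)"
  shows "expectation (\<lambda>\<omega>. \<Prod>l\<in>R. step_fun k w c 0 (D \<omega> l)) \<le> step_mean k w c h \<sigma> ^ card R + e"
    and "step_mean k w c (- h) \<sigma> ^ card R - e \<le> expectation (\<lambda>\<omega>. \<Prod>l\<in>R. step_fun k w c 0 (D \<omega> l))"
    and "integrable M (\<lambda>\<omega>. \<Prod>l\<in>R. step_fun k w c 0 (D \<omega> l))"
proof -
  have fR: "finite R" using R finite_subset by blast
  have h0: "0 \<le> h" using \<alpha> by (simp add: h_def)
  have w0: "\<And>i. 0 \<le> w i" using w by blast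
  obtain B where B: "B \<in> events" "prob B \<le> e"
    "\<And>\<omega> i j. \<omega> \<in> space M - B \<Longrightarrow> i < n \<Longrightarrow> j < n \<Longrightarrow> \<bar>g \<omega> i j\<bar> \<le> \<alpha>"
    using entries_event[OF \<alpha>] unfolding e_def by blast
  define Y where "Y l \<omega> = (\<Sum>k\<in>{..<n}-R. g \<omega> l k)" for l \<omega>
  have Dmeas: "(\<lambda>\<omega>. D \<omega> l) \<in> borel_measurable M" if "l \<in> R" for l
    using that R by (intro measurable_D) auto
  have DY: "\<bar>D \<omega> l - Y l \<omega>\<bar> \<le> h" if \<omega>: "\<omega> \<in> space M - B" and l: "l \<in> R" for \<omega> l
  proof -
    have "D \<omega> l = Y l \<omega> + (\<Sum>k\<in>R. g \<omega> l k)"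
      unfolding D_def Y_def using R(1) by (intro sum.subset_diff) auto
    then have "\<bar>D \<omega> l - Y l \<omega>\<bar> = \<bar>\<Sum>k\<in>R. g \<omega> l k\<bar>" by simp
    also have "\<dots> \<le> (\<Sum>k\<in>R. \<bar>g \<omega> l k\<bar>)" by (rule sum_abs)
    also have "\<dots> \<le> (\<Sum>k\<in>R. \<alpha>)" using \<omega> l R by (intro sum_mono B(3)) auto
    finally show ?thesis by (simp add: h_def)
  qed
  have Yn: "distributed M lborel (Y l) (normal_density 0 \<sigma>)" if "l \<in> R" for l
    unfolding Y_def[abs_def] \<sigma>_def using R that by (intro truncated_row_normal) auto
  have Yind: "indep_vars (\<lambda>_. borel) Y R"
    unfolding Y_def[abs_def] using indep_truncated_rows[OF R(1)] .
  have YE: "expectation (\<lambda>\<omega>. \<Prod>l\<in>R. step_fun k w c h' (Y l \<omega>)) = step_mean k w c h' \<sigma> ^ card R"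
    and Yint: "integrable M (\<lambda>\<omega>. \<Prod>l\<in>R. step_fun k w c h' (Y l \<omega>))"
    if h': "h' = h \<or> h' = - h" for h'
  proof -
    have ok: "c i - h' \<le> c (Suc i) + h'" if "i < k" for i
      using gap[OF that] h' h0 unfolding h_def[symmetric] by auto
    have ind: "indep_vars (\<lambda>_. borel) (\<lambda>l \<omega>. step_fun k w c h' (Y l \<omega>)) R"
      by (intro indep_vars_compose2[OF Yind]) measurable
    have int: "integrable M (\<lambda>\<omega>. step_fun k w c h' (Y l \<omega>))" if "l \<in> R" for l
      by (rule expectation_step_fun(1)[where c=c and k=k and h=h', OF Yn[OF that] ok])
    show "integrable M (\<lambda>\<omega>. \<Prod>l\<in>R. step_fun k w c h' (Y l \<omega>))"
      by (rule indep_vars_integrable[OF fR ind int])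
    have "expectation (\<lambda>\<omega>. \<Prod>l\<in>R. step_fun k w c h' (Y l \<omega>)) = (\<Prod>l\<in>R. expectation (\<lambda>\<omega>. step_fun k w c h' (Y l \<omega>)))"
      by (rule indep_vars_lebesgue_integral[OF fR ind int])
    also have "\<dots> = (\<Prod>l\<in>R. step_mean k w c h' \<sigma>)"
      by (intro prod.cong refl expectation_step_fun(2)[where c=c and k=k and h=h', OF _ ok] Yn)
    finally show "expectation (\<lambda>\<omega>. \<Prod>l\<in>R. step_fun k w c h' (Y l \<omega>)) = step_mean k w c h' \<sigma> ^ card R" by simp
  qed
  have D01: "0 \<le> step_fun k w c 0 d \<and> step_fun k w c 0 d \<le> 1" for d
    using step_fun_nonneg[of w k c 0 d, OF w0] step_fun_le_1[of k c w d, OF c w] by auto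
  have P01: "0 \<le> (\<Prod>l\<in>R. step_fun k w c 0 (D \<omega> l)) \<and> (\<Prod>l\<in>R. step_fun k w c 0 (D \<omega> l)) \<le> 1" for \<omega>
    using D01 by (intro conjI prod_nonneg prod_le_1) auto
  show int: "integrable M (\<lambda>\<omega>. \<Prod>l\<in>R. step_fun k w c 0 (D \<omega> l))"
  proof (rule integrable_const_bound[where B=1])
    show "AE \<omega> in M. norm (\<Prod>l\<in>R. step_fun k w c 0 (D \<omega> l)) \<le> 1" using P01 by (intro AE_I2) simp
    show "(\<lambda>\<omega>. \<Prod>l\<in>R. step_fun k w c 0 (D \<omega> l)) \<in> borel_measurable M"
      by (intro borel_measurable_prod measurable_compose[OF Dmeas step_fun_measurable])
  qed
  have intB: "integrable M (indicator B :: 'a \<Rightarrow> real)"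
    using B(1) by (intro integrable_real_indicator) (auto simp: emeasure_eq_measure)
  have EB: "expectation (indicator B) = prob B" using B(1) sets.sets_into_space[OF B(1)] by (simp add: Int_absorb2)
  have "expectation (\<lambda>\<omega>. \<Prod>l\<in>R. step_fun k w c 0 (D \<omega> l)) \<le> expectation (\<lambda>\<omega>. (\<Prod>l\<in>R. step_fun k w c h (Y l \<omega>)) + indicator B \<omega>)"
  proof (rule integral_mono[OF int])
    show "integrable M (\<lambda>\<omega>. (\<Prod>l\<in>R. step_fun k w c h (Y l \<omega>)) + indicator B \<omega>)"
      using Yint intB by (intro Bochner_Integration.integrable_add) auto
    fix \<omega> assume \<omega>: "\<omega> \<in> space M"
    have n0: "0 \<le> (\<Prod>l\<in>R. step_fun k w c h (Y l \<omega>))" by (intro prod_nonneg ballI step_fun_nonneg w0)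
    show "(\<Prod>l\<in>R. step_fun k w c 0 (D \<omega> l)) \<le> (\<Prod>l\<in>R. step_fun k w c h (Y l \<omega>)) + indicator B \<omega>"
    proof (cases "\<omega> \<in> B")
      case True
      then show ?thesis using P01[of \<omega>] n0 by simp
    next
      case False
      have "(\<Prod>l\<in>R. step_fun k w c 0 (D \<omega> l)) \<le> (\<Prod>l\<in>R. step_fun k w c h (Y l \<omega>))"
      proof (intro prod_mono conjI)
        fix l assume "l \<in> R"
        then show "step_fun k w c 0 (D \<omega> l) \<le> step_fun k w c h (Y l \<omega>)"
          using step_fun_mono[of w "D \<omega> l" "Y l \<omega>" h k c 0, OF w0] DY[of \<omega> l] \<omega> False by simp
      qed (use D01 in auto)
      then show ?thesis using False by simp
    qed
  qed
  also have "\<dots> = step_mean k w c h \<sigma> ^ card R + prob B"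
    using Yint[of h] intB YE[of h] EB by (subst Bochner_Integration.integral_add) auto
  finally show "expectation (\<lambda>\<omega>. \<Prod>l\<in>R. step_fun k w c 0 (D \<omega> l)) \<le> step_mean k w c h \<sigma> ^ card R + e"
    using B(2) by linarith
  have "expectation (\<lambda>\<omega>. \<Prod>l\<in>R. step_fun k w c (- h) (Y l \<omega>)) \<le> expectation (\<lambda>\<omega>. (\<Prod>l\<in>R. step_fun k w c 0 (D \<omega> l)) + indicator B \<omega>)"
  proof (rule integral_mono)
    show "integrable M (\<lambda>\<omega>. \<Prod>l\<in>R. step_fun k w c (- h) (Y l \<omega>))" by (rule Yint) simp
    show "integrable M (\<lambda>\<omega>. (\<Prod>l\<in>R. step_fun k w c 0 (D \<omega> l)) + indicator B \<omega>)"
      using int intB by (rule Bochner_Integration.integrable_add)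
    fix \<omega> assume \<omega>: "\<omega> \<in> space M"
    show "(\<Prod>l\<in>R. step_fun k w c (- h) (Y l \<omega>)) \<le> (\<Prod>l\<in>R. step_fun k w c 0 (D \<omega> l)) + indicator B \<omega>"
    proof (cases "\<omega> \<in> B")
      case True
      have le: "step_fun k w c (- h) y \<le> step_fun k w c 0 y" for y
        using step_fun_mono[of w y y h k c "- h", OF w0] h0 by simp
      have "(\<Prod>l\<in>R. step_fun k w c (- h) (Y l \<omega>)) \<le> 1"
        by (intro prod_le_1 conjI step_fun_nonneg w0 order_trans[OF le D01[THEN conjunct2]])
      then show ?thesis using True P01[of \<omega>] by simp
    next
      case False
      have "(\<Prod>l\<in>R. step_fun k w c (- h) (Y l \<omega>)) \<le> (\<Prod>l\<in>R. step_fun k w c 0 (D \<omega> l))"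
      proof (intro prod_mono conjI step_fun_nonneg w0)
        fix l assume "l \<in> R"
        then show "step_fun k w c (- h) (Y l \<omega>) \<le> step_fun k w c 0 (D \<omega> l)"
          using step_fun_mono[of w "Y l \<omega>" "D \<omega> l" h k c "- h", OF w0] DY[of \<omega> l] \<omega> False
          by (simp add: abs_minus_commute)
      qed
      then show ?thesis using False by simp
    qed
  qed
  also have "\<dots> = expectation (\<lambda>\<omega>. \<Prod>l\<in>R. step_fun k w c 0 (D \<omega> l)) + prob B"
    using int intB EB by (subst Bochner_Integration.integral_add) auto
  finally show "step_mean k w c (- h) \<sigma> ^ card R - e \<le> expectation (\<lambda>\<omega>. \<Prod>l\<in>R. step_fun k w c 0 (D \<omega> l))"
    using B(2) YE[of "- h"] by simp
qed

end

section \<open>Limits of factorial moments and of the joint counts\<close>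

lemma binomial_over_power_tendsto: "(\<lambda>n. real (n choose r) / real n ^ r) \<longlonglongrightarrow> 1 / fact r"
proof -
  have "(\<lambda>n. (\<Prod>i<r. 1 - real i / real n) / fact r) \<longlonglongrightarrow> (\<Prod>i<r. 1 - 0) / fact r"
    by (intro tendsto_intros tendsto_divide_0[OF tendsto_const] filterlim_at_top_imp_at_infinity filterlim_real_sequentially) auto
  moreover have "\<forall>\<^sub>F n in sequentially. (\<Prod>i<r. 1 - real i / real n) / fact r = real (n choose r) / real n ^ r"
    using eventually_gt_at_top[of 0]
  proof eventually_elim
    case (elim n)
    have "real (n choose r) = (\<Prod>i<r. real n - real i) / fact r"
      unfolding binomial_gbinomial gbinomial_prod_rev lessThan_atLeast0 ..
    also have "(\<Prod>i<r. real n - real i) = (\<Prod>i<r. real n * (1 - real i / real n))"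
      using elim by (intro prod.cong refl) (simp add: field_simps)
    also have "\<dots> = real n ^ r * (\<Prod>i<r. 1 - real i / real n)" by (simp add: prod.distrib)
    finally show ?case using elim by simp
  qed
  ultimately have "(\<lambda>n. real (n choose r) / real n ^ r) \<longlonglongrightarrow> (\<Prod>i<r. 1 - 0) / fact r"
    by (rule Lim_transform_eventually)
  then show ?thesis by simp
qed

lemma tail_level_diff: "0 < a_seq n \<Longrightarrow> a_seq n * (tail_level n y - tail_level n x) = y - x"
  by (simp add: tail_level_def field_simps)

definition entry_bound :: "nat \<Rightarrow> real" where
  "entry_bound n = ln (real n) / sqrt (real n)"

lemma entry_bound_tendsto: "(\<lambda>n. a_seq n * (r * entry_bound n)) \<longlonglongrightarrow> 0"
  unfolding a_seq_def entry_bound_def by real_asymp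

text \<open>Summing over the roughly n^r index sets multiplies the exceptional probability by n^r,
  and exp (- (log n)^2 / 4) beats every power of n.\<close>

lemma entry_event_power_tendsto:
  "(\<lambda>n. real n ^ r * (2 * (real n)\<^sup>2 * exp (- real n * (entry_bound n)\<^sup>2 / 4))) \<longlonglongrightarrow> 0"
  unfolding entry_bound_def by real_asymp

lemma truncated_sd_tendsto: "(\<lambda>n. (1 / sqrt (1 - r / real n) - 1) * (a_seq n)\<^sup>2) \<longlonglongrightarrow> 0"
  unfolding a_seq_def by real_asymp

lemma full_sd_tendsto: "(\<lambda>n. (1 / sqrt (1 + 1 / real n) - 1) * (a_seq n)\<^sup>2) \<longlonglongrightarrow> 0"
  unfolding a_seq_def by real_asymp

lemma c_seq_shift_tail_level:
  assumes "(\<lambda>n. a_seq n * h n) \<longlonglongrightarrow> 0"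
  shows "(\<lambda>n. a_seq n * ((c_seq n x + h n) - tail_level n x)) \<longlonglongrightarrow> 0"
  using tendsto_add[OF c_seq_tail_level[of x] assms] by (simp add: algebra_simps)

lemma step_mean_tendsto:
  assumes h: "(\<lambda>n. a_seq n * h n) \<longlonglongrightarrow> 0"
    and \<sigma>: "\<forall>\<^sub>F n in sequentially. 0 < \<sigma> n" "(\<lambda>n. (1 / \<sigma> n - 1) * (a_seq n)\<^sup>2) \<longlonglongrightarrow> 0"
  shows "(\<lambda>n. real n * step_mean k w (\<lambda>i. c_seq n (t i)) (h n) (\<sigma> n))
    \<longlonglongrightarrow> (\<Sum>i<k. w i * (exp (- t i) - exp (- t (Suc i))))"
proof -
  have hm: "(\<lambda>n. a_seq n * (- h n)) \<longlonglongrightarrow> 0" using tendsto_minus[OF h] by simp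
  have "(\<lambda>n. \<Sum>i<k. w i * (real n * normal_tail (\<sigma> n) (c_seq n (t i) + - h n) - real n * normal_tail (\<sigma> n) (c_seq n (t (Suc i)) + h n)))
    \<longlonglongrightarrow> (\<Sum>i<k. w i * (exp (- t i) - exp (- t (Suc i))))"
    by (intro tendsto_intros normal_tail_tendsto \<sigma> c_seq_shift_tail_level h hm)
  then show ?thesis by (simp add: step_mean_def sum_distrib_left algebra_simps)
qed

lemma eventually_c_seq_gap:
  assumes t: "\<And>i. i < k \<Longrightarrow> t i < t (Suc i)" and h: "(\<lambda>n. a_seq n * h n) \<longlonglongrightarrow> 0"
  shows "\<forall>\<^sub>F n in sequentially. \<forall>i<k. c_seq n (t i) + 2 * h n \<le> c_seq n (t (Suc i))"
proof -
  have "\<forall>\<^sub>F n in sequentially. c_seq n (t i) + 2 * h n \<le> c_seq n (t (Suc i))" if i: "i < k" for i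
  proof -
    have "(\<lambda>n. a_seq n * (c_seq n (t (Suc i)) - tail_level n (t (Suc i))) - a_seq n * (c_seq n (t i) - tail_level n (t i))
        - 2 * (a_seq n * h n)) \<longlonglongrightarrow> 0 - 0 - 2 * 0"
      by (intro tendsto_intros c_seq_tail_level h)
    then have "\<forall>\<^sub>F n in sequentially. a_seq n * (c_seq n (t (Suc i)) - tail_level n (t (Suc i))) - a_seq n * (c_seq n (t i) - tail_level n (t i))
        - 2 * (a_seq n * h n) > - (t (Suc i) - t i)"
      using t[OF i] by (intro order_tendstoD) auto
    then show ?thesis using eventually_a_seq_pos
    proof eventually_elim
      case (elim n)
      have "0 < a_seq n * (c_seq n (t (Suc i)) - c_seq n (t i) - 2 * h n)"
        using elim tail_level_diff[of n "t (Suc i)" "t i"] by (simp add: algebra_simps)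
      then show ?case using elim(2) by (simp add: zero_less_mult_iff)
    qed
  qed
  then have "\<forall>\<^sub>F n in sequentially. \<forall>i\<in>{..<k}. c_seq n (t i) + 2 * h n \<le> c_seq n (t (Suc i))"
    by (intro eventually_ball_finite) auto
  then show ?thesis by (rule eventually_mono) auto
qed

lemma mono_upto:
  fixes c :: "nat \<Rightarrow> real"
  assumes "\<And>i. i < k \<Longrightarrow> c i \<le> c (Suc i)" "i \<le> j" "j \<le> k"
  shows "c i \<le> c j"
  using assms(2,3)
proof (induction j rule: dec_induct)
  case (step m)
  then show ?case using assms(1)[of m] by simp
qed simp

context
  fixes M :: "nat \<Rightarrow> 'a measure" and A :: "nat \<Rightarrow> 'a \<Rightarrow> real mat"
  assumes GOE: "\<And>n. n \<ge> 1 \<Longrightarrow> GOE n (M n) (A n)"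
begin

abbreviation (input) DD :: "nat \<Rightarrow> 'a \<Rightarrow> nat \<Rightarrow> real" where "DD n \<equiv> goe_matrix.D n (A n)"

context
  fixes k :: nat and t :: "nat \<Rightarrow> real"
  assumes t: "\<And>i. i < k \<Longrightarrow> t i < t (Suc i)"
begin

lemma eventually_gap:
  assumes "(\<lambda>n. a_seq n * h n) \<longlonglongrightarrow> 0"
  shows "\<forall>\<^sub>F n in sequentially. \<forall>i<k. c_seq n (t i) + 2 * h n \<le> c_seq n (t (Suc i))"
  by (rule eventually_c_seq_gap[OF _ assms]) (rule t)

lemma eventually_c_seq_mono:
  "\<forall>\<^sub>F n in sequentially. \<forall>i j. i \<le> j \<longrightarrow> j \<le> k \<longrightarrow> c_seq n (t i) \<le> c_seq n (t j)"
proof -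
  have "(\<lambda>n. a_seq n * 0) \<longlonglongrightarrow> 0" by simp
  from eventually_gap[OF this] show ?thesis
  proof (rule eventually_mono)
    fix n assume n: "\<forall>i<k. c_seq n (t i) + 2 * 0 \<le> c_seq n (t (Suc i))"
    show "\<forall>i j. i \<le> j \<longrightarrow> j \<le> k \<longrightarrow> c_seq n (t i) \<le> c_seq n (t j)"
    proof (intro allI impI)
      fix i j assume ij: "i \<le> j" "j \<le> k"
      show "c_seq n (t i) \<le> c_seq n (t j)"
        by (rule mono_upto[of k "\<lambda>i. c_seq n (t i)", OF _ ij]) (use n in simp)
    qed
  qed
qed

text \<open>There are n choose r index sets, asymptotically n^r / r!. Each expectation lies between
  powers of two single-row means with enlarged and shrunk intervals, up to the exceptional
  probability, and n times either mean tends to q.\<close>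

lemma esym_integral_tendsto:
  assumes w: "\<And>i. 0 \<le> w i \<and> w i \<le> 1"
  defines "f \<equiv> \<lambda>n \<omega> l. step_fun k w (\<lambda>i. c_seq n (t i)) 0 (DD n \<omega> l)"
  shows "(\<lambda>n. \<integral>\<omega>. esym {..<n} (f n \<omega>) r \<partial>M n) \<longlonglongrightarrow> (\<Sum>i<k. w i * (exp (- t i) - exp (- t (Suc i)))) ^ r / fact r"
    and "\<forall>\<^sub>F n in sequentially. integrable (M n) (\<lambda>\<omega>. esym {..<n} (f n \<omega>) r)"
proof -
  define q where "q = (\<Sum>i<k. w i * (exp (- t i) - exp (- t (Suc i))))"
  define h where "h n = real r * entry_bound n" for n
  define \<sigma> where "\<sigma> n = sqrt (1 - real r / real n)" for n
  define e where "e n = 2 * (real n)\<^sup>2 * exp (- real n * (entry_bound n)\<^sup>2 / 4)" for n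
  have h0: "(\<lambda>n. a_seq n * h n) \<longlonglongrightarrow> 0" unfolding h_def by (rule entry_bound_tendsto)
  then have hm0: "(\<lambda>n. a_seq n * (- h n)) \<longlonglongrightarrow> 0" using tendsto_minus[OF h0] by simp
  have \<sigma>: "\<forall>\<^sub>F n in sequentially. 0 < \<sigma> n"
    using eventually_gt_at_top[of r] by eventually_elim (simp add: \<sigma>_def)
  have \<sigma>': "(\<lambda>n. (1 / \<sigma> n - 1) * (a_seq n)\<^sup>2) \<longlonglongrightarrow> 0" unfolding \<sigma>_def by (rule truncated_sd_tendsto)
  let ?m = "\<lambda>h n. step_mean k w (\<lambda>i. c_seq n (t i)) (h n) (\<sigma> n)"
  have mp: "(\<lambda>n. real n * ?m h n) \<longlonglongrightarrow> q" unfolding q_def by (rule step_mean_tendsto[OF h0 \<sigma> \<sigma>'])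
  have mm: "(\<lambda>n. real n * ?m (\<lambda>n. - h n) n) \<longlonglongrightarrow> q" unfolding q_def by (rule step_mean_tendsto[OF hm0 \<sigma> \<sigma>'])
  have e0: "(\<lambda>n. real n ^ r * e n) \<longlonglongrightarrow> 0" unfolding e_def by (rule entry_event_power_tendsto)
  have bounds: "\<forall>\<^sub>F n in sequentially.
      integrable (M n) (\<lambda>\<omega>. esym {..<n} (f n \<omega>) r) \<and>
      (\<integral>\<omega>. esym {..<n} (f n \<omega>) r \<partial>M n) \<le> real (n choose r) / real n ^ r * ((real n * ?m h n) ^ r + real n ^ r * e n) \<and>
      real (n choose r) / real n ^ r * ((real n * ?m (\<lambda>n. - h n) n) ^ r - real n ^ r * e n) \<le> (\<integral>\<omega>. esym {..<n} (f n \<omega>) r \<partial>M n)"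
    using eventually_gap[OF h0] eventually_c_seq_mono eventually_gt_at_top[of r] eventually_gt_at_top[of 1]
  proof eventually_elim
    case (elim n)
    interpret goe_matrix "M n" n "A n" using GOE[of n] elim by (intro goe_matrixI) auto
    have \<alpha>: "0 < entry_bound n" using elim by (simp add: entry_bound_def)
    let ?R = "{R. R \<subseteq> {..<n} \<and> card R = r}"
    have cR: "card ?R = n choose r" by (simp add: n_subsets)
    have jm: "expectation (\<lambda>\<omega>. \<Prod>l\<in>R. f n \<omega> l) \<le> ?m h n ^ r + e n"
       "?m (\<lambda>n. - h n) n ^ r - e n \<le> expectation (\<lambda>\<omega>. \<Prod>l\<in>R. f n \<omega> l)"
       "integrable (M n) (\<lambda>\<omega>. \<Prod>l\<in>R. f n \<omega> l)" if R: "R \<in> ?R" for R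
    proof -
      have R': "R \<subseteq> {..<n}" "card R < n" "card R = r" using R elim by auto
      have gap: "c_seq n (t i) + 2 * (real (card R) * entry_bound n) \<le> c_seq n (t (Suc i))" if "i < k" for i
        using elim(1) that R' by (simp add: h_def)
      have mono: "c_seq n (t i) \<le> c_seq n (t j)" if "i \<le> j" "j \<le> k" for i j using elim(2) that by blast
      note j = joint_moment_bounds[where k=k and w=w and c="\<lambda>i. c_seq n (t i)", OF R'(1,2) \<alpha> w mono gap]
      show "expectation (\<lambda>\<omega>. \<Prod>l\<in>R. f n \<omega> l) \<le> ?m h n ^ r + e n"
        using j(1) unfolding f_def h_def \<sigma>_def e_def R'(3) by simp
      show "?m (\<lambda>n. - h n) n ^ r - e n \<le> expectation (\<lambda>\<omega>. \<Prod>l\<in>R. f n \<omega> l)"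
        using j(2) unfolding f_def h_def \<sigma>_def e_def R'(3) by simp
      show "integrable (M n) (\<lambda>\<omega>. \<Prod>l\<in>R. f n \<omega> l)" using j(3) unfolding f_def by simp
    qed
    have E: "(\<integral>\<omega>. esym {..<n} (f n \<omega>) r \<partial>M n) = (\<Sum>R\<in>?R. expectation (\<lambda>\<omega>. \<Prod>l\<in>R. f n \<omega> l))"
      unfolding esym_def by (rule Bochner_Integration.integral_sum) (rule jm(3))
    have "integrable (M n) (\<lambda>\<omega>. esym {..<n} (f n \<omega>) r)"
      unfolding esym_def by (rule Bochner_Integration.integrable_sum) (rule jm(3))
    moreover have "(\<Sum>R\<in>?R. expectation (\<lambda>\<omega>. \<Prod>l\<in>R. f n \<omega> l)) \<le> real (card ?R) * (?m h n ^ r + e n)"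
      by (rule sum_bounded_above) (rule jm(1))
    moreover have "real (card ?R) * (?m (\<lambda>n. - h n) n ^ r - e n) \<le> (\<Sum>R\<in>?R. expectation (\<lambda>\<omega>. \<Prod>l\<in>R. f n \<omega> l))"
      by (rule sum_bounded_below) (rule jm(2))
    moreover have "real (card ?R) * (a ^ r + b) = real (n choose r) / real n ^ r * ((real n * a) ^ r + real n ^ r * b)" for a b
      unfolding cR using elim by (simp add: power_mult_distrib distrib_left)
    moreover have "real (card ?R) * (a ^ r - b) = real (n choose r) / real n ^ r * ((real n * a) ^ r - real n ^ r * b)" for a b
      unfolding cR using elim by (simp add: power_mult_distrib right_diff_distrib)
    ultimately show ?case unfolding E by (simp only: simp_thms)
  qed
  then show "\<forall>\<^sub>F n in sequentially. integrable (M n) (\<lambda>\<omega>. esym {..<n} (f n \<omega>) r)" by (rule eventually_mono) (elim conjE, assumption)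
  define U where "U n = real (n choose r) / real n ^ r * ((real n * ?m h n) ^ r + real n ^ r * e n)" for n
  define V where "V n = real (n choose r) / real n ^ r * ((real n * ?m (\<lambda>n. - h n) n) ^ r - real n ^ r * e n)" for n
  have "U \<longlonglongrightarrow> 1 / fact r * (q ^ r + 0)"
    unfolding U_def by (intro tendsto_intros binomial_over_power_tendsto mp e0)
  then have U: "U \<longlonglongrightarrow> q ^ r / fact r" by simp
  have "V \<longlonglongrightarrow> 1 / fact r * (q ^ r - 0)"
    unfolding V_def by (intro tendsto_intros binomial_over_power_tendsto mm e0)
  then have V: "V \<longlonglongrightarrow> q ^ r / fact r" by simp
  have ub: "\<forall>\<^sub>F n in sequentially. (\<integral>\<omega>. esym {..<n} (f n \<omega>) r \<partial>M n) \<le> U n"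
    using bounds unfolding U_def by (rule eventually_mono) (elim conjE, assumption)
  have lb: "\<forall>\<^sub>F n in sequentially. V n \<le> (\<integral>\<omega>. esym {..<n} (f n \<omega>) r \<partial>M n)"
    using bounds unfolding V_def by (rule eventually_mono) (elim conjE, assumption)
  have "(\<lambda>n. \<integral>\<omega>. esym {..<n} (f n \<omega>) r \<partial>M n) \<longlonglongrightarrow> q ^ r / fact r"
    by (rule tendsto_sandwich[OF lb ub V U])
  then show "(\<lambda>n. \<integral>\<omega>. esym {..<n} (f n \<omega>) r \<partial>M n) \<longlonglongrightarrow> (\<Sum>i<k. w i * (exp (- t i) - exp (- t (Suc i)))) ^ r / fact r"
    by (simp add: q_def)
qed

lemma avoidance_tendsto:
  assumes w: "\<And>i. 0 \<le> w i \<and> w i \<le> 1"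
  shows "(\<lambda>n. \<integral>\<omega>. (\<Prod>l<n. 1 - step_fun k w (\<lambda>i. c_seq n (t i)) 0 (DD n \<omega> l)) \<partial>M n)
    \<longlonglongrightarrow> exp (- (\<Sum>i<k. w i * (exp (- t i) - exp (- t (Suc i)))))"
proof (rule avoidance_limit_of_esym)
  let ?f = "\<lambda>n \<omega> l. step_fun k w (\<lambda>i. c_seq n (t i)) 0 (DD n \<omega> l)"
  show "(\<lambda>n. \<integral>\<omega>. esym {..<n} (?f n \<omega>) r \<partial>M n) \<longlonglongrightarrow> (\<Sum>i<k. w i * (exp (- t i) - exp (- t (Suc i)))) ^ r / fact r" for r
    by (rule esym_integral_tendsto(1)[OF w])
  have int_all: "\<forall>\<^sub>F n in sequentially. \<forall>r. integrable (M n) (\<lambda>\<omega>. esym {..<n} (?f n \<omega>) r)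
     \<and> integrable (M n) (\<lambda>\<omega>. \<Prod>l<n. 1 - ?f n \<omega> l) \<and> (\<forall>\<omega> l. 0 \<le> ?f n \<omega> l \<and> ?f n \<omega> l \<le> 1)"
    using eventually_c_seq_mono eventually_gt_at_top[of 0]
  proof eventually_elim
    case (elim n)
    interpret goe_matrix "M n" n "A n" using GOE[of n] elim by (intro goe_matrixI) auto
    have f01: "0 \<le> ?f n \<omega> l \<and> ?f n \<omega> l \<le> 1" for \<omega> l
      using step_fun_nonneg[of w] step_fun_le_1[where k=k and w=w and c="\<lambda>i. c_seq n (t i)"] w elim(1) by blast
    have m: "(\<lambda>\<omega>. ?f n \<omega> l) \<in> borel_measurable (M n)" if "l < n" for l
      by (rule measurable_compose[OF measurable_D[OF that] step_fun_measurable])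
    have "integrable (M n) (\<lambda>\<omega>. \<Prod>l\<in>R. ?f n \<omega> l)" if R: "R \<subseteq> {..<n}" for R
    proof (rule integrable_const_bound[where B=1])
      have "0 \<le> (\<Prod>l\<in>R. ?f n \<omega> l) \<and> (\<Prod>l\<in>R. ?f n \<omega> l) \<le> 1" for \<omega>
        by (intro conjI prod_nonneg prod_le_1 ballI f01 f01[THEN conjunct1])
      then show "AE \<omega> in M n. norm (\<Prod>l\<in>R. ?f n \<omega> l) \<le> 1" by (intro AE_I2) simp
      show "(\<lambda>\<omega>. \<Prod>l\<in>R. ?f n \<omega> l) \<in> borel_measurable (M n)" by (intro borel_measurable_prod m) (use R in auto)
    qed
    then have "integrable (M n) (\<lambda>\<omega>. esym {..<n} (?f n \<omega>) r)" for r
      unfolding esym_def by (intro Bochner_Integration.integrable_sum) auto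
    moreover have "integrable (M n) (\<lambda>\<omega>. \<Prod>l<n. 1 - ?f n \<omega> l)"
    proof (rule integrable_const_bound[where B=1])
      have "0 \<le> (\<Prod>l<n. 1 - ?f n \<omega> l) \<and> (\<Prod>l<n. 1 - ?f n \<omega> l) \<le> 1" for \<omega>
        using f01 by (intro conjI prod_nonneg prod_le_1) auto
      then show "AE \<omega> in M n. norm (\<Prod>l<n. 1 - ?f n \<omega> l) \<le> 1" by (intro AE_I2) simp
      show "(\<lambda>\<omega>. \<Prod>l<n. 1 - ?f n \<omega> l) \<in> borel_measurable (M n)"
        by (intro borel_measurable_prod borel_measurable_diff borel_measurable_const m) auto
    qed
    ultimately show ?case using f01 by blast
  qed
  have part: "(\<integral>\<omega>. esym_partial {..<n} (?f n \<omega>) j \<partial>M n) = (\<Sum>r\<le>j. (- 1) ^ r * (\<integral>\<omega>. esym {..<n} (?f n \<omega>) r \<partial>M n))"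
    and parti: "integrable (M n) (\<lambda>\<omega>. esym_partial {..<n} (?f n \<omega>) j)"
    if "\<forall>r. integrable (M n) (\<lambda>\<omega>. esym {..<n} (?f n \<omega>) r)" for n j
    using that unfolding esym_partial_def
    by (simp_all add: Bochner_Integration.integral_sum Bochner_Integration.integrable_sum)
  show "\<forall>\<^sub>F n in sequentially. \<forall>j. even j \<longrightarrow> (\<integral>\<omega>. (\<Prod>l<n. 1 - ?f n \<omega> l) \<partial>M n)
      \<le> (\<Sum>r\<le>j. (- 1) ^ r * (\<integral>\<omega>. esym {..<n} (?f n \<omega>) r \<partial>M n))"
    using int_all
  proof eventually_elim
    case (elim n)
    show ?case
    proof (intro allI impI)
      fix j :: nat assume "even j"
      then show "(\<integral>\<omega>. (\<Prod>l<n. 1 - ?f n \<omega> l) \<partial>M n) \<le> (\<Sum>r\<le>j. (- 1) ^ r * (\<integral>\<omega>. esym {..<n} (?f n \<omega>) r \<partial>M n))"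
        using elim bonferroni[of "{..<n}"] by (subst part[symmetric]) (auto intro!: integral_mono parti)
    qed
  qed
  show "\<forall>\<^sub>F n in sequentially. \<forall>j. odd j \<longrightarrow> (\<Sum>r\<le>j. (- 1) ^ r * (\<integral>\<omega>. esym {..<n} (?f n \<omega>) r \<partial>M n))
      \<le> (\<integral>\<omega>. (\<Prod>l<n. 1 - ?f n \<omega> l) \<partial>M n)"
    using int_all
  proof eventually_elim
    case (elim n)
    show ?case
    proof (intro allI impI)
      fix j :: nat assume "odd j"
      then show "(\<Sum>r\<le>j. (- 1) ^ r * (\<integral>\<omega>. esym {..<n} (?f n \<omega>) r \<partial>M n)) \<le> (\<integral>\<omega>. (\<Prod>l<n. 1 - ?f n \<omega> l) \<partial>M n)"
        using elim bonferroni[of "{..<n}"] by (subst part[symmetric]) (auto intro!: integral_mono parti)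
    qed
  qed
qed

text \<open>Regrouping the product over rows by intervals turns the avoidance functional into the
  joint generating function of the counts, with weights 1 - \<open>s i\<close>.\<close>

lemma row_sum_counts_tendsto:
  "(\<lambda>n. measure (M n) {\<omega> \<in> space (M n). \<forall>i<k. card {l. l < n \<and> c_seq n (t i) < DD n \<omega> l \<and> DD n \<omega> l \<le> c_seq n (t (Suc i))} = v i})
    \<longlonglongrightarrow> (\<Prod>i<k. poisson_weight (exp (- t i) - exp (- t (Suc i))) (v i))"
proof (rule pgf_to_point_probabilities)
  let ?P = "\<lambda>n i \<omega> l. c_seq n (t i) < DD n \<omega> l \<and> DD n \<omega> l \<le> c_seq n (t (Suc i))"
  show "\<forall>\<^sub>F n in sequentially. prob_space (M n)"
    using eventually_gt_at_top[of 0] by eventually_elim (use GOE in \<open>auto simp: GOE_def\<close>)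
  show "\<forall>\<^sub>F n in sequentially. \<forall>i<k. (\<lambda>\<omega>. card {l. l < n \<and> ?P n i \<omega> l}) \<in> measurable (M n) (count_space UNIV)"
    using eventually_gt_at_top[of 0]
  proof eventually_elim
    case (elim n)
    interpret goe_matrix "M n" n "A n" using GOE[of n] elim by (intro goe_matrixI) auto
    have "(\<lambda>\<omega>. card {l. l < n \<and> ?P n i \<omega> l}) \<in> measurable (M n) (count_space UNIV)" for i
    proof -
      have "(\<lambda>\<omega>. \<Sum>l<n. indicator {c_seq n (t i)<..c_seq n (t (Suc i))} (D \<omega> l) :: real) \<in> borel_measurable (M n)"
        by (intro borel_measurable_sum measurable_compose[OF measurable_D borel_measurable_indicator]) auto
      moreover have "real (card {l. l < n \<and> ?P n i \<omega> l}) = (\<Sum>l<n. indicator {c_seq n (t i)<..c_seq n (t (Suc i))} (D \<omega> l))" for \<omega>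
      proof -
        have "(\<Sum>l<n. indicator {c_seq n (t i)<..c_seq n (t (Suc i))} (D \<omega> l) :: real) = (\<Sum>l\<in>{l \<in> {..<n}. ?P n i \<omega> l}. 1)"
          by (rule sum.mono_neutral_cong_right) (auto simp: indicator_def)
        then show ?thesis by simp
      qed
      ultimately have m: "(\<lambda>\<omega>. real (card {l. l < n \<and> ?P n i \<omega> l})) \<in> borel_measurable (M n)" by simp
      show ?thesis
      proof (subst measurable_count_space_eq_countable)
        show "countable (UNIV :: nat set)" by simp
        have "(\<lambda>\<omega>. card {l. l < n \<and> ?P n i \<omega> l}) -` {a} \<inter> space (M n) \<in> sets (M n)" for a
        proof -
          have "(\<lambda>\<omega>. real (card {l. l < n \<and> ?P n i \<omega> l})) -` {real a} \<inter> space (M n) \<in> sets (M n)"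
            using m by (rule measurable_sets) simp
          then show ?thesis by (simp add: vimage_def)
        qed
        then show "(\<lambda>\<omega>. card {l. l < n \<and> ?P n i \<omega> l}) \<in> space (M n) \<rightarrow> UNIV \<and>
          (\<forall>a\<in>UNIV. (\<lambda>\<omega>. card {l. l < n \<and> ?P n i \<omega> l}) -` {a} \<inter> space (M n) \<in> sets (M n))" by simp
      qed
    qed
    then show ?case by blast
  qed
  show "0 \<le> exp (- t i) - exp (- t (Suc i))" if "i < k" for i using t[OF that] by simp
  fix s :: "nat \<Rightarrow> real" assume s: "\<And>i. 0 \<le> s i \<and> s i \<le> 1"
  define w where "w i = 1 - s i" for i
  have w: "0 \<le> w i \<and> w i \<le> 1" for i using s[of i] by (simp add: w_def)
  have "(\<lambda>n. \<integral>\<omega>. (\<Prod>l<n. 1 - step_fun k w (\<lambda>i. c_seq n (t i)) 0 (DD n \<omega> l)) \<partial>M n)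
    \<longlonglongrightarrow> exp (- (\<Sum>i<k. w i * (exp (- t i) - exp (- t (Suc i)))))"
    by (rule avoidance_tendsto[OF w])
  also have "exp (- (\<Sum>i<k. w i * (exp (- t i) - exp (- t (Suc i))))) = (\<Prod>i<k. exp (- (1 - s i) * (exp (- t i) - exp (- t (Suc i)))))"
    unfolding w_def exp_sum[OF finite_lessThan, symmetric] sum_negf[symmetric]
    by (intro arg_cong[where f=exp] sum.cong refl) (simp only: minus_mult_left)
  finally have lim: "(\<lambda>n. \<integral>\<omega>. (\<Prod>l<n. 1 - step_fun k w (\<lambda>i. c_seq n (t i)) 0 (DD n \<omega> l)) \<partial>M n)
    \<longlonglongrightarrow> (\<Prod>i<k. exp (- (1 - s i) * (exp (- t i) - exp (- t (Suc i)))))" .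
  have "\<forall>\<^sub>F n in sequentially. (\<integral>\<omega>. (\<Prod>l<n. 1 - step_fun k w (\<lambda>i. c_seq n (t i)) 0 (DD n \<omega> l)) \<partial>M n)
     = (\<integral>\<omega>. (\<Prod>i<k. s i ^ card {l. l < n \<and> ?P n i \<omega> l}) \<partial>M n)"
    using eventually_c_seq_mono
  proof eventually_elim
    case (elim n)
    have "(\<Prod>l<n. 1 - step_fun k w (\<lambda>i. c_seq n (t i)) 0 (DD n \<omega> l)) = (\<Prod>i<k. s i ^ card {l. l < n \<and> ?P n i \<omega> l})" for \<omega>
    proof -
      have "(\<Prod>l<n. 1 - step_fun k w (\<lambda>i. c_seq n (t i)) 0 (DD n \<omega> l)) = (\<Prod>l<n. \<Prod>i<k. if ?P n i \<omega> l then 1 - w i else 1)"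
        using elim by (intro prod.cong refl one_minus_step_fun[symmetric]) blast
      also have "\<dots> = (\<Prod>i<k. \<Prod>l<n. if ?P n i \<omega> l then 1 - w i else 1)" by (rule prod.swap)
      also have "\<dots> = (\<Prod>i<k. \<Prod>l<n. if ?P n i \<omega> l then s i else 1)"
        by (intro prod.cong refl if_cong) (simp add: w_def)
      also have "\<dots> = (\<Prod>i<k. s i ^ card {l. l < n \<and> ?P n i \<omega> l})"
      proof (intro prod.cong refl)
        fix i
        have "(\<Prod>l<n. if ?P n i \<omega> l then s i else 1) = (\<Prod>l\<in>{l \<in> {..<n}. ?P n i \<omega> l}. s i)"
          by (rule prod.mono_neutral_cong_right) auto
        then show "(\<Prod>l<n. if ?P n i \<omega> l then s i else 1) = s i ^ card {l. l < n \<and> ?P n i \<omega> l}" by simp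
      qed
      finally show ?thesis .
    qed
    then show ?case by simp
  qed
  with lim show "(\<lambda>n. \<integral>\<omega>. (\<Prod>i<k. s i ^ card {l. l < n \<and> ?P n i \<omega> l}) \<partial>M n)
    \<longlonglongrightarrow> (\<Prod>i<k. exp (- (1 - s i) * (exp (- t i) - exp (- t (Suc i)))))"
    by (rule Lim_transform_eventually)
qed

end

end

section \<open>Convergence of the counts of the point process\<close>

lemma a_seq_nonneg: "0 \<le> a_seq n"
  by (cases "n = 0") (auto simp: a_seq_def)

lemma measurable_ordered_eigenvalue_laplacian:
  assumes G: "GOE n M A" and j: "1 \<le> j" "j \<le> n"
  shows "(\<lambda>\<omega>. ordered_eigenvalue (laplacian (A \<omega>)) j) \<in> borel_measurable M"
proof -
  obtain X where X: "X \<in> measurable M borel" "\<And>\<omega>. \<omega> \<in> space M \<Longrightarrow> symmetric_mat n (X \<omega>) = A \<omega>"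
    by (rule GOE_entries[OF G]; rule that; assumption)
  have "(\<lambda>x. ordered_eigenvalue (laplacian (symmetric_mat n x)) j) \<in> borel_measurable borel"
    by (rule borel_measurable_continuous_onI[OF continuous_on_ordered_eigenvalue_laplacian[OF j]])
  from measurable_compose[OF X(1) this]
  show ?thesis by (rule measurable_cong[THEN iffD1, rotated]) (simp add: X(2))
qed

lemma measurable_emeasure_laplacian_point_process:
  assumes G: "GOE n M A" and B: "B \<in> sets borel"
  shows "(\<lambda>\<omega>. emeasure (laplacian_point_process n (A \<omega>)) B) \<in> borel_measurable M"
proof -
  have "(\<lambda>\<omega>. \<Sum>j=1..n. indicator B (a_seq n * (ordered_eigenvalue (laplacian (A \<omega>)) j - b_seq n)) :: ennreal) \<in> borel_measurable M"
  proof (rule borel_measurable_sum)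
    fix j assume j: "j \<in> {1..n}"
    have "(\<lambda>\<omega>. a_seq n * (ordered_eigenvalue (laplacian (A \<omega>)) j - b_seq n)) \<in> borel_measurable M"
      using j by (intro borel_measurable_times borel_measurable_diff borel_measurable_const
          measurable_ordered_eigenvalue_laplacian[OF G]) auto
    from measurable_compose[OF this borel_measurable_indicator[OF B]]
    show "(\<lambda>\<omega>. indicator B (a_seq n * (ordered_eigenvalue (laplacian (A \<omega>)) j - b_seq n)) :: ennreal) \<in> borel_measurable M" .
  qed
  then show ?thesis using B by (simp add: laplacian_point_process_def emeasure_sum_point_masses)
qed

text \<open>Half-open intervals correspond exactly to differences of the strict counts
  \<open>count_above\<close>; this is why all cells are open on the left and closed on the
  right.\<close>

lemma point_process_interval_count:
  assumes A: "A \<in> carrier_mat n n" "transpose_mat A = A" and a: "0 < a_seq n" and xy: "x \<le> y"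
  shows "emeasure (laplacian_point_process n A) {x<..y}
    = of_nat (count_above (laplacian A) (lam_seq n x) - count_above (laplacian A) (lam_seq n y))"
proof -
  note L = laplacian_carrier[OF A(1)] laplacian_symmetric[OF A]
  let ?e = "\<lambda>j. ordered_eigenvalue (laplacian A) j"
  have iff: "z < a_seq n * (e - b_seq n) \<longleftrightarrow> lam_seq n z < e" for z e
    using a by (simp add: lam_seq_def field_simps)
  let ?S = "\<lambda>z. {j \<in> {1..n}. lam_seq n z < ?e j}"
  have "lam_seq n x \<le> lam_seq n y" using xy a by (simp add: lam_seq_def divide_right_mono)
  then have sub: "?S y \<subseteq> ?S x" by auto
  have "emeasure (laplacian_point_process n A) {x<..y} = (\<Sum>j\<in>{1..n}. indicator {x<..y} (a_seq n * (?e j - b_seq n)))"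
    by (simp add: laplacian_point_process_def emeasure_sum_point_masses)
  also have "\<dots> = (\<Sum>j\<in>?S x - ?S y. 1)"
  proof (rule sum.mono_neutral_cong_right)
    show "\<forall>i\<in>{1..n} - (?S x - ?S y). indicator {x<..y} (a_seq n * (?e i - b_seq n)) = (0 :: ennreal)"
      using iff by (auto simp: indicator_def not_less[symmetric])
    show "indicator {x<..y} (a_seq n * (?e i - b_seq n)) = (1 :: ennreal)" if "i \<in> ?S x - ?S y" for i
      using that iff by (auto simp: indicator_def not_less[symmetric])
  qed auto
  also have "\<dots> = of_nat (card (?S x - ?S y))" by simp
  also have "card (?S x - ?S y) = card (?S x) - card (?S y)" using sub by (intro card_Diff_subset) auto
  finally show ?thesis by (simp only: card_ordered_eigenvalues_greater[OF L])
qed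

context
  fixes M :: "nat \<Rightarrow> 'a measure" and A :: "nat \<Rightarrow> 'a \<Rightarrow> real mat"
  assumes GOE: "\<And>n. n \<ge> 1 \<Longrightarrow> GOE n (M n) (A n)"
begin

text \<open>The union bound leaves a difference of two normal tails, multiplied by n, at levels
  within o(1 / \<open>a_seq n\<close>) of each other; both have the limit exp (- x).\<close>

lemma window_tendsto:
  "(\<lambda>n. measure (M n) (\<Union>i<n. {\<omega> \<in> space (M n). \<bar>goe_matrix.D n (A n) \<omega> i - c_seq n x\<bar> \<le> \<eta>_bound n x})) \<longlonglongrightarrow> 0"
proof -
  define h where "h n = \<bar>\<eta>_bound n x\<bar>" for n
  \<comment> \<open>The extra 1 / (\<open>a_seq n\<close>)^2 enlarges the closed window to a
    half-open interval and is itself o(1 / \<open>a_seq n\<close>).\<close>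
  define h' where "h' n = - (h n + 1 / (a_seq n)\<^sup>2)" for n
  define \<sigma> where "\<sigma> n = sqrt (1 + 1 / real n)" for n
  have "(\<lambda>n. \<bar>a_seq n * \<eta>_bound n x\<bar>) \<longlonglongrightarrow> 0" by (rule tendsto_rabs_zero[OF \<eta>_bound_tendsto])
  then have h: "(\<lambda>n. a_seq n * h n) \<longlonglongrightarrow> 0" by (simp add: h_def abs_mult a_seq_nonneg)
  have "(\<lambda>n. a_seq n * (1 / (a_seq n)\<^sup>2)) \<longlonglongrightarrow> 0" unfolding a_seq_def by real_asymp
  from tendsto_minus[OF tendsto_add[OF h this]]
  have "(\<lambda>n. - (a_seq n * h n + a_seq n * (1 / (a_seq n)\<^sup>2))) \<longlonglongrightarrow> 0" by simp
  moreover have "(\<lambda>n. - (a_seq n * h n + a_seq n * (1 / (a_seq n)\<^sup>2))) = (\<lambda>n. a_seq n * h' n)"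
    by (rule ext) (simp add: h'_def algebra_simps)
  ultimately have h': "(\<lambda>n. a_seq n * h' n) \<longlonglongrightarrow> 0" by (simp only:)
  have \<sigma>: "\<forall>\<^sub>F n in sequentially. 0 < \<sigma> n"
    using eventually_gt_at_top[of 0] by eventually_elim (simp add: \<sigma>_def add_pos_nonneg)
  have \<sigma>': "(\<lambda>n. (1 / \<sigma> n - 1) * (a_seq n)\<^sup>2) \<longlonglongrightarrow> 0" unfolding \<sigma>_def by (rule full_sd_tendsto)
  have "(\<lambda>n. real n * normal_tail (\<sigma> n) (c_seq n x + h' n) - real n * normal_tail (\<sigma> n) (c_seq n x + h n)) \<longlonglongrightarrow> exp (- x) - exp (- x)"
    by (intro tendsto_diff normal_tail_tendsto \<sigma> \<sigma>' c_seq_shift_tail_level h h')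
  then have lim: "(\<lambda>n. real n * normal_tail (\<sigma> n) (c_seq n x + h' n) - real n * normal_tail (\<sigma> n) (c_seq n x + h n)) \<longlonglongrightarrow> 0" by simp
  show ?thesis
  proof (rule tendsto_sandwich[OF _ _ tendsto_const lim])
    show "\<forall>\<^sub>F n in sequentially. 0 \<le> measure (M n) (\<Union>i<n. {\<omega> \<in> space (M n). \<bar>goe_matrix.D n (A n) \<omega> i - c_seq n x\<bar> \<le> \<eta>_bound n x})"
      by simp
    show "\<forall>\<^sub>F n in sequentially. measure (M n) (\<Union>i<n. {\<omega> \<in> space (M n). \<bar>goe_matrix.D n (A n) \<omega> i - c_seq n x\<bar> \<le> \<eta>_bound n x})
       \<le> real n * normal_tail (\<sigma> n) (c_seq n x + h' n) - real n * normal_tail (\<sigma> n) (c_seq n x + h n)"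
      using eventually_gt_at_top[of 0] eventually_a_seq_pos
    proof eventually_elim
      case (elim n)
      interpret goe_matrix "M n" n "A n" using GOE[of n] elim by (intro goe_matrixI) auto
      have pos: "0 < 1 / (a_seq n)\<^sup>2" using elim by simp
      have "0 \<le> h n" by (simp add: h_def)
      then have le: "c_seq n x + h' n \<le> c_seq n x + h n" unfolding h'_def using pos by linarith
      have "prob (\<Union>i<n. {\<omega> \<in> space (M n). \<bar>D \<omega> i - c_seq n x\<bar> \<le> \<eta>_bound n x})
         \<le> real (card {..<n}) * (normal_tail (\<sigma> n) (c_seq n x + h' n) - normal_tail (\<sigma> n) (c_seq n x + h n))"
      proof (rule prob_UN_le)
        fix i assume "i \<in> {..<n}"
        then have i: "i < n" by simp
        note [measurable] = measurable_D[OF i]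
        show "{\<omega> \<in> space (M n). \<bar>D \<omega> i - c_seq n x\<bar> \<le> \<eta>_bound n x} \<in> events" by measurable
        have "prob {\<omega> \<in> space (M n). \<bar>D \<omega> i - c_seq n x\<bar> \<le> \<eta>_bound n x}
           \<le> prob {\<omega> \<in> space (M n). c_seq n x + h' n < D \<omega> i \<and> D \<omega> i \<le> c_seq n x + h n}"
        proof (rule finite_measure_mono)
          show "{\<omega> \<in> space (M n). \<bar>D \<omega> i - c_seq n x\<bar> \<le> \<eta>_bound n x}
             \<subseteq> {\<omega> \<in> space (M n). c_seq n x + h' n < D \<omega> i \<and> D \<omega> i \<le> c_seq n x + h n}"
          proof (rule subsetI, clarify)
            fix \<omega> assume "\<bar>D \<omega> i - c_seq n x\<bar> \<le> \<eta>_bound n x"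
            then have "\<bar>D \<omega> i - c_seq n x\<bar> \<le> h n" unfolding h_def by linarith
            then show "c_seq n x + h' n < D \<omega> i \<and> D \<omega> i \<le> c_seq n x + h n"
              unfolding h'_def using pos by linarith
          qed
        qed measurable
        also have "\<dots> = normal_tail (\<sigma> n) (c_seq n x + h' n) - normal_tail (\<sigma> n) (c_seq n x + h n)"
          unfolding \<sigma>_def by (rule normal_interval_prob[OF D_normal[OF i] le])
        finally show "prob {\<omega> \<in> space (M n). \<bar>D \<omega> i - c_seq n x\<bar> \<le> \<eta>_bound n x}
           \<le> normal_tail (\<sigma> n) (c_seq n x + h' n) - normal_tail (\<sigma> n) (c_seq n x + h n)" .
      qed simp
      then show ?case by (simp add: right_diff_distrib)
    qed
  qed
qed

lemma count_above_agrees: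
  "\<exists>B. (\<forall>\<^sub>F n in sequentially. B n \<in> sets (M n) \<and> (\<forall>\<omega>\<in>space (M n) - B n.
        count_above (laplacian (A n \<omega>)) (lam_seq n x) = card {i. i < n \<and> c_seq n x < goe_matrix.D n (A n) \<omega> i})) \<and>
     (\<lambda>n. measure (M n) (B n)) \<longlonglongrightarrow> 0"
proof -
  define p where "p n = 2 * exp (- 7 * real n) + 2 * (real n)\<^sup>2 * exp (- real n * (ln (real n) / sqrt (real n))\<^sup>2 / 4)
      + 6 * (real n)\<^sup>2 * exp (- real n * (real n powr (-1/4))\<^sup>2 / 16)
      + (real n * exp (- (a_seq n - 22)\<^sup>2 / (2 * (1 + 1 / real n))) / exp (23 * a_seq n)
        + real n * (2 * exp (- (a_seq n powr (3/4))\<^sup>2 / (2 * (1 + 1 / real n)))) / (real n * exp (- (a_seq n powr (3/2)) / 4)))" for n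
  have "p \<longlonglongrightarrow> 0 + 0 + 0 + (0 + 0)"
    unfolding p_def by (intro tendsto_add exceptional_prob_tendsto spike_count_tendsto large_count_tendsto)
  then have p: "p \<longlonglongrightarrow> 0" by simp
  define P where "P n B \<longleftrightarrow> B \<in> sets (M n) \<and> measure (M n) B \<le> p n \<and>
     (\<forall>\<omega>\<in>space (M n) - B. (\<forall>i<n. \<bar>goe_matrix.D n (A n) \<omega> i - c_seq n x\<bar> > \<eta>_bound n x) \<longrightarrow>
        count_above (laplacian (A n \<omega>)) (lam_seq n x) = card {i. i < n \<and> c_seq n x < goe_matrix.D n (A n) \<omega> i})" for n B
  have c1: "\<forall>\<^sub>F n in sequentially. 22 < a_seq n"
    using a_seq_at_top by (rule filterlim_at_top_dense[THEN iffD1, rule_format])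
  have "(\<lambda>n. lam_seq n x - a_seq n) \<longlonglongrightarrow> 0"
    unfolding lam_seq_def b_seq_def a_seq_def by real_asymp
  then have c2: "\<forall>\<^sub>F n in sequentially. - 1 < lam_seq n x - a_seq n" by (rule order_tendstoD) simp
  have m: "(\<lambda>n. a_seq n powr (3/4) / a_seq n) \<longlonglongrightarrow> 0" unfolding a_seq_def by real_asymp
  have "(\<lambda>n. a_seq n powr (3/4) / a_seq n * (a_seq n / lam_seq n x)) \<longlonglongrightarrow> 0 * 1"
    by (intro tendsto_mult m lam_seq_ratio)
  then have c3: "\<forall>\<^sub>F n in sequentially. a_seq n powr (3/4) / a_seq n * (a_seq n / lam_seq n x) < 1/2"
    by (rule order_tendstoD) simp
  have c4: "\<forall>\<^sub>F n in sequentially. a_seq n * \<kappa>_bound n < 1"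
    using \<kappa>_bound_tendsto by (rule order_tendstoD) simp
  have ev: "\<forall>\<^sub>F n in sequentially. \<exists>B. P n B"
    using c1 c2 c3 c4 eventually_ge_at_top[of 2]
  proof eventually_elim
    case (elim n)
    interpret goe_matrix "M n" n "A n" using GOE[of n] elim by (intro goe_matrixI) auto
    have lam: "1 \<le> lam_seq n x" using elim by linarith
    have "a_seq n powr (3/4) / lam_seq n x < 1/2" using elim(1,3) lam by simp
    then have M0: "a_seq n powr (3/4) \<le> lam_seq n x / 2" using lam by (simp add: pos_divide_less_eq)
    have \<kappa>: "\<kappa>_bound n \<le> 1"
    proof (rule ccontr)
      assume "\<not> ?thesis"
      then have "1 * 1 \<le> a_seq n * \<kappa>_bound n" using elim(1) by (intro mult_mono) auto
      then show False using elim(4) by simp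
    qed
    have "1 \<le> a_seq n" "a_seq n - 1 \<le> lam_seq n x" using elim by linarith+
    from count_above_laplacian_event[OF this lam elim(1) M0 \<kappa> elim(5)]
    show ?case unfolding P_def p_def by blast
  qed
  define B0 where "B0 n = (SOME B. P n B)" for n
  have B0: "\<forall>\<^sub>F n in sequentially. P n (B0 n)"
    using ev by eventually_elim (simp add: B0_def someI_ex)
  define W where "W n = (\<Union>i<n. {\<omega> \<in> space (M n). \<bar>goe_matrix.D n (A n) \<omega> i - c_seq n x\<bar> \<le> \<eta>_bound n x})" for n
  have Wlim: "(\<lambda>n. measure (M n) (W n)) \<longlonglongrightarrow> 0" unfolding W_def by (rule window_tendsto)
  have W: "\<forall>\<^sub>F n in sequentially. W n \<in> sets (M n)"
    using eventually_gt_at_top[of 0]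
  proof eventually_elim
    case (elim n)
    interpret goe_matrix "M n" n "A n" using GOE[of n] elim by (intro goe_matrixI) auto
    have "{\<omega> \<in> space (M n). \<bar>D \<omega> i - c_seq n x\<bar> \<le> \<eta>_bound n x} \<in> events" if "i < n" for i
    proof -
      note [measurable] = measurable_D[OF that]
      show ?thesis by measurable
    qed
    then show ?case unfolding W_def by (intro sets.finite_UN) auto
  qed
  show ?thesis
  proof (intro exI[of _ "\<lambda>n. B0 n \<union> W n"] conjI)
    show "\<forall>\<^sub>F n in sequentially. B0 n \<union> W n \<in> sets (M n) \<and> (\<forall>\<omega>\<in>space (M n) - (B0 n \<union> W n).
        count_above (laplacian (A n \<omega>)) (lam_seq n x) = card {i. i < n \<and> c_seq n x < goe_matrix.D n (A n) \<omega> i})"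
      using B0 W
    proof eventually_elim
      case (elim n)
      have "\<forall>i<n. \<bar>goe_matrix.D n (A n) \<omega> i - c_seq n x\<bar> > \<eta>_bound n x" if "\<omega> \<in> space (M n) - W n" for \<omega>
        using that unfolding W_def by (auto simp: not_le)
      then show ?case using elim unfolding P_def by blast
    qed
    have "(\<lambda>n. p n + measure (M n) (W n)) \<longlonglongrightarrow> 0 + 0" by (intro tendsto_add p Wlim)
    then have lim: "(\<lambda>n. p n + measure (M n) (W n)) \<longlonglongrightarrow> 0" by simp
    show "(\<lambda>n. measure (M n) (B0 n \<union> W n)) \<longlonglongrightarrow> 0"
    proof (rule tendsto_sandwich[OF _ _ tendsto_const lim])
      show "\<forall>\<^sub>F n in sequentially. measure (M n) (B0 n \<union> W n) \<le> p n + measure (M n) (W n)"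
        using B0 W
      proof eventually_elim
        case (elim n)
        then have "measure (M n) (B0 n \<union> W n) \<le> measure (M n) (B0 n) + measure (M n) (W n)"
          unfolding P_def by (intro measure_Un_le) auto
        then show ?case using elim unfolding P_def by linarith
      qed
    qed simp
  qed
qed

text \<open>Off k + 1 exceptional events, one for each endpoint, the eigenvalue counts on all
  intervals equal the row sum counts, so the two probabilities differ by at most the sum of the
  exceptional ones.\<close>

lemma point_process_counts_tendsto:
  fixes t :: "nat \<Rightarrow> real"
  assumes t: "\<And>i. i < k \<Longrightarrow> t i < t (Suc i)"
  shows "(\<lambda>n. measure (M n) {\<omega> \<in> space (M n). \<forall>i<k. emeasure (laplacian_point_process n (A n \<omega>)) {t i<..t (Suc i)} = of_nat (v i)})
    \<longlonglongrightarrow> (\<Prod>i<k. poisson_weight (exp (- t i) - exp (- t (Suc i))) (v i))"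
proof -
  let ?D = "\<lambda>n. goe_matrix.D n (A n)"
  define E where "E n = {\<omega> \<in> space (M n). \<forall>i<k. emeasure (laplacian_point_process n (A n \<omega>)) {t i<..t (Suc i)} = of_nat (v i)}" for n
  define F where "F n = {\<omega> \<in> space (M n). \<forall>i<k. card {l. l < n \<and> c_seq n (t i) < ?D n \<omega> l \<and> ?D n \<omega> l \<le> c_seq n (t (Suc i))} = v i}" for n
  have Flim: "(\<lambda>n. measure (M n) (F n)) \<longlonglongrightarrow> (\<Prod>i<k. poisson_weight (exp (- t i) - exp (- t (Suc i))) (v i))"
    unfolding F_def by (rule row_sum_counts_tendsto[where M=M and A=A and t=t and k=k]; rule GOE t; assumption)
  have mono_ev: "\<forall>\<^sub>F n in sequentially. \<forall>i j. i \<le> j \<longrightarrow> j \<le> k \<longrightarrow> c_seq n (t i) \<le> c_seq n (t j)"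
    by (rule eventually_c_seq_mono[where M=M and A=A and t=t and k=k]; rule GOE t; assumption)
  define R where "R i B \<longleftrightarrow> (\<forall>\<^sub>F n in sequentially. B n \<in> sets (M n) \<and> (\<forall>\<omega>\<in>space (M n) - B n.
        count_above (laplacian (A n \<omega>)) (lam_seq n (t i)) = card {l. l < n \<and> c_seq n (t i) < ?D n \<omega> l})) \<and>
     (\<lambda>n. measure (M n) (B n)) \<longlonglongrightarrow> 0" for i B
  have "\<forall>i. \<exists>B. R i B" unfolding R_def by (rule allI) (rule count_above_agrees)
  from choice[OF this] obtain B where BR: "\<And>i. R i (B i)" by blast
  have B: "\<forall>\<^sub>F n in sequentially. B i n \<in> sets (M n) \<and> (\<forall>\<omega>\<in>space (M n) - B i n.
        count_above (laplacian (A n \<omega>)) (lam_seq n (t i)) = card {l. l < n \<and> c_seq n (t i) < ?D n \<omega> l})"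
     "(\<lambda>n. measure (M n) (B i n)) \<longlonglongrightarrow> 0" for i
    using BR[of i] unfolding R_def by (rule conjunct1, rule conjunct2)
  have ball: "\<forall>\<^sub>F n in sequentially. \<forall>i\<in>{..k}. B i n \<in> sets (M n) \<and> (\<forall>\<omega>\<in>space (M n) - B i n.
        count_above (laplacian (A n \<omega>)) (lam_seq n (t i)) = card {l. l < n \<and> c_seq n (t i) < ?D n \<omega> l})"
    by (rule eventually_ball_finite) (use B(1) in blast)+
  have "(\<lambda>n. \<Sum>i\<le>k. measure (M n) (B i n)) \<longlonglongrightarrow> (\<Sum>i\<le>k. 0)" by (intro tendsto_sum B(2))
  then have Blim: "(\<lambda>n. \<Sum>i\<le>k. measure (M n) (B i n)) \<longlonglongrightarrow> 0" by simp
  have diff: "\<forall>\<^sub>F n in sequentially. \<bar>measure (M n) (E n) - measure (M n) (F n)\<bar> \<le> (\<Sum>i\<le>k. measure (M n) (B i n))"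
    using ball mono_ev eventually_a_seq_pos eventually_gt_at_top[of 0]
  proof eventually_elim
    case (elim n)
    interpret goe_matrix "M n" n "A n" using GOE[of n] elim by (intro goe_matrixI) auto
    let ?B = "\<Union>i\<le>k. B i n"
    have BS: "?B \<in> events" using elim(1) by (intro sets.finite_UN) auto
    have same: "\<omega> \<in> E n \<longleftrightarrow> \<omega> \<in> F n" if w: "\<omega> \<in> space (M n) - ?B" for \<omega>
    proof -
      have "emeasure (laplacian_point_process n (A n \<omega>)) {t i<..t (Suc i)}
         = of_nat (card {l. l < n \<and> c_seq n (t i) < D \<omega> l \<and> D \<omega> l \<le> c_seq n (t (Suc i))})" if i: "i < k" for i
      proof -
        have ca: "count_above (laplacian (A n \<omega>)) (lam_seq n (t j)) = card {l. l < n \<and> c_seq n (t j) < D \<omega> l}" if "j \<le> k" for j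
        proof -
          have "\<omega> \<in> space (M n) - B j n" using w that by blast
          moreover have "j \<in> {..k}" using that by simp
          ultimately show ?thesis by (rule elim(1)[THEN bspec, THEN conjunct2, THEN bspec, rotated])
        qed
        have le: "c_seq n (t i) \<le> c_seq n (t (Suc i))"
          by (rule elim(2)[THEN spec, THEN spec, THEN mp, THEN mp]) (use i in \<open>simp_all add: Suc_le_eq\<close>)
        let ?S = "\<lambda>j. {l. l < n \<and> c_seq n (t j) < D \<omega> l}"
        have split: "{l. l < n \<and> c_seq n (t i) < D \<omega> l \<and> D \<omega> l \<le> c_seq n (t (Suc i))} = ?S i - ?S (Suc i)" by auto
        have "?S (Suc i) \<subseteq> ?S i" using le by auto
        then have card: "card (?S i - ?S (Suc i)) = card (?S i) - card (?S (Suc i))" by (intro card_Diff_subset) auto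
        have "A n \<omega> \<in> carrier_mat n n" "transpose_mat (A n \<omega>) = A n \<omega>" using A_carrier A_sym w by blast+
        from point_process_interval_count[OF this elim(3) less_imp_le[OF t[OF i]]]
        show ?thesis unfolding split card ca[OF less_imp_le[OF i]] ca[OF Suc_leI[OF i]] .
      qed
      then show ?thesis using w unfolding E_def F_def by auto
    qed
    have EM: "E n \<in> events"
    proof -
      have "{\<omega> \<in> space (M n). \<forall>i\<in>{..<k}. emeasure (laplacian_point_process n (A n \<omega>)) {t i<..t (Suc i)} = of_nat (v i)} \<in> events"
      proof (rule sets.sets_Collect_finite_All)
        fix i
        have "(\<lambda>\<omega>. emeasure (laplacian_point_process n (A n \<omega>)) {t i<..t (Suc i)}) -` {of_nat (v i)} \<inter> space (M n) \<in> events"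
          by (rule measurable_sets[OF measurable_emeasure_laplacian_point_process[OF local.GOE]]) auto
        moreover have "(\<lambda>\<omega>. emeasure (laplacian_point_process n (A n \<omega>)) {t i<..t (Suc i)}) -` {of_nat (v i)} \<inter> space (M n)
          = {\<omega> \<in> space (M n). emeasure (laplacian_point_process n (A n \<omega>)) {t i<..t (Suc i)} = of_nat (v i)}" by auto
        ultimately show "{\<omega> \<in> space (M n). emeasure (laplacian_point_process n (A n \<omega>)) {t i<..t (Suc i)} = of_nat (v i)} \<in> events" by simp
      qed simp
      moreover have "E n = {\<omega> \<in> space (M n). \<forall>i\<in>{..<k}. emeasure (laplacian_point_process n (A n \<omega>)) {t i<..t (Suc i)} = of_nat (v i)}"
        by (auto simp: E_def)
      ultimately show ?thesis by simp
    qed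
    have FM: "F n \<in> events"
    proof -
      have "{\<omega> \<in> space (M n). \<forall>i\<in>{..<k}. card {l. l < n \<and> c_seq n (t i) < D \<omega> l \<and> D \<omega> l \<le> c_seq n (t (Suc i))} = v i} \<in> events"
      proof (rule sets.sets_Collect_finite_All)
        fix i
        have m: "{\<omega> \<in> space (M n). c_seq n (t i) < D \<omega> l \<and> D \<omega> l \<le> c_seq n (t (Suc i))} \<in> events" if l: "l < n" for l
        proof -
          note [measurable] = measurable_D[OF l]
          show ?thesis by measurable
        qed
        have ge: "{\<omega> \<in> space (M n). N \<le> real (card {l. l < n \<and> c_seq n (t i) < D \<omega> l \<and> D \<omega> l \<le> c_seq n (t (Suc i))})} \<in> events" for N :: real
        proof (cases "0 < N")
          case True
          show ?thesis by (rule count_markov(1)[where p=1, OF m _ True]) auto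
        next
          case False
          then have "{\<omega> \<in> space (M n). N \<le> real (card {l. l < n \<and> c_seq n (t i) < D \<omega> l \<and> D \<omega> l \<le> c_seq n (t (Suc i))})} = space (M n)"
            by (auto intro: order_trans[OF _ of_nat_0_le_iff])
          then show ?thesis by simp
        qed
        have "{\<omega> \<in> space (M n). card {l. l < n \<and> c_seq n (t i) < D \<omega> l \<and> D \<omega> l \<le> c_seq n (t (Suc i))} = v i}
          = {\<omega> \<in> space (M n). real (v i) \<le> real (card {l. l < n \<and> c_seq n (t i) < D \<omega> l \<and> D \<omega> l \<le> c_seq n (t (Suc i))})}
          - {\<omega> \<in> space (M n). real (Suc (v i)) \<le> real (card {l. l < n \<and> c_seq n (t i) < D \<omega> l \<and> D \<omega> l \<le> c_seq n (t (Suc i))})}"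
          unfolding of_nat_le_iff by (auto simp: not_less_eq_eq)
        then show "{\<omega> \<in> space (M n). card {l. l < n \<and> c_seq n (t i) < D \<omega> l \<and> D \<omega> l \<le> c_seq n (t (Suc i))} = v i} \<in> events"
          using sets.Diff[OF ge ge] by simp
      qed simp
      moreover have "F n = {\<omega> \<in> space (M n). \<forall>i\<in>{..<k}. card {l. l < n \<and> c_seq n (t i) < D \<omega> l \<and> D \<omega> l \<le> c_seq n (t (Suc i))} = v i}"
        by (auto simp: F_def)
      ultimately show ?thesis by simp
    qed
    have ES: "E n \<subseteq> space (M n)" "F n \<subseteq> space (M n)" by (auto simp: E_def F_def)
    have "prob (E n) \<le> prob (F n \<union> ?B)" using same ES FM BS by (intro finite_measure_mono) auto
    also have "\<dots> \<le> prob (F n) + prob ?B" by (intro measure_Un_le FM BS)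
    finally have 1: "prob (E n) \<le> prob (F n) + prob ?B" .
    have "prob (F n) \<le> prob (E n \<union> ?B)" using same ES EM BS by (intro finite_measure_mono) auto
    also have "\<dots> \<le> prob (E n) + prob ?B" by (intro measure_Un_le EM BS)
    finally have 2: "prob (F n) \<le> prob (E n) + prob ?B" .
    have "prob ?B \<le> (\<Sum>i\<le>k. prob (B i n))"
      using elim(1) by (intro finite_measure_subadditive_finite) auto
    then show ?case using 1 2 by linarith
  qed
  have "(\<lambda>n. measure (M n) (E n) - measure (M n) (F n)) \<longlonglongrightarrow> 0"
    using diff by (intro Lim_null_comparison[OF _ Blim]) simp
  from tendsto_add[OF this Flim] show ?thesis unfolding E_def by simp
qed

end

section \<open>Vague topology and counts on grids\<close>

text \<open>Convergence of the integrals handles subbasic sets, and induction over the generation of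
  the topology carries it through finite intersections and unions.\<close>

lemma limitin_vagueI:
  assumes \<mu>: "\<mu> \<in> locally_finite_measures" and \<nu>: "\<And>m. \<nu> m \<in> locally_finite_measures"
    and lim: "\<And>f. continuous_compact_support f \<Longrightarrow> (\<lambda>m. integral\<^sup>L (\<nu> m) f) \<longlonglongrightarrow> integral\<^sup>L \<mu> f"
  shows "limitin vague_topology \<nu> \<mu> sequentially"
proof -
  let ?S = "{{\<mu> \<in> locally_finite_measures. integral\<^sup>L \<mu> f \<in> U} | f U. continuous_compact_support f \<and> open U}"
  have "\<mu> \<in> U \<Longrightarrow> \<forall>\<^sub>F m in sequentially. \<nu> m \<in> U" if "generate_topology_on ?S U" for U
    using that
  proof induction
    case (Int a b)
    then have "\<forall>\<^sub>F m in sequentially. \<nu> m \<in> a" "\<forall>\<^sub>F m in sequentially. \<nu> m \<in> b" by auto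
    then show ?case by eventually_elim auto
  next
    case (UN K)
    then obtain k where "k \<in> K" "\<mu> \<in> k" by auto
    then have "\<forall>\<^sub>F m in sequentially. \<nu> m \<in> k" using UN by auto
    then show ?case by (rule eventually_mono) (use \<open>k \<in> K\<close> in auto)
  next
    case (Basis s)
    then obtain f :: "real \<Rightarrow> real" and U where s: "s = {\<mu> \<in> locally_finite_measures. integral\<^sup>L \<mu> f \<in> U}"
      and f: "continuous_compact_support f" and U: "open U" by blast
    have "\<forall>\<^sub>F m in sequentially. integral\<^sup>L (\<nu> m) f \<in> U"
      using lim[OF f] U Basis(2) unfolding s by (intro topological_tendstoD) auto
    then show ?case unfolding s by (rule eventually_mono) (use \<nu> in auto)
  qed simp
  then show ?thesis
    using \<mu> unfolding limitin_def topspace_vague_topology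
    by (auto simp: vague_topology_def openin_topology_generated_by_iff)
qed

text \<open>The mesh 2^(-m) shrinks while the covered range from -(m + 1) to m + 1 grows, so the
  single index m controls both resolution and truncation.\<close>

definition grid :: "nat \<Rightarrow> nat \<Rightarrow> real" where
  "grid m i = real i / 2 ^ m - (real m + 1)"

definition grid_size :: "nat \<Rightarrow> nat" where
  "grid_size m = 2 * (m + 1) * 2 ^ m"

definition cell :: "nat \<Rightarrow> nat \<Rightarrow> real set" where
  "cell m i = {grid m i<..grid m (Suc i)}"

text \<open>A list of naturals, hence a value in a countable type. The floor recovers the mass
  whenever it is an integer and otherwise serves as a default.\<close>

definition cell_counts :: "nat \<Rightarrow> real measure \<Rightarrow> nat list" where
  "cell_counts m \<nu> = map (\<lambda>i. nat \<lfloor>measure \<nu> (cell m i)\<rfloor>) [0..<grid_size m]"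

lemma grid_less: "grid m i < grid m (Suc i)"
  by (simp add: grid_def divide_strict_right_mono)

lemma grid_Suc: "grid m (Suc i) = grid m i + 1 / 2 ^ m"
  by (simp add: grid_def add_divide_distrib)

lemma cell_sets [measurable]: "cell m i \<in> sets borel"
  by (simp add: cell_def)

lemma cell_disjoint: "i \<noteq> j \<Longrightarrow> cell m i \<inter> cell m j = {}"
proof -
  have "cell m i \<inter> cell m j = {}" if "i < j" for i j
  proof -
    have "grid m (Suc i) \<le> grid m j" using that by (simp add: grid_def divide_right_mono)
    then show ?thesis by (auto simp: cell_def)
  qed
  from this[of i j] this[of j i] show "i \<noteq> j \<Longrightarrow> cell m i \<inter> cell m j = {}" by (cases i j rule: linorder_cases) auto
qed

lemma in_some_cell:
  assumes "\<bar>x\<bar> < real m + 1"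
  shows "\<exists>i<grid_size m. x \<in> cell m i"
proof -
  define z where "z = (x + (real m + 1)) * 2 ^ m"
  have z: "0 < z" using assms by (simp add: z_def abs_less_iff)
  define i where "i = nat (\<lceil>z\<rceil> - 1)"
  have i: "real i < z" "z \<le> real i + 1"
    using z by (auto simp: i_def of_nat_nat) linarith+
  have "x = z / 2 ^ m - (real m + 1)" by (simp add: z_def)
  then have "x \<in> cell m i"
    using i by (simp add: cell_def grid_def divide_strict_right_mono divide_right_mono add.commute)
  moreover have "z < (2 * (real m + 1)) * 2 ^ m"
    unfolding z_def using assms by (intro mult_strict_right_mono) auto
  then have "real i < real (grid_size m)" using i by (simp add: grid_size_def algebra_simps)
  ultimately show ?thesis by auto
qed

lemma locally_finite_cell: "\<nu> \<in> locally_finite_measures \<Longrightarrow> emeasure \<nu> (cell m i) < \<infinity>"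
proof -
  assume "\<nu> \<in> locally_finite_measures"
  then have s: "sets \<nu> = sets borel" and "emeasure \<nu> {grid m i..grid m (Suc i)} < \<infinity>"
    by (auto simp: locally_finite_measures_def)
  moreover have "emeasure \<nu> (cell m i) \<le> emeasure \<nu> {grid m i..grid m (Suc i)}"
    by (intro emeasure_mono) (auto simp: cell_def s)
  ultimately show ?thesis by (metis order_le_less_trans)
qed

lemma integrable_continuous_compact_support:
  assumes \<nu>: "\<nu> \<in> locally_finite_measures" and f: "continuous_compact_support f"
  shows "integrable \<nu> f"
proof -
  have s: "sets \<nu> = sets borel" using \<nu> by (simp add: locally_finite_measures_def)
  define K where "K = closure {x. f x \<noteq> 0}"
  have cf: "continuous_on UNIV f" and K: "compact K" using f unfolding continuous_compact_support_def K_def by blast+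
  have "bounded (f ` K)" using K cf by (intro compact_imp_bounded compact_continuous_image) (auto intro: continuous_on_subset)
  then obtain b where b: "\<And>x. x \<in> K \<Longrightarrow> norm (f x) \<le> b" unfolding bounded_iff by blast
  have "f \<in> borel_measurable borel" by (rule borel_measurable_continuous_onI[OF cf])
  then have fm: "f \<in> borel_measurable \<nu>" using measurable_cong_sets[OF s refl] by blast
  have "K \<in> sets \<nu>" using K s by (simp add: borel_compact)
  then have "integrable \<nu> (\<lambda>x. b * indicator K x)"
    using \<nu> K by (intro integrable_mult_right integrable_real_indicator) (auto simp: locally_finite_measures_def)
  then show ?thesis
  proof (rule Bochner_Integration.integrable_bound[OF _ fm])
    show "AE x in \<nu>. norm (f x) \<le> norm (b * indicator K x)"
    proof (intro AE_I2)
      fix x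
      show "norm (f x) \<le> norm (b * indicator K x)"
      proof (cases "x \<in> K")
        case True
        then show ?thesis using b[OF True] by simp
      next
        case False
        then have "f x = 0" unfolding K_def using closure_subset[of "{x. f x \<noteq> 0}"] by auto
        then show ?thesis by simp
      qed
    qed
  qed
qed

lemma integral_cell_step:
  assumes \<nu>: "\<nu> \<in> locally_finite_measures"
  shows "integrable \<nu> (\<lambda>x. \<Sum>i<k. c i * indicator (cell m i) x :: real)"
    "(\<integral>x. (\<Sum>i<k. c i * indicator (cell m i) x) \<partial>\<nu>) = (\<Sum>i<k. c i * measure \<nu> (cell m i))"
proof -
  have s: "sets \<nu> = sets borel" using \<nu> by (simp add: locally_finite_measures_def)
  have sp: "space \<nu> = UNIV" using sets_eq_imp_space_eq[OF s] by simp
  have i: "integrable \<nu> (\<lambda>x. c i * indicator (cell m i) x)" for i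
    using locally_finite_cell[OF \<nu>] s by (intro integrable_mult_right integrable_real_indicator) auto
  then show "integrable \<nu> (\<lambda>x. \<Sum>i<k. c i * indicator (cell m i) x)"
    by (intro Bochner_Integration.integrable_sum)
  show "(\<integral>x. (\<Sum>i<k. c i * indicator (cell m i) x) \<partial>\<nu>) = (\<Sum>i<k. c i * measure \<nu> (cell m i))"
    by (subst Bochner_Integration.integral_sum[OF i]) (simp add: sp)
qed

lemma cell_step_at:
  assumes "i < k" "x \<in> cell m i"
  shows "(\<Sum>j<k. c j * indicator (cell m j) x) = (c i :: real)"
proof -
  have "(\<Sum>j<k. c j * indicator (cell m j) x) = (\<Sum>j<k. if j = i then c j else 0)"
  proof (intro sum.cong refl)
    fix j
    have "x \<notin> cell m j" if "j \<noteq> i" using assms(2) cell_disjoint[OF that, of m] by blast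
    then show "c j * indicator (cell m j) x = (if j = i then c j else 0)" using assms(2) by (simp add: indicator_def)
  qed
  then show ?thesis using assms(1) by simp
qed

text \<open>By uniform continuity f is close to a function constant on the cells. The integral of
  that step function, and the mass of the cells on which the error lives, depend on the cell masses
  alone and so agree for \<nu> m and \<mu>.\<close>

lemma vague_limit_of_equal_cells:
  assumes \<mu>: "\<mu> \<in> locally_finite_measures" and \<nu>: "\<And>m. \<nu> m \<in> locally_finite_measures"
    and eq: "\<And>m i. i < grid_size m \<Longrightarrow> measure (\<nu> m) (cell m i) = measure \<mu> (cell m i)"
  shows "limitin vague_topology \<nu> \<mu> sequentially"
proof (rule limitin_vagueI[OF \<mu> \<nu>])
  fix f assume f: "continuous_compact_support f"
  have cf: "continuous_on UNIV f" and K: "compact (closure {x. f x \<noteq> 0})"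
    using f unfolding continuous_compact_support_def by blast+
  have "bounded {x. f x \<noteq> 0}" using K bounded_subset[OF compact_imp_bounded closure_subset] by blast
  then obtain b where b: "\<And>x. f x \<noteq> 0 \<Longrightarrow> \<bar>x\<bar> \<le> b" unfolding bounded_iff by auto
  define L where "L = \<bar>b\<bar>"
  have L: "f x = 0" if "L < \<bar>x\<bar>" for x using b[of x] that by (force simp: L_def)
  define C where "C = measure \<mu> {- (L + 3)..L + 3}"
  have sb: "sets \<mu> = sets borel" using \<mu> by (simp add: locally_finite_measures_def)
  have C0: "0 \<le> C" by (simp add: C_def)
  have uc: "uniformly_continuous_on {- (L + 3)..L + 3} f"
    using cf by (intro compact_uniformly_continuous) (auto intro: continuous_on_subset)
  show "(\<lambda>m. integral\<^sup>L (\<nu> m) f) \<longlonglongrightarrow> integral\<^sup>L \<mu> f"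
  proof (rule tendstoI)
    fix e :: real assume e: "0 < e"
    \<comment> \<open>The error e' is paid twice, once for each measure, on a mass of at most C; the
      summand 1 makes the final bound strict.\<close>
    define e' where "e' = e / (2 * C + 1)"
    have e': "0 < e'" using e C0 by (simp add: e'_def)
    obtain d where d: "0 < d" "\<And>x y. \<bar>x\<bar> \<le> L + 3 \<Longrightarrow> \<bar>y\<bar> \<le> L + 3 \<Longrightarrow> \<bar>x - y\<bar> < d \<Longrightarrow> \<bar>f x - f y\<bar> < e'"
      using uc e' unfolding uniformly_continuous_on_def dist_real_def abs_le_iff by (metis abs_minus_commute atLeastAtMost_iff minus_le_iff)
    have "(\<lambda>m. (1/2 :: real) ^ m) \<longlonglongrightarrow> 0" by (rule LIMSEQ_power_zero) simp
    then have "\<forall>\<^sub>F m in sequentially. (1/2 :: real) ^ m < min d 1" using d by (intro order_tendstoD) auto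
    moreover have "\<forall>\<^sub>F m in sequentially. L \<le> real m" using eventually_ge_at_top[of "nat \<lceil>L\<rceil>"] by (rule eventually_mono) linarith
    ultimately show "\<forall>\<^sub>F m in sequentially. dist (integral\<^sup>L (\<nu> m) f) (integral\<^sup>L \<mu> f) < e"
    proof eventually_elim
      case (elim m)
      let ?k = "grid_size m"
      have small: "1 / 2 ^ m < d" "1 / 2 ^ m \<le> (1::real)" using elim(1) by (auto simp: power_divide)
      define s where "s x = (\<Sum>i<?k. f (grid m (Suc i)) * indicator (cell m i) x)" for x
      \<comment> \<open>Marks the cells that matter, as a step function so that its integral is the
        same for both measures. With mesh at most 1, cells ending beyond L + 2 miss the support of
        f, and the marked ones lie within L + 3.\<close>
      define u where "u x = (\<Sum>i<?k. (if \<bar>grid m (Suc i)\<bar> \<le> L + 2 then 1 else 0) * indicator (cell m i) x :: real)" for x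
      have near: "\<bar>x - grid m (Suc i)\<bar> \<le> 1 / 2 ^ m" if "x \<in> cell m i" for x i
        using that grid_Suc[of m i] by (auto simp: cell_def abs_le_iff)
      have fs: "\<bar>f x - s x\<bar> \<le> e' * u x" for x
      proof (cases "\<exists>i<?k. x \<in> cell m i")
        case True
        then obtain i where i: "i < ?k" "x \<in> cell m i" by blast
        have sx: "s x = f (grid m (Suc i))" unfolding s_def by (rule cell_step_at[OF i])
        have ux: "u x = (if \<bar>grid m (Suc i)\<bar> \<le> L + 2 then 1 else 0)" unfolding u_def by (rule cell_step_at[OF i])
        show ?thesis
        proof (cases "\<bar>grid m (Suc i)\<bar> \<le> L + 2")
          case True
          have "\<bar>f x - f (grid m (Suc i))\<bar> < e'"
            using near[OF i(2)] small True by (intro d(2)) linarith+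
          then show ?thesis using sx ux True by simp
        next
          case False
          then have "L < \<bar>grid m (Suc i)\<bar>" "L < \<bar>x\<bar>" using near[OF i(2)] small by linarith+
          then have "f x = 0" "f (grid m (Suc i)) = 0" using L by blast+
          then show ?thesis using sx ux False by simp
        qed
      next
        case False
        then have "L < \<bar>x\<bar>" using in_some_cell[of x m] elim(2) by fastforce
        then have "f x = 0" by (rule L)
        moreover have "s x = 0" unfolding s_def using False by (intro sum.neutral) (auto simp: indicator_def)
        moreover have "u x = 0" unfolding u_def using False by (intro sum.neutral) (auto simp: indicator_def)
        ultimately show ?thesis by simp
      qed
      have bound: "\<bar>integral\<^sup>L \<rho> f - integral\<^sup>L \<rho> s\<bar> \<le> e' * integral\<^sup>L \<rho> u" if \<rho>: "\<rho> \<in> locally_finite_measures" for \<rho>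
      proof -
        have si: "integrable \<rho> s" and iu: "integrable \<rho> u"
          unfolding s_def[abs_def] u_def[abs_def] by (rule integral_cell_step(1)[OF \<rho>])+
        note if' = integrable_continuous_compact_support[OF \<rho> f]
        have "integral\<^sup>L \<rho> f - integral\<^sup>L \<rho> s = (\<integral>x. f x - s x \<partial>\<rho>)"
          using if' si by (rule Bochner_Integration.integral_diff[symmetric])
        then have "\<bar>integral\<^sup>L \<rho> f - integral\<^sup>L \<rho> s\<bar> \<le> (\<integral>x. \<bar>f x - s x\<bar> \<partial>\<rho>)"
          using integral_abs_bound[of \<rho> "\<lambda>x. f x - s x"] by simp
        also have "\<dots> \<le> (\<integral>x. e' * u x \<partial>\<rho>)"
          by (intro integral_mono integrable_abs Bochner_Integration.integrable_diff if' si integrable_mult_right iu fs)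
        finally show ?thesis by simp
      qed
      have same: "integral\<^sup>L (\<nu> m) s = integral\<^sup>L \<mu> s" "integral\<^sup>L (\<nu> m) u = integral\<^sup>L \<mu> u"
        unfolding s_def u_def integral_cell_step(2)[OF \<mu>] integral_cell_step(2)[OF \<nu>]
        by (intro sum.cong refl; simp add: eq)+
      have "integral\<^sup>L \<mu> u \<le> integral\<^sup>L \<mu> (indicator {- (L + 3)..L + 3})"
      proof (rule integral_mono)
        show "integrable \<mu> u" unfolding u_def[abs_def] by (rule integral_cell_step(1)[OF \<mu>])
        show "integrable \<mu> (indicat_real {- (L + 3)..L + 3})"
          using \<mu> sb by (intro integrable_real_indicator) (auto simp: locally_finite_measures_def)
        fix x
        show "u x \<le> indicator {- (L + 3)..L + 3} x"
        proof (cases "\<exists>i<?k. x \<in> cell m i")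
          case True
          then obtain i where i: "i < ?k" "x \<in> cell m i" by blast
          have ux: "u x = (if \<bar>grid m (Suc i)\<bar> \<le> L + 2 then 1 else 0)" unfolding u_def by (rule cell_step_at[OF i])
          show ?thesis
          proof (cases "\<bar>grid m (Suc i)\<bar> \<le> L + 2")
            case True
            then have "\<bar>x\<bar> \<le> L + 3" using near[OF i(2)] small by linarith
            then show ?thesis using ux by (auto simp: indicator_def abs_le_iff)
          next
            case False
            then show ?thesis using ux by simp
          qed
        next
          case False
          then have "u x = 0" unfolding u_def by (intro sum.neutral) (auto simp: indicator_def)
          then show ?thesis by simp
        qed
      qed
      also have "\<dots> = C" using sets_eq_imp_space_eq[OF sb] by (simp add: C_def)
      finally have "e' * integral\<^sup>L \<mu> u \<le> e' * C" using e' by (intro mult_left_mono) auto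
      then have "\<bar>integral\<^sup>L (\<nu> m) f - integral\<^sup>L \<mu> f\<bar> \<le> 2 * (e' * C)"
        using bound[OF \<mu>] bound[OF \<nu>, of m] unfolding same by linarith
      also have "\<dots> < e' * (2 * C + 1)" using e' by (simp add: algebra_simps)
      also have "\<dots> = e" using C0 by (simp add: e'_def)
      finally show ?case by (simp add: dist_real_def)
    qed
  qed
qed

text \<open>A predicate of its own because it holds surely for the eigenvalue process but is
  available only almost surely for the Poisson process.\<close>

definition cells_integral :: "nat \<Rightarrow> real measure \<Rightarrow> bool" where
  "cells_integral m \<nu> \<longleftrightarrow> (\<forall>i<grid_size m. \<exists>j::nat. emeasure \<nu> (cell m i) = of_nat j)"

definition cell_fibre :: "nat \<Rightarrow> nat list \<Rightarrow> real measure set" where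
  "cell_fibre m v = {\<nu> \<in> locally_finite_measures. \<forall>i<grid_size m. measure \<nu> (cell m i) = real (v ! i)}"

text \<open>\<open>upper_envelope \<Phi> m\<close> is a function of the discrete variable \<open>cell_counts m\<close> that dominates
  \<open>\<Phi>\<close> and converges to it pointwise along the grids, by vague continuity. The value on an
  empty fibre is irrelevant.\<close>

definition upper_envelope :: "(real measure \<Rightarrow> real) \<Rightarrow> nat \<Rightarrow> nat list \<Rightarrow> real" where
  "upper_envelope \<Phi> m v = (if cell_fibre m v = {} then 0 else Sup (\<Phi> ` cell_fibre m v))"

lemma in_own_fibre:
  assumes "\<nu> \<in> locally_finite_measures" "cells_integral m \<nu>"
  shows "\<nu> \<in> cell_fibre m (cell_counts m \<nu>)"
proof -
  have "measure \<nu> (cell m i) = real (cell_counts m \<nu> ! i)" if i: "i < grid_size m" for i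
  proof -
    obtain j :: nat where j: "emeasure \<nu> (cell m i) = of_nat j" using assms(2) i unfolding cells_integral_def by blast
    then have "measure \<nu> (cell m i) = real j" by (simp add: measure_def)
    then show ?thesis using i by (simp add: cell_counts_def)
  qed
  then show ?thesis using assms(1) by (simp add: cell_fibre_def)
qed

section \<open>Envelopes of a bounded vaguely continuous functional\<close>

context
  fixes \<Phi> :: "real measure \<Rightarrow> real" and K :: real
  assumes cont: "continuous_map vague_topology euclideanreal \<Phi>"
    and K: "\<And>\<nu>. \<nu> \<in> locally_finite_measures \<Longrightarrow> \<bar>\<Phi> \<nu>\<bar> \<le> K"
begin

lemma bdd_fibre: "bdd_above (\<Phi> ` cell_fibre m v)"
  by (rule bdd_aboveI2[where M=K]) (use K in \<open>auto simp: cell_fibre_def abs_le_iff\<close>)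

lemma upper_envelope_bound: "0 \<le> K \<Longrightarrow> \<bar>upper_envelope \<Phi> m v\<bar> \<le> K"
proof (cases "cell_fibre m v = {}")
  case False
  then obtain \<nu> where \<nu>: "\<nu> \<in> cell_fibre m v" by blast
  have "Sup (\<Phi> ` cell_fibre m v) \<le> K"
    using False by (intro cSup_least) (use K in \<open>auto simp: cell_fibre_def abs_le_iff\<close>)
  moreover have "\<Phi> \<nu> \<le> Sup (\<Phi> ` cell_fibre m v)" using \<nu> bdd_fibre by (intro cSup_upper) auto
  moreover have "- K \<le> \<Phi> \<nu>" using K[of \<nu>] \<nu> by (auto simp: cell_fibre_def abs_le_iff)
  ultimately show ?thesis using False by (simp add: upper_envelope_def abs_le_iff)
qed (simp add: upper_envelope_def)

lemma le_upper_envelope: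
  assumes "\<nu> \<in> locally_finite_measures" "cells_integral m \<nu>"
  shows "\<Phi> \<nu> \<le> upper_envelope \<Phi> m (cell_counts m \<nu>)"
  unfolding upper_envelope_def using in_own_fibre[OF assms] bdd_fibre by (auto intro: cSup_upper)

text \<open>A near maximiser in the m-th fibre of \<mu> has the same cell masses as \<mu> on the
  m-th grid. These maximisers converge vaguely to \<mu>, so the suprema cannot stay above the value
  at \<mu>.\<close>

lemma upper_envelope_tendsto:
  assumes \<mu>: "\<mu> \<in> locally_finite_measures" "\<And>m. cells_integral m \<mu>"
  shows "(\<lambda>m. upper_envelope \<Phi> m (cell_counts m \<mu>)) \<longlonglongrightarrow> \<Phi> \<mu>"
proof -
  let ?u = "\<lambda>m. upper_envelope \<Phi> m (cell_counts m \<mu>)"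
  have "\<exists>\<nu>\<in>cell_fibre m (cell_counts m \<mu>). ?u m - 1 / real (Suc m) < \<Phi> \<nu>" for m
  proof -
    have ne: "cell_fibre m (cell_counts m \<mu>) \<noteq> {}" using in_own_fibre[OF \<mu>] by blast
    then have "?u m - 1 / real (Suc m) < Sup (\<Phi> ` cell_fibre m (cell_counts m \<mu>))" by (simp add: upper_envelope_def)
    then show ?thesis using less_cSupD[of "\<Phi> ` cell_fibre m (cell_counts m \<mu>)"] ne by blast
  qed
  then obtain \<nu> where \<nu>: "\<And>m. \<nu> m \<in> cell_fibre m (cell_counts m \<mu>)" "\<And>m. ?u m - 1 / real (Suc m) < \<Phi> (\<nu> m)" by metis
  have lf: "\<nu> m \<in> locally_finite_measures" for m using \<nu>(1)[of m] by (simp add: cell_fibre_def)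
  have eq: "measure (\<nu> m) (cell m i) = measure \<mu> (cell m i)" if "i < grid_size m" for m i
    using \<nu>(1)[of m] in_own_fibre[OF \<mu>, of m] that by (simp add: cell_fibre_def)
  have "limitin vague_topology \<nu> \<mu> sequentially"
    by (rule vague_limit_of_equal_cells[OF \<mu>(1) lf eq])
  then have "limitin euclideanreal (\<Phi> \<circ> \<nu>) (\<Phi> \<mu>) sequentially" by (rule continuous_map_limit[OF cont])
  then have lim: "(\<lambda>m. \<Phi> (\<nu> m)) \<longlonglongrightarrow> \<Phi> \<mu>" by (simp add: comp_def)
  have "(\<lambda>m. \<Phi> (\<nu> m) + 1 / real (Suc m)) \<longlonglongrightarrow> \<Phi> \<mu> + 0"
    by (intro tendsto_add lim LIMSEQ_inverse_real_of_nat[unfolded inverse_eq_divide])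
  then have up: "(\<lambda>m. \<Phi> (\<nu> m) + 1 / real (Suc m)) \<longlonglongrightarrow> \<Phi> \<mu>" by simp
  show ?thesis
  proof (rule tendsto_sandwich[OF _ _ tendsto_const up])
    show "\<forall>\<^sub>F m in sequentially. \<Phi> \<mu> \<le> ?u m" by (intro always_eventually allI le_upper_envelope \<mu>)
    show "\<forall>\<^sub>F m in sequentially. ?u m \<le> \<Phi> (\<nu> m) + 1 / real (Suc m)"
      using \<nu>(2) by (intro always_eventually allI) (simp add: less_imp_le diff_less_eq)
  qed
qed

lemma measurable_vague_continuous: "\<Phi> \<in> borel_measurable vague_borel"
proof (rule borel_measurableI)
  fix U :: "real set" assume U: "open U"
  have sp: "space vague_borel = locally_finite_measures"
    and st: "sets vague_borel = sigma_sets locally_finite_measures {U. openin vague_topology U}"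
    using openin_subset[of vague_topology] unfolding vague_borel_def
    by (auto simp: space_measure_of_conv sets_measure_of_conv)
  have "openin vague_topology {\<nu> \<in> topspace vague_topology. \<Phi> \<nu> \<in> U}"
    using cont U unfolding continuous_map_def by simp
  moreover have "\<Phi> -` U \<inter> space vague_borel = {\<nu> \<in> topspace vague_topology. \<Phi> \<nu> \<in> U}" using sp by auto
  ultimately show "\<Phi> -` U \<inter> space vague_borel \<in> sets vague_borel" unfolding st by auto
qed

end

lemma truncated_expectation:
  fixes X :: "'d \<Rightarrow> 'c" and \<psi> :: "'c \<Rightarrow> real"
  assumes P: "prob_space P" and X: "X \<in> measurable P (count_space UNIV)" and F: "finite F"
    and \<psi>: "\<And>v. \<bar>\<psi> v\<bar> \<le> K"
  shows "\<bar>(\<integral>\<omega>. \<psi> (X \<omega>) \<partial>P) - (\<Sum>v\<in>F. \<psi> v * measure P {\<omega> \<in> space P. X \<omega> = v})\<bar>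
      \<le> K * (1 - (\<Sum>v\<in>F. measure P {\<omega> \<in> space P. X \<omega> = v}))"
proof -
  interpret prob_space P by fact
  have m: "(\<lambda>\<omega>. h (X \<omega>)) \<in> borel_measurable P" for h :: "'c \<Rightarrow> real"
    using measurable_compose[OF X, of h borel] by simp
  let ?i = "\<lambda>v. indicator {\<omega> \<in> space P. X \<omega> = v} :: 'd \<Rightarrow> real"
  have ev: "{\<omega> \<in> space P. X \<omega> = v} \<in> events" for v
    using measurable_sets[OF X, of "{v}"] by (simp add: vimage_def Int_def conj_commute)
  have ii: "integrable P (?i v)" for v using ev by (intro integrable_real_indicator) (auto simp: emeasure_eq_measure)
  have Ei: "expectation (?i v) = prob {\<omega> \<in> space P. X \<omega> = v}" for v
    using ev[of v] by (simp add: Int_absorb2)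
  have i1: "integrable P (\<lambda>\<omega>. \<psi> (X \<omega>))"
    by (rule integrable_const_bound[where B=K]) (use \<psi> m in auto)
  have s1: "(\<Sum>v\<in>F. \<psi> v * prob {\<omega> \<in> space P. X \<omega> = v}) = expectation (\<lambda>\<omega>. \<Sum>v\<in>F. \<psi> v * ?i v \<omega>)"
    by (subst Bochner_Integration.integral_sum; (intro integrable_mult_right ii)?; simp only: Ei integral_mult_right_zero)
  have s2: "(\<Sum>v\<in>F. prob {\<omega> \<in> space P. X \<omega> = v}) = expectation (\<lambda>\<omega>. \<Sum>v\<in>F. ?i v \<omega>)"
    by (subst Bochner_Integration.integral_sum; (intro integrable_mult_right ii)?; simp only: Ei integral_mult_right_zero)
  have j1: "integrable P (\<lambda>\<omega>. \<Sum>v\<in>F. \<psi> v * ?i v \<omega>)" and j2: "integrable P (\<lambda>\<omega>. \<Sum>v\<in>F. ?i v \<omega>)"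
    by (intro Bochner_Integration.integrable_sum integrable_mult_right ii)+
  have "\<bar>expectation (\<lambda>\<omega>. \<psi> (X \<omega>)) - (\<Sum>v\<in>F. \<psi> v * prob {\<omega> \<in> space P. X \<omega> = v})\<bar>
     = \<bar>expectation (\<lambda>\<omega>. \<psi> (X \<omega>) - (\<Sum>v\<in>F. \<psi> v * ?i v \<omega>))\<bar>"
    unfolding s1 using i1 j1 by simp
  also have "\<dots> \<le> expectation (\<lambda>\<omega>. \<bar>\<psi> (X \<omega>) - (\<Sum>v\<in>F. \<psi> v * ?i v \<omega>)\<bar>)" by (rule integral_abs_bound)
  also have "\<dots> \<le> expectation (\<lambda>\<omega>. K * (1 - (\<Sum>v\<in>F. ?i v \<omega>)))"
  proof (rule integral_mono)
    show "integrable P (\<lambda>\<omega>. \<bar>\<psi> (X \<omega>) - (\<Sum>v\<in>F. \<psi> v * ?i v \<omega>)\<bar>)" using i1 j1 by simp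
    show "integrable P (\<lambda>\<omega>. K * (1 - (\<Sum>v\<in>F. ?i v \<omega>)))" using j2 by simp
    fix \<omega> assume w: "\<omega> \<in> space P"
    have e: "(\<Sum>v\<in>F. h v * ?i v \<omega>) = (if X \<omega> \<in> F then h (X \<omega>) else 0)" for h :: "'c \<Rightarrow> real"
    proof -
      have "(\<Sum>v\<in>F. h v * ?i v \<omega>) = (\<Sum>v\<in>F. if v = X \<omega> then h v else 0)"
        using w by (intro sum.cong refl) (auto simp: indicator_def)
      then show ?thesis using F by simp
    qed
    show "\<bar>\<psi> (X \<omega>) - (\<Sum>v\<in>F. \<psi> v * ?i v \<omega>)\<bar> \<le> K * (1 - (\<Sum>v\<in>F. ?i v \<omega>))"
      using e[of \<psi>] e[of "\<lambda>_. 1"] \<psi>[of "X \<omega>"] by simp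
  qed
  also have "\<dots> = K * (1 - (\<Sum>v\<in>F. prob {\<omega> \<in> space P. X \<omega> = v}))"
    unfolding s2 using j2 by (simp add: prob_space)
  finally show ?thesis .
qed

text \<open>A finite set of values carries almost all mass of the limit law, hence almost all mass
  of the n-th law for large n: tightness follows because the limiting masses add up to 1.\<close>

lemma discrete_convergence:
  fixes C :: "nat \<Rightarrow> 'a \<Rightarrow> 'c :: countable" and C' :: "'b \<Rightarrow> 'c"
  assumes M: "\<forall>\<^sub>F n in sequentially. prob_space (M n) \<and> C n \<in> measurable (M n) (count_space UNIV)"
    and N: "prob_space N" "C' \<in> measurable N (count_space UNIV)"
    and conv: "\<And>v. (\<lambda>n. measure (M n) {\<omega> \<in> space (M n). C n \<omega> = v}) \<longlonglongrightarrow> measure N {\<omega> \<in> space N. C' \<omega> = v}"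
    and \<psi>: "\<And>v. \<bar>\<psi> v\<bar> \<le> (K::real)"
  shows "(\<lambda>n. \<integral>\<omega>. \<psi> (C n \<omega>) \<partial>M n) \<longlonglongrightarrow> (\<integral>\<omega>. \<psi> (C' \<omega>) \<partial>N)"
proof -
  have K0: "0 \<le> K" using \<psi>[of undefined] by linarith
  show ?thesis
  proof (rule tendstoI)
    fix e :: real assume e: "0 < e"
    interpret N: prob_space N by fact
    define F where "F j = {v :: 'c. to_nat v \<le> j}" for j
    have finF: "finite (F j)" for j
      using finite_vimageI[OF finite_atMost inj_to_nat, of j] by (simp add: F_def vimage_def)
    have evN: "{\<omega> \<in> space N. C' \<omega> \<in> S} \<in> sets N" for S
      using measurable_sets[OF N(2), of S] by (simp add: vimage_def Int_def conj_commute)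
    have "(\<lambda>j. N.prob {\<omega> \<in> space N. C' \<omega> \<in> F j}) \<longlonglongrightarrow> N.prob (\<Union>j. {\<omega> \<in> space N. C' \<omega> \<in> F j})"
      by (intro N.finite_Lim_measure_incseq) (use evN[of "F i" for i] in \<open>auto simp: incseq_def F_def\<close>)
    also have "(\<Union>j. {\<omega> \<in> space N. C' \<omega> \<in> F j}) = space N" by (auto simp: F_def)
    finally have "(\<lambda>j. N.prob {\<omega> \<in> space N. C' \<omega> \<in> F j}) \<longlonglongrightarrow> 1" by (simp add: N.prob_space)
    then have "\<forall>\<^sub>F j in sequentially. 1 - e / (4 * (K + 1)) < N.prob {\<omega> \<in> space N. C' \<omega> \<in> F j}"
      using e K0 by (intro order_tendstoD) auto
    then obtain j where j: "1 - e / (4 * (K + 1)) < N.prob {\<omega> \<in> space N. C' \<omega> \<in> F j}"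
      by (auto dest: eventually_happens)
    have "N.prob {\<omega> \<in> space N. C' \<omega> \<in> F j} = N.prob (\<Union>v\<in>F j. {\<omega> \<in> space N. C' \<omega> = v})"
      by (rule arg_cong[where f=N.prob]) auto
    also have "\<dots> = (\<Sum>v\<in>F j. N.prob {\<omega> \<in> space N. C' \<omega> = v})"
      using evN[of "{_}"] by (intro N.finite_measure_finite_Union finF) (auto simp: disjoint_family_on_def)
    finally have j': "1 - (\<Sum>v\<in>F j. N.prob {\<omega> \<in> space N. C' \<omega> = v}) < e / (4 * (K + 1))" using j by linarith
    let ?s = "\<lambda>n. \<Sum>v\<in>F j. \<psi> v * measure (M n) {\<omega> \<in> space (M n). C n \<omega> = v}"
    let ?r = "\<lambda>n. 1 - (\<Sum>v\<in>F j. measure (M n) {\<omega> \<in> space (M n). C n \<omega> = v})"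
    have "?s \<longlonglongrightarrow> (\<Sum>v\<in>F j. \<psi> v * N.prob {\<omega> \<in> space N. C' \<omega> = v})" by (intro tendsto_intros conv)
    then have e1: "\<forall>\<^sub>F n in sequentially. dist (?s n) (\<Sum>v\<in>F j. \<psi> v * N.prob {\<omega> \<in> space N. C' \<omega> = v}) < e / 4"
      using e by (intro tendstoD) auto
    have "?r \<longlonglongrightarrow> 1 - (\<Sum>v\<in>F j. N.prob {\<omega> \<in> space N. C' \<omega> = v})" by (intro tendsto_intros conv)
    then have e2: "\<forall>\<^sub>F n in sequentially. ?r n < e / (4 * (K + 1))" using j' by (rule order_tendstoD)
    have small: "K * r < e / 4" if "r < e / (4 * (K + 1))" for r
    proof -
      have "K * r \<le> K * (e / (4 * (K + 1)))" using that K0 by (intro mult_left_mono) auto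
      also have "\<dots> < (K + 1) * (e / (4 * (K + 1)))" using e K0 by (intro mult_strict_right_mono) auto
      also have "\<dots> = e / 4" using K0 by (simp add: divide_simps)
      finally show ?thesis .
    qed
    show "\<forall>\<^sub>F n in sequentially. dist (\<integral>\<omega>. \<psi> (C n \<omega>) \<partial>M n) (\<integral>\<omega>. \<psi> (C' \<omega>) \<partial>N) < e"
      using e1 e2 M
    proof eventually_elim
      case (elim n)
      have "\<bar>(\<integral>\<omega>. \<psi> (C n \<omega>) \<partial>M n) - ?s n\<bar> \<le> K * ?r n" using elim(3) finF \<psi> by (intro truncated_expectation) auto
      moreover have "\<bar>(\<integral>\<omega>. \<psi> (C' \<omega>) \<partial>N) - (\<Sum>v\<in>F j. \<psi> v * N.prob {\<omega> \<in> space N. C' \<omega> = v})\<bar>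
         \<le> K * (1 - (\<Sum>v\<in>F j. N.prob {\<omega> \<in> space N. C' \<omega> = v}))" using N finF \<psi> by (intro truncated_expectation) auto
      ultimately show ?case using elim(1) small[OF elim(2)] small[OF j'] unfolding dist_real_def by linarith
    qed
  qed
qed

section \<open>The Poisson limit\<close>

abbreviation (input) gumbel_intensity :: "real measure" where
  "gumbel_intensity \<equiv> density lborel (\<lambda>x. ennreal (exp (- x)))"

lemma gumbel_intensity_interval:
  assumes "a \<le> b"
  shows "emeasure gumbel_intensity {a<..b} = ennreal (exp (- a) - exp (- b))"
proof -
  have "emeasure gumbel_intensity {a<..b} = (\<integral>\<^sup>+x. ennreal (exp (- x)) * indicator {a<..b} x \<partial>lborel)"
    by (subst emeasure_density) auto
  also have "\<dots> = (\<integral>\<^sup>+x. ennreal (exp (- x)) * indicator {a..b} x \<partial>lborel)"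
  proof (rule nn_integral_cong_AE)
    have "AE x in lborel. x \<noteq> a" by (rule AE_lborel_singleton)
    then show "AE x in lborel. ennreal (exp (- x)) * indicator {a<..b} x = ennreal (exp (- x)) * indicator {a..b} x"
      by eventually_elim (auto simp: indicator_def)
  qed
  also have "\<dots> = ennreal (- exp (- b) - - exp (- a))"
    by (rule nn_integral_FTC_Icc) (auto intro!: derivative_eq_intros simp: has_real_derivative_iff_has_vector_derivative[symmetric] assms)
  finally show ?thesis by simp
qed

lemma cells_integral_laplacian_point_process: "cells_integral m (laplacian_point_process n A)"
proof -
  have count: "(\<Sum>j=1..n. indicator B (x j) :: ennreal) = of_nat (card {j \<in> {1..n}. x j \<in> B})" for B :: "real set" and x :: "nat \<Rightarrow> real"
  proof -
    have "(\<Sum>j=1..n. indicator B (x j) :: ennreal) = (\<Sum>j\<in>{j \<in> {1..n}. x j \<in> B}. 1)"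
      by (rule sum.mono_neutral_cong_right) (auto simp: indicator_def)
    then show ?thesis by simp
  qed
  show ?thesis
    unfolding cells_integral_def laplacian_point_process_def emeasure_sum_point_masses[OF cell_sets]
    by (intro allI impI exI) (rule count)
qed

lemma cell_counts_eq_iff:
  assumes "cells_integral m \<nu>"
  shows "cell_counts m \<nu> = v \<longleftrightarrow>
    length v = grid_size m \<and> (\<forall>i<grid_size m. emeasure \<nu> (cell m i) = of_nat (v ! i))"
proof -
  have "nat \<lfloor>measure \<nu> (cell m i)\<rfloor> = v ! i \<longleftrightarrow> emeasure \<nu> (cell m i) = of_nat (v ! i)" if i: "i < grid_size m" for i
  proof -
    obtain j :: nat where j: "emeasure \<nu> (cell m i) = of_nat j" using assms i unfolding cells_integral_def by blast
    then have "measure \<nu> (cell m i) = real j" by (simp add: measure_def)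
    then show ?thesis using j by simp
  qed
  then show ?thesis by (auto simp: cell_counts_def list_eq_iff_nth_eq)
qed

lemma measurable_cell_counts:
  assumes X: "\<And>i. (\<lambda>\<omega>. emeasure (\<xi> \<omega>) (cell m i)) \<in> borel_measurable M"
  shows "(\<lambda>\<omega>. cell_counts m (\<xi> \<omega>)) \<in> measurable M (count_space UNIV)"
proof -
  define c where "c i \<omega> = nat \<lfloor>measure (\<xi> \<omega>) (cell m i)\<rfloor>" for i \<omega>
  have c: "c i \<in> measurable M (count_space UNIV)" for i
  proof -
    have "(\<lambda>\<omega>. measure (\<xi> \<omega>) (cell m i)) \<in> borel_measurable M"
      unfolding measure_def using X by measurable
    from measurable_compose[OF measurable_compose[OF this measurable_real_floor], of nat "count_space UNIV"]
    show ?thesis unfolding c_def[abs_def] by simp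
  qed
  have "(\<lambda>\<omega>. cell_counts m (\<xi> \<omega>)) -` {v} \<inter> space M \<in> sets M" for v
  proof (cases "length v = grid_size m")
    case True
    have "{\<omega> \<in> space M. \<forall>i\<in>{..<grid_size m}. c i \<omega> = v ! i} \<in> sets M"
    proof (rule sets.sets_Collect_finite_All)
      show "{\<omega> \<in> space M. c i \<omega> = v ! i} \<in> sets M" for i
        using measurable_sets[OF c, of "{v ! i}" i] by (simp add: vimage_def Int_def conj_commute)
    qed simp
    moreover have "(\<lambda>\<omega>. cell_counts m (\<xi> \<omega>)) -` {v} \<inter> space M = {\<omega> \<in> space M. \<forall>i\<in>{..<grid_size m}. c i \<omega> = v ! i}"
      using True by (auto simp: cell_counts_def c_def list_eq_iff_nth_eq)
    ultimately show ?thesis by simp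
  next
    case False
    then have "(\<lambda>\<omega>. cell_counts m (\<xi> \<omega>)) -` {v} \<inter> space M = {}" by (auto simp: cell_counts_def)
    then show ?thesis by simp
  qed
  then show ?thesis by (subst measurable_count_space_eq_countable) auto
qed

lemma grid_size_pos: "0 < grid_size m"
  by (simp add: grid_size_def)

context
  fixes N :: "'b measure" and P :: "'b \<Rightarrow> real measure"
  assumes P: "poisson_process gumbel_intensity N P"
begin

lemma poisson_process_prob_space: "prob_space N"
  using P by (simp add: poisson_process_def random_measure_def)

lemma poisson_process_locally_finite: "\<omega> \<in> space N \<Longrightarrow> P \<omega> \<in> locally_finite_measures"
proof -
  assume w: "\<omega> \<in> space N"
  have "P \<in> measurable N vague_borel" using P by (simp add: poisson_process_def random_measure_def)
  from measurable_space[OF this w] show ?thesis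
    using openin_subset[of vague_topology] unfolding vague_borel_def by (simp add: space_measure_of_conv)
qed

lemma poisson_process_indep_cells:
  "prob_space.indep_vars N (\<lambda>_. borel) (\<lambda>i \<omega>. emeasure (P \<omega>) (cell m i)) {..<k}"
proof -
  have "disjoint_family_on (cell m) {..<k}" unfolding disjoint_family_on_def using cell_disjoint by blast
  moreover have "\<forall>i<k. cell m i \<in> sets borel" by simp
  ultimately show ?thesis using P unfolding poisson_process_def by blast
qed

text \<open>Read off from the independence of the first i + 1 cells, which includes the
  measurability of each mass.\<close>

lemma measurable_poisson_process_cell: "(\<lambda>\<omega>. emeasure (P \<omega>) (cell m i)) \<in> borel_measurable N"
  using poisson_process_indep_cells[of m "Suc i"]
  unfolding prob_space.indep_vars_def[OF poisson_process_prob_space] by simp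

lemma poisson_process_cell:
  "measure N {\<omega> \<in> space N. emeasure (P \<omega>) (cell m i) = of_nat k}
    = poisson_weight (exp (- grid m i) - exp (- grid m (Suc i))) k"
proof -
  have e: "emeasure gumbel_intensity (cell m i) = ennreal (exp (- grid m i) - exp (- grid m (Suc i)))"
    unfolding cell_def by (rule gumbel_intensity_interval[OF less_imp_le[OF grid_less]])
  have "0 \<le> exp (- grid m i) - exp (- grid m (Suc i))" using grid_less[of m i] by simp
  then have me: "measure gumbel_intensity (cell m i) = exp (- grid m i) - exp (- grid m (Suc i))"
    unfolding measure_def e by (rule enn2real_ennreal)
  have "emeasure gumbel_intensity (cell m i) < \<infinity>" unfolding e by simp
  then have "measure N {\<omega> \<in> space N. emeasure (P \<omega>) (cell m i) = of_nat k} =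
      exp (- measure gumbel_intensity (cell m i)) * measure gumbel_intensity (cell m i) ^ k / fact k"
    using P cell_sets unfolding poisson_process_def by blast
  then show ?thesis unfolding me poisson_weight_def .
qed

lemma poisson_process_cells:
  "measure N {\<omega> \<in> space N. \<forall>i<grid_size m. emeasure (P \<omega>) (cell m i) = of_nat (v i)}
    = (\<Prod>i<grid_size m. poisson_weight (exp (- grid m i) - exp (- grid m (Suc i))) (v i))"
proof -
  interpret prob_space N by (rule poisson_process_prob_space)
  let ?X = "\<lambda>i \<omega>. emeasure (P \<omega>) (cell m i)"
  have pre: "?X i -` {of_nat (v i)} \<inter> space N = {\<omega> \<in> space N. emeasure (P \<omega>) (cell m i) = of_nat (v i)}" for i by auto
  have "prob (\<Inter>i\<in>{..<grid_size m}. ?X i -` {of_nat (v i)} \<inter> space N) = (\<Prod>i\<in>{..<grid_size m}. prob (?X i -` {of_nat (v i)} \<inter> space N))"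
    by (rule indep_varsD_finite[OF poisson_process_indep_cells]) (use grid_size_pos[of m] in auto)
  moreover have "(\<Inter>i\<in>{..<grid_size m}. ?X i -` {of_nat (v i)} \<inter> space N)
    = {\<omega> \<in> space N. \<forall>i<grid_size m. emeasure (P \<omega>) (cell m i) = of_nat (v i)}"
    using grid_size_pos[of m] by auto
  ultimately show ?thesis unfolding pre poisson_process_cell by simp
qed

text \<open>The Poisson weights of all naturals sum to 1, so every cell mass is almost surely one of
  them; there are only countably many cells.\<close>

lemma poisson_process_cells_integral: "AE \<omega> in N. \<forall>m. cells_integral m (P \<omega>)"
proof -
  interpret prob_space N by (rule poisson_process_prob_space)
  have "AE \<omega> in N. \<exists>k::nat. emeasure (P \<omega>) (cell m i) = of_nat k" for m i
  proof -
    let ?l = "exp (- grid m i) - exp (- grid m (Suc i))"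
    let ?E = "\<lambda>k::nat. {\<omega> \<in> space N. emeasure (P \<omega>) (cell m i) = of_nat k}"
    have ev: "?E k \<in> events" for k
      using measurable_sets[OF measurable_poisson_process_cell, of "{of_nat k}" m i] by (simp add: vimage_def Int_def conj_commute)
    have "(\<lambda>k. prob (?E k)) sums prob (\<Union>k. ?E k)"
      by (rule finite_measure_UNION) (use ev in \<open>auto simp: disjoint_family_on_def\<close>)
    moreover have "(\<lambda>k. prob (?E k)) sums 1"
      unfolding poisson_process_cell by (rule poisson_weight_sums)
    ultimately have "prob (\<Union>k. ?E k) = 1" by (rule sums_unique2)
    then have "AE \<omega> in N. \<omega> \<in> (\<Union>k. ?E k)" by (rule AE_prob_1)
    then show ?thesis by eventually_elim auto
  qed
  then have "AE \<omega> in N. \<forall>m i. \<exists>k::nat. emeasure (P \<omega>) (cell m i) = of_nat k"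
    by (simp add: AE_all_countable)
  then show ?thesis by eventually_elim (simp add: cells_integral_def)
qed

lemma measurable_poisson_process_cell_counts:
  "(\<lambda>\<omega>. cell_counts m (P \<omega>)) \<in> measurable N (count_space UNIV)"
  by (rule measurable_cell_counts) (rule measurable_poisson_process_cell)

lemma poisson_process_cell_counts:
  "measure N {\<omega> \<in> space N. cell_counts m (P \<omega>) = v} = (if length v = grid_size m
    then \<Prod>i<grid_size m. poisson_weight (exp (- grid m i) - exp (- grid m (Suc i))) (v ! i) else 0)"
proof (cases "length v = grid_size m")
  case True
  interpret prob_space N by (rule poisson_process_prob_space)
  have "{\<omega> \<in> space N. cell_counts m (P \<omega>) = v} \<in> events"
    using measurable_sets[OF measurable_poisson_process_cell_counts, of "{v}" m] by (simp add: vimage_def Int_def conj_commute)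
  moreover have "{\<omega> \<in> space N. \<forall>i\<in>{..<grid_size m}. emeasure (P \<omega>) (cell m i) = of_nat (v ! i)} \<in> events"
  proof (rule sets.sets_Collect_finite_All)
    show "{\<omega> \<in> space N. emeasure (P \<omega>) (cell m i) = of_nat (v ! i)} \<in> events" for i
      using measurable_sets[OF measurable_poisson_process_cell, of "{of_nat (v ! i)}" m i] by (simp add: vimage_def Int_def conj_commute)
  qed simp
  moreover have "AE \<omega> in N. \<omega> \<in> {\<omega> \<in> space N. cell_counts m (P \<omega>) = v}
      \<longleftrightarrow> \<omega> \<in> {\<omega> \<in> space N. \<forall>i\<in>{..<grid_size m}. emeasure (P \<omega>) (cell m i) = of_nat (v ! i)}"
    using poisson_process_cells_integral
  proof eventually_elim
    case (elim \<omega>)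
    then show ?case using cell_counts_eq_iff[of m "P \<omega>" v] True by auto
  qed
  ultimately have "prob {\<omega> \<in> space N. cell_counts m (P \<omega>) = v}
      = prob {\<omega> \<in> space N. \<forall>i\<in>{..<grid_size m}. emeasure (P \<omega>) (cell m i) = of_nat (v ! i)}"
    by (intro finite_measure_eq_AE)
  then show ?thesis using True poisson_process_cells[of m "\<lambda>i. v ! i"] by (simp add: Ball_def)
next
  case False
  then have "{\<omega> \<in> space N. cell_counts m (P \<omega>) = v} = {}" by (auto simp: cell_counts_def)
  then show ?thesis using False by (simp only: measure_empty if_False)
qed

text \<open>Dominated convergence: the envelopes inherit the bound K and converge at every sample
  point where all cell masses are integers, which is almost everywhere.\<close>

lemma upper_envelope_expectation_tendsto:
  assumes cont: "continuous_map vague_topology euclideanreal \<Phi>"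
    and K: "\<And>\<nu>. \<nu> \<in> locally_finite_measures \<Longrightarrow> \<bar>\<Phi> \<nu>\<bar> \<le> K"
  shows "(\<lambda>m. \<integral>\<omega>. upper_envelope \<Phi> m (cell_counts m (P \<omega>)) \<partial>N) \<longlonglongrightarrow> (\<integral>\<omega>. \<Phi> (P \<omega>) \<partial>N)"
proof -
  interpret prob_space N by (rule poisson_process_prob_space)
  have K0: "0 \<le> K" using K[OF sum_point_masses_locally_finite[of 0 undefined]] by linarith
  have Pm: "P \<in> measurable N vague_borel" using P by (simp add: poisson_process_def random_measure_def)
  show ?thesis
  proof (rule integral_dominated_convergence[where w="\<lambda>_. K"])
    show "(\<lambda>\<omega>. \<Phi> (P \<omega>)) \<in> borel_measurable N"
      by (rule measurable_compose[OF Pm measurable_vague_continuous[OF cont K]])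
    show "(\<lambda>\<omega>. upper_envelope \<Phi> m (cell_counts m (P \<omega>))) \<in> borel_measurable N" for m
      by (rule measurable_compose[OF measurable_poisson_process_cell_counts]) simp
    show "AE \<omega> in N. (\<lambda>m. upper_envelope \<Phi> m (cell_counts m (P \<omega>))) \<longlonglongrightarrow> \<Phi> (P \<omega>)"
      using poisson_process_cells_integral AE_space
    proof eventually_elim
      case (elim \<omega>)
      show ?case by (rule upper_envelope_tendsto[OF cont K poisson_process_locally_finite[OF elim(2)]]) (use elim(1) in auto)
    qed
    show "AE \<omega> in N. norm (upper_envelope \<Phi> m (cell_counts m (P \<omega>))) \<le> K" for m
      using upper_envelope_bound[OF cont K K0] by simp
  qed simp
qed

context
  fixes M :: "nat \<Rightarrow> 'a measure" and A :: "nat \<Rightarrow> 'a \<Rightarrow> real mat"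
  assumes GOE: "\<And>n. n \<ge> 1 \<Longrightarrow> GOE n (M n) (A n)"
begin

abbreviation (input) \<xi> :: "nat \<Rightarrow> 'a \<Rightarrow> real measure" where
  "\<xi> n \<omega> \<equiv> laplacian_point_process n (A n \<omega>)"

lemma cell_counts_tendsto:
  "(\<lambda>n. measure (M n) {\<omega> \<in> space (M n). cell_counts m (\<xi> n \<omega>) = v})
    \<longlonglongrightarrow> measure N {\<omega> \<in> space N. cell_counts m (P \<omega>) = v}"
proof (cases "length v = grid_size m")
  case True
  have "{\<omega> \<in> space (M n). cell_counts m (\<xi> n \<omega>) = v}
     = {\<omega> \<in> space (M n). \<forall>i<grid_size m. emeasure (\<xi> n \<omega>) {grid m i<..grid m (Suc i)} = of_nat (v ! i)}" for n
    using cell_counts_eq_iff[OF cells_integral_laplacian_point_process] True by (simp add: cell_def)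
  moreover have "(\<lambda>n. measure (M n) {\<omega> \<in> space (M n). \<forall>i<grid_size m. emeasure (\<xi> n \<omega>) {grid m i<..grid m (Suc i)} = of_nat (v ! i)})
    \<longlonglongrightarrow> (\<Prod>i<grid_size m. poisson_weight (exp (- grid m i) - exp (- grid m (Suc i))) (v ! i))"
    by (rule point_process_counts_tendsto[where M=M and A=A and t="grid m" and v="\<lambda>i. v ! i"]; rule GOE grid_less; assumption)
  ultimately show ?thesis unfolding poisson_process_cell_counts using True by simp
next
  case False
  then have "{\<omega> \<in> space (M n). cell_counts m (\<xi> n \<omega>) = v} = {}" for n by (auto simp: cell_counts_def)
  then show ?thesis unfolding poisson_process_cell_counts using False by (simp only: measure_empty if_False tendsto_const)
qed

text \<open>The grid is fixed before n grows: m is chosen so that the Poisson expectation of the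
  envelope is already below l. For this m the envelope is a bounded function of the discrete counts,
  whose laws converge, and it dominates \<Phi> at every n.\<close>

lemma expectation_upper_limit:
  assumes cont: "continuous_map vague_topology euclideanreal \<Phi>"
    and K: "\<And>\<nu>. \<nu> \<in> locally_finite_measures \<Longrightarrow> \<bar>\<Phi> \<nu>\<bar> \<le> K"
    and l: "(\<integral>\<omega>. \<Phi> (P \<omega>) \<partial>N) < l"
  shows "\<forall>\<^sub>F n in sequentially. (\<integral>\<omega>. \<Phi> (\<xi> n \<omega>) \<partial>M n) < l"
proof -
  have K0: "0 \<le> K" using K[OF sum_point_masses_locally_finite[of 0 undefined]] by linarith
  have "\<forall>\<^sub>F m in sequentially. (\<integral>\<omega>. upper_envelope \<Phi> m (cell_counts m (P \<omega>)) \<partial>N) < l"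
    by (rule order_tendstoD(2)[OF upper_envelope_expectation_tendsto[OF cont K] l])
  then obtain m where m: "(\<integral>\<omega>. upper_envelope \<Phi> m (cell_counts m (P \<omega>)) \<partial>N) < l"
    by (auto dest: eventually_happens)
  have bound: "\<bar>upper_envelope \<Phi> m v\<bar> \<le> K" for v by (rule upper_envelope_bound[OF cont K K0])
  have ps: "prob_space (M n)" if "1 \<le> n" for n using GOE[OF that] by (simp add: GOE_def)
  have ccm: "(\<lambda>\<omega>. cell_counts m (\<xi> n \<omega>)) \<in> measurable (M n) (count_space UNIV)" if "1 \<le> n" for n
    by (intro measurable_cell_counts measurable_emeasure_laplacian_point_process[OF GOE[OF that]] cell_sets)
  have "(\<lambda>n. \<integral>\<omega>. upper_envelope \<Phi> m (cell_counts m (\<xi> n \<omega>)) \<partial>M n)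
      \<longlonglongrightarrow> (\<integral>\<omega>. upper_envelope \<Phi> m (cell_counts m (P \<omega>)) \<partial>N)"
  proof (rule discrete_convergence[where C="\<lambda>n \<omega>. cell_counts m (\<xi> n \<omega>)" and C'="\<lambda>\<omega>. cell_counts m (P \<omega>)" and \<psi>="upper_envelope \<Phi> m" and K=K])
    show "\<forall>\<^sub>F n in sequentially. prob_space (M n) \<and> (\<lambda>\<omega>. cell_counts m (\<xi> n \<omega>)) \<in> measurable (M n) (count_space UNIV)"
      using eventually_ge_at_top[of 1] by (rule eventually_mono) (use ps ccm in blast)
  qed (rule poisson_process_prob_space measurable_poisson_process_cell_counts cell_counts_tendsto bound)+
  then have "\<forall>\<^sub>F n in sequentially. (\<integral>\<omega>. upper_envelope \<Phi> m (cell_counts m (\<xi> n \<omega>)) \<partial>M n) < l"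
    using m by (rule order_tendstoD(2))
  then show ?thesis
    using eventually_ge_at_top[of 1]
  proof eventually_elim
    case (elim n)
    interpret prob_space "M n" using elim(2) by (rule ps)
    have \<xi>m: "\<xi> n \<in> measurable (M n) vague_borel"
      using GOE_random_measure[OF GOE[OF elim(2)]] by (simp add: random_measure_def)
    have "(\<integral>\<omega>. \<Phi> (\<xi> n \<omega>) \<partial>M n) \<le> (\<integral>\<omega>. upper_envelope \<Phi> m (cell_counts m (\<xi> n \<omega>)) \<partial>M n)"
    proof (rule integral_mono)
      show "integrable (M n) (\<lambda>\<omega>. \<Phi> (\<xi> n \<omega>))"
      proof (rule integrable_const_bound[where B=K])
        show "(\<lambda>\<omega>. \<Phi> (\<xi> n \<omega>)) \<in> borel_measurable (M n)"
          by (rule measurable_compose[OF \<xi>m measurable_vague_continuous[OF cont K]])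
      qed (simp add: K laplacian_point_process_def sum_point_masses_locally_finite)
      show "integrable (M n) (\<lambda>\<omega>. upper_envelope \<Phi> m (cell_counts m (\<xi> n \<omega>)))"
      proof (rule integrable_const_bound[where B=K])
        show "(\<lambda>\<omega>. upper_envelope \<Phi> m (cell_counts m (\<xi> n \<omega>))) \<in> borel_measurable (M n)"
          by (rule measurable_compose[OF ccm[OF elim(2)]]) simp
      qed (simp add: bound)
      show "\<Phi> (\<xi> n \<omega>) \<le> upper_envelope \<Phi> m (cell_counts m (\<xi> n \<omega>))" for \<omega>
        by (rule le_upper_envelope[OF cont K _ cells_integral_laplacian_point_process])
          (simp_all add: laplacian_point_process_def sum_point_masses_locally_finite)
    qed
    then show ?case using elim(1) by (rule order.strict_trans1)
  qed
qed

end

end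

theorem corollary1p6:
  fixes M :: "nat \<Rightarrow> 'a measure" and A :: "nat \<Rightarrow> 'a \<Rightarrow> real mat"
    and N :: "'b measure" and P :: "'b \<Rightarrow> real measure"
  assumes "\<And>n. n \<ge> 1 \<Longrightarrow> GOE n (M n) (A n)"
    and "poisson_process (density lborel (\<lambda>x. ennreal (exp (- x)))) N P"
  shows "vague_converges_in_distribution M (\<lambda>n \<omega>. laplacian_point_process n (A n \<omega>)) N P"
  unfolding vague_converges_in_distribution_def
proof (intro conjI allI impI)
  show "\<forall>\<^sub>F n in sequentially. random_measure (M n) (\<lambda>\<omega>. laplacian_point_process n (A n \<omega>))"
    using eventually_ge_at_top[of 1] by (rule eventually_mono) (rule GOE_random_measure[OF assms(1)])
  show "random_measure N P" using assms(2) by (simp add: poisson_process_def)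
  fix \<Phi> :: "real measure \<Rightarrow> real"
  assume \<Phi>: "continuous_map vague_topology euclideanreal \<Phi> \<and> bounded (\<Phi> ` locally_finite_measures)"
  then have cont: "continuous_map vague_topology euclideanreal \<Phi>" by blast
  then have cont': "continuous_map vague_topology euclideanreal (\<lambda>\<nu>. - \<Phi> \<nu>)" by (rule continuous_map_minus)
  obtain K where K: "\<And>\<nu>. \<nu> \<in> locally_finite_measures \<Longrightarrow> \<bar>\<Phi> \<nu>\<bar> \<le> K"
    using \<Phi> unfolding bounded_iff by auto
  then have K': "\<And>\<nu>. \<nu> \<in> locally_finite_measures \<Longrightarrow> \<bar>- \<Phi> \<nu>\<bar> \<le> K" by simp
  show "(\<lambda>n. \<integral>\<omega>. \<Phi> (laplacian_point_process n (A n \<omega>)) \<partial>M n) \<longlonglongrightarrow> (\<integral>\<omega>. \<Phi> (P \<omega>) \<partial>N)"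
  proof (rule order_tendstoI)
    fix l assume "(\<integral>\<omega>. \<Phi> (P \<omega>) \<partial>N) < l"
    then show "\<forall>\<^sub>F n in sequentially. (\<integral>\<omega>. \<Phi> (laplacian_point_process n (A n \<omega>)) \<partial>M n) < l"
      using expectation_upper_limit[OF assms(2,1) cont K] by blast
  next
    fix l assume "l < (\<integral>\<omega>. \<Phi> (P \<omega>) \<partial>N)"
    then have "(\<integral>\<omega>. - \<Phi> (P \<omega>) \<partial>N) < - l" by simp
    then have "\<forall>\<^sub>F n in sequentially. (\<integral>\<omega>. - \<Phi> (laplacian_point_process n (A n \<omega>)) \<partial>M n) < - l"
      using expectation_upper_limit[OF assms(2,1) cont' K'] by blast
    then show "\<forall>\<^sub>F n in sequentially. l < (\<integral>\<omega>. \<Phi> (laplacian_point_process n (A n \<omega>)) \<partial>M n)"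
      by (rule eventually_mono) simp
  qed
qed

end
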